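(* Let $g$ be a bounded real function of $t\ge0$. Let $1<r\le\infty$, $1\le p\le\infty$, and let $A=L^\infty\cap\dot B^{\frac1p}_{p,r}\cap\dot B^{1+\frac1p}_{p,r}$ (on $\mathbb{R}$). For any $\epsilon>0$ there exists $u_0\in H^\infty(\mathbb{R})$ such that: (1) $\|u_0\|_A\le\epsilon$; (2) there exists a unique solution $u\in E^\infty_{p,r}$ of $$u_t+uu_x=\int_{-\infty}^{x}\tfrac12u_x^2(t,z)\,dz+g(t),\qquad u(0,x)=u_0(x),\quad x\in\mathbb{R},$$ with maximal existence time $T<\epsilon$; (3) $\displaystyle\lim_{t\to T}\|u_x(t)\|_{B^{\frac1p}_{p,r}}\ge\lim_{t\to T}\|u_x(t)\|_{B^0_{\infty,\infty}}=\infty.$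
   Context: All functions are real-valued on $\mathbb{R}$; $H^\infty=\bigcap_{\sigma}H^\sigma$. Let $\chi,\varphi\in C_c^\infty(\mathbb{R})$ be even, valued in $[0,1]$, with $\operatorname{supp}\chi\subset\{|\xi|\le\frac43\}$, $\operatorname{supp}\varphi\subset\{\frac34\le|\xi|\le\frac83\}$, $\chi(\xi)+\sum_{j\ge0}\varphi(2^{-j}\xi)=1$ for all $\xi$ and $\sum_{j\in\mathbb{Z}}\varphi(2^{-j}\xi)=1$ for $\xi\ne0$. Set $\dot\Delta_ju=\mathcal{F}^{-1}(\varphi(2^{-j}\cdot)\mathcal{F}u)$ for $j\in\mathbb{Z}$; $\Delta_ju=0$ for $j\le-2$, $\Delta_{-1}u=\mathcal{F}^{-1}(\chi\mathcal{F}u)$, $\Delta_ju=\dot\Delta_ju$ for $j\ge0$. Then $$\|u\|_{\dot B^\sigma_{p,r}}=\big\|(2^{j\sigma}\|\dot\Delta_ju\|_{L^p})_{j\in\mathbb{Z}}\big\|_{\ell^r},\qquad \|u\|_{B^\sigma_{p,r}}=\big\|(2^{j\sigma}\|\Delta_ju\|_{L^p})_{j\in\mathbb{Z}}\big\|_{\ell^r};$$ a bounded function belongs to $\dot B^\sigma_{p,r}$ if the first quantity is finite. The norm of $A$ is the sum of the three (semi)norms. With $\frac1p+\frac1q=1$ and $\|u\|_{\dot W^{1,q}}=\|u_x\|_{L^q}$, for $s>2$ let $E^s_{p,r}=L^\infty\cap\dot B^s_{p,r}\cap\dot B^{s-1}_{p,r}\cap\dot W^{1,q}$ and $\bar E^s_{p,r}=L^\infty\cap\dot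 B^{s-1}_{p,r}$, and $E^\infty_{p,r}=\bigcap_{s>2}E^s_{p,r}$. A solution in $E^\infty_{p,r}$ on $[0,T)$ is a solution lying in $C([0,T'];E^s_{p,r})\cap C^1([0,T'];\bar E^s_{p,r})$ for all $T'<T$ and all $s>2$; the maximal existence time is the supremum of the times $T$ for which the solution exists on $[0,T)$.
   Formalization: Besides being bounded, g is assumed continuous on some interval [0,δ) with δ>0; this is necessary, since a solution that is C^1 in time forces g to be continuous (for g(t)=sin(1/t) near 0 no solution exists). *)

theory Defs
  imports "HOL-Probability.Essential_Supremum"
begin

section \<open>Schwartz functions and tempered distributions on the real line\<close>

definition vderiv :: "(real \<Rightarrow> 'a::real_normed_vector) \<Rightarrow> real \<Rightarrow> 'a" where
  "vderiv f = (\<lambda>x. vector_derivative f (at x))"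

definition smooth :: "(real \<Rightarrow> 'a::real_normed_vector) \<Rightarrow> bool" where
  "smooth f \<longleftrightarrow> (\<forall>n x. (vderiv ^^ n) f differentiable (at x))"

definition schwartz :: "(real \<Rightarrow> complex) set" where
  "schwartz = {f. smooth f \<and> (\<forall>m n. bounded (range (\<lambda>x. x ^ m *\<^sub>R (vderiv ^^ n) f x)))}"

definition fourier :: "(real \<Rightarrow> complex) \<Rightarrow> real \<Rightarrow> complex" where
  "fourier f \<xi> = (\<integral>x. exp (- \<i> * complex_of_real (x * \<xi>)) * f x \<partial>lborel)"

definition inv_fourier :: "(real \<Rightarrow> complex) \<Rightarrow> real \<Rightarrow> complex" where
  "inv_fourier f x =
     (\<integral>\<xi>. exp (\<i> * complex_of_real (x * \<xi>)) * f \<xi> \<partial>lborel) / complex_of_real (2 * pi)"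

text \<open>A distribution is given by its values on Schwartz functions; values at other arguments
  are never used. The operations below are the usual transposes.\<close>

type_synonym distr = "(real \<Rightarrow> complex) \<Rightarrow> complex"

definition distr_of :: "(real \<Rightarrow> complex) \<Rightarrow> distr" where
  "distr_of f \<psi> = (\<integral>x. f x * \<psi> x \<partial>lborel)"

definition fourier_distr :: "distr \<Rightarrow> distr" where
  "fourier_distr U \<psi> = U (fourier \<psi>)"

definition inv_fourier_distr :: "distr \<Rightarrow> distr" where
  "inv_fourier_distr U \<psi> = U (inv_fourier \<psi>)"

definition mult_distr :: "(real \<Rightarrow> real) \<Rightarrow> distr \<Rightarrow> distr" where
  "mult_distr m U \<psi> = U (\<lambda>\<xi>. complex_of_real (m \<xi>) * \<psi> \<xi>)"

definition deriv_distr :: "distr \<Rightarrow> distr" where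
  "deriv_distr U \<psi> = - U (vderiv \<psi>)"

definition tempered_fun :: "(real \<Rightarrow> complex) \<Rightarrow> bool" where
  "tempered_fun f \<longleftrightarrow>
     f \<in> borel_measurable lborel \<and> (\<forall>\<psi>\<in>schwartz. integrable lborel (\<lambda>x. f x * \<psi> x))"

text \<open>The distribution U is the (tempered) function f.\<close>

definition is_fun :: "distr \<Rightarrow> (real \<Rightarrow> complex) \<Rightarrow> bool" where
  "is_fun U f \<longleftrightarrow> tempered_fun f \<and> (\<forall>\<psi>\<in>schwartz. U \<psi> = distr_of f \<psi>)"

abbreviation cfun :: "(real \<Rightarrow> real) \<Rightarrow> real \<Rightarrow> complex" where
  "cfun f \<equiv> (\<lambda>x. complex_of_real (f x))"

abbreviation rdistr :: "(real \<Rightarrow> real) \<Rightarrow> distr" where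
  "rdistr f \<equiv> distr_of (cfun f)"


section \<open>Norms\<close>

definition epow :: "ennreal \<Rightarrow> real \<Rightarrow> ennreal" where
  "epow x a = (if x = \<infinity> then \<infinity> else ennreal (enn2real x powr a))"

text \<open>For lborel this is the Lebesgue norm, for the counting measure the sequence norm;
  the exponent ranges over [1, \<infinity>].\<close>

definition lp_norm :: "'a measure \<Rightarrow> ennreal \<Rightarrow> ('a \<Rightarrow> ennreal) \<Rightarrow> ennreal" where
  "lp_norm M p f =
     (if p = \<infinity> then esssup M f
      else epow (\<integral>\<^sup>+x. epow (f x) (enn2real p) \<partial>M) (1 / enn2real p))"

text \<open>A distribution is represented by at most one function up to null sets, so the infimum
  is the norm of that function, and it is \<infinity> if there is none.\<close>

definition Lp_distr :: "ennreal \<Rightarrow> distr \<Rightarrow> ennreal" where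
  "Lp_distr p U = (INF f\<in>{f. is_fun U f}. lp_norm lborel p (\<lambda>x. ennreal (cmod (f x))))"

definition LP_pair :: "(real \<Rightarrow> real) \<Rightarrow> (real \<Rightarrow> real) \<Rightarrow> bool" where
  "LP_pair chi \<phi> \<longleftrightarrow>
     smooth chi \<and> smooth \<phi> \<and>
     (\<forall>\<xi>. chi (- \<xi>) = chi \<xi>) \<and> (\<forall>\<xi>. \<phi> (- \<xi>) = \<phi> \<xi>) \<and>
     range chi \<subseteq> {0..1} \<and> range \<phi> \<subseteq> {0..1} \<and>
     closure {\<xi>. chi \<xi> \<noteq> 0} \<subseteq> {\<xi>. \<bar>\<xi>\<bar> \<le> 4/3} \<and>
     closure {\<xi>. \<phi> \<xi> \<noteq> 0} \<subseteq> {\<xi>. 3/4 \<le> \<bar>\<xi>\<bar> \<and> \<bar>\<xi>\<bar> \<le> 8/3} \<and>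
     (\<forall>\<xi>. (\<lambda>j::nat. \<phi> (\<xi> / 2 ^ j)) sums (1 - chi \<xi>)) \<and>
     (\<forall>\<xi>. \<xi> \<noteq> 0 \<longrightarrow> ((\<lambda>j::int. \<phi> (2 powi (- j) * \<xi>)) has_sum 1) UNIV)"

definition hblock :: "(real \<Rightarrow> real) \<Rightarrow> int \<Rightarrow> distr \<Rightarrow> distr" where
  "hblock \<phi> j U =
     inv_fourier_distr (mult_distr (\<lambda>\<xi>. \<phi> (2 powi (- j) * \<xi>)) (fourier_distr U))"

definition nblock :: "(real \<Rightarrow> real) \<Rightarrow> (real \<Rightarrow> real) \<Rightarrow> int \<Rightarrow> distr \<Rightarrow> distr" where
  "nblock chi \<phi> j U =
     (if j \<le> -2 then (\<lambda>\<psi>. 0)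
      else if j = -1 then inv_fourier_distr (mult_distr chi (fourier_distr U))
      else hblock \<phi> j U)"

definition hBesov_norm :: "(real \<Rightarrow> real) \<Rightarrow> real \<Rightarrow> ennreal \<Rightarrow> ennreal \<Rightarrow> distr \<Rightarrow> ennreal" where
  "hBesov_norm \<phi> \<sigma> p r U =
     lp_norm (count_space UNIV) r
       (\<lambda>j::int. ennreal (2 powr (of_int j * \<sigma>)) * Lp_distr p (hblock \<phi> j U))"

definition Besov_norm ::
  "(real \<Rightarrow> real) \<Rightarrow> (real \<Rightarrow> real) \<Rightarrow> real \<Rightarrow> ennreal \<Rightarrow> ennreal \<Rightarrow> distr \<Rightarrow> ennreal" where
  "Besov_norm chi \<phi> \<sigma> p r U =
     lp_norm (count_space UNIV) r
       (\<lambda>j::int. ennreal (2 powr (of_int j * \<sigma>)) * Lp_distr p (nblock chi \<phi> j U))"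

definition Linf_norm :: "(real \<Rightarrow> real) \<Rightarrow> ennreal" where
  "Linf_norm f = lp_norm lborel \<infinity> (\<lambda>x. ennreal \<bar>f x\<bar>)"

definition H_infty :: "(real \<Rightarrow> real) set" where
  "H_infty = {f. tempered_fun (cfun f) \<and>
     (\<forall>\<sigma>::real. \<exists>h. is_fun (fourier_distr (rdistr f)) h \<and>
        (\<integral>\<^sup>+\<xi>. ennreal ((1 + \<xi>\<^sup>2) powr \<sigma> * (cmod (h \<xi>))\<^sup>2) \<partial>lborel) < \<infinity>)}"

text \<open>The norms of A and of the two scales of solution spaces. Here \<open>enn2real (1 / p)\<close> is the
  real number 1/p, which is 0 for p = \<infinity>.\<close>

definition A_norm :: "(real \<Rightarrow> real) \<Rightarrow> ennreal \<Rightarrow> ennreal \<Rightarrow> (real \<Rightarrow> real) \<Rightarrow> ennreal" where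
  "A_norm \<phi> p r f =
     Linf_norm f + hBesov_norm \<phi> (enn2real (1 / p)) p r (rdistr f)
                 + hBesov_norm \<phi> (1 + enn2real (1 / p)) p r (rdistr f)"

definition conj_exp :: "ennreal \<Rightarrow> ennreal" where
  "conj_exp p = 1 / (1 - 1 / p)"

lemma conj_exp: "1 / p + 1 / conj_exp p = 1" if "1 \<le> p"
proof -
  have "1 / p \<le> 1"
  proof (cases p)
    case (real x)
    then have "1 \<le> x"
      using that by simp
    then have "1 / p = ennreal (1 / x)"
      using real divide_ennreal[of 1 x] by simp
    then show ?thesis
      using \<open>1 \<le> x\<close> by simp
  next
    case top
    then show ?thesis by simp
  qed
  then show ?thesis
    by (simp add: conj_exp_def one_divide_one_divide_ennreal add_diff_inverse_ennreal)
qed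

definition E_norm :: "(real \<Rightarrow> real) \<Rightarrow> ennreal \<Rightarrow> ennreal \<Rightarrow> real \<Rightarrow> (real \<Rightarrow> real) \<Rightarrow> ennreal" where
  "E_norm \<phi> p r s f =
     Linf_norm f + hBesov_norm \<phi> s p r (rdistr f) + hBesov_norm \<phi> (s - 1) p r (rdistr f)
       + Lp_distr (conj_exp p) (deriv_distr (rdistr f))"

definition Ebar_norm :: "(real \<Rightarrow> real) \<Rightarrow> ennreal \<Rightarrow> ennreal \<Rightarrow> real \<Rightarrow> (real \<Rightarrow> real) \<Rightarrow> ennreal" where
  "Ebar_norm \<phi> p r s f = Linf_norm f + hBesov_norm \<phi> (s - 1) p r (rdistr f)"


section \<open>Solutions\<close>

text \<open>Continuous, and continuously differentiable, maps u from [0,b] into the space of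
  measurable functions of finite norm N; v is the time derivative of u with respect to N.\<close>

definition C0_into :: "((real \<Rightarrow> real) \<Rightarrow> ennreal) \<Rightarrow> real \<Rightarrow> (real \<Rightarrow> real \<Rightarrow> real) \<Rightarrow> bool" where
  "C0_into N b u \<longleftrightarrow>
     (\<forall>t\<in>{0..b}. u t \<in> borel_measurable lborel \<and> N (u t) < \<infinity> \<and>
        ((\<lambda>\<tau>. N (\<lambda>x. u \<tau> x - u t x)) \<longlongrightarrow> 0) (at t within {0..b}))"

definition C1_into ::
  "((real \<Rightarrow> real) \<Rightarrow> ennreal) \<Rightarrow> real \<Rightarrow> (real \<Rightarrow> real \<Rightarrow> real) \<Rightarrow> (real \<Rightarrow> real \<Rightarrow> real) \<Rightarrow> bool" where
  "C1_into N b u v \<longleftrightarrow>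
     C0_into N b u \<and> C0_into N b v \<and>
     (\<forall>t\<in>{0..b}.
        ((\<lambda>\<tau>. N (\<lambda>x. (u \<tau> x - u t x) / (\<tau> - t) - v t x)) \<longlongrightarrow> 0) (at t within {0..b}))"

text \<open>u is a solution in \<open>E\<^sup>\<infinity>\<close> on [0,T). The functions u t are representatives of elements of
  \<open>L\<^sup>\<infinity>\<close>, so identities between functions of x hold almost everywhere; v is the time
  derivative and w t represents the distributional derivative of u t. All terms of the equation
  other than g t are continuous in t with values in \<open>L\<^sup>\<infinity>\<close>, so a solution can exist only if g is
  continuous on [0,T).\<close>

definition is_solution ::
  "(real \<Rightarrow> real) \<Rightarrow> ennreal \<Rightarrow> ennreal \<Rightarrow> (real \<Rightarrow> real) \<Rightarrow> (real \<Rightarrow> real) \<Rightarrow> real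
     \<Rightarrow> (real \<Rightarrow> real \<Rightarrow> real) \<Rightarrow> bool" where
  "is_solution \<phi> p r g u0 T u \<longleftrightarrow>
     (\<exists>v w.
        (\<forall>s>2. \<forall>b. 0 \<le> b \<and> b < T \<longrightarrow>
           C0_into (E_norm \<phi> p r s) b u \<and> C1_into (Ebar_norm \<phi> p r s) b u v) \<and>
        (\<forall>t. 0 \<le> t \<and> t < T \<longrightarrow>
           is_fun (deriv_distr (rdistr (u t))) (cfun (w t)) \<and>
           (\<forall>x. set_integrable lborel {..x} (\<lambda>z. (w t z)\<^sup>2 / 2)) \<and>
           (AE x in lborel.
              v t x + u t x * w t x = (LINT z:{..x}|lborel. (w t z)\<^sup>2 / 2) + g t)) \<and>
        (AE x in lborel. u 0 x = u0 x))"

definition max_time ::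
  "(real \<Rightarrow> real) \<Rightarrow> ennreal \<Rightarrow> ennreal \<Rightarrow> (real \<Rightarrow> real) \<Rightarrow> (real \<Rightarrow> real) \<Rightarrow> ereal" where
  "max_time \<phi> p r g u0 = (SUP T\<in>{T. 0 < T \<and> (\<exists>u. is_solution \<phi> p r g u0 T u)}. ereal T)"

end

theory Submission
  imports Defs "HOL-Real_Asymp.Real_Asymp" "HOL-Probability.Probability"
begin

text \<open>
  Along the characteristics \<open>Y(t, a) = a + t u0(a) + t\<^sup>2/2 H0(a) + \<integral>\<integral>g\<close>, where \<open>H0\<close> is the primitive of
  \<open>u0'\<^sup>2/2\<close> vanishing at \<open>-\<infinity>\<close>, the slope satisfies the Riccati equation \<open>w' = -w\<^sup>2/2\<close>. Hence the solution
  is explicit, \<open>w = u0' / (1 + t u0'/2)\<close> and \<open>Y\<^sub>a = (1 + t u0'/2)\<^sup>2\<close>, and it lives exactly until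
  \<open>T = 2 / K\<close> with \<open>- K = min u0'\<close>. For the initial datum take \<open>u0 = \<Sum>k=1..N. (K/N) 2\<^sup>-\<^sup>k h(2\<^sup>k x)\<close> with
  \<open>h = (exp(-x\<^sup>2/2))'\<close>: all derivatives add up at 0, so that \<open>min u0' = - K\<close> is as large as desired, whereas
  the norm of \<open>A\<close> is of order \<open>K N powr (1/r - 1)\<close>, since the summands have essentially disjoint frequencies;
  it is small for large \<open>N\<close> because \<open>r > 1\<close>. The low frequencies of \<open>u\<^sub>x\<close> below \<open>2\<^sup>N\<close> are bounded by
  \<open>N + 1\<close> times the Besov norm, which therefore blows up with \<open>w\<close>. Uniqueness: elements of \<open>E\<^sup>\<infinity>\<close> are
  smooth in \<open>x\<close>, and the difference of two solutions obeys, jointly with the difference of their energies,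
  a Gronwall inequality in the sup norm. A solution beyond \<open>T\<close> would have bounded slope on \<open>[0, T]\<close>.
\<close>

section \<open>Smooth functions\<close>

text \<open>The solution does not decay in x: for t > 0 it tends to \<open>G1 t\<close> plus t times
  the total energy at the right end, so u is only bounded while all its derivatives decay. This is
  enough because a homogeneous block sees u through u_x: block j of u is at most
  \<open>2 powr (- j)\<close> times the size of u_x, which is summable against
  \<open>2 powr (j * \<sigma>)\<close> towards low frequencies exactly when \<sigma> > 1, and s > 2
  puts both orders s and s - 1 into this range. \<open>Lp_distr\<close> is an infimum over
  representing functions. Upper bounds follow by exhibiting a convolution. Lower bounds, which are
  behind both the blow-up and the smoothness of arbitrary solutions, must hold for every
  representing function and are obtained by testing a block against the kernel of a wider
  multiplier. The explicit formula uses g on all of [0, T], so T is taken below both \<epsilon> and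
  the time up to which g is continuous; then K = 2 / T is fixed, and only the number N of summands
  remains free to make the norm of the datum small.\<close>

lemma smooth_has_vderiv:
  assumes "smooth f"
  shows "((vderiv ^^ n) f has_vector_derivative (vderiv ^^ Suc n) f x) (at x)"
  using assms unfolding smooth_def by (simp add: vderiv_def vector_derivative_works[symmetric])

lemma funpow_vderiv_eq:
  assumes "\<And>n x. (F n has_vector_derivative F (Suc n) x) (at x)"
  shows "(vderiv ^^ n) (F 0) = F n"
proof (induction n)
  case (Suc n)
  then show ?case
    using assms by (auto simp: vderiv_def intro!: vector_derivative_at)
qed simp

lemma smoothI:
  assumes "\<And>n x. (F n has_vector_derivative F (Suc n) x) (at x)" and "f = F 0"
  shows "smooth f"
  unfolding smooth_def \<open>f = F 0\<close> funpow_vderiv_eq[of F, OF assms(1)]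
  using assms(1) differentiableI_vector by blast

text \<open>Replaces formulas for the n-th derivative: it is enough to find a class each of whose
  members has a derivative in the class. For products and quotients only the first derivative then
  has to be recognised as a member.\<close>

lemma smooth_coinduct:
  assumes P: "\<And>h. P h \<Longrightarrow> \<exists>h'. P h' \<and> (\<forall>x. (h has_vector_derivative h' x) (at x))" and "P f"
  shows "smooth f"
proof -
  have d: "P (vderiv h) \<and> (\<forall>x. (h has_vector_derivative vderiv h x) (at x))" if h: "P h" for h
  proof -
    obtain h' where h': "P h'" "\<And>x. (h has_vector_derivative h' x) (at x)"
      using P[OF h] by (elim exE conjE) auto
    then have "vderiv h = h'"
      by (auto simp: vderiv_def intro!: vector_derivative_at)
    then show ?thesis using h' by auto
  qed
  have "P ((vderiv ^^ n) f)" for n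
    by (induction n) (use d \<open>P f\<close> in auto)
  then show ?thesis
    by (intro smoothI[of "\<lambda>n. (vderiv ^^ n) f"]) (use d in auto)
qed

lemma smooth_vderiv: "smooth f \<Longrightarrow> smooth (vderiv f)"
  by (rule smoothI[of "\<lambda>n. (vderiv ^^ Suc n) f"])
    (simp_all only: smooth_has_vderiv, simp)

lemma smooth_vderiv_at: "smooth f \<Longrightarrow> (f has_vector_derivative vderiv f x) (at x)"
  using smooth_has_vderiv[of f 0] by simp

lemma smooth_continuous: "smooth f \<Longrightarrow> continuous_on A f"
  by (meson smooth_vderiv_at has_vector_derivative_continuous continuous_at_imp_continuous_on)

text \<open>The class left invariant by the product rule, used as the predicate of
  \<open>smooth_coinduct\<close>: the derivative of one product is a sum of two.\<close>

inductive sum_of_products :: "(real \<Rightarrow> complex) \<Rightarrow> bool" where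
  prod: "smooth f \<Longrightarrow> smooth g \<Longrightarrow> sum_of_products (\<lambda>x. f x * g x)"
| add: "sum_of_products f \<Longrightarrow> sum_of_products g \<Longrightarrow> sum_of_products (\<lambda>x. f x + g x)"

lemma smooth_mult:
  fixes f g :: "real \<Rightarrow> complex"
  assumes "smooth f" "smooth g"
  shows "smooth (\<lambda>x. f x * g x)"
proof (rule smooth_coinduct)
  show "sum_of_products (\<lambda>x. f x * g x)"
    using assms by (rule sum_of_products.prod)
  show "\<exists>h'. sum_of_products h' \<and> (\<forall>x. (h has_vector_derivative h' x) (at x))" if "sum_of_products h" for h
    using that
  proof induction
    case (prod f g)
    then show ?case
      by (intro exI[of _ "\<lambda>x. f x * vderiv g x + vderiv f x * g x"] conjI allI sum_of_products.intros
          has_vector_derivative_mult smooth_vderiv smooth_vderiv_at)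
  next
    case (add f g)
    then obtain f' g' where "sum_of_products f'" "sum_of_products g'"
      "\<And>x. (f has_vector_derivative f' x) (at x)" "\<And>x. (g has_vector_derivative g' x) (at x)" by blast
    then show ?case
      by (intro exI[of _ "\<lambda>x. f' x + g' x"] conjI allI sum_of_products.intros has_vector_derivative_add)
  qed
qed

lemma smooth_add:
  fixes f g :: "real \<Rightarrow> 'a::real_normed_vector"
  assumes "smooth f" "smooth g"
  shows "smooth (\<lambda>x. f x + g x)"
  by (rule smoothI[of "\<lambda>n x. (vderiv ^^ n) f x + (vderiv ^^ n) g x"])
     (intro has_vector_derivative_add smooth_has_vderiv assms, simp)

lemma smooth_affine: "smooth f \<Longrightarrow> smooth (\<lambda>x. f (c * x + d))"
  for f :: "real \<Rightarrow> 'a::real_normed_vector"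
proof (rule smoothI[of "\<lambda>n x. c ^ n *\<^sub>R (vderiv ^^ n) f (c * x + d)"])
  fix n x assume f: "smooth f"
  have "(((vderiv ^^ n) f \<circ> (\<lambda>x. c * x + d)) has_vector_derivative c *\<^sub>R (vderiv ^^ Suc n) f (c * x + d)) (at x)"
    by (intro vector_diff_chain_at smooth_has_vderiv f) (auto intro!: derivative_eq_intros)
  from bounded_linear.has_vector_derivative[OF bounded_linear_scaleR_right this, of "c ^ n"]
  show "((\<lambda>x. c ^ n *\<^sub>R (vderiv ^^ n) f (c * x + d)) has_vector_derivative
      c ^ Suc n *\<^sub>R (vderiv ^^ Suc n) f (c * x + d)) (at x)"
    by (simp add: mult.commute o_def)
qed simp

lemma smooth_cfun: "smooth f \<Longrightarrow> smooth (cfun f)"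
proof (rule smoothI[of "\<lambda>n. cfun ((vderiv ^^ n) f)"])
  fix n x assume "smooth f"
  then show "(cfun ((vderiv ^^ n) f) has_vector_derivative cfun ((vderiv ^^ Suc n) f) x) (at x)"
    by (intro has_vector_derivative_of_real) (simp only: has_real_derivative_iff_has_vector_derivative smooth_has_vderiv)
qed simp

lemma has_vderiv_exp_ii:
  "((\<lambda>\<xi>. exp (c * complex_of_real \<xi>)) has_vector_derivative c * exp (c * complex_of_real \<xi>)) (at \<xi> within S)"
  by (rule has_vector_derivative_real_field) (auto intro!: derivative_eq_intros)

lemma smooth_exp: "smooth (\<lambda>\<xi>. exp (c * complex_of_real \<xi>))"
proof (rule smoothI[of "\<lambda>n \<xi>. c ^ n * exp (c * complex_of_real \<xi>)"])
  fix n x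
  show "((\<lambda>\<xi>. c ^ n * exp (c * complex_of_real \<xi>)) has_vector_derivative c ^ Suc n * exp (c * complex_of_real x)) (at x)"
    using has_vector_derivative_mult_right[OF has_vderiv_exp_ii, of "c^n" c x UNIV] by (simp add: mult_ac)
qed simp

lemma smooth_linear: "smooth (\<lambda>\<xi>. c + d * complex_of_real \<xi>)"
proof (rule smooth_coinduct[of "\<lambda>h. \<exists>c d. h = (\<lambda>\<xi>. c + d * complex_of_real \<xi>)"])
  fix h assume "\<exists>c d. h = (\<lambda>\<xi>. c + d * complex_of_real \<xi>)"
  then obtain c d where h: "h = (\<lambda>\<xi>. c + d * complex_of_real \<xi>)" by auto
  have "(h has_vector_derivative d + 0 * complex_of_real x) (at x)" for x
    unfolding h by (auto intro!: derivative_eq_intros)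
  then show "\<exists>h'. (\<exists>c d. h' = (\<lambda>\<xi>. c + d * complex_of_real \<xi>)) \<and> (\<forall>x. (h has_vector_derivative h' x) (at x))"
    by blast
qed blast

lemma smooth_mult_power: "smooth \<theta> \<Longrightarrow> smooth (\<lambda>\<xi>. (c * complex_of_real \<xi>) ^ n * \<theta> \<xi>)"
proof (induction n)
  case (Suc n)
  then show ?case
    using smooth_mult[OF smooth_linear[of 0 c], of "\<lambda>\<xi>. (c * complex_of_real \<xi>) ^ n * \<theta> \<xi>"]
    by (simp add: mult.assoc)
qed simp

text \<open>The class of all \<open>\<psi> / \<xi> ^ m\<close> with \<open>\<psi>\<close> vanishing
  on \<open>\<bar>\<xi>\<bar> < c\<close> is closed under differentiation. On that interval, which
  contains the singularity, every member is identically 0, since 0 divided by anything, even by 0,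
  is 0.\<close>

lemma smooth_divide_away_from_zero:
  fixes \<psi> :: "real \<Rightarrow> complex"
  assumes "smooth \<psi>" "0 < c" "\<And>\<xi>. \<bar>\<xi>\<bar> < c \<Longrightarrow> \<psi> \<xi> = 0"
  shows "smooth (\<lambda>\<xi>. \<psi> \<xi> / of_real \<xi>)"
proof (rule smooth_coinduct)
  let ?P = "\<lambda>h. \<exists>\<psi> (m::nat). smooth \<psi> \<and> (\<forall>\<xi>. \<bar>\<xi>\<bar> < c \<longrightarrow> \<psi> \<xi> = 0) \<and> h = (\<lambda>\<xi>. \<psi> \<xi> / complex_of_real \<xi> ^ m)"
  show "?P (\<lambda>\<xi>. \<psi> \<xi> / of_real \<xi>)"
    by (rule exI[of _ \<psi>], rule exI[of _ 1]) (use assms in auto)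
  fix h assume "?P h"
  then obtain \<psi> m where \<psi>: "smooth \<psi>" and z: "\<And>\<xi>. \<bar>\<xi>\<bar> < c \<Longrightarrow> \<psi> \<xi> = 0"
    and h: "h = (\<lambda>\<xi>. \<psi> \<xi> / complex_of_real \<xi> ^ m)" by blast
  \<comment> \<open>Numerator of the quotient rule over \<open>\<xi> ^ Suc m\<close>, that is
    \<open>\<xi> * \<psi>' - m * \<psi>\<close>, with both coefficients written as affine functions
    so that \<open>smooth_linear\<close> applies.\<close>
  let ?\<psi> = "\<lambda>\<xi>. (0 + 1 * complex_of_real \<xi>) * vderiv \<psi> \<xi> + (- of_nat m + 0 * complex_of_real \<xi>) * \<psi> \<xi>"
  have zero_near: "\<forall>\<^sub>F \<xi> in nhds x. \<bar>\<xi>\<bar> < c" if "\<bar>x\<bar> < c" for x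
    by (rule eventually_nhds_in_open[of "{\<xi>. \<bar>\<xi>\<bar> < c}", simplified])
       (use that in \<open>auto intro!: open_Collect_less continuous_intros\<close>)
  have const: "(k has_vector_derivative 0) (at x)" if "\<bar>x\<bar> < c" "\<And>\<xi>. \<bar>\<xi>\<bar> < c \<Longrightarrow> k \<xi> = 0" for k :: "real \<Rightarrow> complex" and x
  proof -
    have "((\<lambda>_. 0::complex) has_vector_derivative 0) (at x) \<longleftrightarrow> (k has_vector_derivative 0) (at x)"
      using that by (intro has_vector_derivative_cong_ev eventually_mono[OF zero_near[OF that(1)]]) auto
    then show ?thesis by simp
  qed
  have dz: "vderiv \<psi> x = 0" if "\<bar>x\<bar> < c" for x
    using const[OF that z] by (auto simp: vderiv_def intro!: vector_derivative_at)
  have sm: "smooth ?\<psi>"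
    by (intro smooth_add smooth_mult smooth_linear smooth_vderiv \<psi>)
  have "(h has_vector_derivative ?\<psi> x / complex_of_real x ^ Suc m) (at x)" for x
  proof (cases "\<bar>x\<bar> < c")
    case True
    then show ?thesis using const[OF True, of h] z dz by (auto simp: h)
  next
    case False
    then have x0: "x \<noteq> 0" using \<open>0 < c\<close> by auto
    have "((\<lambda>\<xi>. inverse (complex_of_real \<xi> ^ m)) has_vector_derivative
        - (of_nat m * of_real x ^ (m - 1)) / (of_real x ^ m * of_real x ^ m)) (at x)"
      by (rule has_vector_derivative_real_field)
         (use x0 in \<open>auto intro!: derivative_eq_intros simp: field_simps power_add mult_2\<close>)
    from has_vector_derivative_mult[OF smooth_vderiv_at[OF \<psi>] this]
    have "(h has_vector_derivative \<psi> x * (- (of_nat m * of_real x ^ (m - 1)) / (of_real x ^ m * of_real x ^ m)) + vderiv \<psi> x * inverse (of_real x ^ m)) (at x)"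
      by (simp add: h divide_inverse)
    also have "\<psi> x * (- (of_nat m * of_real x ^ (m - 1)) / (of_real x ^ m * of_real x ^ m)) + vderiv \<psi> x * inverse (of_real x ^ m)
       = ?\<psi> x / complex_of_real x ^ Suc m"
      using x0 by (cases m) (auto simp: field_simps power_add mult_2)
    finally show ?thesis .
  qed
  then show "\<exists>h'. ?P h' \<and> (\<forall>x. (h has_vector_derivative h' x) (at x))"
    by (intro exI[of _ "\<lambda>x. ?\<psi> x / complex_of_real x ^ Suc m"] conjI exI[of _ ?\<psi>] exI[of _ "Suc m"])
       (use sm z dz in auto)
qed

section \<open>Differentiation under the integral sign\<close>

lemma has_vector_derivative_quotient:
  "(f has_vector_derivative f') (at x within S) \<longleftrightarrow> ((\<lambda>y. (f y - f x) /\<^sub>R (y - x)) \<longlongrightarrow> f') (at x within S)"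
proof -
  have "(f has_vector_derivative f') (at x within S) \<longleftrightarrow>
    ((\<lambda>y. norm (f y - f x - (y - x) *\<^sub>R f') / norm (y - x)) \<longlongrightarrow> 0) (at x within S)"
    unfolding has_vector_derivative_def has_derivative_iff_norm
    using bounded_linear_scaleR_left[of f'] by simp
  also have "\<dots> \<longleftrightarrow> ((\<lambda>y. norm ((f y - f x) /\<^sub>R (y - x) - f')) \<longlongrightarrow> 0) (at x within S)"
  proof (rule filterlim_cong[OF refl refl])
    have "norm (f y - f x - (y - x) *\<^sub>R f') / norm (y - x) = norm ((f y - f x) /\<^sub>R (y - x) - f')" if "y \<noteq> x" for y
    proof -
      have "(f y - f x) /\<^sub>R (y - x) - f' = (f y - f x - (y - x) *\<^sub>R f') /\<^sub>R (y - x)"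
        using that by (simp add: scaleR_diff_right)
      then show ?thesis by (simp add: divide_inverse mult.commute)
    qed
    then show "\<forall>\<^sub>F y in at x within S. norm (f y - f x - (y - x) *\<^sub>R f') / norm (y - x) = norm ((f y - f x) /\<^sub>R (y - x) - f')"
      by (auto simp: eventually_at_filter)
  qed
  also have "\<dots> \<longleftrightarrow> ((\<lambda>y. (f y - f x) /\<^sub>R (y - x)) \<longlongrightarrow> f') (at x within S)"
    by (simp add: tendsto_norm_zero_iff LIM_zero_iff)
  finally show ?thesis .
qed

text \<open>The mean value inequality bounds the difference quotients on the unit ball around
  \<open>x0\<close> by \<open>D\<close>, so dominated convergence applies along every sequence
  tending to \<open>x0\<close>.\<close>

lemma has_vector_derivative_integral:
  fixes F :: "real \<Rightarrow> 'a \<Rightarrow> complex"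
  assumes int: "\<And>x. x \<in> ball x0 1 \<Longrightarrow> integrable M (F x)"
    and deriv: "\<And>x y. x \<in> ball x0 1 \<Longrightarrow> y \<in> space M \<Longrightarrow> ((\<lambda>x. F x y) has_vector_derivative F' x y) (at x)"
    and bound: "\<And>x y. x \<in> ball x0 1 \<Longrightarrow> y \<in> space M \<Longrightarrow> cmod (F' x y) \<le> D y"
    and D: "integrable M D"
  shows "((\<lambda>x. \<integral>y. F x y \<partial>M) has_vector_derivative (\<integral>y. F' x0 y \<partial>M)) (at x0)"
    and "integrable M (F' x0)"
proof -
  have lim: "(\<lambda>n. (F (X n) y - F x0 y) /\<^sub>R (X n - x0)) \<longlonglongrightarrow> F' x0 y"
    if "y \<in> space M" "X \<longlonglongrightarrow> x0" "\<And>n. X n \<noteq> x0" for X :: "nat \<Rightarrow> real" and y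
  proof -
    have "((\<lambda>x. (F x y - F x0 y) /\<^sub>R (x - x0)) \<longlongrightarrow> F' x0 y) (at x0)"
      using deriv[of x0 y] that unfolding has_vector_derivative_quotient by simp
    then show ?thesis using that by (auto simp: tendsto_at_iff_sequentially o_def)
  qed
  have lip: "cmod ((F x y - F x0 y) /\<^sub>R (x - x0)) \<le> D y" if "y \<in> space M" "x \<in> ball x0 1" "x \<noteq> x0" for x y
  proof -
    have "cmod (F x y - F x0 y) \<le> D y * norm (x - x0)"
    proof (rule differentiable_bound[of "ball x0 1" "\<lambda>x. F x y" "\<lambda>x h. h *\<^sub>R F' x y"])
      show "((\<lambda>x. F x y) has_derivative (\<lambda>h. h *\<^sub>R F' x y)) (at x within ball x0 1)" if "x \<in> ball x0 1" for x
        using deriv[OF that \<open>y \<in> space M\<close>] by (auto simp: has_vector_derivative_def intro: has_derivative_at_withinI)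
      show "onorm (\<lambda>h. h *\<^sub>R F' x y) \<le> D y" if "x \<in> ball x0 1" for x
        using bound[OF that \<open>y \<in> space M\<close>]
        by (intro onorm_bound) (auto simp: mult.commute[of _ "\<bar>_\<bar>"] intro: order_trans[OF norm_ge_zero] mult_left_mono)
    qed (use that in auto)
    then show ?thesis using that by (simp add: divide_simps mult.commute)
  qed
  have gen: "(\<lambda>n. \<integral>y. (F (X n) y - F x0 y) /\<^sub>R (X n - x0) \<partial>M) \<longlonglongrightarrow> (\<integral>y. F' x0 y \<partial>M)" (is ?A)
     "integrable M (F' x0)" (is ?B)
    if X: "X \<longlonglongrightarrow> x0" "\<And>n. X n \<noteq> x0" "\<And>n. X n \<in> ball x0 1" for X :: "nat \<Rightarrow> real"
  proof -
    have meas: "(\<lambda>y. (F (X n) y - F x0 y) /\<^sub>R (X n - x0)) \<in> borel_measurable M" for n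
      using int[of "X n"] int[of x0] X by (intro borel_measurable_scaleR borel_measurable_diff) (auto simp: integrable_iff_bounded)
    have meas': "F' x0 \<in> borel_measurable M"
      by (rule borel_measurable_LIMSEQ_metric[OF meas lim]) (use X in auto)
    have ae1: "AE y in M. (\<lambda>n. (F (X n) y - F x0 y) /\<^sub>R (X n - x0)) \<longlonglongrightarrow> F' x0 y"
      by (rule AE_I2) (use lim X in auto)
    have ae2: "AE y in M. norm ((F (X n) y - F x0 y) /\<^sub>R (X n - x0)) \<le> D y" for n
      by (rule AE_I2) (use lip X in auto)
    show ?A by (rule integral_dominated_convergence[OF meas' meas D ae1 ae2])
    show ?B by (rule integrable_dominated_convergence[OF meas' meas D ae1 ae2])
  qed
  \<comment> \<open>Any one admissible sequence shows that the limit \<open>F' x0\<close> is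
    integrable; the offset 2 keeps this one inside the open unit ball.\<close>
  have "(\<lambda>n. x0 + 1 / (real n + 2)) \<longlonglongrightarrow> x0" by real_asymp
  then show "integrable M (F' x0)"
    by (rule gen(2)) (auto simp: dist_real_def)
  show "((\<lambda>x. \<integral>y. F x y \<partial>M) has_vector_derivative (\<integral>y. F' x0 y \<partial>M)) (at x0)"
    unfolding has_vector_derivative_quotient tendsto_at_iff_sequentially
  proof (intro allI impI)
    fix X :: "nat \<Rightarrow> real" assume X: "\<forall>i. X i \<in> UNIV - {x0}" "X \<longlonglongrightarrow> x0"
    have "\<forall>\<^sub>F n in sequentially. X n \<in> ball x0 1"
      using topological_tendstoD[OF X(2), of "ball x0 1"] by simp
    \<comment> \<open>A general sequence enters the ball only eventually, so the limit is taken for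
      its tail and transferred back by \<open>LIMSEQ_offset\<close>.\<close>
    then obtain N where N: "\<And>n. n \<ge> N \<Longrightarrow> X n \<in> ball x0 1"
      by (auto simp: eventually_sequentially)
    have "(\<lambda>n. \<integral>y. (F (X (n + N)) y - F x0 y) /\<^sub>R (X (n + N) - x0) \<partial>M) \<longlonglongrightarrow> (\<integral>y. F' x0 y \<partial>M)"
      by (rule gen(1)) (use X N in \<open>auto intro: LIMSEQ_ignore_initial_segment\<close>)
    also have "(\<lambda>n. \<integral>y. (F (X (n + N)) y - F x0 y) /\<^sub>R (X (n + N) - x0) \<partial>M)
       = (\<lambda>n. ((\<integral>y. F (X (n + N)) y \<partial>M) - (\<integral>y. F x0 y \<partial>M)) /\<^sub>R (X (n + N) - x0))"
      using int[OF N] int[of x0] by (auto simp: Bochner_Integration.integral_diff)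
    finally have "(\<lambda>n. ((\<integral>y. F (X (n + N)) y \<partial>M) - (\<integral>y. F x0 y \<partial>M)) /\<^sub>R (X (n + N) - x0)) \<longlonglongrightarrow> (\<integral>y. F' x0 y \<partial>M)" .
    from LIMSEQ_offset[OF this]
    show "((\<lambda>x. ((\<integral>y. F x y \<partial>M) - (\<integral>y. F x0 y \<partial>M)) /\<^sub>R (x - x0)) \<circ> X) \<longlonglongrightarrow> (\<integral>y. F' x0 y \<partial>M)"
      by (simp add: o_def)
  qed
qed

section \<open>The Fourier transform of test functions\<close>

text \<open>Compactly supported smooth functions, thought of as living on the frequency side. Their
  transforms are Schwartz functions and can be inverted, which is the part of Fourier theory that
  the multipliers below rest on.\<close>

definition test_funs :: "(real \<Rightarrow> complex) set" where
  "test_funs = {\<theta>. smooth \<theta> \<and> (\<exists>R. \<forall>\<xi>. \<bar>\<xi>\<bar> > R \<longrightarrow> \<theta> \<xi> = 0)}"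

lemma test_funs_smooth: "\<theta> \<in> test_funs \<Longrightarrow> smooth \<theta>"
  by (simp add: test_funs_def)

lemma test_funs_support:
  assumes "\<theta> \<in> test_funs"
  obtains R where "0 < R" "\<And>\<xi>. \<bar>\<xi>\<bar> > R \<Longrightarrow> \<theta> \<xi> = 0"
proof -
  from assms obtain R where "\<And>\<xi>. \<bar>\<xi>\<bar> > R \<Longrightarrow> \<theta> \<xi> = 0"
    by (auto simp: test_funs_def)
  then show thesis
    by (intro that[of "max R 1"]) auto
qed

lemma test_funs_integrable: "\<theta> \<in> test_funs \<Longrightarrow> integrable lborel \<theta>"
proof -
  assume \<theta>: "\<theta> \<in> test_funs"
  obtain R where R: "0 < R" "\<And>\<xi>. \<bar>\<xi>\<bar> > R \<Longrightarrow> \<theta> \<xi> = 0"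
    using test_funs_support[OF \<theta>] by blast
  have "integrable lborel (\<lambda>x. indicator {-R..R} x *\<^sub>R \<theta> x)"
    by (intro borel_integrable_compact smooth_continuous test_funs_smooth \<theta>) auto
  also have "(\<lambda>x. indicator {-R..R} x *\<^sub>R \<theta> x) = \<theta>"
    using R by (auto simp: fun_eq_iff indicator_def)
  finally show ?thesis .
qed

lemma test_funs_mult: "smooth f \<Longrightarrow> \<theta> \<in> test_funs \<Longrightarrow> (\<lambda>\<xi>. f \<xi> * \<theta> \<xi>) \<in> test_funs"
  by (auto simp: test_funs_def smooth_mult)

lemma test_funs_vderiv:
  assumes "\<theta> \<in> test_funs" shows "vderiv \<theta> \<in> test_funs"
proof -
  obtain R where R: "0 < R" "\<And>\<xi>. \<bar>\<xi>\<bar> > R \<Longrightarrow> \<theta> \<xi> = 0"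
    using test_funs_support[OF assms] by blast
  have "vderiv \<theta> x = 0" if "\<bar>x\<bar> > R" for x
  proof -
    have "\<forall>\<^sub>F \<xi> in nhds x. \<bar>\<xi>\<bar> > R"
      by (rule eventually_nhds_in_open[of "{\<xi>. \<bar>\<xi>\<bar> > R}", simplified])
         (use that in \<open>auto intro!: open_Collect_less continuous_intros\<close>)
    then have "((\<lambda>_. 0::complex) has_vector_derivative 0) (at x) \<longleftrightarrow> (\<theta> has_vector_derivative 0) (at x)"
      using R that by (intro has_vector_derivative_cong_ev) (auto elim: eventually_mono)
    then show ?thesis by (auto simp: vderiv_def intro!: vector_derivative_at)
  qed
  then show ?thesis
    using assms smooth_vderiv unfolding test_funs_def by blast
qed

lemma test_funs_power: "\<theta> \<in> test_funs \<Longrightarrow> (\<lambda>\<xi>. (c * complex_of_real \<xi>) ^ n * \<theta> \<xi>) \<in> test_funs"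
  by (auto simp: test_funs_def smooth_mult_power)

lemma test_funs_affine: "\<theta> \<in> test_funs \<Longrightarrow> c \<noteq> 0 \<Longrightarrow> (\<lambda>\<xi>. \<theta> (c * \<xi> + d)) \<in> test_funs"
proof -
  assume \<theta>: "\<theta> \<in> test_funs" and c: "c \<noteq> 0"
  obtain R where R: "0 < R" "\<And>\<xi>. \<bar>\<xi>\<bar> > R \<Longrightarrow> \<theta> \<xi> = 0"
    using test_funs_support[OF \<theta>] by blast
  have "\<theta> (c * \<xi> + d) = 0" if "\<bar>\<xi>\<bar> > (R + \<bar>d\<bar>) / \<bar>c\<bar>" for \<xi>
  proof (rule R(2))
    have "R + \<bar>d\<bar> < \<bar>c * \<xi>\<bar>"
      using that c by (simp add: field_simps abs_mult)
    then show "R < \<bar>c * \<xi> + d\<bar>" by linarith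
  qed
  then show ?thesis
    using \<theta> by (auto simp: test_funs_def smooth_affine)
qed

lemma test_funs_exp: "\<theta> \<in> test_funs \<Longrightarrow> (\<lambda>\<xi>. exp (c * complex_of_real \<xi>) * \<theta> \<xi>) \<in> test_funs"
  by (intro test_funs_mult smooth_exp)

section \<open>Derivatives and decay of Fourier transforms\<close>

lemma continuous_imp_measurable_borel:
  "continuous_on UNIV f \<Longrightarrow> f \<in> borel_measurable borel"
  for f :: "real \<Rightarrow> 'a::topological_space"
  by (rule borel_measurable_continuous_onI)

lemma integrable_exp_mult:
  assumes "integrable lborel f"
  shows "integrable lborel (\<lambda>x. exp (- \<i> * complex_of_real (x * \<xi>)) * f x)"
proof (rule Bochner_Integration.integrable_bound[OF assms])
  have [measurable]: "f \<in> borel_measurable lborel" using assms by auto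
  show "(\<lambda>x. exp (- \<i> * complex_of_real (x * \<xi>)) * f x) \<in> borel_measurable lborel"
    by measurable
qed (auto simp: norm_mult)

lemma fourier_has_vector_derivative:
  assumes f: "integrable lborel f" and xf: "integrable lborel (\<lambda>x. of_real x * f x)"
  shows "(fourier f has_vector_derivative fourier (\<lambda>x. (- \<i> * of_real x) * f x) \<xi>) (at \<xi>)"
proof -
  let ?F' = "\<lambda>\<xi> y. exp (- \<i> * complex_of_real (y * \<xi>)) * ((- \<i> * of_real y) * f y)"
  have "((\<lambda>\<xi>. \<integral>y. exp (- \<i> * complex_of_real (y * \<xi>)) * f y \<partial>lborel) has_vector_derivative
     (\<integral>y. ?F' \<xi> y \<partial>lborel)) (at \<xi>)"
  proof (rule has_vector_derivative_integral(1))
    show "integrable lborel (\<lambda>y. cmod (of_real y * f y))" using xf by simp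
    show "cmod (?F' x y) \<le> cmod (of_real y * f y)" for x y
      by (simp add: norm_mult)
    show "((\<lambda>x. exp (- \<i> * complex_of_real (y * x)) * f y) has_vector_derivative ?F' x y) (at x)" for x y
    proof -
      have "((\<lambda>x. exp ((- \<i> * of_real y) * complex_of_real x) * f y) has_vector_derivative
          ((- \<i> * of_real y) * exp ((- \<i> * of_real y) * complex_of_real x)) * f y) (at x)"
        by (intro has_vector_derivative_mult_left has_vderiv_exp_ii)
      then show ?thesis by (simp add: mult_ac)
    qed
  qed (use integrable_exp_mult[OF f] in auto)
  then show ?thesis by (simp add: fourier_def[abs_def])
qed

text \<open>The integrals over [-n, n] equal G(n) - G(-n), which tends to 0. Applied to a product
  this is integration by parts over the line without boundary terms.\<close>

lemma integral_derivative_eq_0: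
  fixes G :: "real \<Rightarrow> complex"
  assumes G: "\<And>x. (G has_vector_derivative G' x) (at x)" and int: "integrable lborel G'"
    and lim: "(G \<longlongrightarrow> 0) at_top" "(G \<longlongrightarrow> 0) at_bot"
  shows "(\<integral>x. G' x \<partial>lborel) = 0"
proof -
  have [measurable]: "G' \<in> borel_measurable lborel" using int by auto
  have "(\<lambda>n. \<integral>x. indicator {- real n..real n} x *\<^sub>R G' x \<partial>lborel) \<longlonglongrightarrow> (\<integral>x. G' x \<partial>lborel)"
  proof (rule integral_dominated_convergence[where w="\<lambda>x. cmod (G' x)"])
    show "AE x in lborel. (\<lambda>n. indicator {- real n..real n} x *\<^sub>R G' x) \<longlonglongrightarrow> G' x"
    proof (rule AE_I2)
      fix x :: real
      obtain N :: nat where N: "\<bar>x\<bar> \<le> real N" using real_arch_simple by blast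
      show "(\<lambda>n. indicator {- real n..real n} x *\<^sub>R G' x) \<longlonglongrightarrow> G' x"
        by (rule tendsto_eventually) (use N in \<open>auto simp: eventually_sequentially indicator_def intro!: exI[of _ N]\<close>)
    qed
  qed (use int in \<open>auto simp: indicator_def\<close>)
  moreover have "(\<integral>x. indicator {- real n..real n} x *\<^sub>R G' x \<partial>lborel) = G (real n) - G (- real n)" for n
  proof -
    have "set_integrable lborel {- real n..real n} G'"
      using int by (auto simp: set_integrable_def intro!: integrable_mult_indicator)
    then have "(LINT x:{- real n..real n}|lborel. G' x) = integral {- real n..real n} G'"
      by (rule set_borel_integral_eq_integral(2))
    moreover have "(G' has_integral (G (real n) - G (- real n))) {- real n..real n}"
      by (intro fundamental_theorem_of_calculus) (auto intro: has_vector_derivative_at_within G)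
    ultimately show ?thesis
      by (auto simp: set_lebesgue_integral_def integral_unique)
  qed
  moreover have "(\<lambda>n. G (real n) - G (- real n)) \<longlonglongrightarrow> 0 - 0"
    by (intro tendsto_diff filterlim_compose[OF lim(1)] filterlim_compose[OF lim(2)])
       (auto intro: filterlim_real_sequentially simp: filterlim_uminus_at_top_at_bot filterlim_uminus_at_bot)
  ultimately show ?thesis by (auto dest: LIMSEQ_unique)
qed

lemma fourier_derivative:
  assumes f: "\<And>x. (f has_vector_derivative f' x) (at x)" "integrable lborel f" "integrable lborel f'"
    and lim: "(f \<longlongrightarrow> 0) at_top" "(f \<longlongrightarrow> 0) at_bot"
  shows "fourier f' \<xi> = \<i> * of_real \<xi> * fourier f \<xi>"
proof -
  let ?e = "\<lambda>x. exp (- \<i> * complex_of_real (x * \<xi>))"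
  have "(\<integral>x. ?e x * f' x + (- \<i> * of_real \<xi>) * (?e x * f x) \<partial>lborel) = 0"
  proof (rule integral_derivative_eq_0)
    show "((\<lambda>x. ?e x * f x) has_vector_derivative ?e x * f' x + (- \<i> * of_real \<xi>) * (?e x * f x)) (at x)" for x
    proof -
      have "((\<lambda>x. exp ((- \<i> * of_real \<xi>) * complex_of_real x) * f x) has_vector_derivative
          exp ((- \<i> * of_real \<xi>) * complex_of_real x) * f' x + ((- \<i> * of_real \<xi>) * exp ((- \<i> * of_real \<xi>) * complex_of_real x)) * f x) (at x)"
        by (intro has_vector_derivative_mult has_vderiv_exp_ii f)
      then show ?thesis by (simp add: mult_ac)
    qed
    show "integrable lborel (\<lambda>x. ?e x * f' x + (- \<i> * of_real \<xi>) * (?e x * f x))"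
      by (intro Bochner_Integration.integrable_add integrable_mult_right integrable_exp_mult f)
    have "((\<lambda>x. norm (f x)) \<longlongrightarrow> 0) at_top" "((\<lambda>x. norm (f x)) \<longlongrightarrow> 0) at_bot"
      using lim by (auto intro: tendsto_norm_zero)
    then show "((\<lambda>x. ?e x * f x) \<longlongrightarrow> 0) at_top" "((\<lambda>x. ?e x * f x) \<longlongrightarrow> 0) at_bot"
      by (intro tendsto_norm_zero_cancel[of "\<lambda>x. ?e x * f x"]; simp add: norm_mult)+
  qed
  also have "(\<integral>x. ?e x * f' x + (- \<i> * of_real \<xi>) * (?e x * f x) \<partial>lborel) =
     (\<integral>x. ?e x * f' x \<partial>lborel) + (\<integral>x. (- \<i> * of_real \<xi>) * (?e x * f x) \<partial>lborel)"
    by (intro Bochner_Integration.integral_add integrable_mult_right integrable_exp_mult f)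
  also have "(\<integral>x. (- \<i> * of_real \<xi>) * (?e x * f x) \<partial>lborel) = (- \<i> * of_real \<xi>) * (\<integral>x. ?e x * f x \<partial>lborel)"
    by (rule integral_mult_right_zero)
  finally show ?thesis by (simp add: fourier_def algebra_simps)
qed

lemma norm_fourier_le: "cmod (fourier f \<xi>) \<le> (\<integral>x. cmod (f x) \<partial>lborel)"
proof -
  have "cmod (fourier f \<xi>) \<le> (\<integral>x. cmod (exp (- \<i> * complex_of_real (x * \<xi>)) * f x) \<partial>lborel)"
    unfolding fourier_def by (rule integral_norm_bound)
  then show ?thesis by (simp add: norm_mult)
qed

text \<open>Each power of x is traded for one derivative of \<open>\<theta>\<close>, which is a test
  function again; hence the induction over m generalises \<open>\<theta>\<close>.\<close>

lemma fourier_test_funs_decay: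
  assumes "\<theta> \<in> test_funs"
  shows "\<exists>B. \<forall>x. \<bar>x\<bar> ^ m * cmod (fourier \<theta> x) \<le> B"
  using assms
proof (induction m arbitrary: \<theta>)
  case 0
  then show ?case using norm_fourier_le[of \<theta>] by auto
next
  case (Suc m)
  obtain R where R: "0 < R" "\<And>\<xi>. \<bar>\<xi>\<bar> > R \<Longrightarrow> \<theta> \<xi> = 0"
    using test_funs_support[OF Suc.prems] by blast
  have "(\<theta> \<longlongrightarrow> 0) at_top"
    by (intro tendsto_eventually eventually_mono[OF eventually_gt_at_top[of R]] R) auto
  moreover have "(\<theta> \<longlongrightarrow> 0) at_bot"
    by (intro tendsto_eventually eventually_mono[OF eventually_at_bot_dense[THEN iffD2, OF exI[of _ "-R"]]] R) auto
  ultimately have "fourier (vderiv \<theta>) \<xi> = \<i> * of_real \<xi> * fourier \<theta> \<xi>" for \<xi>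
    by (intro fourier_derivative) (auto intro: Suc.prems test_funs_integrable test_funs_vderiv smooth_vderiv_at test_funs_smooth)
  then have eq: "\<bar>x\<bar> ^ m * cmod (fourier (vderiv \<theta>) x) = \<bar>x\<bar> ^ Suc m * cmod (fourier \<theta> x)" for x
    by (simp add: norm_mult mult_ac)
  show ?case using Suc.IH[OF test_funs_vderiv[OF Suc.prems]] unfolding eq .
qed

lemma fourier_test_funs_has_vderiv:
  assumes "\<theta> \<in> test_funs"
  shows "(fourier \<theta> has_vector_derivative fourier (\<lambda>x. (- \<i> * of_real x) * \<theta> x) \<xi>) (at \<xi>)"
  by (rule fourier_has_vector_derivative[OF test_funs_integrable[OF assms]])
     (use test_funs_integrable[OF test_funs_power[OF assms, of 1 1]] in simp)

lemma fourier_test_funs_schwartz: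
  assumes \<theta>: "\<theta> \<in> test_funs"
  shows "fourier \<theta> \<in> schwartz"
proof -
  define F where "F = (\<lambda>n. fourier (\<lambda>\<xi>. (- \<i> * of_real \<xi>) ^ n * \<theta> \<xi>))"
  have F: "(F n has_vector_derivative F (Suc n) x) (at x)" for n x
    using fourier_test_funs_has_vderiv[OF test_funs_power[OF \<theta>, of "-\<i>" n]] by (simp add: F_def mult.assoc)
  have F0: "fourier \<theta> = F 0" by (simp add: F_def)
  have "bounded (range (\<lambda>x. x ^ m *\<^sub>R F n x))" for m n
    using fourier_test_funs_decay[OF test_funs_power[OF \<theta>, of "-\<i>" n], of m]
    by (auto simp: bounded_iff F_def power_abs)
  moreover have "(vderiv ^^ n) (F 0) = F n" for n
    by (rule funpow_vderiv_eq, rule F)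
  ultimately show ?thesis
    using smoothI[of F, OF F] by (auto simp: schwartz_def F0)
qed

lemma integrable_inverse_1_plus_sq: "integrable lborel (\<lambda>x::real. 1 / (1 + x\<^sup>2))"
  using integrable_inverse_1_plus_square by (simp add: set_integrable_def einterval_def inverse_eq_divide)

lemma abs_le_imp_integrable_1_plus_sq:
  fixes f :: "real \<Rightarrow> 'a::{banach, second_countable_topology}"
  assumes [measurable]: "f \<in> borel_measurable borel" and "\<And>x. norm (f x) \<le> C / (1 + x\<^sup>2)"
  shows "integrable lborel f"
  by (rule Bochner_Integration.integrable_bound[OF integrable_mult_right[OF integrable_inverse_1_plus_sq, of C]])
     (use assms in \<open>auto intro!: AE_I2 order_trans[OF assms(2)] divide_right_mono\<close>)

lemma fourier_test_funs_le:
  assumes \<theta>: "\<theta> \<in> test_funs"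
  obtains C where "\<And>x. cmod (fourier \<theta> x) \<le> C / (1 + x\<^sup>2)" "0 < C"
proof -
  obtain B0 where B0: "\<And>x. cmod (fourier \<theta> x) \<le> B0"
    using fourier_test_funs_decay[OF \<theta>, of 0] by auto
  obtain B2 where B2: "\<And>x. x\<^sup>2 * cmod (fourier \<theta> x) \<le> B2"
    using fourier_test_funs_decay[OF \<theta>, of 2] by auto
  have "cmod (fourier \<theta> x) \<le> (\<bar>B0\<bar> + \<bar>B2\<bar> + 1) / (1 + x\<^sup>2)" for x
  proof -
    have "(1 + x\<^sup>2) * cmod (fourier \<theta> x) \<le> \<bar>B0\<bar> + \<bar>B2\<bar> + 1"
      using B0[of x] B2[of x] by (simp add: algebra_simps)
    moreover have "0 < 1 + x\<^sup>2" by (simp add: add_pos_nonneg)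
    ultimately show ?thesis by (simp add: pos_le_divide_eq mult.commute)
  qed
  then show thesis by (rule that) simp
qed

lemma fourier_test_funs_continuous: "\<theta> \<in> test_funs \<Longrightarrow> continuous_on A (fourier \<theta>)"
  by (meson fourier_test_funs_has_vderiv has_vector_derivative_continuous continuous_at_imp_continuous_on)

lemma fourier_test_funs_integrable:
  assumes "\<theta> \<in> test_funs" shows "integrable lborel (fourier \<theta>)"
proof -
  obtain C where "\<And>x. cmod (fourier \<theta> x) \<le> C / (1 + x\<^sup>2)" using fourier_test_funs_le[OF assms] by blast
  then show ?thesis
    by (intro abs_le_imp_integrable_1_plus_sq continuous_imp_measurable_borel fourier_test_funs_continuous assms)
qed

section \<open>Fubini with a bounded kernel, and Fourier inversion\<close>

lemma integrable_pair_bounded_mult: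
  fixes f g :: "real \<Rightarrow> complex" and K :: "real \<Rightarrow> real \<Rightarrow> complex"
  assumes f: "integrable lborel f" and g: "integrable lborel g"
    and K: "(\<lambda>(x, y). K x y) \<in> borel_measurable (borel \<Otimes>\<^sub>M borel)" "\<And>x y. cmod (K x y) \<le> 1"
  shows "integrable (lborel \<Otimes>\<^sub>M lborel) (\<lambda>(x, y). K x y * f x * g y)"
proof (rule lborel_pair.Fubini_integrable)
  have [measurable]: "f \<in> borel_measurable borel" "g \<in> borel_measurable borel"
    using f g by auto
  note K(1)[measurable]
  have [measurable]: "K x \<in> borel_measurable borel" for x
    using measurable_compose_Pair1[OF _ K(1), of x] by simp
  show "(\<lambda>(x, y). K x y * f x * g y) \<in> borel_measurable (lborel \<Otimes>\<^sub>M lborel)"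
    by measurable
  have le: "cmod (K x y * f x * g y) \<le> cmod (f x) * cmod (g y)" for x y
    using mult_right_mono[OF K(2)[of x y], of "cmod (f x) * cmod (g y)"] by (simp add: norm_mult mult_ac)
  have int: "integrable lborel (\<lambda>y. K x y * f x * g y)" for x
    by (rule Bochner_Integration.integrable_bound[OF integrable_mult_right[OF integrable_norm[OF g], of "cmod (f x)"]])
       (use le[of x] in auto)
  show "AE x in lborel. integrable lborel (\<lambda>y. case (x, y) of (x, y) \<Rightarrow> K x y * f x * g y)"
    using int by auto
  show "integrable lborel (\<lambda>x. \<integral>y. norm (case (x, y) of (x, y) \<Rightarrow> K x y * f x * g y) \<partial>lborel)"
  proof (rule Bochner_Integration.integrable_bound[OF integrable_mult_left[OF integrable_norm[OF f], of "\<integral>y. cmod (g y) \<partial>lborel"]])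
    show "(\<lambda>x. \<integral>y. norm (case (x, y) of (x, y) \<Rightarrow> K x y * f x * g y) \<partial>lborel) \<in> borel_measurable lborel"
      by measurable
    have "(\<integral>y. cmod (K x y * f x * g y) \<partial>lborel) \<le> (\<integral>y. cmod (f x) * cmod (g y) \<partial>lborel)" for x
      by (intro integral_mono le integrable_norm int integrable_mult_right g)
    then show "AE x in lborel. norm (\<integral>y. norm (case (x, y) of (x, y) \<Rightarrow> K x y * f x * g y) \<partial>lborel)
        \<le> norm (cmod (f x) * (\<integral>y. cmod (g y) \<partial>lborel))"
      by (intro AE_I2) (simp add: abs_mult integral_nonneg)
  qed
qed

text \<open>K stands for the exponential of a Fourier integral, with either sign; exchanging the
  integrals moves the transform from one factor to the other.\<close>

lemma Fubini_bounded_mult: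
  fixes f g :: "real \<Rightarrow> complex" and K :: "real \<Rightarrow> real \<Rightarrow> complex"
  assumes f: "integrable lborel f" and g: "integrable lborel g"
    and K: "(\<lambda>(x, y). K x y) \<in> borel_measurable (borel \<Otimes>\<^sub>M borel)" "\<And>x y. cmod (K x y) \<le> 1"
  shows "(\<integral>x. f x * (\<integral>y. K x y * g y \<partial>lborel) \<partial>lborel) = (\<integral>y. g y * (\<integral>x. K x y * f x \<partial>lborel) \<partial>lborel)"
proof -
  have "(\<integral>y. (\<integral>x. K x y * f x * g y \<partial>lborel) \<partial>lborel) = (\<integral>x. (\<integral>y. K x y * f x * g y \<partial>lborel) \<partial>lborel)"
    by (rule lborel_pair.Fubini_integral) (rule integrable_pair_bounded_mult[OF assms])
  moreover have "(\<integral>x. K x y * f x * g y \<partial>lborel) = g y * (\<integral>x. K x y * f x \<partial>lborel)" for y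
    by (simp add: mult.commute)
  moreover have "(\<integral>y. K x y * f x * g y \<partial>lborel) = f x * (\<integral>y. K x y * g y \<partial>lborel)" for x
    by (simp add: mult_ac flip: integral_mult_right_zero)
  ultimately show ?thesis by (simp add: mult.commute)
qed

lemma fourier_gaussian:
  "(\<integral>x. exp (- \<i> * complex_of_real (\<xi> * x)) * complex_of_real (std_normal_density x) \<partial>lborel) = of_real (exp (- \<xi>\<^sup>2 / 2))"
proof -
  have "char std_normal_distribution (- \<xi>) = (\<integral>x. std_normal_density x *\<^sub>R iexp (- \<xi> * x) \<partial>lborel)"
    unfolding char_def by (subst integral_density) auto
  then show ?thesis
    by (simp add: char_std_normal_distribution scaleR_conv_of_real mult.commute)
qed

text \<open>Inversion at the point 0 by Gaussian regularisation. Fubini turns the integral of the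
  transform against a wide Gaussian into an average of \<open>\<theta>\<close> against a narrow one.
  As n grows, the first tends to the integral of the transform and the second to
  \<open>2 * pi * \<theta> 0\<close>.\<close>

lemma integral_fourier:
  assumes \<theta>: "\<theta> \<in> test_funs"
  shows "(\<integral>x. fourier \<theta> x \<partial>lborel) = of_real (2 * pi) * \<theta> 0"
proof -
  \<comment> \<open>The factor c enters once when the weight is written as a normal density and once
    when a density is recovered from the transformed Gaussian; the product is
    \<open>2 * pi\<close>.\<close>
  define c where "c = sqrt (2 * pi)"
  have c0: "c > 0" by (simp add: c_def)
  define A where "A = (\<lambda>n::nat. \<integral>x. complex_of_real (exp (- (x / (real n+1))\<^sup>2 / 2)) * fourier \<theta> x \<partial>lborel)"
  have [measurable]: "\<theta> \<in> borel_measurable borel" "fourier \<theta> \<in> borel_measurable borel"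
    by (intro continuous_imp_measurable_borel smooth_continuous test_funs_smooth \<theta> fourier_test_funs_continuous)+
  have gauss: "integrable lborel (\<lambda>x. complex_of_real (exp (- (x / (real n+1))\<^sup>2 / 2)))" for n :: nat
  proof -
    have "integrable lborel (\<lambda>x. c * std_normal_density (0 + (1 / (real n+1)) * x))"
      by (intro integrable_mult_right lborel_integrable_real_affine integrable_normal_density) auto
    then have "integrable lborel (\<lambda>x. complex_of_real (c * std_normal_density (0 + (1 / (real n+1)) * x)))"
      by (rule integrable_of_real)
    then show ?thesis using c0 by (simp add: std_normal_density_def c_def add.commute)
  qed
  have lim1: "A \<longlonglongrightarrow> (\<integral>x. fourier \<theta> x \<partial>lborel)"
    unfolding A_def
  proof (rule integral_dominated_convergence[where w="\<lambda>x. cmod (fourier \<theta> x)"])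
    show "integrable lborel (\<lambda>x. cmod (fourier \<theta> x))"
      by (intro integrable_norm fourier_test_funs_integrable \<theta>)
    show "AE x in lborel. (\<lambda>n. complex_of_real (exp (- (x / (real n+1))\<^sup>2 / 2)) * fourier \<theta> x) \<longlonglongrightarrow> fourier \<theta> x"
    proof (rule AE_I2)
      fix x :: real
      have "(\<lambda>n. x / (real n+1)) \<longlonglongrightarrow> 0" by real_asymp
      then have "(\<lambda>n. exp (- (x / (real n+1))\<^sup>2 / 2)) \<longlonglongrightarrow> exp (- 0\<^sup>2 / 2)"
        by (intro tendsto_intros) auto
      then have "(\<lambda>n. exp (- (x / (real n+1))\<^sup>2 / 2)) \<longlonglongrightarrow> 1" by simp
      then have "(\<lambda>n. complex_of_real (exp (- (x / (real n+1))\<^sup>2 / 2)) * fourier \<theta> x) \<longlonglongrightarrow> of_real 1 * fourier \<theta> x"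
        by (intro tendsto_intros)
      then show "(\<lambda>n. complex_of_real (exp (- (x / (real n+1))\<^sup>2 / 2)) * fourier \<theta> x) \<longlonglongrightarrow> fourier \<theta> x" by simp
    qed
    show "AE x in lborel. norm (complex_of_real (exp (- (x / (real n+1))\<^sup>2 / 2)) * fourier \<theta> x) \<le> cmod (fourier \<theta> x)" for n
      by (rule AE_I2) (simp add: norm_mult mult_left_le_one_le)
  qed auto
  have inner: "(\<integral>x. exp (- \<i> * complex_of_real (\<xi> * x)) * complex_of_real (exp (- (x / (real n+1))\<^sup>2 / 2)) \<partial>lborel)
      = of_real ((real n+1) * c * exp (- ((real n+1) * \<xi>)\<^sup>2 / 2))" for \<xi> and n :: nat
  proof -
    have "(\<integral>x. exp (- \<i> * complex_of_real (\<xi> * x)) * complex_of_real (exp (- (x / (real n+1))\<^sup>2 / 2)) \<partial>lborel)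
      = \<bar>real n+1\<bar> *\<^sub>R (\<integral>y. exp (- \<i> * complex_of_real (\<xi> * (0 + (real n+1) * y))) *
           complex_of_real (exp (- ((0 + (real n+1) * y) / (real n+1))\<^sup>2 / 2)) \<partial>lborel)"
      by (rule lborel_integral_real_affine) simp
    also have "(\<lambda>y. exp (- \<i> * complex_of_real (\<xi> * (0 + (real n+1) * y))) *
           complex_of_real (exp (- ((0 + (real n+1) * y) / (real n+1))\<^sup>2 / 2))) =
       (\<lambda>y. of_real c * (exp (- \<i> * complex_of_real ((real n+1) * \<xi> * y)) * complex_of_real (std_normal_density y)))"
    proof
      fix y :: real
      have "real n + 1 \<noteq> 0" by linarith
      then have "(0 + (real n+1) * y) / (real n+1) = y" by (simp add: field_simps)
      then show "exp (- \<i> * complex_of_real (\<xi> * (0 + (real n+1) * y))) *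
           complex_of_real (exp (- ((0 + (real n+1) * y) / (real n+1))\<^sup>2 / 2)) =
         of_real c * (exp (- \<i> * complex_of_real ((real n+1) * \<xi> * y)) * complex_of_real (std_normal_density y))"
        using c0 by (simp add: std_normal_density_def c_def mult_ac)
    qed
    also have "integral\<^sup>L lborel \<dots> = of_real c * of_real (exp (- ((real n+1) * \<xi>)\<^sup>2 / 2))"
      by (subst integral_mult_right_zero, subst fourier_gaussian) simp
    finally show ?thesis by (simp add: scaleR_conv_of_real mult_ac)
  qed
  have A: "A n = (\<integral>\<eta>. of_real (2 * pi * std_normal_density \<eta>) * \<theta> (\<eta> / (real n+1)) \<partial>lborel)" for n :: nat
  proof -
    have "A n = (\<integral>x. complex_of_real (exp (- (x / (real n+1))\<^sup>2 / 2)) * (\<integral>\<xi>. exp (- \<i> * complex_of_real (\<xi> * x)) * \<theta> \<xi> \<partial>lborel) \<partial>lborel)"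
      by (simp add: A_def fourier_def add.commute)
    also have "\<dots> = (\<integral>\<xi>. \<theta> \<xi> * (\<integral>x. exp (- \<i> * complex_of_real (\<xi> * x)) * complex_of_real (exp (- (x / (real n+1))\<^sup>2 / 2)) \<partial>lborel) \<partial>lborel)"
      by (rule Fubini_bounded_mult[OF gauss test_funs_integrable[OF \<theta>]]) auto
    also have "\<dots> = (\<integral>\<xi>. \<theta> \<xi> * of_real ((real n+1) * c * exp (- ((real n+1) * \<xi>)\<^sup>2 / 2)) \<partial>lborel)"
      by (simp only: inner)
    also have "\<dots> = \<bar>1 / (real n+1)\<bar> *\<^sub>R (\<integral>\<eta>. \<theta> (0 + 1 / (real n+1) * \<eta>) * of_real ((real n+1) * c * exp (- ((real n+1) * (0 + 1 / (real n+1) * \<eta>))\<^sup>2 / 2)) \<partial>lborel)"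
      by (rule lborel_integral_real_affine) simp
    also have "\<dots> = (\<integral>\<eta>. \<bar>1 / (real n+1)\<bar> *\<^sub>R (\<theta> (0 + 1 / (real n+1) * \<eta>) * of_real ((real n+1) * c * exp (- ((real n+1) * (0 + 1 / (real n+1) * \<eta>))\<^sup>2 / 2))) \<partial>lborel)"
      by simp
    also have "(\<lambda>\<eta>. \<bar>1 / (real n+1)\<bar> *\<^sub>R (\<theta> (0 + 1 / (real n+1) * \<eta>) * of_real ((real n+1) * c * exp (- ((real n+1) * (0 + 1 / (real n+1) * \<eta>))\<^sup>2 / 2))))
        = (\<lambda>\<eta>. of_real (2 * pi * std_normal_density \<eta>) * \<theta> (\<eta> / (real n+1)))"
    proof
      fix \<eta> :: real
      have n: "real n + 1 \<noteq> 0" by linarith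
      have e: "(real n+1) * (0 + 1 / (real n+1) * \<eta>) = \<eta>" using n by simp
      have cc: "c * c = 2 * pi" by (simp add: c_def)
      have "2 * pi * std_normal_density \<eta> = c * exp (- \<eta>\<^sup>2 / 2)"
        using c0 unfolding std_normal_density_def c_def[symmetric] cc[symmetric] by simp
      moreover have "\<bar>1 / (real n+1)\<bar> * ((real n+1) * c * E) = c * E" for E
        using n by simp
      ultimately have "\<bar>1 / (real n+1)\<bar> * ((real n+1) * c * exp (- ((real n+1) * (0 + 1 / (real n+1) * \<eta>))\<^sup>2 / 2)) = 2 * pi * std_normal_density \<eta>"
        unfolding e by simp
      then show "\<bar>1 / (real n+1)\<bar> *\<^sub>R (\<theta> (0 + 1 / (real n+1) * \<eta>) * of_real ((real n+1) * c * exp (- ((real n+1) * (0 + 1 / (real n+1) * \<eta>))\<^sup>2 / 2)))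
        = of_real (2 * pi * std_normal_density \<eta>) * \<theta> (\<eta> / (real n+1))"
        by (simp only: scaleR_conv_of_real mult.left_commute[of "of_real _" "\<theta> _"] flip: of_real_mult) (simp add: add.commute)
    qed
    finally show ?thesis .
  qed
  \<comment> \<open>Boundedness of \<open>\<theta>\<close> provides the dominating function, a
    multiple of the normal density.\<close>
  obtain B where B: "\<And>\<xi>. cmod (\<theta> \<xi>) \<le> B"
  proof -
    obtain R where R: "0 < R" "\<And>\<xi>. \<bar>\<xi>\<bar> > R \<Longrightarrow> \<theta> \<xi> = 0"
      using test_funs_support[OF \<theta>] by blast
    have "compact (\<theta> ` {-R..R})"
      by (intro compact_continuous_image smooth_continuous test_funs_smooth \<theta>) auto
    then obtain B where "\<forall>y\<in>\<theta> ` {-R..R}. cmod y \<le> B"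
      using compact_imp_bounded bounded_iff by blast
    have "cmod (\<theta> \<xi>) \<le> max B 0" for \<xi>
      using R(2)[of \<xi>] \<open>\<forall>y\<in>\<theta> ` {-R..R}. cmod y \<le> B\<close>
      by (cases "\<bar>\<xi>\<bar> > R") (auto simp: not_less abs_le_iff intro!: max.coboundedI1)
    then show thesis by (rule that)
  qed
  have lim2: "A \<longlonglongrightarrow> (\<integral>\<eta>. of_real (2 * pi * std_normal_density \<eta>) * \<theta> 0 \<partial>lborel)"
    unfolding A
  proof (rule integral_dominated_convergence[where w="\<lambda>\<eta>. B * (2 * pi * std_normal_density \<eta>)"])
    show "AE \<eta> in lborel. (\<lambda>n. of_real (2 * pi * std_normal_density \<eta>) * \<theta> (\<eta> / (real n+1))) \<longlonglongrightarrow> of_real (2 * pi * std_normal_density \<eta>) * \<theta> 0"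
    proof (rule AE_I2)
      fix \<eta> :: real
      have "isCont \<theta> 0"
        using smooth_vderiv_at[OF test_funs_smooth[OF \<theta>]] has_vector_derivative_continuous by blast
      moreover have "(\<lambda>n. \<eta> / (real n+1)) \<longlonglongrightarrow> 0" by real_asymp
      ultimately show "(\<lambda>n. of_real (2 * pi * std_normal_density \<eta>) * \<theta> (\<eta> / (real n+1))) \<longlonglongrightarrow> of_real (2 * pi * std_normal_density \<eta>) * \<theta> 0"
        by (intro tendsto_mult tendsto_const isCont_tendsto_compose[of _ \<theta>])
    qed
    show "AE \<eta> in lborel. norm (of_real (2 * pi * std_normal_density \<eta>) * \<theta> (\<eta> / (real n+1))) \<le> B * (2 * pi * std_normal_density \<eta>)" for n
      by (rule AE_I2) (use B in \<open>auto simp: norm_mult mult.commute[of B] intro!: mult_left_mono\<close>)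
  qed auto
  have "(\<integral>\<eta>. of_real (2 * pi * std_normal_density \<eta>) * \<theta> 0 \<partial>lborel) = complex_of_real (\<integral>\<eta>. 2 * pi * std_normal_density \<eta> \<partial>lborel) * \<theta> 0"
    by (subst integral_mult_left_zero, subst integral_of_real) (auto intro: integrable_mult_right)
  also have "\<dots> = of_real (2 * pi) * \<theta> 0" by simp
  finally show ?thesis using LIMSEQ_unique[OF lim1 lim2] by simp
qed

lemma fourier_shift:
  "exp (\<i> * complex_of_real (x * a)) * fourier \<theta> x = fourier (\<lambda>\<xi>. \<theta> (\<xi> + a)) x"
proof -
  have "fourier \<theta> x = (\<integral>\<xi>. exp (- \<i> * complex_of_real ((a + 1 * \<xi>) * x)) * \<theta> (a + 1 * \<xi>) \<partial>lborel)"
    unfolding fourier_def by (subst lborel_integral_real_affine[of 1 _ a]) auto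
  also have "\<dots> = (\<integral>\<xi>. exp (- \<i> * complex_of_real (x * a)) * (exp (- \<i> * complex_of_real (\<xi> * x)) * \<theta> (\<xi> + a)) \<partial>lborel)"
    by (intro Bochner_Integration.integral_cong) (auto simp: algebra_simps exp_add[symmetric] mult_exp_exp)
  also have "\<dots> = exp (- \<i> * complex_of_real (x * a)) * fourier (\<lambda>\<xi>. \<theta> (\<xi> + a)) x"
    by (simp add: fourier_def)
  finally show ?thesis by (simp add: exp_minus)
qed

text \<open>Modulating the transform translates \<open>\<theta>\<close>, so inversion at a reduces
  to \<open>integral_fourier\<close> for a translate.\<close>

theorem inv_fourier_fourier:
  assumes "\<theta> \<in> test_funs"
  shows "inv_fourier (fourier \<theta>) = \<theta>"
proof
  fix a
  have "inv_fourier (fourier \<theta>) a = (\<integral>x. fourier (\<lambda>\<xi>. \<theta> (\<xi> + a)) x \<partial>lborel) / of_real (2 * pi)"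
    by (simp add: inv_fourier_def mult.commute[of a] flip: fourier_shift)
  also have "\<dots> = \<theta> a"
    using integral_fourier[OF test_funs_affine[OF assms, of 1 a]] by simp
  finally show "inv_fourier (fourier \<theta>) a = \<theta> a" .
qed

section \<open>Kernels of Fourier multipliers\<close>

lemma inv_fourier_eq_fourier: "inv_fourier \<theta> = fourier (\<lambda>\<xi>. \<theta> (- \<xi>) / of_real (2 * pi))"
proof
  fix x
  have "(\<integral>\<xi>. exp (\<i> * complex_of_real (x * \<xi>)) * \<theta> \<xi> \<partial>lborel)
     = \<bar>-1\<bar> *\<^sub>R (\<integral>\<xi>. exp (\<i> * complex_of_real (x * (0 + (-1) * \<xi>))) * \<theta> (0 + (-1) * \<xi>) \<partial>lborel)"
    by (rule lborel_integral_real_affine) simp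
  also have "\<dots> = (\<integral>\<xi>. exp (- \<i> * complex_of_real (\<xi> * x)) * \<theta> (- \<xi>) \<partial>lborel)"
    by (simp add: mult.commute)
  finally show "inv_fourier \<theta> x = fourier (\<lambda>\<xi>. \<theta> (- \<xi>) / of_real (2 * pi)) x"
    by (simp add: inv_fourier_def fourier_def)
qed

lemma test_funs_cmult: "\<theta> \<in> test_funs \<Longrightarrow> (\<lambda>\<xi>. c * \<theta> \<xi>) \<in> test_funs"
  using test_funs_mult[OF smooth_linear[of c 0]] by simp

lemma test_funs_reflect: "\<theta> \<in> test_funs \<Longrightarrow> (\<lambda>\<xi>. \<theta> (- \<xi>) / of_real (2 * pi)) \<in> test_funs"
  using test_funs_cmult[OF test_funs_affine[of \<theta> "-1" 0], of "1 / of_real (2 * pi)"] by simp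

lemma inv_fourier_test_funs_continuous: "\<theta> \<in> test_funs \<Longrightarrow> continuous_on A (inv_fourier \<theta>)"
  unfolding inv_fourier_eq_fourier by (intro fourier_test_funs_continuous test_funs_reflect)

lemma inv_fourier_test_funs_measurable: "\<theta> \<in> test_funs \<Longrightarrow> inv_fourier \<theta> \<in> borel_measurable borel"
  by (intro continuous_imp_measurable_borel inv_fourier_test_funs_continuous)

lemma inv_fourier_test_funs_integrable: "\<theta> \<in> test_funs \<Longrightarrow> integrable lborel (inv_fourier \<theta>)"
  unfolding inv_fourier_eq_fourier by (intro fourier_test_funs_integrable test_funs_reflect)

lemma inv_fourier_test_funs_le:
  assumes "\<theta> \<in> test_funs"
  obtains C where "\<And>x. cmod (inv_fourier \<theta> x) \<le> C / (1 + x\<^sup>2)" "0 < C"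
  using fourier_test_funs_le[OF test_funs_reflect[OF assms]] unfolding inv_fourier_eq_fourier by blast

lemma inv_fourier_has_vderiv:
  assumes "\<theta> \<in> test_funs"
  shows "(inv_fourier \<theta> has_vector_derivative inv_fourier (\<lambda>\<xi>. (\<i> * of_real \<xi>) * \<theta> \<xi>) x) (at x)"
  using fourier_test_funs_has_vderiv[OF test_funs_reflect[OF assms]] unfolding inv_fourier_eq_fourier
  by (simp add: mult.assoc)

lemma inv_fourier_scale:
  assumes "0 < l"
  shows "inv_fourier (\<lambda>\<xi>. \<theta> (\<xi> / l)) x = of_real l * inv_fourier \<theta> (l * x)"
proof -
  have "(\<integral>\<xi>. exp (\<i> * complex_of_real (x * \<xi>)) * \<theta> (\<xi> / l) \<partial>lborel)
     = \<bar>l\<bar> *\<^sub>R (\<integral>\<xi>. exp (\<i> * complex_of_real (x * (0 + l * \<xi>))) * \<theta> ((0 + l * \<xi>) / l) \<partial>lborel)"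
    by (rule lborel_integral_real_affine) (use assms in simp)
  also have "\<dots> = of_real l * (\<integral>\<xi>. exp (\<i> * complex_of_real (l * x * \<xi>)) * \<theta> \<xi> \<partial>lborel)"
    using assms by (simp add: scaleR_conv_of_real mult_ac)
  finally show ?thesis by (simp add: inv_fourier_def)
qed

text \<open>Exhibits the reflected and translated kernel as the transform of a test function. It is
  therefore a Schwartz function, at which distributions may be evaluated, and its inverse transform
  is known explicitly.\<close>

lemma inv_fourier_translate:
  "inv_fourier \<zeta> (x - y) = fourier (\<lambda>\<xi>. exp (\<i> * of_real x * of_real \<xi>) * (1 / of_real (2 * pi) * \<zeta> \<xi>)) y"
proof -
  have "exp (\<i> * complex_of_real ((x - y) * \<xi>)) * \<zeta> \<xi> = of_real (2 * pi) *
    (exp (- \<i> * complex_of_real (\<xi> * y)) * (exp (\<i> * of_real x * of_real \<xi>) * (1 / of_real (2 * pi) * \<zeta> \<xi>)))" for \<xi>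
  proof -
    have "exp (\<i> * complex_of_real ((x - y) * \<xi>)) = exp (- \<i> * complex_of_real (\<xi> * y)) * exp (\<i> * of_real x * of_real \<xi>)"
      by (simp add: algebra_simps mult_exp_exp)
    then show ?thesis by simp
  qed
  then show ?thesis
    unfolding inv_fourier_def fourier_def by (simp only: integral_mult_right_zero) simp
qed

lemma test_funs_translate:
  "\<zeta> \<in> test_funs \<Longrightarrow> (\<lambda>\<xi>. exp (\<i> * of_real x * of_real \<xi>) * (1 / of_real (2 * pi) * \<zeta> \<xi>)) \<in> test_funs"
  by (intro test_funs_exp test_funs_cmult)

section \<open>Decay and integrability of Schwartz functions\<close>

lemma schwartz_le:
  assumes "\<psi> \<in> schwartz"
  obtains C where "\<And>x. cmod (\<psi> x) \<le> C / (1 + x\<^sup>2)" "0 < C"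
proof -
  have b: "bounded (range (\<lambda>x. x ^ m *\<^sub>R \<psi> x))" for m
  proof -
    have "bounded (range (\<lambda>x. x ^ m *\<^sub>R (vderiv ^^ 0) \<psi> x))"
      using assms unfolding schwartz_def by blast
    then show ?thesis by simp
  qed
  obtain B0 where B0: "\<And>x. cmod (\<psi> x) \<le> B0"
    using b[of 0] by (auto simp: bounded_iff)
  obtain B2 where B2: "\<And>x. x\<^sup>2 * cmod (\<psi> x) \<le> B2"
    using b[of 2] by (auto simp: bounded_iff)
  have "cmod (\<psi> x) \<le> (\<bar>B0\<bar> + \<bar>B2\<bar> + 1) / (1 + x\<^sup>2)" for x
  proof -
    have "(1 + x\<^sup>2) * cmod (\<psi> x) \<le> \<bar>B0\<bar> + \<bar>B2\<bar> + 1"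
      using B0[of x] B2[of x] by (simp add: algebra_simps)
    moreover have "0 < 1 + x\<^sup>2" by (simp add: add_pos_nonneg)
    ultimately show ?thesis by (simp add: pos_le_divide_eq mult.commute)
  qed
  then show thesis by (rule that) simp
qed

lemma schwartz_smooth: "\<psi> \<in> schwartz \<Longrightarrow> smooth \<psi>"
  by (simp add: schwartz_def)

lemma schwartz_measurable: "\<psi> \<in> schwartz \<Longrightarrow> \<psi> \<in> borel_measurable borel"
  by (intro continuous_imp_measurable_borel smooth_continuous schwartz_smooth)

lemma schwartz_integrable:
  assumes "\<psi> \<in> schwartz" shows "integrable lborel \<psi>"
proof -
  obtain C where "\<And>x. cmod (\<psi> x) \<le> C / (1 + x\<^sup>2)" using schwartz_le[OF assms] by blast
  then show ?thesis by (intro abs_le_imp_integrable_1_plus_sq schwartz_measurable assms)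
qed

text \<open>Action of a multiplier on the test function side: after Fubini the inner integral is the
  inverse transform of \<open>\<theta>\<close> at y - x, so the result is a convolution with the
  reflected kernel.\<close>

lemma fourier_mult_inv_fourier:
  assumes \<theta>: "\<theta> \<in> test_funs" and \<psi>: "integrable lborel \<psi>"
  shows "fourier (\<lambda>\<xi>. \<theta> \<xi> * inv_fourier \<psi> \<xi>) x = (\<integral>y. \<psi> y * inv_fourier \<theta> (y - x) \<partial>lborel)"
proof -
  let ?f = "\<lambda>\<xi>. exp (- \<i> * complex_of_real (\<xi> * x)) * \<theta> \<xi>"
  have "fourier (\<lambda>\<xi>. \<theta> \<xi> * inv_fourier \<psi> \<xi>) x =
     (\<integral>\<xi>. (?f \<xi> * (\<integral>y. exp (\<i> * complex_of_real (\<xi> * y)) * \<psi> y \<partial>lborel)) / of_real (2 * pi) \<partial>lborel)"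
    by (simp add: fourier_def inv_fourier_def mult.assoc)
  also have "\<dots> = (\<integral>\<xi>. ?f \<xi> * (\<integral>y. exp (\<i> * complex_of_real (\<xi> * y)) * \<psi> y \<partial>lborel) \<partial>lborel) / of_real (2 * pi)"
    by (rule integral_divide_zero)
  also have "(\<integral>\<xi>. ?f \<xi> * (\<integral>y. exp (\<i> * complex_of_real (\<xi> * y)) * \<psi> y \<partial>lborel) \<partial>lborel)
     = (\<integral>y. \<psi> y * (\<integral>\<xi>. exp (\<i> * complex_of_real (\<xi> * y)) * ?f \<xi> \<partial>lborel) \<partial>lborel)"
    by (rule Fubini_bounded_mult[OF integrable_exp_mult[OF test_funs_integrable[OF \<theta>]] \<psi>]) auto
  also have "(\<lambda>y. \<psi> y * (\<integral>\<xi>. exp (\<i> * complex_of_real (\<xi> * y)) * ?f \<xi> \<partial>lborel))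
     = (\<lambda>y. of_real (2 * pi) * (\<psi> y * inv_fourier \<theta> (y - x)))"
  proof
    fix y
    have "exp (\<i> * complex_of_real (\<xi> * y)) * ?f \<xi> = exp (\<i> * complex_of_real ((y - x) * \<xi>)) * \<theta> \<xi>" for \<xi>
      by (simp add: algebra_simps mult_exp_exp exp_add[symmetric])
    then show "\<psi> y * (\<integral>\<xi>. exp (\<i> * complex_of_real (\<xi> * y)) * ?f \<xi> \<partial>lborel) = of_real (2 * pi) * (\<psi> y * inv_fourier \<theta> (y - x))"
      unfolding inv_fourier_def by (simp only:) simp
  qed
  also have "(\<integral>y. of_real (2 * pi) * (\<psi> y * inv_fourier \<theta> (y - x)) \<partial>lborel) / of_real (2 * pi)
    = (\<integral>y. \<psi> y * inv_fourier \<theta> (y - x) \<partial>lborel)"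
    by (subst integral_mult_right_zero) simp
  finally show ?thesis .
qed

section \<open>Convolution and multiplier operators\<close>

definition conv :: "(real \<Rightarrow> complex) \<Rightarrow> (real \<Rightarrow> complex) \<Rightarrow> real \<Rightarrow> complex" where
  "conv f k x = (\<integral>y. f y * k (x - y) \<partial>lborel)"

lemma integrable_reflect_translate:
  fixes k :: "real \<Rightarrow> 'a::{banach, second_countable_topology}"
  shows "integrable lborel k \<Longrightarrow> integrable lborel (\<lambda>y. k (x - y))"
  using lborel_integrable_real_affine[of k "-1" x] by simp

lemma integral_reflect_translate:
  fixes k :: "real \<Rightarrow> 'a::{banach, second_countable_topology}"
  shows "(\<integral>y. k (x - y) \<partial>lborel) = (\<integral>y. k y \<partial>lborel)"
  using lborel_integral_real_affine[of "-1" k x] by simp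

lemma integrable_conv_integrand:
  fixes f k :: "real \<Rightarrow> complex"
  assumes [measurable]: "f \<in> borel_measurable borel" and f: "\<And>x. cmod (f x) \<le> B"
    and k: "integrable lborel k"
  shows "integrable lborel (\<lambda>y. f y * k (x - y))"
proof (rule Bochner_Integration.integrable_bound[OF integrable_mult_right[OF integrable_norm[OF integrable_reflect_translate[OF k]], of B]])
  have [measurable]: "k \<in> borel_measurable borel" using k by auto
  show "(\<lambda>y. f y * k (x - y)) \<in> borel_measurable lborel" by measurable
  have "0 \<le> B" using norm_ge_zero f order_trans by blast
  then show "AE y in lborel. norm (f y * k (x - y)) \<le> norm (B * norm (k (x - y)))"
    by (intro AE_I2) (auto simp: norm_mult abs_mult intro!: mult_right_mono f)
qed

lemma norm_conv_le:
  assumes [measurable]: "f \<in> borel_measurable borel" and f: "\<And>x. cmod (f x) \<le> B" and k: "integrable lborel k"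
  shows "cmod (conv f k x) \<le> B * (\<integral>y. cmod (k y) \<partial>lborel)"
proof -
  have "cmod (conv f k x) \<le> (\<integral>y. cmod (f y * k (x - y)) \<partial>lborel)"
    unfolding conv_def by (rule integral_norm_bound)
  also have "\<dots> \<le> (\<integral>y. B * cmod (k (x - y)) \<partial>lborel)"
    by (intro integral_mono integrable_norm integrable_conv_integrand[OF assms] integrable_mult_right integrable_reflect_translate k)
       (auto simp: norm_mult intro!: mult_right_mono f)
  also have "\<dots> = B * (\<integral>y. cmod (k y) \<partial>lborel)"
    using integral_reflect_translate[of "\<lambda>y. cmod (k y)" x] by simp
  finally show ?thesis .
qed

lemma conv_measurable [measurable]:
  assumes [measurable]: "f \<in> borel_measurable borel" "k \<in> borel_measurable borel"
  shows "conv f k \<in> borel_measurable borel"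
  unfolding conv_def by measurable

lemma nn_integral_reflect_translate:
  fixes h :: "real \<Rightarrow> ennreal"
  assumes [measurable]: "h \<in> borel_measurable borel"
  shows "(\<integral>\<^sup>+x. h (x - y) \<partial>lborel) = (\<integral>\<^sup>+x. h x \<partial>lborel)"
  using nn_integral_real_affine[of h 1 "-y"] by simp

text \<open>Holds without integrability, because the Bochner integral of a non-integrable function
  is 0.\<close>

lemma norm_integral_le_nn_integral: "ennreal (norm (\<integral>x. f x \<partial>M)) \<le> (\<integral>\<^sup>+x. ennreal (norm (f x)) \<partial>M)"
  for f :: "'a \<Rightarrow> 'b::{banach, second_countable_topology}"
  using integral_norm_bound_ennreal not_integrable_integral_eq by (cases "integrable M f") fastforce+

text \<open>Young's inequality in L1, by Tonelli and translation invariance.\<close>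

lemma nn_integral_conv_le:
  assumes [measurable]: "f \<in> borel_measurable borel" "k \<in> borel_measurable borel"
  shows "(\<integral>\<^sup>+x. ennreal (cmod (conv f k x)) \<partial>lborel) \<le>
    (\<integral>\<^sup>+y. ennreal (cmod (f y)) \<partial>lborel) * (\<integral>\<^sup>+y. ennreal (cmod (k y)) \<partial>lborel)"
proof -
  have "(\<integral>\<^sup>+x. ennreal (cmod (conv f k x)) \<partial>lborel)
      \<le> (\<integral>\<^sup>+x. (\<integral>\<^sup>+y. ennreal (cmod (f y)) * ennreal (cmod (k (x - y))) \<partial>lborel) \<partial>lborel)"
    unfolding conv_def
    by (intro nn_integral_mono order_trans[OF norm_integral_le_nn_integral]) (simp add: norm_mult ennreal_mult)
  also have "\<dots> = (\<integral>\<^sup>+y. (\<integral>\<^sup>+x. ennreal (cmod (f y)) * ennreal (cmod (k (x - y))) \<partial>lborel) \<partial>lborel)"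
    by (rule lborel_pair.Fubini') measurable
  also have "\<dots> = (\<integral>\<^sup>+y. ennreal (cmod (f y)) * (\<integral>\<^sup>+x. ennreal (cmod (k (x - y))) \<partial>lborel) \<partial>lborel)"
    by (intro nn_integral_cong nn_integral_cmult) measurable
  also have "\<dots> = (\<integral>\<^sup>+y. ennreal (cmod (f y)) * (\<integral>\<^sup>+x. ennreal (cmod (k x)) \<partial>lborel) \<partial>lborel)"
    by (intro nn_integral_cong arg_cong2[where f="(*)"] refl nn_integral_reflect_translate) measurable
  also have "\<dots> = (\<integral>\<^sup>+y. ennreal (cmod (f y)) \<partial>lborel) * (\<integral>\<^sup>+y. ennreal (cmod (k y)) \<partial>lborel)"
    by (rule nn_integral_multc) measurable
  finally show ?thesis .
qed

text \<open>Carries a convolution from the test function over to the bounded function f; for this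
  reason a multiplier applied to a bounded function gives a function again.\<close>

lemma Fubini_conv:
  assumes [measurable]: "f \<in> borel_measurable borel" and f: "\<And>x. cmod (f x) \<le> B"
    and \<psi>: "integrable lborel \<psi>" and k: "integrable lborel k"
  shows "(\<integral>x. f x * (\<integral>y. \<psi> y * k (y - x) \<partial>lborel) \<partial>lborel) = (\<integral>y. conv f k y * \<psi> y \<partial>lborel)"
proof -
  have [measurable]: "\<psi> \<in> borel_measurable borel" "k \<in> borel_measurable borel"
    using \<psi> k by auto
  have "0 \<le> B" using norm_ge_zero f order_trans by blast
  have "integrable (lborel \<Otimes>\<^sub>M lborel) (\<lambda>(y, x). \<psi> y * (f x * k (y - x)))"
  proof (rule lborel_pair.Fubini_integrable)
    show "AE y in lborel. integrable lborel (\<lambda>x. case (y, x) of (y, x) \<Rightarrow> \<psi> y * (f x * k (y - x)))"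
      by (intro AE_I2) (auto intro!: integrable_mult_right integrable_conv_integrand[OF _ f] k)
    show "integrable lborel (\<lambda>y. \<integral>x. norm (case (y, x) of (y, x) \<Rightarrow> \<psi> y * (f x * k (y - x))) \<partial>lborel)"
    proof (rule Bochner_Integration.integrable_bound[OF integrable_mult_left[OF integrable_norm[OF \<psi>], of "B * (\<integral>y. cmod (k y) \<partial>lborel)"]])
      have "(\<integral>x. norm (\<psi> y * (f x * k (y - x))) \<partial>lborel) \<le> cmod (\<psi> y) * (B * (\<integral>y. cmod (k y) \<partial>lborel))" for y
      proof -
        have "(\<integral>x. norm (\<psi> y * (f x * k (y - x))) \<partial>lborel) \<le> (\<integral>x. cmod (\<psi> y) * (B * cmod (k (y - x))) \<partial>lborel)"
          by (intro integral_mono integrable_norm integrable_mult_right integrable_conv_integrand[OF _ f] integrable_reflect_translate k)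
             (auto simp: norm_mult intro!: mult_left_mono mult_right_mono f)
        then show ?thesis using integral_reflect_translate[of "\<lambda>y. cmod (k y)" y] by simp
      qed
      then show "AE y in lborel. norm (\<integral>x. norm (case (y, x) of (y, x) \<Rightarrow> \<psi> y * (f x * k (y - x))) \<partial>lborel)
         \<le> norm (cmod (\<psi> y) * (B * (\<integral>y. cmod (k y) \<partial>lborel)))"
        using \<open>0 \<le> B\<close> by (intro AE_I2) (simp add: abs_mult integral_nonneg)
    qed measurable
  qed measurable
  from lborel_pair.Fubini_integral[OF this]
  have "(\<integral>x. (\<integral>y. \<psi> y * (f x * k (y - x)) \<partial>lborel) \<partial>lborel) = (\<integral>y. (\<integral>x. \<psi> y * (f x * k (y - x)) \<partial>lborel) \<partial>lborel)" .
  moreover have "(\<integral>y. \<psi> y * (f x * k (y - x)) \<partial>lborel) = f x * (\<integral>y. \<psi> y * k (y - x) \<partial>lborel)" for x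
    by (simp add: mult.left_commute flip: integral_mult_right_zero)
  moreover have "(\<integral>x. \<psi> y * (f x * k (y - x)) \<partial>lborel) = conv f k y * \<psi> y" for y
    by (subst integral_mult_right_zero) (simp add: conv_def)
  ultimately show ?thesis by (simp only:)
qed

lemma tempered_fun_bounded:
  assumes [measurable]: "f \<in> borel_measurable borel" and f: "\<And>x. cmod (f x) \<le> B"
  shows "tempered_fun f"
  unfolding tempered_fun_def
proof (intro conjI ballI)
  fix \<psi> :: "real \<Rightarrow> complex" assume \<psi>: "\<psi> \<in> schwartz"
  note [measurable] = schwartz_measurable[OF \<psi>]
  have "0 \<le> B" using norm_ge_zero f order_trans by blast
  show "integrable lborel (\<lambda>x. f x * \<psi> x)"
    by (rule Bochner_Integration.integrable_bound[OF integrable_mult_right[OF integrable_norm[OF schwartz_integrable[OF \<psi>]], of B]])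
       (use \<open>0 \<le> B\<close> in \<open>auto simp: norm_mult abs_mult intro!: mult_right_mono f\<close>)
qed simp

section \<open>Fourier multipliers of distributions\<close>

abbreviation mult_op :: "(real \<Rightarrow> real) \<Rightarrow> distr \<Rightarrow> distr" where
  "mult_op \<theta> U \<equiv> inv_fourier_distr (mult_distr \<theta> (fourier_distr U))"

lemma mult_op_apply: "mult_op \<theta> U \<psi> = U (fourier (\<lambda>\<xi>. cfun \<theta> \<xi> * inv_fourier \<psi> \<xi>))"
  by (simp add: inv_fourier_distr_def mult_distr_def fourier_distr_def)

text \<open>Source of the upper bounds for blocks: the image of a bounded function under a
  multiplier has an explicit representative, whose norm bounds the infimum
  \<open>Lp_distr\<close>.\<close>

lemma is_fun_mult_op:
  assumes [measurable]: "f \<in> borel_measurable borel" and f: "\<And>x. cmod (f x) \<le> B" and \<theta>: "cfun \<theta> \<in> test_funs"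
  shows "is_fun (mult_op \<theta> (distr_of f)) (conv f (inv_fourier (cfun \<theta>)))"
  unfolding is_fun_def
proof (intro conjI ballI)
  note [measurable] = inv_fourier_test_funs_measurable[OF \<theta>]
  show "tempered_fun (conv f (inv_fourier (cfun \<theta>)))"
    by (rule tempered_fun_bounded[OF _ norm_conv_le[OF _ f inv_fourier_test_funs_integrable[OF \<theta>]]]) auto
  fix \<psi> :: "real \<Rightarrow> complex" assume \<psi>: "\<psi> \<in> schwartz"
  show "mult_op \<theta> (distr_of f) \<psi> = distr_of (conv f (inv_fourier (cfun \<theta>))) \<psi>"
    unfolding mult_op_apply distr_of_def fourier_mult_inv_fourier[OF \<theta> schwartz_integrable[OF \<psi>]]
    by (rule Fubini_conv[OF _ f schwartz_integrable[OF \<psi>] inv_fourier_test_funs_integrable[OF \<theta>]]) simp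
qed

text \<open>Source of the lower bounds: f need only be tempered. The inverse transform of the kernel
  is known, so the two symbols multiply. When \<open>\<zeta>\<close> is 1 on the support of
  \<open>\<theta>\<close>, the pointwise values of the filtered function are thus recovered from its
  action as a distribution.\<close>

lemma mult_op_kernel:
  assumes U: "is_fun U f" and \<theta>: "cfun \<theta> \<in> test_funs" and \<zeta>: "\<zeta> \<in> test_funs"
  shows "(\<lambda>y. inv_fourier \<zeta> (x - y)) \<in> schwartz"
    and "mult_op \<theta> U (\<lambda>y. inv_fourier \<zeta> (x - y)) = conv f (inv_fourier (\<lambda>\<xi>. cfun \<theta> \<xi> * \<zeta> \<xi>)) x"
proof -
  let ?e = "\<lambda>\<zeta>. \<lambda>\<xi>. exp (\<i> * of_real x * of_real \<xi>) * (1 / of_real (2 * pi) * \<zeta> \<xi>)"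
  let ?\<psi> = "\<lambda>y. inv_fourier \<zeta> (x - y)"
  have \<psi>: "?\<psi> = fourier (?e \<zeta>)"
    by (rule ext) (rule inv_fourier_translate)
  show "?\<psi> \<in> schwartz"
    unfolding \<psi> by (intro fourier_test_funs_schwartz test_funs_translate \<zeta>)
  have inv: "inv_fourier ?\<psi> = ?e \<zeta>"
    unfolding \<psi> by (intro inv_fourier_fourier test_funs_translate \<zeta>)
  let ?\<theta>\<zeta> = "\<lambda>\<xi>. cfun \<theta> \<xi> * \<zeta> \<xi>"
  have \<theta>\<zeta>: "?\<theta>\<zeta> \<in> test_funs"
    by (intro test_funs_mult test_funs_smooth \<theta> \<zeta>)
  have "(\<lambda>\<xi>. cfun \<theta> \<xi> * inv_fourier ?\<psi> \<xi>) = ?e ?\<theta>\<zeta>"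
    by (simp add: inv fun_eq_iff)
  then have "mult_op \<theta> U ?\<psi> = U (fourier (?e ?\<theta>\<zeta>))"
    by (simp add: mult_op_apply)
  also have "\<dots> = distr_of f (fourier (?e ?\<theta>\<zeta>))"
    using U fourier_test_funs_schwartz[OF test_funs_translate[OF \<theta>\<zeta>]] by (simp add: is_fun_def)
  also have "\<dots> = conv f (inv_fourier ?\<theta>\<zeta>) x"
    by (simp only: distr_of_def conv_def inv_fourier_translate)
  finally show "mult_op \<theta> U ?\<psi> = conv f (inv_fourier ?\<theta>\<zeta>) x" .
qed

lemma conv_inv_fourier_has_vderiv:
  assumes [measurable]: "f \<in> borel_measurable borel" and f: "\<And>x. cmod (f x) \<le> B" and \<theta>: "\<theta> \<in> test_funs"
  shows "(conv f (inv_fourier \<theta>) has_vector_derivative conv f (inv_fourier (\<lambda>\<xi>. (\<i> * of_real \<xi>) * \<theta> \<xi>)) x) (at x)"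
proof -
  let ?k = "inv_fourier \<theta>" and ?k' = "inv_fourier (\<lambda>\<xi>. (\<i> * of_real \<xi>) * \<theta> \<xi>)"
  have \<theta>': "(\<lambda>\<xi>. (\<i> * of_real \<xi>) * \<theta> \<xi>) \<in> test_funs"
    using test_funs_power[OF \<theta>, of \<i> 1] by simp
  obtain C where C: "\<And>x. cmod (?k' x) \<le> C / (1 + x\<^sup>2)" "0 < C"
    using inv_fourier_test_funs_le[OF \<theta>'] by blast
  have "0 \<le> B" using norm_ge_zero f order_trans by blast
  have "((\<lambda>x. \<integral>y. f y * ?k (x - y) \<partial>lborel) has_vector_derivative (\<integral>y. f y * ?k' (x - y) \<partial>lborel)) (at x)"
  proof (rule has_vector_derivative_integral(1))
    \<comment> \<open>The domination must be uniform for z within distance 1 of x; there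
      \<open>(x - y)\<^sup>2 \<le> 2 * (z - y)\<^sup>2 + 2\<close>, whence the factor 3.\<close>
    show "integrable lborel (\<lambda>y. B * (3 * C * (1 / (1 + (x - y)\<^sup>2))))"
      by (intro integrable_mult_right integrable_reflect_translate[OF integrable_inverse_1_plus_sq])
    show "integrable lborel (\<lambda>y. f y * ?k (x - y))" for x
      by (intro integrable_conv_integrand[OF _ f] inv_fourier_test_funs_integrable \<theta>) simp
    show "((\<lambda>x. f y * ?k (x - y)) has_vector_derivative f y * ?k' (x - y)) (at x)" for x y
    proof -
      have "((?k \<circ> (\<lambda>x. x - y)) has_vector_derivative 1 *\<^sub>R ?k' (x - y)) (at x)"
        by (intro vector_diff_chain_at inv_fourier_has_vderiv \<theta>) (auto intro!: derivative_eq_intros)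
      then show ?thesis by (intro has_vector_derivative_mult_right) (simp add: o_def)
    qed
    show "cmod (f y * ?k' (z - y)) \<le> B * (3 * C * (1 / (1 + (x - y)\<^sup>2)))" if "z \<in> ball x 1" for z y
    proof -
      have "(z - x)\<^sup>2 \<le> 1" using that by (simp add: dist_real_def abs_square_le_1 abs_minus_commute)

      moreover have "(x - y)\<^sup>2 \<le> 2 * (z - y)\<^sup>2 + 2 * (z - x)\<^sup>2"
        using zero_le_power2[of "(z - y) + (z - x)"] by (simp add: power2_eq_square algebra_simps)
      moreover have "1 + c \<le> 3 * (1 + a)" if "b \<le> 1" "c \<le> 2 * a + 2 * b" "0 \<le> a" for a b c :: real
        using that by argo
      ultimately have "1 + (x - y)\<^sup>2 \<le> 3 * (1 + (z - y)\<^sup>2)"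
        by (meson zero_le_power2)
      then have "C * (1 + (x - y)\<^sup>2) \<le> C * (3 * (1 + (z - y)\<^sup>2))"
        using C(2) by (intro mult_left_mono) auto
      moreover have "0 < 1 + (x - y)\<^sup>2" "0 < 1 + (z - y)\<^sup>2" by (simp_all add: add_pos_nonneg)
      ultimately have "C / (1 + (z - y)\<^sup>2) \<le> 3 * C * (1 / (1 + (x - y)\<^sup>2))"
        by (simp add: divide_simps mult_ac)
      then show ?thesis
        unfolding norm_mult by (intro mult_mono f order_trans[OF C(1)] \<open>0 \<le> B\<close> norm_ge_zero)
    qed
  qed
  then show ?thesis by (simp add: conv_def[abs_def])
qed

text \<open>Integration by parts in the convolution. The decay of the kernel kills the boundary
  terms, although f is merely bounded.\<close>

lemma conv_derivative:
  assumes f: "\<And>x. (f has_vector_derivative f' x) (at x)" "\<And>x. cmod (f x) \<le> B" "\<And>x. cmod (f' x) \<le> B'"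
    and [measurable]: "f' \<in> borel_measurable borel" and \<theta>: "\<theta> \<in> test_funs"
  shows "conv f (inv_fourier (\<lambda>\<xi>. (\<i> * of_real \<xi>) * \<theta> \<xi>)) x = conv f' (inv_fourier \<theta>) x"
proof -
  let ?k = "inv_fourier \<theta>" and ?k' = "inv_fourier (\<lambda>\<xi>. (\<i> * of_real \<xi>) * \<theta> \<xi>)"
  have \<theta>': "(\<lambda>\<xi>. (\<i> * of_real \<xi>) * \<theta> \<xi>) \<in> test_funs"
    using test_funs_power[OF \<theta>, of \<i> 1] by simp
  obtain C where C: "\<And>x. cmod (?k x) \<le> C / (1 + x\<^sup>2)" "0 < C"
    using inv_fourier_test_funs_le[OF \<theta>] by blast
  have "0 \<le> B" using norm_ge_zero f order_trans by blast
  have [measurable]: "f \<in> borel_measurable borel"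
    by (meson f(1) continuous_imp_measurable_borel has_vector_derivative_continuous continuous_at_imp_continuous_on)
  have i1: "integrable lborel (\<lambda>y. f y * ?k' (x - y))"
    by (intro integrable_conv_integrand[OF _ f(2)] inv_fourier_test_funs_integrable \<theta>') simp
  have i2: "integrable lborel (\<lambda>y. f' y * ?k (x - y))"
    by (intro integrable_conv_integrand[OF _ f(3)] inv_fourier_test_funs_integrable \<theta>) simp
  have lim: "((\<lambda>y. f y * ?k (x - y)) \<longlongrightarrow> 0) F" if "((\<lambda>y. B * (C / (1 + (x - y)\<^sup>2))) \<longlongrightarrow> 0) F" for F
  proof (rule Lim_null_comparison[OF _ that])
    show "\<forall>\<^sub>F y in F. cmod (f y * ?k (x - y)) \<le> B * (C / (1 + (x - y)\<^sup>2))"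
      unfolding norm_mult by (intro always_eventually allI mult_mono f C \<open>0 \<le> B\<close> norm_ge_zero)
  qed
  have "(\<integral>y. f' y * ?k (x - y) - f y * ?k' (x - y) \<partial>lborel) = 0"
  proof (rule integral_derivative_eq_0)
    show "((\<lambda>y. f y * ?k (x - y)) has_vector_derivative f' y * ?k (x - y) - f y * ?k' (x - y)) (at y)" for y
    proof -
      have "((?k \<circ> (\<lambda>y. x - y)) has_vector_derivative (-1) *\<^sub>R ?k' (x - y)) (at y)"
        by (intro vector_diff_chain_at inv_fourier_has_vderiv \<theta>) (auto intro!: derivative_eq_intros)
      from has_vector_derivative_mult[OF f(1) this]
      show ?thesis by (simp add: o_def)
    qed
    show "integrable lborel (\<lambda>y. f' y * ?k (x - y) - f y * ?k' (x - y))"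
      by (intro Bochner_Integration.integrable_diff i1 i2)
    show "((\<lambda>y. f y * ?k (x - y)) \<longlongrightarrow> 0) at_top" by (rule lim) real_asymp
    show "((\<lambda>y. f y * ?k (x - y)) \<longlongrightarrow> 0) at_bot" by (rule lim) real_asymp
  qed
  then show ?thesis using Bochner_Integration.integral_diff[OF i2 i1] by (simp add: conv_def)
qed

section \<open>Estimates for the norms\<close>

lemma exponent_cases [case_names infinite finite]:
  fixes p :: ennreal
  assumes "1 \<le> p"
  obtains "p = \<infinity>" "enn2real (1 / p) = 0"
  | q where "p = ennreal q" "1 \<le> q" "enn2real p = q" "p \<noteq> \<infinity>" "enn2real (1 / p) = 1 / q"
proof (cases p)
  case top
  then show ?thesis using that(1) by simp
next
  case (real q)
  then have "1 \<le> q" using assms by simp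
  moreover have "1 / p = ennreal (1 / q)"
    using real \<open>1 \<le> q\<close> divide_ennreal[of 1 q] by simp
  ultimately show ?thesis using that(2)[of q] real by simp
qed

lemma epow_ennreal: "0 \<le> x \<Longrightarrow> epow (ennreal x) a = ennreal (x powr a)"
  by (simp add: epow_def)

lemma epow_mono: "x \<le> y \<Longrightarrow> 0 \<le> a \<Longrightarrow> epow x a \<le> epow y a"
  by (cases x; cases y) (auto simp: epow_def top_unique intro!: ennreal_leI powr_mono2)

lemma epow_measurable [measurable]: "(\<lambda>x. epow x a) \<in> borel_measurable borel"
  unfolding epow_def by measurable

text \<open>Interpolation between the sup bound A and the integral bound A * S, from the pointwise
  inequality \<open>G powr q \<le> A powr (q - 1) * G\<close>. It is used with Lebesgue measure for
  a single block and with counting measure for the sequence of blocks.\<close>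

lemma lp_norm_interpolation:
  assumes p: "1 \<le> p" and [measurable]: "G \<in> borel_measurable M"
    and A: "\<And>x. G x \<le> ennreal A" "(\<integral>\<^sup>+x. G x \<partial>M) \<le> ennreal (A * S)" and A0: "0 \<le> A" and S: "0 < S"
  shows "lp_norm M p G \<le> ennreal (A * S powr enn2real (1 / p))"
  using p
proof (cases rule: exponent_cases)
  case infinite
  then show ?thesis
    using S A by (auto simp: lp_norm_def)
next
  case (finite q)
  have "epow (G x) q \<le> ennreal (A powr (q - 1)) * G x" for x
  proof -
    obtain a where a: "G x = ennreal a" "0 \<le> a"
      using A(1)[of x] by (cases "G x") (auto simp: top_unique)
    then have "a \<le> A" using A(1)[of x] A0 by simp
    then have "a powr (q - 1) \<le> A powr (q - 1)"
      using a finite by (intro powr_mono2) auto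
    moreover have "a powr q = a powr (q - 1) * a"
      using a by (cases "a = 0") (auto simp: powr_diff)
    ultimately show ?thesis
      using a by (simp add: epow_ennreal mult_right_mono flip: ennreal_mult)
  qed
  then have "(\<integral>\<^sup>+x. epow (G x) q \<partial>M) \<le> (\<integral>\<^sup>+x. ennreal (A powr (q - 1)) * G x \<partial>M)"
    by (intro nn_integral_mono)
  also have "\<dots> = ennreal (A powr (q - 1)) * (\<integral>\<^sup>+x. G x \<partial>M)"
    by (rule nn_integral_cmult) measurable
  also have "\<dots> \<le> ennreal (A powr (q - 1)) * ennreal (A * S)"
    by (intro mult_left_mono A) auto
  also have "\<dots> = ennreal (A powr q * S)"
    using A0 S by (cases "A = 0") (auto simp: powr_diff simp flip: ennreal_mult)
  finally have "epow (\<integral>\<^sup>+x. epow (G x) q \<partial>M) (1 / q) \<le> epow (ennreal (A powr q * S)) (1 / q)"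
    using finite by (intro epow_mono) auto
  also have "\<dots> = ennreal (A * S powr (1 / q))"
    using A0 S finite by (simp add: epow_ennreal powr_mult powr_powr)
  finally show ?thesis using finite by (simp add: lp_norm_def)
qed

text \<open>Up to the factor 2 this is Hoelder's inequality together with interpolation for \<open>\<psi>\<close>; it follows
  by integrating \<open>a \<le> \<lambda> + \<lambda> powr (1 - q) * a powr q\<close> and optimising over \<open>\<lambda>\<close>.\<close>

lemma norm_integral_mult_le_lp_norm:
  fixes f \<psi> :: "real \<Rightarrow> complex"
  assumes p: "1 \<le> p" and [measurable]: "f \<in> borel_measurable borel" "\<psi> \<in> borel_measurable borel"
    and A: "(\<integral>\<^sup>+x. ennreal (cmod (\<psi> x)) \<partial>lborel) \<le> ennreal A" "\<And>x. cmod (\<psi> x) \<le> A * S"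
    and A0: "0 < A" and S: "0 < S"
  shows "ennreal (cmod (\<integral>x. f x * \<psi> x \<partial>lborel)) \<le>
    ennreal (2 * A * S powr enn2real (1 / p)) * lp_norm lborel p (\<lambda>x. ennreal (cmod (f x)))"
proof -
  let ?I = "ennreal (cmod (\<integral>x. f x * \<psi> x \<partial>lborel))"
  have I: "?I \<le> (\<integral>\<^sup>+x. ennreal (cmod (f x)) * ennreal (cmod (\<psi> x)) \<partial>lborel)"
    using norm_integral_le_nn_integral[of lborel "\<lambda>x. f x * \<psi> x"] by (simp add: norm_mult ennreal_mult)
  show ?thesis
    using p
  proof (cases rule: exponent_cases)
    case infinite
    let ?E = "esssup lborel (\<lambda>x. ennreal (cmod (f x)))"
    have "?I \<le> (\<integral>\<^sup>+x. ?E * ennreal (cmod (\<psi> x)) \<partial>lborel)"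
      by (rule order_trans[OF I], rule nn_integral_mono_AE)
         (use esssup_AE[where M=lborel and f="\<lambda>x. ennreal (cmod (f x))"] in \<open>auto intro!: mult_right_mono\<close>)
    also have "\<dots> = ?E * (\<integral>\<^sup>+x. ennreal (cmod (\<psi> x)) \<partial>lborel)"
      by (rule nn_integral_cmult) measurable
    also have "\<dots> \<le> ?E * ennreal (2 * A)"
      by (intro mult_left_mono order_trans[OF A(1)] ennreal_leI) (use A0 in auto)
    finally show ?thesis using infinite S by (simp add: lp_norm_def mult.commute)
  next
    case (finite q)
    let ?P = "\<integral>\<^sup>+x. epow (ennreal (cmod (f x))) q \<partial>lborel"
    show ?thesis
    proof (cases ?P)
      case top
      then have "lp_norm lborel p (\<lambda>x. ennreal (cmod (f x))) = \<infinity>"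
        using finite by (simp add: lp_norm_def epow_def)
      moreover have "ennreal (2 * A * S powr enn2real (1 / p)) \<noteq> 0"
        using A0 S by (simp add: ennreal_eq_0_iff not_le)
      ultimately show ?thesis by (simp add: ennreal_mult_top)
    next
      case (real P)
      define m where "m = P powr (1 / q)"
      have m: "lp_norm lborel p (\<lambda>x. ennreal (cmod (f x))) = ennreal m"
        using finite real by (simp add: lp_norm_def epow_ennreal m_def)
      have key: "?I \<le> ennreal (l * A + l powr (1 - q) * (A * S) * P)" if l: "0 < l" for l
      proof -
        have pw: "a \<le> l + l powr (1 - q) * a powr q" if "0 \<le> a" for a
        proof (cases "a \<le> l")
          case True
          then show ?thesis using l by (simp add: add_increasing2)
        next
          case False
          then have "a powr (1 - q) \<le> l powr (1 - q)"
            using l finite by (intro powr_mono2') auto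
          then have "a powr (1 - q) * a powr q \<le> l powr (1 - q) * a powr q"
            by (intro mult_right_mono) auto
          moreover have "a powr (1 - q) * a powr q = a"
            using False l by (simp flip: powr_add)
          ultimately show ?thesis using l by linarith
        qed
        have "?I \<le> (\<integral>\<^sup>+x. ennreal l * ennreal (cmod (\<psi> x)) + ennreal (l powr (1 - q) * (A * S)) * epow (ennreal (cmod (f x))) q \<partial>lborel)"
        proof (rule order_trans[OF I], rule nn_integral_mono)
          fix x
          have "cmod (f x) * cmod (\<psi> x) \<le> (l + l powr (1 - q) * cmod (f x) powr q) * cmod (\<psi> x)"
            by (intro mult_right_mono pw) auto
          also have "\<dots> = l * cmod (\<psi> x) + (l powr (1 - q) * cmod (f x) powr q) * cmod (\<psi> x)"
            by (simp add: algebra_simps)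
          also have "\<dots> \<le> l * cmod (\<psi> x) + (l powr (1 - q) * cmod (f x) powr q) * (A * S)"
            by (intro add_left_mono mult_left_mono A) auto
          finally have "cmod (f x) * cmod (\<psi> x) \<le> l * cmod (\<psi> x) + (l powr (1 - q) * (A * S)) * cmod (f x) powr q"
            by (simp add: mult_ac)
          then show "ennreal (cmod (f x)) * ennreal (cmod (\<psi> x)) \<le>
            ennreal l * ennreal (cmod (\<psi> x)) + ennreal (l powr (1 - q) * (A * S)) * epow (ennreal (cmod (f x))) q"
            using l A0 S by (simp add: epow_ennreal flip: ennreal_mult ennreal_plus)
        qed
        also have "\<dots> = (\<integral>\<^sup>+x. ennreal l * ennreal (cmod (\<psi> x)) \<partial>lborel) + (\<integral>\<^sup>+x. ennreal (l powr (1 - q) * (A * S)) * epow (ennreal (cmod (f x))) q \<partial>lborel)"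
          by (rule nn_integral_add) measurable
        also have "(\<integral>\<^sup>+x. ennreal l * ennreal (cmod (\<psi> x)) \<partial>lborel) = ennreal l * (\<integral>\<^sup>+x. ennreal (cmod (\<psi> x)) \<partial>lborel)"
          by (rule nn_integral_cmult) measurable
        also have "(\<integral>\<^sup>+x. ennreal (l powr (1 - q) * (A * S)) * epow (ennreal (cmod (f x))) q \<partial>lborel) = ennreal (l powr (1 - q) * (A * S)) * ?P"
          by (rule nn_integral_cmult) measurable
        also have "ennreal l * (\<integral>\<^sup>+x. ennreal (cmod (\<psi> x)) \<partial>lborel) + ennreal (l powr (1 - q) * (A * S)) * ?P \<le>
          ennreal l * ennreal A + ennreal (l powr (1 - q) * (A * S)) * ennreal P"
          using real by (intro add_mono mult_left_mono A) auto
        also have "\<dots> = ennreal (l * A + l powr (1 - q) * (A * S) * P)"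
          using l A0 S real by (simp flip: ennreal_mult ennreal_plus)
        finally show ?thesis .
      qed
      have P: "P = m powr q"
        using real finite by (simp add: m_def powr_powr)
      show ?thesis
      proof (cases "m = 0")
        case True
        then have "P = 0" using P finite by simp
        \<comment> \<open>For vanishing norm no optimal \<lambda> exists; letting \<lambda> tend to
          0 gives the bound.\<close>
        have "?I \<le> ennreal e" if "0 < e" for e
          using key[of "e / A"] that A0 \<open>P = 0\<close> by simp
        then have "cmod (\<integral>x. f x * \<psi> x \<partial>lborel) \<le> 0 + e" if "0 < e" for e
          using that by (simp add: ennreal_le_iff)
        from field_le_epsilon[OF this] show ?thesis by simp
      next
        case False
        then have m0: "m > 0" by (simp add: m_def order_less_le)
        \<comment> \<open>At this value the two terms of \<open>key\<close> are equal, which is the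
          origin of the factor 2 in the statement.\<close>
        let ?l = "m * S powr (1 / q)"
        have "?l powr (1 - q) * (A * S) * P = m powr (1 - q) * m powr q * (S powr ((1 - q) / q) * S powr 1) * A"
          using m0 S by (simp add: P powr_mult powr_powr mult_ac)
        also have "S powr ((1 - q) / q) * S powr 1 = S powr (1 / q)"
          using finite by (subst powr_add[symmetric]) (simp add: diff_divide_distrib)
        also have "m powr (1 - q) * m powr q * S powr (1 / q) * A = m * S powr (1 / q) * A"
          using m0 by (simp flip: powr_add)
        finally have eq: "?l * A + ?l powr (1 - q) * (A * S) * P = 2 * A * S powr (1 / q) * m"
          by (simp add: mult_ac)
        have "?I \<le> ennreal (2 * A * S powr (1 / q) * m)"
          using key[of ?l] m0 S unfolding eq by simp
        then show ?thesis
          using A0 S m0 unfolding m finite(5) by (simp add: ennreal_mult)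
      qed
    qed
  qed
qed

section \<open>Bounding a distribution by its Lebesgue norm\<close>

lemma Lp_distr_le: "is_fun U f \<Longrightarrow> Lp_distr p U \<le> lp_norm lborel p (\<lambda>x. ennreal (cmod (f x)))"
  unfolding Lp_distr_def by (rule INF_lower) simp

text \<open>The positive constant is moved to the left by its reciprocal, so that a plain infimum
  remains. If nothing represents U, the infimum is over the empty set and the bound is
  \<open>\<infinity>\<close>.\<close>

lemma le_Lp_distrI:
  assumes "\<And>f. is_fun U f \<Longrightarrow> y \<le> ennreal c * lp_norm lborel p (\<lambda>x. ennreal (cmod (f x)))" and "0 < c"
  shows "y \<le> ennreal c * Lp_distr p U"
proof -
  have c: "ennreal (1 / c) * (ennreal c * z) = z" "ennreal c * (ennreal (1 / c) * z) = z" for z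
    using \<open>0 < c\<close> by (simp_all flip: mult.assoc ennreal_mult)
  have "ennreal (1 / c) * y \<le> Lp_distr p U"
    unfolding Lp_distr_def
  proof (rule INF_greatest)
    fix f assume "f \<in> {f. is_fun U f}"
    then have "ennreal (1 / c) * y \<le> ennreal (1 / c) * (ennreal c * lp_norm lborel p (\<lambda>x. ennreal (cmod (f x))))"
      by (intro mult_left_mono assms(1)) auto
    then show "ennreal (1 / c) * y \<le> lp_norm lborel p (\<lambda>x. ennreal (cmod (f x)))"
      by (simp add: c)
  qed
  then have "ennreal c * (ennreal (1 / c) * y) \<le> ennreal c * Lp_distr p U"
    by (intro mult_left_mono) auto
  then show ?thesis by (simp add: c)
qed

text \<open>Every function representing U gives the same value at \<open>\<psi>\<close>, so the
  Hoelder bound holds for each of them and hence for the infimum.\<close>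

lemma norm_distr_le_Lp_distr:
  assumes p: "1 \<le> p" and \<psi>: "\<psi> \<in> schwartz"
    and A: "(\<integral>\<^sup>+x. ennreal (cmod (\<psi> x)) \<partial>lborel) \<le> ennreal A" "\<And>x. cmod (\<psi> x) \<le> A * S"
    and A0: "0 < A" and S: "0 < S"
  shows "ennreal (cmod (U \<psi>)) \<le> ennreal (2 * A * S powr enn2real (1 / p)) * Lp_distr p U"
proof (rule le_Lp_distrI)
  fix f assume f: "is_fun U f"
  then have [measurable]: "f \<in> borel_measurable borel"
    by (simp add: is_fun_def tempered_fun_def)
  have "U \<psi> = (\<integral>x. f x * \<psi> x \<partial>lborel)"
    using f \<psi> by (simp add: is_fun_def distr_of_def)
  then show "ennreal (cmod (U \<psi>)) \<le> ennreal (2 * A * S powr enn2real (1 / p)) * lp_norm lborel p (\<lambda>x. ennreal (cmod (f x)))"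
    using norm_integral_mult_le_lp_norm[OF p _ schwartz_measurable[OF \<psi>] A A0 S, of f] by simp
qed (use A0 S in auto)

lemma le_lp_norm_count_space:
  assumes "1 \<le> r"
  shows "a j \<le> lp_norm (count_space UNIV) r a"
  using assms
proof (cases rule: exponent_cases)
  case infinite
  then show ?thesis
    using esssup_AE[where M="count_space UNIV" and f=a] by (simp add: lp_norm_def AE_count_space)
next
  case (finite q)
  have "epow (epow (a j) q) (1 / q) \<le> epow (\<integral>\<^sup>+j. epow (a j) q \<partial>count_space UNIV) (1 / q)"
    using finite by (intro epow_mono nn_integral_ge_point) auto
  moreover have "epow (epow (a j) q) (1 / q) = a j"
    using finite by (cases "a j") (auto simp: epow_def powr_powr)
  ultimately show ?thesis using finite by (simp add: lp_norm_def)
qed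

section \<open>Injectivity of the Fourier transform\<close>

text \<open>The positive and the negative part of g have equal transforms, in particular equal mass
  c. If c > 0, both divided by c are probability densities with the same characteristic function,
  and Levy's uniqueness theorem identifies them; if c = 0, both vanish.\<close>

lemma integrable_fourier_eq_0_real:
  fixes g :: "real \<Rightarrow> real"
  assumes g: "integrable lborel g" and z: "\<And>t. (\<integral>x. iexp (t * x) * complex_of_real (g x) \<partial>lborel) = 0"
  shows "AE x in lborel. g x = 0"
proof -
  define P where "P = (\<lambda>s x. max 0 (s * g x))"
  have [measurable]: "g \<in> borel_measurable borel" using g by auto
  have Pm [measurable]: "P s \<in> borel_measurable borel" for s unfolding P_def by measurable
  have Pi: "integrable lborel (P s)" for s
    unfolding P_def by (intro integrable_max integrable_mult_right g) auto
  have P0: "0 \<le> P s x" for s x by (simp add: P_def)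
  have g_eq: "g x = P 1 x - P (-1) x" for x by (simp add: P_def max_def)
  have i: "integrable lborel (\<lambda>x. iexp (t * x) * complex_of_real (P s x))" for t s
    by (rule Bochner_Integration.integrable_bound[OF Pi[of s]]) (auto simp: norm_mult P0)
  have eq: "(\<integral>x. iexp (t * x) * complex_of_real (P 1 x) \<partial>lborel) = (\<integral>x. iexp (t * x) * complex_of_real (P (-1) x) \<partial>lborel)" for t
  proof -
    have "(\<integral>x. iexp (t * x) * complex_of_real (g x) \<partial>lborel) =
      (\<integral>x. iexp (t * x) * complex_of_real (P 1 x) - iexp (t * x) * complex_of_real (P (-1) x) \<partial>lborel)"
      by (intro Bochner_Integration.integral_cong refl) (simp add: g_eq algebra_simps)
    also have "\<dots> = (\<integral>x. iexp (t * x) * complex_of_real (P 1 x) \<partial>lborel) - (\<integral>x. iexp (t * x) * complex_of_real (P (-1) x) \<partial>lborel)"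
      by (rule Bochner_Integration.integral_diff[OF i i])
    finally show ?thesis using z[of t] by simp
  qed
  define c where "c = (\<integral>x. P 1 x \<partial>lborel)"
  have "complex_of_real (\<integral>x. P 1 x \<partial>lborel) = complex_of_real (\<integral>x. P (-1) x \<partial>lborel)"
    using eq[of 0] by (simp add: integral_complex_of_real)
  then have c: "(\<integral>x. P s x \<partial>lborel) = c" if "s \<in> {1, -1}" for s
    using that by (auto simp: c_def)
  show ?thesis
  proof (cases "c = 0")
    case True
    have "AE x in lborel. P s x = 0" if "s \<in> {1, -1}" for s
      using integral_nonneg_eq_0_iff_AE[OF Pi[of s]] c[OF that] True P0 by auto
    then have "AE x in lborel. P 1 x = 0" "AE x in lborel. P (-1) x = 0" by blast+
    then show ?thesis
      by eventually_elim (simp add: g_eq)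
  next
    case False
    have "c \<ge> 0" using P0 by (simp add: c_def integral_nonneg)
    with False have c0: "c > 0" by simp
    define M where "M = (\<lambda>s. density lborel (\<lambda>x. ennreal (P s x / c)))"
    have rd: "real_distribution (M s)" if "s \<in> {1, -1}" for s
    proof -
      have "emeasure (M s) (space (M s)) = (\<integral>\<^sup>+x. ennreal (P s x / c) \<partial>lborel)"
        by (simp add: M_def emeasure_density)
      also have "\<dots> = ennreal (\<integral>x. P s x / c \<partial>lborel)"
        using Pi[of s] P0 c0 by (intro nn_integral_eq_integral) auto
      also have "\<dots> = 1" using c[OF that] c0 by simp
      finally have "prob_space (M s)" by (rule prob_spaceI)
      then show ?thesis
        by (intro real_distribution.intro real_distribution_axioms.intro) (simp_all add: M_def)
    qed
    have ch: "char (M s) t = (\<integral>x. iexp (t * x) * complex_of_real (P s x) \<partial>lborel) / c" for s t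
    proof -
      have "char (M s) t = (\<integral>x. (P s x / c) *\<^sub>R iexp (t * x) \<partial>lborel)"
        unfolding char_def M_def by (rule integral_density) (use P0 c0 in auto)
      also have "\<dots> = (\<integral>x. (iexp (t * x) * complex_of_real (P s x)) / c \<partial>lborel)"
        by (intro Bochner_Integration.integral_cong refl) (simp add: scaleR_conv_of_real mult_ac)
      finally show ?thesis by simp
    qed
    have "char (M 1) = char (M (-1))"
      by (rule ext) (simp only: ch eq)
    then have "M 1 = M (-1)"
      by (intro Levy_uniqueness rd) auto
    then have "AE x in lborel. ennreal (P 1 x / c) = ennreal (P (-1) x / c)"
      unfolding M_def
      by (subst (asm) sigma_finite_measure.density_unique_iff[OF sigma_finite_lborel]) auto
    then show ?thesis
      using c0 P0 by (auto simp: g_eq)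
  qed
qed

text \<open>Through conjugation, the transform of \<open>Re F\<close> is a combination of values of
  the transform of F at t and - t, so it vanishes as well. The imaginary part of G is the real part
  of \<open>- \<i> * G\<close>.\<close>

lemma integrable_fourier_eq_0:
  assumes G: "integrable lborel G" and z: "\<And>\<xi>. fourier G \<xi> = 0"
  shows "AE x in lborel. G x = 0"
proof -
  have Re: "AE x in lborel. Re (F x) = 0" if F: "integrable lborel F" "\<And>\<xi>. fourier F \<xi> = 0" for F
  proof (rule integrable_fourier_eq_0_real)
    show "integrable lborel (\<lambda>x. Re (F x))" using F by simp
    fix t
    let ?e = "\<lambda>s x. exp (- \<i> * complex_of_real (x * s))"
    have i: "integrable lborel (\<lambda>x. ?e s x * F x)" for s
      by (rule integrable_exp_mult) fact
    have "(\<integral>x. iexp (t * x) * complex_of_real (Re (F x)) \<partial>lborel)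
      = (\<integral>x. (?e (-t) x * F x + cnj (?e t x * F x)) / 2 \<partial>lborel)"
    proof (intro Bochner_Integration.integral_cong refl)
      fix x
      have "complex_of_real (Re (F x)) = (F x + cnj (F x)) / 2"
        by (simp add: complex_eq_iff)
      moreover have "cnj (?e t x) = iexp (t * x)" "?e (-t) x = iexp (t * x)"
        by (simp_all add: exp_cnj mult.commute)
      ultimately show "iexp (t * x) * complex_of_real (Re (F x)) = (?e (-t) x * F x + cnj (?e t x * F x)) / 2"
        by (simp only: complex_cnj_mult) (simp add: algebra_simps add_divide_distrib)
    qed
    also have "\<dots> = ((\<integral>x. ?e (-t) x * F x \<partial>lborel) + (\<integral>x. cnj (?e t x * F x) \<partial>lborel)) / 2"
      using i[of t] i[of "-t"]
      by (subst integral_divide_zero, subst Bochner_Integration.integral_add) (auto simp del: complex_cnj_mult)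
    also have "(\<integral>x. cnj (?e t x * F x) \<partial>lborel) = cnj (fourier F t)"
      unfolding fourier_def by (rule Bochner_Integration.integral_cnj)
    also have "(\<integral>x. ?e (-t) x * F x \<partial>lborel) = fourier F (-t)"
      by (simp add: fourier_def)
    finally show "(\<integral>x. iexp (t * x) * complex_of_real (Re (F x)) \<partial>lborel) = 0"
      using F(2) by simp
  qed
  have "fourier (\<lambda>x. - \<i> * G x) \<xi> = - \<i> * fourier G \<xi>" for \<xi>
    unfolding fourier_def by (subst integral_mult_right_zero[symmetric]) (simp add: mult_ac)
  then have "AE x in lborel. Re (- \<i> * G x) = 0"
    using z by (intro Re integrable_mult_right G) simp
  with Re[OF G z] show ?thesis
    by eventually_elim (simp add: complex_eq_iff)
qed

lemma fourier_scale:
  assumes "0 < l" shows "fourier (\<lambda>\<xi>. of_real l * \<theta> (l * \<xi>)) x = fourier \<theta> (x / l)"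
proof -
  have "fourier \<theta> (x / l) = \<bar>l\<bar> *\<^sub>R (\<integral>\<xi>. exp (- \<i> * complex_of_real ((0 + l * \<xi>) * (x / l))) * \<theta> (0 + l * \<xi>) \<partial>lborel)"
    unfolding fourier_def by (rule lborel_integral_real_affine) (use assms in simp)
  also have "\<dots> = (\<integral>\<xi>. of_real l * (exp (- \<i> * complex_of_real (\<xi> * x)) * \<theta> (l * \<xi>)) \<partial>lborel)"
    using assms by (simp add: scaleR_conv_of_real)
  also have "\<dots> = fourier (\<lambda>\<xi>. of_real l * \<theta> (l * \<xi>)) x"
    unfolding fourier_def by (intro Bochner_Integration.integral_cong refl) (simp add: mult_ac)
  finally show ?thesis ..
qed

text \<open>A tempered f need not be integrable, so it is multiplied by the slowly varying cutoffs
  \<open>\<rho> (x / (n + 1))\<close>, where \<open>\<rho>\<close> is the transform of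
  \<open>\<theta>0\<close>. Modulating a cutoff only shifts the test function behind it, so the
  product has vanishing transform and is 0. As n grows the cutoff tends to \<open>\<rho> 0\<close>,
  which is not 0.\<close>

lemma tempered_fun_eq_0:
  assumes f: "tempered_fun f" and z: "\<And>\<theta>. \<theta> \<in> test_funs \<Longrightarrow> (\<integral>x. f x * fourier \<theta> x \<partial>lborel) = 0"
    and \<theta>0: "\<theta>0 \<in> test_funs" "fourier \<theta>0 0 \<noteq> 0"
  shows "AE x in lborel. f x = 0"
proof -
  define \<rho> where "\<rho> = fourier \<theta>0"
  have "AE x in lborel. f x * \<rho> (x / (real n + 1)) = 0" for n :: nat
  proof (rule integrable_fourier_eq_0)
    have n: "real n + 1 > 0" by simp
    define \<theta> where "\<theta> = (\<lambda>\<xi>. of_real (real n + 1) * \<theta>0 ((real n + 1) * \<xi>))"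
    have \<theta>: "\<theta> \<in> test_funs"
      unfolding \<theta>_def using test_funs_cmult[OF test_funs_affine[OF \<theta>0(1), of "real n + 1" 0]] n by simp
    have \<rho>: "\<rho> (x / (real n + 1)) = fourier \<theta> x" for x
      unfolding \<rho>_def \<theta>_def using fourier_scale[OF n] by simp
    show "integrable lborel (\<lambda>x. f x * \<rho> (x / (real n + 1)))"
      unfolding \<rho> using f fourier_test_funs_schwartz[OF \<theta>] by (simp add: tempered_fun_def)
    fix \<xi>
    have "fourier (\<lambda>x. f x * \<rho> (x / (real n + 1))) \<xi> = (\<integral>x. f x * (exp (\<i> * complex_of_real (x * (- \<xi>))) * fourier \<theta> x) \<partial>lborel)"
      unfolding \<rho> by (subst fourier_def) (simp add: mult_ac)
    also have "\<dots> = (\<integral>x. f x * fourier (\<lambda>\<eta>. \<theta> (\<eta> + - \<xi>)) x \<partial>lborel)"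
      by (simp only: fourier_shift)
    also have "\<dots> = 0"
      using test_funs_affine[OF \<theta>, of 1 "-\<xi>"] by (intro z) simp
    finally show "fourier (\<lambda>x. f x * \<rho> (x / (real n + 1))) \<xi> = 0" .
  qed
  then have "AE x in lborel. \<forall>n::nat. f x * \<rho> (x / (real n + 1)) = 0"
    by (subst AE_all_countable) blast
  then show ?thesis
  proof eventually_elim
    fix x assume x: "\<forall>n::nat. f x * \<rho> (x / (real n + 1)) = 0"
    have "isCont \<rho> 0"
      unfolding \<rho>_def using fourier_test_funs_has_vderiv[OF \<theta>0(1)] has_vector_derivative_continuous by blast
    moreover have "(\<lambda>n. x / (real n + 1)) \<longlonglongrightarrow> 0" by real_asymp
    ultimately have "(\<lambda>n. \<rho> (x / (real n + 1))) \<longlonglongrightarrow> \<rho> 0"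
      by (rule isCont_tendsto_compose)
    then have "(\<lambda>n. f x * \<rho> (x / (real n + 1))) \<longlonglongrightarrow> f x * \<rho> 0"
      by (intro tendsto_intros)
    moreover have "(\<lambda>n::nat. f x * \<rho> (x / (real n + 1))) = (\<lambda>n. 0)"
      using x by (intro ext) blast
    ultimately have "(\<lambda>n::nat. 0) \<longlonglongrightarrow> f x * \<rho> 0"
      by metis
    from LIMSEQ_unique[OF this tendsto_const]
    have "f x * \<rho> 0 = 0" .
    then show "f x = 0" using \<theta>0(2) by (simp add: \<rho>_def)
  qed
qed

section \<open>Littlewood-Paley blocks\<close>

text \<open>Convolution kernel of the i-th derivative of the multiplier with symbol
  \<open>\<theta> (\<xi> / l)\<close>; l is the frequency scale.\<close>

definition kern :: "nat \<Rightarrow> (real \<Rightarrow> complex) \<Rightarrow> real \<Rightarrow> real \<Rightarrow> complex" where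
  "kern i \<theta> l = inv_fourier (\<lambda>\<xi>. (\<i> * of_real \<xi>) ^ i * \<theta> (\<xi> / l))"

lemma test_funs_scale: "\<theta> \<in> test_funs \<Longrightarrow> 0 < l \<Longrightarrow> (\<lambda>\<xi>. \<theta> (\<xi> / l)) \<in> test_funs"
  using test_funs_affine[of \<theta> "1 / l" 0] by simp

lemma kern_test_funs: "\<theta> \<in> test_funs \<Longrightarrow> 0 < l \<Longrightarrow> (\<lambda>\<xi>. (\<i> * of_real \<xi>) ^ i * \<theta> (\<xi> / l)) \<in> test_funs"
  by (intro test_funs_power test_funs_scale)

lemma inv_fourier_cmult: "inv_fourier (\<lambda>\<xi>. c * \<theta> \<xi>) x = c * inv_fourier \<theta> x"
proof -
  have "(\<integral>\<xi>. exp (\<i> * complex_of_real (x * \<xi>)) * (c * \<theta> \<xi>) \<partial>lborel) = (\<integral>\<xi>. c * (exp (\<i> * complex_of_real (x * \<xi>)) * \<theta> \<xi>) \<partial>lborel)"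
    by (intro Bochner_Integration.integral_cong refl) (simp add: mult_ac)
  then show ?thesis by (simp add: inv_fourier_def)
qed

lemma kern_scale:
  assumes "0 < l"
  shows "kern i \<theta> l x = of_real (l ^ i * l) * kern i \<theta> 1 (l * x)"
proof -
  have "(\<lambda>\<xi>. (\<i> * of_real \<xi>) ^ i * \<theta> (\<xi> / l)) = (\<lambda>\<xi>. of_real (l ^ i) * ((\<i> * of_real (\<xi> / l)) ^ i * \<theta> (\<xi> / l)))"
    using assms by (simp add: fun_eq_iff power_mult_distrib power_divide)
  then have "kern i \<theta> l x = of_real (l ^ i) * inv_fourier (\<lambda>\<xi>. (\<i> * of_real (\<xi> / l)) ^ i * \<theta> (\<xi> / l)) x"
    unfolding kern_def by (simp only: inv_fourier_cmult)
  also have "inv_fourier (\<lambda>\<xi>. (\<i> * of_real (\<xi> / l)) ^ i * \<theta> (\<xi> / l)) x = of_real l * kern i \<theta> 1 (l * x)"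
    unfolding kern_def using inv_fourier_scale[OF assms, of "\<lambda>\<eta>. (\<i> * of_real \<eta>) ^ i * \<theta> \<eta>" x] by simp
  finally show ?thesis by (simp add: mult.assoc)
qed

lemma kern_integrable: "\<theta> \<in> test_funs \<Longrightarrow> 0 < l \<Longrightarrow> integrable lborel (kern i \<theta> l)"
  unfolding kern_def by (intro inv_fourier_test_funs_integrable kern_test_funs)

lemma integral_norm_kern:
  assumes "0 < l"
  shows "(\<integral>x. cmod (kern i \<theta> l x) \<partial>lborel) = l ^ i * (\<integral>x. cmod (kern i \<theta> 1 x) \<partial>lborel)"
proof -
  have "(\<integral>x. cmod (kern i \<theta> 1 x) \<partial>lborel) = \<bar>l\<bar> *\<^sub>R (\<integral>x. cmod (kern i \<theta> 1 (0 + l * x)) \<partial>lborel)"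
    by (rule lborel_integral_real_affine) (use assms in simp)
  then have "l ^ i * (\<integral>x. cmod (kern i \<theta> 1 x) \<partial>lborel) = (\<integral>x. (l ^ i * l) * cmod (kern i \<theta> 1 (l * x)) \<partial>lborel)"
    using assms by (simp add: mult.assoc)
  also have "\<dots> = (\<integral>x. cmod (kern i \<theta> l x) \<partial>lborel)"
    using assms by (intro Bochner_Integration.integral_cong refl) (simp add: kern_scale[of l] norm_mult norm_power)
  finally show ?thesis ..
qed

text \<open>Bernstein's inequality. Testing the block with the kernel of a multiplier that equals 1 on the
  support of \<open>\<theta>\<close> bounds it by every function representing the block, hence by the infimum.\<close>

lemma Bernstein:
  assumes \<theta>: "cfun \<theta> \<in> test_funs" and \<Theta>: "\<Theta> \<in> test_funs" "\<And>\<xi>. cfun \<theta> \<xi> * \<Theta> \<xi> = cfun \<theta> \<xi>"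
  obtains C where "0 < C" "\<And>p U f l x. \<lbrakk>1 \<le> p; 0 < l; is_fun U f\<rbrakk> \<Longrightarrow>
    ennreal (cmod (conv f (kern i (cfun \<theta>) l) x)) \<le>
      ennreal (C * l ^ i * l powr enn2real (1 / p)) * Lp_distr p (mult_op (\<lambda>\<xi>. \<theta> (\<xi> / l)) U)"
proof -
  let ?K = "kern i \<Theta> 1"
  have K: "integrable lborel ?K" by (intro kern_integrable \<Theta>) simp
  obtain C0 where C0: "\<And>x. cmod (?K x) \<le> C0 / (1 + x\<^sup>2)" "0 < C0"
    unfolding kern_def using inv_fourier_test_funs_le[OF kern_test_funs[OF \<Theta>(1), of 1 i]] by auto
  have C0': "cmod (?K x) \<le> C0" for x
  proof -
    have "C0 / (1 + x\<^sup>2) \<le> C0 / 1"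
      using C0(2) by (intro divide_left_mono) (auto simp: add_pos_nonneg)
    then show ?thesis using C0(1)[of x] by simp
  qed
  \<comment> \<open>One constant for both the sup and the integral of the unit kernel. After scaling
    these become \<open>l ^ i * a * l\<close> and \<open>l ^ i * a\<close>, the form asked for by
    \<open>norm_distr_le_Lp_distr\<close> with S = l.\<close>
  define a where "a = C0 + (\<integral>x. cmod (?K x) \<partial>lborel)"
  have a: "C0 \<le> a" "(\<integral>x. cmod (?K x) \<partial>lborel) \<le> a" "0 < a"
    using C0(2) by (auto simp: a_def integral_nonneg add_pos_nonneg)
  show thesis
  proof (rule that[of "2 * a"])
    fix p U f l x assume p: "(1::ennreal) \<le> p" and l: "(0::real) < l" and U: "is_fun U f"
    let ?\<psi> = "\<lambda>y. kern i \<Theta> l (x - y)"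
    have \<theta>l: "cfun (\<lambda>\<xi>. \<theta> (\<xi> / l)) \<in> test_funs"
      using test_funs_scale[OF \<theta> l] by simp
    note ker = mult_op_kernel[OF U \<theta>l kern_test_funs[OF \<Theta>(1) l, of i], of x]
    have "(\<lambda>\<xi>. cfun (\<lambda>\<xi>. \<theta> (\<xi> / l)) \<xi> * ((\<i> * of_real \<xi>) ^ i * \<Theta> (\<xi> / l))) = (\<lambda>\<xi>. (\<i> * of_real \<xi>) ^ i * cfun \<theta> (\<xi> / l))"
    proof
      fix \<xi>
      show "cfun (\<lambda>\<xi>. \<theta> (\<xi> / l)) \<xi> * ((\<i> * of_real \<xi>) ^ i * \<Theta> (\<xi> / l)) = (\<i> * of_real \<xi>) ^ i * cfun \<theta> (\<xi> / l)"
        using \<Theta>(2)[of "\<xi> / l"] by (metis mult.left_commute)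
    qed
    with ker(2) have eq: "mult_op (\<lambda>\<xi>. \<theta> (\<xi> / l)) U ?\<psi> = conv f (kern i (cfun \<theta>) l) x"
      unfolding kern_def by simp
    have "(\<integral>\<^sup>+y. ennreal (cmod (?\<psi> y)) \<partial>lborel) = ennreal (\<integral>y. cmod (?\<psi> y) \<partial>lborel)"
      by (intro nn_integral_eq_integral integrable_norm integrable_reflect_translate kern_integrable \<Theta> l) auto
    also have "(\<integral>y. cmod (?\<psi> y) \<partial>lborel) = l ^ i * (\<integral>x. cmod (?K x) \<partial>lborel)"
      using integral_reflect_translate[of "\<lambda>y. cmod (kern i \<Theta> l y)" x] integral_norm_kern[OF l] by simp
    also have "\<dots> \<le> l ^ i * a"
      using a l by (intro mult_left_mono) auto
    finally have int: "(\<integral>\<^sup>+y. ennreal (cmod (?\<psi> y)) \<partial>lborel) \<le> ennreal (l ^ i * a)"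
      by (simp add: ennreal_leI)
    have sup: "cmod (?\<psi> y) \<le> (l ^ i * a) * l" for y
    proof -
      have "cmod (?\<psi> y) = l ^ i * l * cmod (?K (l * (x - y)))"
        using l by (simp add: kern_scale[of l] norm_mult norm_power)
      also have "\<dots> \<le> l ^ i * l * a"
        using l a C0' by (intro mult_left_mono order_trans[OF C0' a(1)]) auto
      finally show ?thesis by (simp add: mult_ac)
    qed
    have "?\<psi> \<in> schwartz" using ker(1) by (simp add: kern_def)
    from norm_distr_le_Lp_distr[OF p this int sup _ l, of "mult_op (\<lambda>\<xi>. \<theta> (\<xi> / l)) U"]
    show "ennreal (cmod (conv f (kern i (cfun \<theta>) l) x)) \<le>
      ennreal (2 * a * l ^ i * l powr enn2real (1 / p)) * Lp_distr p (mult_op (\<lambda>\<xi>. \<theta> (\<xi> / l)) U)"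
      using l a by (simp add: eq mult_ac)
  qed (use a in simp)
qed

text \<open>Supplies the finite first moment for \<open>conv_kern_approx\<close>; the decay
  estimates with the powers 1 and 3 combine to this bound.\<close>

lemma fourier_test_funs_le_cubic:
  assumes \<theta>: "\<theta> \<in> test_funs"
  obtains C where "\<And>x. cmod (of_real x * fourier \<theta> x) \<le> C / (1 + x\<^sup>2)" "0 < C"
proof -
  obtain B1 where B1: "\<And>x. \<bar>x\<bar> ^ 1 * cmod (fourier \<theta> x) \<le> B1"
    using fourier_test_funs_decay[OF \<theta>, of 1] by auto
  obtain B3 where B3: "\<And>x. \<bar>x\<bar> ^ 3 * cmod (fourier \<theta> x) \<le> B3"
    using fourier_test_funs_decay[OF \<theta>, of 3] by auto
  have "cmod (of_real x * fourier \<theta> x) \<le> (\<bar>B1\<bar> + \<bar>B3\<bar> + 1) / (1 + x\<^sup>2)" for x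
  proof -
    have "\<bar>x\<bar> ^ 3 = x\<^sup>2 * \<bar>x\<bar>" by (simp add: power3_eq_cube power2_eq_square abs_mult_self_eq)
    then have "(1 + x\<^sup>2) * cmod (of_real x * fourier \<theta> x) \<le> \<bar>B1\<bar> + \<bar>B3\<bar> + 1"
      using B1[of x] B3[of x] by (simp add: norm_mult algebra_simps)
    moreover have "0 < 1 + x\<^sup>2" by (simp add: add_pos_nonneg)
    ultimately show ?thesis by (simp add: pos_le_divide_eq mult.commute)
  qed
  then show thesis by (rule that) simp
qed

text \<open>The kernel has total mass \<open>\<theta> 0 = 1\<close>, so the error is an average of
  f(x - z / l) - f(x), at most L / l times the first moment of the kernel.\<close>

lemma conv_kern_approx:
  assumes \<theta>: "\<theta> \<in> test_funs" and \<theta>0: "\<theta> 0 = 1"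
  obtains C where "0 < C" "\<And>f B L l x. \<lbrakk>f \<in> borel_measurable borel; \<And>x. cmod (f x) \<le> B;
     \<And>x y. cmod (f x - f y) \<le> L * \<bar>x - y\<bar>; 0 < l\<rbrakk> \<Longrightarrow> cmod (conv f (kern 0 \<theta> l) x - f x) \<le> C * L / l"
proof -
  let ?K = "kern 0 \<theta> 1"
  have K_eq: "?K = inv_fourier \<theta>" by (simp add: kern_def)
  have K: "integrable lborel ?K" by (intro kern_integrable \<theta>) simp
  have K1: "(\<integral>y. ?K y \<partial>lborel) = 1"
    unfolding K_eq inv_fourier_eq_fourier using integral_fourier[OF test_funs_reflect[OF \<theta>]] \<theta>0 by simp
  have yK: "integrable lborel (\<lambda>y. of_real y * ?K y)"
  proof -
    obtain C where C: "\<And>x. cmod (of_real x * fourier (\<lambda>\<xi>. \<theta> (- \<xi>) / of_real (2 * pi)) x) \<le> C / (1 + x\<^sup>2)"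
      using fourier_test_funs_le_cubic[OF test_funs_reflect[OF \<theta>]] by blast
    have [measurable]: "inv_fourier \<theta> \<in> borel_measurable borel" by (rule inv_fourier_test_funs_measurable[OF \<theta>])
    show ?thesis
      by (rule abs_le_imp_integrable_1_plus_sq[of _ C])
         (simp add: K_eq, use C in \<open>simp only: K_eq inv_fourier_eq_fourier\<close>)
  qed
  define C where "C = (\<integral>y. cmod (of_real y * ?K y) \<partial>lborel) + 1"
  show thesis
  proof (rule that[of C])
    show "0 < C" by (simp add: C_def add_nonneg_pos integral_nonneg)
    fix f B L l x assume [measurable]: "f \<in> borel_measurable borel" and B: "\<And>x. cmod (f x) \<le> B"
     and L: "\<And>x y. cmod (f x - f y) \<le> L * \<bar>x - y\<bar>" and l: "(0::real) < l"
    \<comment> \<open>Nonnegativity of L is implicit in the Lipschitz condition and read off at the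
      points 1 and 0.\<close>
    have "0 \<le> L * \<bar>1 - 0\<bar>" by (rule order_trans[OF norm_ge_zero L])
    then have L0: "0 \<le> L" by simp
    have i1: "integrable lborel (\<lambda>y. f y * kern 0 \<theta> l (x - y))"
      by (rule integrable_conv_integrand[OF _ B kern_integrable[OF \<theta> l]]) simp
    have "conv f (kern 0 \<theta> l) x = \<bar>- 1 / l\<bar> *\<^sub>R (\<integral>z. f (x + (- 1 / l) * z) * kern 0 \<theta> l (x - (x + (- 1 / l) * z)) \<partial>lborel)"
      unfolding conv_def by (rule lborel_integral_real_affine) (use l in simp)
    also have "\<dots> = (\<integral>z. f (x - z / l) * ?K z \<partial>lborel)"
      using l by (subst integral_scaleR_right[symmetric], intro Bochner_Integration.integral_cong refl)
        (simp add: kern_scale[of l] scaleR_conv_of_real)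
    finally have c: "conv f (kern 0 \<theta> l) x = (\<integral>z. f (x - z / l) * ?K z \<partial>lborel)" .
    have [measurable]: "?K \<in> borel_measurable borel" using K by auto
    have i2: "integrable lborel (\<lambda>z. f (x - z / l) * ?K z)"
      by (rule Bochner_Integration.integrable_bound[OF integrable_mult_right[OF integrable_norm[OF K], of B]])
         (use order_trans[OF norm_ge_zero B] in \<open>auto simp: norm_mult abs_mult intro!: mult_right_mono B\<close>)
    have i3: "integrable lborel (\<lambda>z. f x * ?K z)" by (intro integrable_mult_right K)
    have "conv f (kern 0 \<theta> l) x - f x = (\<integral>z. f (x - z / l) * ?K z \<partial>lborel) - (\<integral>z. f x * ?K z \<partial>lborel)"
      using K1 by (simp add: c)
    also have "\<dots> = (\<integral>z. f (x - z / l) * ?K z - f x * ?K z \<partial>lborel)"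
      by (rule Bochner_Integration.integral_diff[OF i2 i3, symmetric])
    finally have "cmod (conv f (kern 0 \<theta> l) x - f x) \<le> (\<integral>z. cmod (f (x - z / l) * ?K z - f x * ?K z) \<partial>lborel)"
      by (simp add: integral_norm_bound)
    also have "\<dots> \<le> (\<integral>z. L / l * cmod (of_real z * ?K z) \<partial>lborel)"
    proof (intro integral_mono integrable_norm Bochner_Integration.integrable_diff i2 i3 integrable_mult_right yK)
      fix z
      have "cmod (f (x - z / l) * ?K z - f x * ?K z) = cmod (f (x - z / l) - f x) * cmod (?K z)"
        by (simp add: norm_mult flip: left_diff_distrib)
      also have "\<dots> \<le> (L * \<bar>x - z / l - x\<bar>) * cmod (?K z)"
        by (intro mult_right_mono L) auto
      finally show "cmod (f (x - z / l) * ?K z - f x * ?K z) \<le> L / l * cmod (of_real z * ?K z)"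
        using l by (simp add: norm_mult abs_divide)
    qed
    also have "\<dots> = L / l * (C - 1)"
      by (simp add: C_def)
    also have "\<dots> \<le> L / l * C"
      using L0 l by (intro mult_left_mono) auto
    finally show "cmod (conv f (kern 0 \<theta> l) x - f x) \<le> C * L / l"
      by (simp add: mult_ac)
  qed
qed

lemma enn2real_recip:
  assumes "(1::ennreal) \<le> p"
  shows "0 \<le> enn2real (1 / p)" "enn2real (1 / p) \<le> 1"
  using assms by (cases rule: exponent_cases; simp only:; simp)+

section \<open>The dyadic partition of unity and its kernels\<close>

locale LP =
  fixes chi \<phi> :: "real \<Rightarrow> real"
  assumes LP: "LP_pair chi \<phi>"
begin

lemma chi_eq_0: "4/3 < \<bar>\<xi>\<bar> \<Longrightarrow> chi \<xi> = 0"
  using LP closure_subset[of "{\<xi>. chi \<xi> \<noteq> 0}"] unfolding LP_pair_def by force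

lemma phi_eq_0: "8/3 < \<bar>\<xi>\<bar> \<or> \<bar>\<xi>\<bar> < 3/4 \<Longrightarrow> \<phi> \<xi> = 0"
  using LP closure_subset[of "{\<xi>. \<phi> \<xi> \<noteq> 0}"] unfolding LP_pair_def by force

lemma chi_test: "cfun chi \<in> test_funs"
  using LP chi_eq_0 unfolding test_funs_def LP_pair_def by (auto intro!: smooth_cfun exI[of _ "4/3"])

lemma phi_test: "cfun \<phi> \<in> test_funs"
  using LP phi_eq_0 unfolding test_funs_def LP_pair_def by (auto intro!: smooth_cfun exI[of _ "8/3"])

lemma phi_sums: "(\<lambda>j::nat. \<phi> (\<xi> / 2 ^ j)) sums (1 - chi \<xi>)"
  using LP by (simp add: LP_pair_def)

lemma chi_eq_1:
  assumes "\<bar>\<xi>\<bar> < 3/4" shows "chi \<xi> = 1"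
proof -
  have "\<bar>\<xi> / 2 ^ j\<bar> < 3/4" for j :: nat
  proof -
    have "\<bar>\<xi>\<bar> / 2 ^ j \<le> \<bar>\<xi>\<bar> / 1" by (intro divide_left_mono) auto
    then have "\<bar>\<xi>\<bar> / 2 ^ j < 3/4" using assms by linarith
    then show ?thesis by (simp add: abs_divide)
  qed
  then have "(\<lambda>j::nat. \<phi> (\<xi> / 2 ^ j)) = (\<lambda>j. 0)" by (intro ext phi_eq_0 disjI2)
  then have "1 - chi \<xi> = 0" using phi_sums[of \<xi>] sums_unique2[OF _ sums_zero] by metis
  then show ?thesis by simp
qed

text \<open>Comparison of the partition of unity at \<open>\<xi>\<close> and at
  \<open>\<xi> / 2\<close>. Iterated, it telescopes the low-pass filter at scale
  \<open>2 ^ N\<close> into \<open>chi\<close> and the first N blocks.\<close>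

lemma chi_half: "chi (\<xi> / 2) = chi \<xi> + \<phi> \<xi>"
proof -
  have "(\<lambda>j::nat. \<phi> (\<xi> / 2 ^ Suc j)) sums (1 - chi \<xi> - \<phi> \<xi>)"
    using phi_sums[of \<xi>] by (subst sums_Suc_iff) simp
  moreover have "(\<lambda>j::nat. \<phi> (\<xi> / 2 ^ Suc j)) sums (1 - chi (\<xi> / 2))"
    using phi_sums[of "\<xi> / 2"] by (simp add: divide_divide_eq_left)
  ultimately have "1 - chi \<xi> - \<phi> \<xi> = 1 - chi (\<xi> / 2)"
    by (rule sums_unique2)
  then show ?thesis by simp
qed

lemma hblock_eq: "hblock \<phi> j U = mult_op (\<lambda>\<xi>. \<phi> (\<xi> / 2 powi j)) U"
  by (simp add: hblock_def power_int_minus divide_inverse mult.commute)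

lemma wide_test: "(\<lambda>\<xi>. cfun chi (\<xi> / 4)) \<in> test_funs"
  by (rule test_funs_scale[OF chi_test]) simp

text \<open>\<open>chi (\<xi> / 4)\<close> is 1 for \<open>\<bar>\<xi>\<bar> < 3\<close>, which
  covers both supports, of radius 8/3 and 4/3. It is the wider multiplier \<open>\<Theta>\<close>
  demanded by \<open>Bernstein\<close>.\<close>

lemma wide_mult: "cfun \<phi> \<xi> * cfun chi (\<xi> / 4) = cfun \<phi> \<xi>" "cfun chi \<xi> * cfun chi (\<xi> / 4) = cfun chi \<xi>"
  using phi_eq_0[of \<xi>] chi_eq_0[of \<xi>] chi_eq_1[of "\<xi> / 4"] by (cases "\<bar>\<xi>\<bar> \<le> 8/3"; force)+

lemma conv_kern_chi_double:
  assumes [measurable]: "f \<in> borel_measurable borel" and B: "\<And>x. cmod (f x) \<le> B" and l: "0 < l"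
  shows "conv f (kern i (cfun chi) (2 * l)) x = conv f (kern i (cfun chi) l) x + conv f (kern i (cfun \<phi>) l) x"
proof -
  have "kern i (cfun chi) (2 * l) y = kern i (cfun chi) l y + kern i (cfun \<phi>) l y" for y
  proof -
    have "chi (\<xi> / (2 * l)) = chi (\<xi> / l) + \<phi> (\<xi> / l)" for \<xi>
      using chi_half[of "\<xi> / l"] by (simp add: mult.commute)
    then have "kern i (cfun chi) (2 * l) y = (\<integral>\<xi>. exp (\<i> * complex_of_real (y * \<xi>)) * ((\<i> * of_real \<xi>) ^ i * cfun chi (\<xi> / l)) +
       exp (\<i> * complex_of_real (y * \<xi>)) * ((\<i> * of_real \<xi>) ^ i * cfun \<phi> (\<xi> / l)) \<partial>lborel) / of_real (2 * pi)"
      by (simp add: kern_def inv_fourier_def algebra_simps)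
    also have "\<dots> = kern i (cfun chi) l y + kern i (cfun \<phi>) l y"
    proof (subst Bochner_Integration.integral_add)
      show "integrable lborel (\<lambda>\<xi>. exp (\<i> * complex_of_real (y * \<xi>)) * ((\<i> * of_real \<xi>) ^ i * cfun chi (\<xi> / l)))"
        using integrable_exp_mult[OF test_funs_integrable[OF kern_test_funs[OF chi_test l]], of "-y"] by (simp add: mult.commute)
      show "integrable lborel (\<lambda>\<xi>. exp (\<i> * complex_of_real (y * \<xi>)) * ((\<i> * of_real \<xi>) ^ i * cfun \<phi> (\<xi> / l)))"
        using integrable_exp_mult[OF test_funs_integrable[OF kern_test_funs[OF phi_test l]], of "-y"] by (simp add: mult.commute)
    qed (simp add: kern_def inv_fourier_def add_divide_distrib)
    finally show ?thesis .
  qed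
  then have "conv f (kern i (cfun chi) (2 * l)) x = (\<integral>y. f y * kern i (cfun chi) l (x - y) + f y * kern i (cfun \<phi>) l (x - y) \<partial>lborel)"
    by (simp add: conv_def distrib_left)
  also have "\<dots> = conv f (kern i (cfun chi) l) x + conv f (kern i (cfun \<phi>) l) x"
    unfolding conv_def
    by (intro Bochner_Integration.integral_add integrable_conv_integrand[OF _ B] kern_integrable chi_test phi_test l) auto
  finally show ?thesis .
qed

lemma conv_kern_chi_sum:
  assumes "f \<in> borel_measurable borel" "\<And>x. cmod (f x) \<le> B"
  shows "conv f (kern i (cfun chi) (2 ^ N)) x = conv f (kern i (cfun chi) 1) x + (\<Sum>n<N. conv f (kern i (cfun \<phi>) (2 ^ n)) x)"
  by (induction N) (use conv_kern_chi_double[OF assms, of "2 ^ _"] in simp_all)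

lemma Bernstein_hblock:
  obtains C where "0 < C" "\<And>p U f n x. \<lbrakk>1 \<le> p; is_fun U f\<rbrakk> \<Longrightarrow>
    ennreal (cmod (conv f (kern i (cfun \<phi>) (2 ^ n)) x)) \<le>
      ennreal (C * 2 powr (real n * (real i + enn2real (1 / p)))) * Lp_distr p (hblock \<phi> (int n) U)"
proof -
  obtain C where C: "0 < C" "\<And>p U f l x. \<lbrakk>1 \<le> p; 0 < l; is_fun U f\<rbrakk> \<Longrightarrow>
    ennreal (cmod (conv f (kern i (cfun \<phi>) l) x)) \<le>
      ennreal (C * l ^ i * l powr enn2real (1 / p)) * Lp_distr p (mult_op (\<lambda>\<xi>. \<phi> (\<xi> / l)) U)"
    using Bernstein[OF phi_test wide_test wide_mult(1), of i] by blast
  have "C * (2 ^ n) ^ i * (2 ^ n) powr a = C * 2 powr (real n * (real i + a))" for n a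
  proof -
    have "(2 ^ n) ^ i = 2 powr (real n * real i)"
      by (metis of_nat_mult power_mult powr_realpow zero_less_numeral)
    moreover have "(2 ^ n) powr a = 2 powr (real n * a)"
      by (metis powr_powr powr_realpow zero_less_numeral)
    ultimately show ?thesis by (simp add: distrib_left powr_add)
  qed
  note eq = this
  show thesis
  proof (rule that[of C])
    fix p U f n x assume "(1::ennreal) \<le> p" "is_fun U f"
    from C(2)[OF this(1) _ this(2), of "2 ^ n" x]
    show "ennreal (cmod (conv f (kern i (cfun \<phi>) (2 ^ n)) x)) \<le>
      ennreal (C * 2 powr (real n * (real i + enn2real (1 / p)))) * Lp_distr p (hblock \<phi> (int n) U)"
      unfolding hblock_eq eq by simp
  qed (rule C(1))
qed

text \<open>Bernstein's factor \<open>2 powr (n / p)\<close> is exactly the weight of the norm of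
  order 1/p, so each of the N + 1 pieces of the low-pass filter costs one multiple of the norm.
  Bounding the pieces one by one works for every r, including \<open>\<infinity>\<close>, at the
  price of the factor N + 1.\<close>

theorem norm_conv_chi_le_Besov_norm:
  obtains C where "0 < C" "\<And>p r U f B N x. \<lbrakk>1 \<le> p; 1 \<le> r; is_fun U f; \<And>x. cmod (f x) \<le> B\<rbrakk> \<Longrightarrow>
    ennreal (cmod (conv f (kern 0 (cfun chi) (2 ^ N)) x)) \<le>
      ennreal (C * (real N + 1)) * Besov_norm chi \<phi> (enn2real (1 / p)) p r U"
proof -
  obtain C1 where C1: "0 < C1" "\<And>p U f n x. \<lbrakk>1 \<le> p; is_fun U f\<rbrakk> \<Longrightarrow>
    ennreal (cmod (conv f (kern 0 (cfun \<phi>) (2 ^ n)) x)) \<le>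
      ennreal (C1 * 2 powr (real n * (real 0 + enn2real (1 / p)))) * Lp_distr p (hblock \<phi> (int n) U)"
    using Bernstein_hblock[of 0] by blast
  obtain C2 where C2: "0 < C2" "\<And>p U f l x. \<lbrakk>1 \<le> p; 0 < l; is_fun U f\<rbrakk> \<Longrightarrow>
    ennreal (cmod (conv f (kern 0 (cfun chi) l) x)) \<le>
      ennreal (C2 * l ^ 0 * l powr enn2real (1 / p)) * Lp_distr p (mult_op (\<lambda>\<xi>. chi (\<xi> / l)) U)"
    using Bernstein[OF chi_test wide_test wide_mult(2), of 0] by blast
  show thesis
  proof (rule that[of "C1 + 2 * C2"])
    fix p r :: ennreal and U f B N x
    assume p: "1 \<le> p" and r: "1 \<le> r" and U: "is_fun U f" and B: "\<And>x. cmod (f x) \<le> (B::real)"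
    let ?a = "enn2real (1 / p)" and ?Bs = "Besov_norm chi \<phi> (enn2real (1 / p)) p r U"
    note a = enn2real_recip[OF p]
    have [measurable]: "f \<in> borel_measurable borel"
      using U by (simp add: is_fun_def tempered_fun_def)
    have le: "ennreal (2 powr (of_int j * ?a)) * Lp_distr p (nblock chi \<phi> j U) \<le> ?Bs" for j
      unfolding Besov_norm_def by (rule le_lp_norm_count_space[OF r])
    have hi: "ennreal (cmod (conv f (kern 0 (cfun \<phi>) (2 ^ n)) x)) \<le> ennreal C1 * ?Bs" for n
    proof -
      have "ennreal (C1 * 2 powr (real n * (real 0 + ?a))) * Lp_distr p (hblock \<phi> (int n) U)
        = ennreal C1 * (ennreal (2 powr (of_int (int n) * ?a)) * Lp_distr p (nblock chi \<phi> (int n) U))"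
        using C1(1) by (simp add: nblock_def ennreal_mult mult.assoc)
      also have "\<dots> \<le> ennreal C1 * ?Bs" by (intro mult_left_mono le) simp
      finally show ?thesis using C1(2)[OF p U, of n x] by (rule order_trans[rotated])
    qed
    \<comment> \<open>The block of index -1 carries the weight
      \<open>2 powr (- 1 / p) \<ge> 1 / 2\<close>, whence the factor 2.\<close>
    have lo: "ennreal (cmod (conv f (kern 0 (cfun chi) 1) x)) \<le> ennreal (2 * C2) * ?Bs"
    proof -
      have "ennreal (cmod (conv f (kern 0 (cfun chi) 1) x)) \<le> ennreal C2 * Lp_distr p (nblock chi \<phi> (-1) U)"
        using C2(2)[OF p _ U, of 1 x] by (simp add: nblock_def)
      also have "ennreal C2 * Lp_distr p (nblock chi \<phi> (-1) U) =
        ennreal (C2 * 2 powr ?a) * (ennreal (2 powr (of_int (-1) * ?a)) * Lp_distr p (nblock chi \<phi> (-1) U))"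
      proof -
        have "ennreal (C2 * 2 powr ?a) * ennreal (2 powr (of_int (-1) * ?a)) = ennreal C2"
          using C2(1) by (subst ennreal_mult[symmetric]) (auto simp: powr_minus field_simps)
        then show ?thesis by (simp only: mult.assoc[symmetric])
      qed
      also have "\<dots> \<le> ennreal (2 * C2) * ?Bs"
      proof -
        have "2 powr ?a \<le> 2 powr 1" using a by (intro powr_mono) auto
        then have "C2 * 2 powr ?a \<le> 2 * C2" using C2(1) by simp
        from mult_mono[OF ennreal_leI[OF this] le[of "-1"]] show ?thesis by simp
      qed
      finally show ?thesis .
    qed
    have "cmod (conv f (kern 0 (cfun chi) (2 ^ N)) x) \<le> cmod (conv f (kern 0 (cfun chi) 1) x) + (\<Sum>n<N. cmod (conv f (kern 0 (cfun \<phi>) (2 ^ n)) x))"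
      unfolding conv_kern_chi_sum[OF \<open>f \<in> borel_measurable borel\<close> B, of 0 N x]
      by (intro order_trans[OF norm_triangle_ineq] add_left_mono norm_sum)
    then have "ennreal (cmod (conv f (kern 0 (cfun chi) (2 ^ N)) x)) \<le>
      ennreal (cmod (conv f (kern 0 (cfun chi) 1) x)) + (\<Sum>n<N. ennreal (cmod (conv f (kern 0 (cfun \<phi>) (2 ^ n)) x)))"
      by (simp add: ennreal_leI sum_nonneg flip: ennreal_plus)
    also have "\<dots> \<le> ennreal (2 * C2) * ?Bs + (\<Sum>n<N. ennreal C1 * ?Bs)"
      by (intro add_mono lo sum_mono hi)
    also have "\<dots> = ennreal (2 * C2 + real N * C1) * ?Bs"
      using C1(1) C2(1) by (simp add: distrib_right ennreal_of_nat_eq_real_of_nat mult.assoc ennreal_mult)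
    also have "\<dots> \<le> ennreal ((C1 + 2 * C2) * (real N + 1)) * ?Bs"
      using C1(1) C2(1) by (intro mult_right_mono ennreal_leI) (auto simp: algebra_simps)
    finally show "ennreal (cmod (conv f (kern 0 (cfun chi) (2 ^ N)) x)) \<le> ennreal ((C1 + 2 * C2) * (real N + 1)) * ?Bs" .
  qed (use C1 C2 in auto)
qed

section \<open>Functions in high-order Besov spaces are smooth\<close>

text \<open>Makes \<open>chi\<close> an admissible \<open>\<theta>0\<close> in
  \<open>tempered_fun_eq_0\<close>: it is nonnegative and equals 1 near 0, so its integral is
  positive.\<close>

lemma fourier_chi_neq_0: "fourier (cfun chi) 0 \<noteq> 0"
proof -
  have i: "integrable lborel chi"
    using test_funs_integrable[OF chi_test] complex_of_real_integrable_eq by blast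
  have "(\<integral>x. indicator {-1/2..1/2::real} x \<partial>lborel) \<le> (\<integral>x. chi x \<partial>lborel)"
  proof (rule integral_mono)
    show "integrable lborel (indicator {-1/2..1/2::real} :: real \<Rightarrow> real)" by simp
    have "range chi \<subseteq> {0..1}" using LP by (simp add: LP_pair_def)
    then have "0 \<le> chi x" for x by (auto simp: subset_iff)
    then show "indicator {-1/2..1/2} x \<le> chi x" for x
      using chi_eq_1[of x] by (auto simp: indicator_def abs_le_iff)
  qed (rule i)
  then have "(\<integral>x. chi x \<partial>lborel) \<noteq> 0" by simp
  then show ?thesis by (simp add: fourier_def)
qed

text \<open>The representative is the sum of the Littlewood-Paley series. Order 6 beats the
  Bernstein factor of up to three derivatives for every p, so the differentiated series converge
  geometrically; the part below frequency 1 is bounded through B. The sum represents f because a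
  low-pass filter of large scale acts as the identity on any fixed bounded range of
  frequencies.\<close>

lemma smooth_representative:
  obtains C where "0 < C" "\<And>p r f B R. \<lbrakk>1 \<le> p; 1 \<le> r; f \<in> borel_measurable borel; \<And>x. \<bar>f x\<bar> \<le> B;
      hBesov_norm \<phi> 6 p r (rdistr f) \<le> ennreal R; 0 \<le> R\<rbrakk> \<Longrightarrow>
    \<exists>F::nat \<Rightarrow> real \<Rightarrow> real. (AE x in lborel. f x = F 0 x) \<and>
      (\<forall>i\<le>3. \<forall>x. \<bar>F i x\<bar> \<le> C * (B + R)) \<and> (\<forall>i<3. \<forall>x. (F i has_real_derivative F (Suc i) x) (at x))"
proof -
  have "\<exists>C. 0 < C \<and> (\<forall>p U f n x. 1 \<le> p \<longrightarrow> is_fun U f \<longrightarrow>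
    ennreal (cmod (conv f (kern i (cfun \<phi>) (2 ^ n)) x)) \<le>
      ennreal (C * 2 powr (real n * (real i + enn2real (1 / p)))) * Lp_distr p (hblock \<phi> (int n) U))" for i
    using Bernstein_hblock[of i] by metis
  then obtain C1 where C1: "\<And>i. 0 < C1 i" "\<And>i p U f n x. \<lbrakk>1 \<le> p; is_fun U f\<rbrakk> \<Longrightarrow>
    ennreal (cmod (conv f (kern i (cfun \<phi>) (2 ^ n)) x)) \<le>
      ennreal (C1 i * 2 powr (real n * (real i + enn2real (1 / p)))) * Lp_distr p (hblock \<phi> (int n) U)"
    by metis
  define C2 where "C2 = (\<lambda>i. \<integral>x. cmod (kern i (cfun chi) 1 x) \<partial>lborel)"
  have C2: "0 \<le> C2 i" for i by (simp add: C2_def integral_nonneg)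
  define C where "C = (\<Sum>i\<le>3. 2 * C1 i + C2 i)"
  have C_ge: "2 * C1 i + C2 i \<le> C" if "i \<le> 3" for i
    unfolding C_def
    by (rule member_le_sum[of i "{..3}" "\<lambda>i. 2 * C1 i + C2 i"])
       (use that C1(1) C2 in \<open>auto intro!: add_nonneg_nonneg less_imp_le[OF mult_pos_pos]\<close>)
  have C0: "0 < C" using C_ge[of 0] C1(1)[of 0] C2[of 0] by simp
  show thesis
  proof (rule that[OF C0])
    fix p r :: ennreal and f B R
    assume p: "1 \<le> p" and r: "1 \<le> r" and f[measurable]: "f \<in> borel_measurable borel" and B: "\<And>x. \<bar>f x\<bar> \<le> (B::real)"
      and R: "hBesov_norm \<phi> 6 p r (rdistr f) \<le> ennreal R" "0 \<le> R"
    have B0: "0 \<le> B" using order_trans[OF abs_ge_zero B] .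
    have Bc: "cmod (cfun f x) \<le> B" for x using B by simp
    have cf [measurable]: "cfun f \<in> borel_measurable borel" by measurable
    let ?a = "enn2real (1 / p)"
    note a = enn2real_recip[OF p]
    have is_f: "is_fun (rdistr f) (cfun f)"
      unfolding is_fun_def using tempered_fun_bounded[OF cf Bc] by simp
    define t where "t = (\<lambda>i n x. conv (cfun f) (kern i (cfun \<phi>) (2 ^ n)) x)"
    have t_le: "cmod (t i n x) \<le> C1 i * R * (1/2) ^ n" if i: "i \<le> 3" for i n x
    proof -
      have "ennreal (cmod (t i n x)) \<le> ennreal (C1 i * 2 powr (real n * (real i + ?a))) * Lp_distr p (hblock \<phi> (int n) (rdistr f))"
        unfolding t_def by (rule C1(2)[OF p is_f])
      also have "\<dots> = ennreal (C1 i * 2 powr (real n * (real i + ?a - 6))) * (ennreal (2 powr (of_int (int n) * 6)) * Lp_distr p (hblock \<phi> (int n) (rdistr f)))"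
      proof -
        have "2 powr (real n * (real i + ?a)) = 2 powr (real n * (real i + ?a - 6)) * 2 powr (of_int (int n) * 6)"
          by (simp add: algebra_simps flip: powr_add)
        then show ?thesis using C1(1)[of i] by (simp add: ennreal_mult mult.assoc)
      qed
      also have "\<dots> \<le> ennreal (C1 i * 2 powr (real n * (real i + ?a - 6))) * ennreal R"
        using le_lp_norm_count_space[OF r, of "\<lambda>j::int. ennreal (2 powr (of_int j * 6)) * Lp_distr p (hblock \<phi> j (rdistr f))" "int n"] R
        by (intro mult_left_mono) (auto simp: hBesov_norm_def)
      also have "\<dots> \<le> ennreal (C1 i * (1/2) ^ n) * ennreal R"
      proof (intro mult_right_mono ennreal_leI mult_left_mono)
        \<comment> \<open>Since \<open>i \<le> 3\<close> and \<open>1 / p \<le> 1\<close>, the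
          exponent \<open>i + 1 / p - 6\<close> is at most -2; already -1 gives a convergent
          geometric series.\<close>
        have "2 powr (real n * (real i + ?a - 6)) \<le> 2 powr (- real n)"
          using a i mult_left_mono[of "real i + ?a - 6" "-1" "real n"] by (intro powr_mono) auto
        then show "2 powr (real n * (real i + ?a - 6)) \<le> (1/2) ^ n"
          by (simp add: powr_minus powr_realpow power_one_over inverse_eq_divide)
      qed (use C1(1)[of i] in auto)
      also have "\<dots> = ennreal (C1 i * R * (1/2) ^ n)"
        using C1(1)[of i] R by (simp add: mult_ac flip: ennreal_mult)
      finally show ?thesis
        using C1(1)[of i] R by (subst (asm) ennreal_le_iff) auto
    qed
    define s where "s = (\<lambda>i x. conv (cfun f) (kern i (cfun chi) 1) x)"
    have s_le: "cmod (s i x) \<le> B * C2 i" for i x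
      unfolding s_def C2_def by (rule norm_conv_le[OF cf Bc kern_integrable[OF chi_test]]) simp

    have sm: "summable (\<lambda>n. t i n x)" if "i \<le> 3" for i x
      by (rule summable_comparison_test'[of "\<lambda>n. C1 i * R * (1/2) ^ n" 0]) (use t_le[OF that] in \<open>auto intro!: summable_mult\<close>)
    define G where "G = (\<lambda>i x. s i x + (\<Sum>n. t i n x))"
    have G_le: "cmod (G i x) \<le> C * (B + R)" if i: "i \<le> 3" for i x
    proof -
      have "cmod (\<Sum>n. t i n x) \<le> (\<Sum>n. C1 i * R * (1/2) ^ n)"
        by (rule norm_suminf_le) (use t_le[OF i] in \<open>auto intro!: summable_mult\<close>)
      also have "\<dots> = 2 * C1 i * R"
        by (subst suminf_mult) (auto simp: suminf_geometric)
      finally have "cmod (G i x) \<le> B * C2 i + 2 * C1 i * R"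
        using s_le[of i x] norm_triangle_ineq[of "s i x"] unfolding G_def by (smt (verit))
      also have "\<dots> \<le> B * (2 * C1 i + C2 i) + (2 * C1 i + C2 i) * R"
        using B0 R C1(1)[of i] C2[of i] by (intro add_mono mult_left_mono mult_right_mono) auto
      also have "\<dots> = (2 * C1 i + C2 i) * (B + R)" by (simp add: algebra_simps)
      also have "\<dots> \<le> C * (B + R)" using C_ge[OF i] B0 R by (intro mult_right_mono) auto
      finally show ?thesis .
    qed
    have deriv: "(conv (cfun f) (kern i \<theta> l) has_vector_derivative conv (cfun f) (kern (Suc i) \<theta> l) x) (at x)"
      if "\<theta> \<in> test_funs" "0 < l" for i \<theta> l x
      using conv_inv_fourier_has_vderiv[OF cf Bc kern_test_funs[OF that], of i x]
      by (simp add: kern_def mult.assoc)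
    have Re_deriv: "((\<lambda>x. Re (h x)) has_real_derivative Re h') (at x)" if "(h has_vector_derivative h') (at x)" for h h' x
      using bounded_linear.has_vector_derivative[OF bounded_linear_Re that] by (simp add: has_real_derivative_iff_has_vector_derivative)
    have G_deriv: "((\<lambda>x. Re (G i x)) has_real_derivative Re (G (Suc i) x)) (at x)" if i: "i < 3" for i x
    proof -
      have "((\<lambda>x. \<Sum>n. Re (t i n x)) has_real_derivative (\<Sum>n. Re (t (Suc i) n x))) (at x)"
      proof (rule has_field_derivative_series'(2)[of UNIV _ _ 0])
        show "((\<lambda>x. Re (t i n x)) has_real_derivative Re (t (Suc i) n x)) (at x within UNIV)" for n x
          unfolding t_def by (intro Re_deriv deriv phi_test) simp
        show "uniformly_convergent_on UNIV (\<lambda>n x. \<Sum>k<n. Re (t (Suc i) k x))"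
          by (rule Weierstrass_m_test'[of _ _ "\<lambda>n. C1 (Suc i) * R * (1/2) ^ n"])
             (use t_le[of "Suc i"] i in \<open>auto intro!: summable_mult order_trans[OF abs_Re_le_cmod]\<close>)
        show "summable (\<lambda>n. Re (t i n 0))" using sm[of i 0] i by (intro summable_Re) simp
      qed auto
      moreover have "((\<lambda>x. Re (s i x)) has_real_derivative Re (s (Suc i) x)) (at x)"
        unfolding s_def by (intro Re_deriv deriv chi_test) simp
      ultimately have "((\<lambda>x. Re (s i x) + (\<Sum>n. Re (t i n x))) has_real_derivative Re (s (Suc i) x) + (\<Sum>n. Re (t (Suc i) n x))) (at x)"
        by (rule DERIV_add[rotated])
      moreover have "Re (G j x) = Re (s j x) + (\<Sum>n. Re (t j n x))" if "j \<le> 3" for j x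
        unfolding G_def using Re_suminf[OF sm[OF that]] by simp
      ultimately show ?thesis using i by simp
    qed
    have fN: "(\<lambda>N. conv (cfun f) (kern 0 (cfun chi) (2 ^ N)) x) \<longlonglongrightarrow> G 0 x" for x
    proof -
      have "(\<lambda>N. s 0 x + (\<Sum>n<N. t 0 n x)) \<longlonglongrightarrow> G 0 x"
        unfolding G_def by (intro tendsto_intros summable_LIMSEQ sm) simp
      then show ?thesis
        unfolding s_def t_def conv_kern_chi_sum[OF cf Bc] .
    qed
    have km: "kern 0 (cfun chi) l \<in> borel_measurable borel" if "0 < l" for l
      using kern_integrable[OF chi_test that] by auto
    have Gm [measurable]: "G 0 \<in> borel_measurable borel"
      by (rule borel_measurable_LIMSEQ_metric[OF _ fN]) (intro conv_measurable cf km, simp)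
    have "AE x in lborel. cfun f x - G 0 x = 0"
    proof (rule tempered_fun_eq_0[OF _ _ chi_test fourier_chi_neq_0])
      show "tempered_fun (\<lambda>x. cfun f x - G 0 x)"
      proof (rule tempered_fun_bounded[of _ "B + C * (B + R)"])
        show "cmod (cfun f x - G 0 x) \<le> B + C * (B + R)" for x
          using norm_triangle_ineq4[of "cfun f x" "G 0 x"] Bc[of x] G_le[of 0 x] by simp
      qed measurable
      fix \<theta> assume \<theta>: "\<theta> \<in> test_funs"
      obtain Rt where Rt: "0 < Rt" "\<And>\<xi>. \<bar>\<xi>\<bar> > Rt \<Longrightarrow> \<theta> \<xi> = 0"
        using test_funs_support[OF \<theta>] by blast
      let ?\<psi> = "fourier \<theta>"
      note \<psi>i = fourier_test_funs_integrable[OF \<theta>] and \<psi>s = fourier_test_funs_schwartz[OF \<theta>]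
      have [measurable]: "?\<psi> \<in> borel_measurable borel" by (rule schwartz_measurable[OF \<psi>s])
      \<comment> \<open>For such N the symbol \<open>chi (\<xi> / 2 ^ N)\<close> is 1 on the support
        of \<open>\<theta>\<close>, so the filtered function and f agree against the transform of
        \<open>\<theta>\<close>.\<close>
      have eqN: "(\<integral>x. conv (cfun f) (kern 0 (cfun chi) (2 ^ N)) x * ?\<psi> x \<partial>lborel) = (\<integral>x. cfun f x * ?\<psi> x \<partial>lborel)"
        if N: "Rt * 2 < 2 ^ N" for N
      proof -
        let ?c = "\<lambda>\<xi>. chi (\<xi> / 2 ^ N)"
        have c: "cfun ?c \<in> test_funs" using test_funs_scale[OF chi_test, of "2 ^ N"] by simp
        have k: "kern 0 (cfun chi) (2 ^ N) = inv_fourier (cfun ?c)" by (simp add: kern_def)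
        have "is_fun (mult_op ?c (rdistr f)) (conv (cfun f) (inv_fourier (cfun ?c)))"
          by (rule is_fun_mult_op[OF cf Bc c])
        then have "(\<integral>x. conv (cfun f) (kern 0 (cfun chi) (2 ^ N)) x * ?\<psi> x \<partial>lborel) = mult_op ?c (rdistr f) ?\<psi>"
          using \<psi>s by (simp add: is_fun_def distr_of_def k)
        also have "\<dots> = rdistr f (fourier (\<lambda>\<xi>. cfun ?c \<xi> * \<theta> \<xi>))"
          by (simp add: mult_op_apply inv_fourier_fourier[OF \<theta>])
        also have "(\<lambda>\<xi>. cfun ?c \<xi> * \<theta> \<xi>) = \<theta>"
        proof
          fix \<xi>
          show "cfun ?c \<xi> * \<theta> \<xi> = \<theta> \<xi>"
          proof (cases "\<bar>\<xi>\<bar> > Rt")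
            case False
            then have "\<bar>\<xi> / 2 ^ N\<bar> < 3 / 4"
              using N Rt(1) by (simp add: field_simps)
            then show ?thesis using chi_eq_1 by simp
          qed (use Rt in simp)
        qed
        finally show ?thesis by (simp add: distr_of_def)
      qed
      have lim: "(\<lambda>N. \<integral>x. conv (cfun f) (kern 0 (cfun chi) (2 ^ N)) x * ?\<psi> x \<partial>lborel) \<longlonglongrightarrow> (\<integral>x. G 0 x * ?\<psi> x \<partial>lborel)"
      proof (rule integral_dominated_convergence[where w="\<lambda>x. B * C2 0 * cmod (?\<psi> x)"])
        show "(\<lambda>x. conv (cfun f) (kern 0 (cfun chi) (2 ^ N)) x * ?\<psi> x) \<in> borel_measurable lborel" for N
          using conv_measurable[OF cf km, of "2 ^ N"] by simp
        show "integrable lborel (\<lambda>x. B * C2 0 * cmod (?\<psi> x))" by (intro integrable_mult_right integrable_norm \<psi>i)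
        show "AE x in lborel. (\<lambda>N. conv (cfun f) (kern 0 (cfun chi) (2 ^ N)) x * ?\<psi> x) \<longlonglongrightarrow> G 0 x * ?\<psi> x"
          by (intro AE_I2 tendsto_mult tendsto_const fN)
        have "cmod (conv (cfun f) (kern 0 (cfun chi) (2 ^ N)) x) \<le> B * C2 0" for N x
          using norm_conv_le[OF cf Bc kern_integrable[OF chi_test, of "2^N" 0]] integral_norm_kern[of "2^N" 0 "cfun chi"]
          by (simp add: C2_def)
        then show "AE x in lborel. norm (conv (cfun f) (kern 0 (cfun chi) (2 ^ N)) x * ?\<psi> x) \<le> B * C2 0 * cmod (?\<psi> x)" for N
          by (intro AE_I2) (simp add: norm_mult mult_right_mono)
      qed measurable
      obtain N0 :: nat where N0: "Rt * 2 < 2 ^ N0" using real_arch_pow[of 2 "Rt * 2"] by auto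
      have "(\<lambda>N. \<integral>x. conv (cfun f) (kern 0 (cfun chi) (2 ^ N)) x * ?\<psi> x \<partial>lborel) \<longlonglongrightarrow> (\<integral>x. cfun f x * ?\<psi> x \<partial>lborel)"
      proof (rule tendsto_eventually)
        show "\<forall>\<^sub>F N in sequentially. (\<integral>x. conv (cfun f) (kern 0 (cfun chi) (2 ^ N)) x * ?\<psi> x \<partial>lborel) = (\<integral>x. cfun f x * ?\<psi> x \<partial>lborel)"
          unfolding eventually_sequentially
        proof (intro exI[of _ N0] allI impI eqN)
          fix N assume "N0 \<le> N"
          then have "(2::real) ^ N0 \<le> 2 ^ N" by (intro power_increasing) auto
          with N0 show "Rt * 2 < 2 ^ N" by linarith
        qed
      qed
      with lim have eq: "(\<integral>x. G 0 x * ?\<psi> x \<partial>lborel) = (\<integral>x. cfun f x * ?\<psi> x \<partial>lborel)"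
        by (rule LIMSEQ_unique)
      have i1: "integrable lborel (\<lambda>x. cfun f x * ?\<psi> x)"
        using tempered_fun_bounded[OF cf Bc] \<psi>s by (simp add: tempered_fun_def)
      have i2: "integrable lborel (\<lambda>x. G 0 x * ?\<psi> x)"
        using tempered_fun_bounded[OF Gm G_le[of 0]] \<psi>s by (simp add: tempered_fun_def)
      show "(\<integral>x. (cfun f x - G 0 x) * ?\<psi> x \<partial>lborel) = 0"
        using Bochner_Integration.integral_diff[OF i1 i2] eq by (simp add: left_diff_distrib)
    qed
    then have "AE x in lborel. f x = Re (G 0 x)"
      by eventually_elim (simp add: complex_eq_iff)
    moreover have "\<bar>Re (G i x)\<bar> \<le> C * (B + R)" if "i \<le> 3" for i x
      by (rule order_trans[OF abs_Re_le_cmod G_le[OF that]])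
    ultimately show "\<exists>F::nat \<Rightarrow> real \<Rightarrow> real. (AE x in lborel. f x = F 0 x) \<and>
      (\<forall>i\<le>3. \<forall>x. \<bar>F i x\<bar> \<le> C * (B + R)) \<and> (\<forall>i<3. \<forall>x. (F i has_real_derivative F (Suc i) x) (at x))"
      using G_deriv by (intro exI[of _ "\<lambda>i x. Re (G i x)"]) auto
  qed
qed

end

section \<open>Upper bounds for homogeneous Besov norms\<close>

lemma nn_integral_geometric_int:
  fixes q :: real
  assumes q: "0 < q" "q < 1"
  shows "(\<integral>\<^sup>+j. ennreal (q ^ nat \<bar>j - k\<bar>) \<partial>count_space (UNIV :: int set)) \<le> ennreal (2 / (1 - q))"
proof -
  let ?f = "\<lambda>j::int. ennreal (q ^ nat \<bar>j\<bar>)"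
  have geo: "(\<integral>\<^sup>+n. ennreal (q ^ n) \<partial>count_space (UNIV :: nat set)) = ennreal (1 / (1 - q))"
    using q by (subst nn_integral_count_space_nat, subst suminf_ennreal2) (auto simp: suminf_geometric)
  have "(\<integral>\<^sup>+j. ennreal (q ^ nat \<bar>j - k\<bar>) \<partial>count_space UNIV) = (\<integral>\<^sup>+j. ?f j \<partial>count_space UNIV)"
    by (rule nn_integral_bij_count_space[of "\<lambda>j. j - k"]) (rule bij_betwI[of _ _ _ "\<lambda>j. j + k"], auto)
  also have "\<dots> = (\<integral>\<^sup>+j. ?f j * indicator {0..} j + ?f j * indicator {..<0} j \<partial>count_space UNIV)"
    by (intro nn_integral_cong) (auto simp: indicator_def)
  also have "\<dots> = (\<integral>\<^sup>+j. ?f j * indicator {0..} j \<partial>count_space UNIV) + (\<integral>\<^sup>+j. ?f j * indicator {..<0} j \<partial>count_space UNIV)"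
    by (rule nn_integral_add) auto
  also have "(\<integral>\<^sup>+j. ?f j * indicator {0..} j \<partial>count_space UNIV) = (\<integral>\<^sup>+j. ?f j \<partial>count_space {0..})"
    by (rule nn_integral_count_space_indicator[symmetric]) simp
  also have "(\<integral>\<^sup>+j. ?f j \<partial>count_space {0..}) = (\<integral>\<^sup>+n. ?f (int n) \<partial>count_space UNIV)"
    by (rule nn_integral_bij_count_space[symmetric]) (rule bij_betwI[of _ _ _ nat], auto)
  also have "\<dots> = ennreal (1 / (1 - q))" using geo by simp
  also have "(\<integral>\<^sup>+j. ?f j * indicator {..<0} j \<partial>count_space UNIV) = (\<integral>\<^sup>+j. ?f j \<partial>count_space {..<0})"
    by (rule nn_integral_count_space_indicator[symmetric]) simp
  also have "(\<integral>\<^sup>+j. ?f j \<partial>count_space {..<0}) = (\<integral>\<^sup>+n. ?f (- int n - 1) \<partial>count_space UNIV)"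
    by (rule nn_integral_bij_count_space[symmetric]) (rule bij_betwI[of _ _ _ "\<lambda>j. nat (- j - 1)"], auto)
  also have "\<dots> \<le> (\<integral>\<^sup>+n. ennreal (q ^ n) \<partial>count_space UNIV)"
    using q by (intro nn_integral_mono ennreal_leI power_decreasing) auto
  also have "\<dots> = ennreal (1 / (1 - q))" by (rule geo)
  also have "ennreal (1 / (1 - q)) + ennreal (1 / (1 - q)) = ennreal (2 / (1 - q))"
    using q by (simp flip: ennreal_plus)
  finally show ?thesis by (simp add: add_left_mono)
qed

section \<open>Trading derivatives for powers of the frequency\<close>

lemma has_vderiv_measurable:
  fixes f :: "real \<Rightarrow> 'a::real_normed_vector"
  assumes "\<And>x. (f has_vector_derivative f' x) (at x)"
  shows "f \<in> borel_measurable borel"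
  by (meson assms continuous_imp_measurable_borel has_vector_derivative_continuous continuous_at_imp_continuous_on)

text \<open>Symbol of an antiderivative. It is applied to symbols that vanish near 0, where the
  division is harmless and preserves smoothness.\<close>

definition ddiv :: "(real \<Rightarrow> complex) \<Rightarrow> real \<Rightarrow> complex" where
  "ddiv \<theta> \<xi> = \<theta> \<xi> / (\<i> * of_real \<xi>)"

definition vanishing_test_funs :: "(real \<Rightarrow> complex) set" where
  "vanishing_test_funs = {\<theta> \<in> test_funs. \<exists>c>0. \<forall>\<xi>. \<bar>\<xi>\<bar> < c \<longrightarrow> \<theta> \<xi> = 0}"

lemma ddiv_vanishing: "\<theta> \<in> vanishing_test_funs \<Longrightarrow> ddiv \<theta> \<in> vanishing_test_funs"
proof -
  assume "\<theta> \<in> vanishing_test_funs"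
  then obtain c where \<theta>: "\<theta> \<in> test_funs" and c: "0 < c" "\<And>\<xi>. \<bar>\<xi>\<bar> < c \<Longrightarrow> \<theta> \<xi> = 0"
    by (auto simp: vanishing_test_funs_def)
  have "smooth (\<lambda>\<xi>. \<theta> \<xi> / of_real \<xi>)"
    by (rule smooth_divide_away_from_zero[OF test_funs_smooth[OF \<theta>] c])
  then have "(\<lambda>\<xi>. \<theta> \<xi> / of_real \<xi>) \<in> test_funs"
    using \<theta> by (auto simp: test_funs_def)
  moreover have "(\<lambda>\<xi>. - \<i> * (\<theta> \<xi> / of_real \<xi>)) = ddiv \<theta>"
  proof
    show "- \<i> * (\<theta> \<xi> / of_real \<xi>) = ddiv \<theta> \<xi>" for \<xi>
      by (cases "\<xi> = 0") (auto simp: ddiv_def field_simps)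
  qed
  ultimately have "ddiv \<theta> \<in> test_funs"
    using test_funs_cmult[of "\<lambda>\<xi>. \<theta> \<xi> / of_real \<xi>" "- \<i>"] by (simp only:)
  then show ?thesis
    using c by (auto simp: vanishing_test_funs_def ddiv_def intro!: exI[of _ c])
qed

lemma vanishing_test_funs_D: "\<theta> \<in> vanishing_test_funs \<Longrightarrow> \<theta> \<in> test_funs" "\<theta> \<in> vanishing_test_funs \<Longrightarrow> \<theta> 0 = 0"
  by (auto simp: vanishing_test_funs_def)

lemma conv_cmult: "conv f (\<lambda>x. c * k x) x = c * conv f k x"
proof -
  have "(\<integral>y. f y * (c * k (x - y)) \<partial>lborel) = (\<integral>y. c * (f y * k (x - y)) \<partial>lborel)"
    by (intro Bochner_Integration.integral_cong refl) (simp add: mult_ac)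
  then show ?thesis by (simp add: conv_def)
qed

text \<open>Dividing and multiplying the symbol by \<open>\<i> * \<xi>\<close> puts one derivative
  on f; at scale l the division leaves the factor 1 / l.\<close>

lemma conv_kern_ddiv:
  assumes \<theta>: "\<theta> \<in> vanishing_test_funs" and l: "0 < l"
    and f: "\<And>x. (f has_vector_derivative f' x) (at x)" "\<And>x. cmod (f x) \<le> B" "\<And>x. cmod (f' x) \<le> B'"
    and f': "f' \<in> borel_measurable borel"
  shows "conv f (kern 0 \<theta> l) x = of_real (1 / l) * conv f' (kern 0 (ddiv \<theta>) l) x"
proof -
  let ?\<eta> = "\<lambda>\<xi>. of_real (1 / l) * ddiv \<theta> (\<xi> / l)"
  have \<eta>: "?\<eta> \<in> test_funs"
    by (intro test_funs_cmult test_funs_scale vanishing_test_funs_D(1) ddiv_vanishing \<theta> l)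
  have "(\<lambda>\<xi>. \<theta> (\<xi> / l)) = (\<lambda>\<xi>. (\<i> * of_real \<xi>) * ?\<eta> \<xi>)"
    using l vanishing_test_funs_D(2)[OF \<theta>] by (auto simp: fun_eq_iff ddiv_def)
  then have "conv f (kern 0 \<theta> l) x = conv f' (inv_fourier ?\<eta>) x"
    using conv_derivative[OF f f' \<eta>, of x] by (simp add: kern_def)
  also have "inv_fourier ?\<eta> = (\<lambda>x. of_real (1 / l) * kern 0 (ddiv \<theta>) l x)"
    by (rule ext) (simp only: inv_fourier_cmult kern_def power_0 mult_1)
  finally show ?thesis by (simp only: conv_cmult)
qed

lemma conv_kern_ddiv_iterate:
  assumes "\<theta> \<in> vanishing_test_funs" and l: "0 < l"
    and F: "\<And>n x. (F n has_vector_derivative F (Suc n) x) (at x)" "\<And>n. n \<le> m \<Longrightarrow> \<exists>B. \<forall>x. cmod (F n x) \<le> B"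
  shows "conv (F 0) (kern 0 \<theta> l) x = of_real ((1 / l) ^ m) * conv (F m) (kern 0 ((ddiv ^^ m) \<theta>) l) x"
  using assms(1) F
proof (induction m arbitrary: \<theta> F)
  case (Suc m)
  obtain B B' where B: "\<And>x. cmod (F 0 x) \<le> B" "\<And>x. cmod (F 1 x) \<le> B'"
    using Suc.prems(3)[of 0] Suc.prems(3)[of 1] by auto
  have "F 1 \<in> borel_measurable borel"
    by (meson Suc.prems(2) continuous_imp_measurable_borel has_vector_derivative_continuous continuous_at_imp_continuous_on)
  then have "conv (F 0) (kern 0 \<theta> l) x = of_real (1 / l) * conv (F 1) (kern 0 (ddiv \<theta>) l) x"
    using Suc.prems(2)[of 0] by (intro conv_kern_ddiv[OF Suc.prems(1) l _ B]) auto
  also have "conv (F 1) (kern 0 (ddiv \<theta>) l) x =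
      of_real ((1 / l) ^ m) * conv (F (Suc m)) (kern 0 ((ddiv ^^ m) (ddiv \<theta>)) l) x"
    using Suc.IH[of "ddiv \<theta>" "\<lambda>n. F (Suc n)"] Suc.prems ddiv_vanishing by auto
  finally show ?case by (simp add: funpow_swap1)
qed simp

lemma norm_conv_kern_0_le:
  assumes [measurable]: "f \<in> borel_measurable borel" and "\<And>x. cmod (f x) \<le> A" and "\<theta> \<in> test_funs" "0 < l"
  shows "cmod (conv f (kern 0 \<theta> l) x) \<le> A * (\<integral>y. cmod (kern 0 \<theta> 1 y) \<partial>lborel)"
  using norm_conv_le[OF assms(1,2) kern_integrable[OF assms(3,4), of 0], of x] integral_norm_kern[OF assms(4), of 0 \<theta>] by simp

lemma nn_integral_conv_kern_0_le:
  assumes [measurable]: "f \<in> borel_measurable borel" and f: "(\<integral>\<^sup>+x. ennreal (cmod (f x)) \<partial>lborel) \<le> ennreal A"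
    and \<theta>: "\<theta> \<in> test_funs" and l: "0 < l" and A: "0 \<le> A"
  shows "(\<integral>\<^sup>+x. ennreal (cmod (conv f (kern 0 \<theta> l) x)) \<partial>lborel) \<le> ennreal (A * (\<integral>y. cmod (kern 0 \<theta> 1 y) \<partial>lborel))"
proof -
  note i = kern_integrable[OF \<theta> l, of 0]
  have "(\<integral>\<^sup>+x. ennreal (cmod (kern 0 \<theta> l x)) \<partial>lborel) = ennreal (\<integral>y. cmod (kern 0 \<theta> 1 y) \<partial>lborel)"
    using i integral_norm_kern[OF l, of 0 \<theta>] by (subst nn_integral_eq_integral) auto
  moreover have "kern 0 \<theta> l \<in> borel_measurable borel" using i by auto
  ultimately show ?thesis
    using nn_integral_conv_le[OF assms(1), of "kern 0 \<theta> l"] mult_right_mono[OF f, of "ennreal (\<integral>y. cmod (kern 0 \<theta> 1 y) \<partial>lborel)"] A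
    by (simp add: ennreal_mult' integral_nonneg)
qed

lemma nn_integral_inverse_1_plus_sq_le:
  assumes "\<And>x. cmod (f x) \<le> A / (1 + (x::real)\<^sup>2)" "0 \<le> A"
  shows "(\<integral>\<^sup>+x. ennreal (cmod (f x)) \<partial>lborel) \<le> ennreal (A * (\<integral>x. 1 / (1 + x\<^sup>2) \<partial>lborel))"
proof -
  have "(\<integral>\<^sup>+x. ennreal (cmod (f x)) \<partial>lborel) \<le> (\<integral>\<^sup>+x. ennreal (A * (1 / (1 + x\<^sup>2))) \<partial>lborel)"
    using assms(1) by (intro nn_integral_mono ennreal_leI) simp
  also have "\<dots> = ennreal (\<integral>x. A * (1 / (1 + x\<^sup>2)) \<partial>lborel)"
    by (intro nn_integral_eq_integral integrable_mult_right integrable_inverse_1_plus_sq)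
       (use assms(2) in \<open>auto intro!: AE_I2 divide_nonneg_nonneg add_nonneg_nonneg\<close>)
  finally show ?thesis by (simp del: times_divide_eq_right)
qed

text \<open>The summand 1 makes \<open>I0 \<ge> 1\<close>, so that
  \<open>I0 powr (1 / p) \<le> I0\<close> for every p and the constants do not depend on p.\<close>

definition I0 :: real where "I0 = 1 + (\<integral>x. 1 / (1 + x\<^sup>2) \<partial>lborel)"

lemma I0_ge_1: "1 \<le> I0"
  by (auto simp: I0_def intro!: integral_nonneg divide_nonneg_nonneg add_nonneg_nonneg)

lemma decay_le:
  assumes "y \<le> A / (1 + (x::real)\<^sup>2)" "0 \<le> A" shows "y \<le> A"
proof -
  have "A / (1 + x\<^sup>2) \<le> A / 1" using assms(2) by (intro divide_left_mono) (auto simp: add_pos_nonneg)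
  with assms show ?thesis by simp
qed

context LP
begin

lemma phi_vanishing: "cfun \<phi> \<in> vanishing_test_funs"
  using phi_test phi_eq_0 by (auto simp: vanishing_test_funs_def intro!: exI[of _ "3/4"])

lemma ddiv_phi_vanishing: "(ddiv ^^ m) (cfun \<phi>) \<in> vanishing_test_funs"
  by (induction m) (use phi_vanishing ddiv_vanishing in auto)

lemma Lp_hblock_le:
  assumes f: "f \<in> borel_measurable borel" "\<And>x. cmod (f x) \<le> B" and p: "1 \<le> p"
    and A: "\<And>x. cmod (conv f (kern 0 (cfun \<phi>) (2 powi j)) x) \<le> A"
      "(\<integral>\<^sup>+x. ennreal (cmod (conv f (kern 0 (cfun \<phi>) (2 powi j)) x)) \<partial>lborel) \<le> ennreal (A * S)" and S: "0 < S"
  shows "Lp_distr p (hblock \<phi> j (distr_of f)) \<le> ennreal (A * S powr enn2real (1 / p))"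
proof -
  have t: "cfun (\<lambda>\<xi>. \<phi> (\<xi> / 2 powi j)) \<in> test_funs"
    using test_funs_scale[OF phi_test, of "2 powi j"] by simp
  have k: "inv_fourier (cfun (\<lambda>\<xi>. \<phi> (\<xi> / 2 powi j))) = kern 0 (cfun \<phi>) (2 powi j)"
    by (simp add: kern_def)
  have "kern 0 (cfun \<phi>) (2 powi j) \<in> borel_measurable borel"
    using kern_integrable[OF phi_test, of "2 powi j" 0] by auto
  then have [measurable]: "conv f (kern 0 (cfun \<phi>) (2 powi j)) \<in> borel_measurable borel"
    by (intro conv_measurable f)
  have "0 \<le> A" by (rule order_trans[OF norm_ge_zero A(1)])
  have "is_fun (hblock \<phi> j (distr_of f)) (conv f (kern 0 (cfun \<phi>) (2 powi j)))"
    unfolding hblock_eq using is_fun_mult_op[OF f t] k by simp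
  from Lp_distr_le[OF this, of p]
  show ?thesis
    by (rule order_trans) (intro lp_norm_interpolation p ennreal_leI A S \<open>0 \<le> A\<close>, measurable)
qed

text \<open>The bound for block j after m integrations by parts, in the sup norm and in L1 with one
  constant. Naming it fixes the order of quantifiers: \<open>\<kappa>\<close> depends on m, but not
  on the function, its size or j.\<close>

definition gain :: "nat \<Rightarrow> real \<Rightarrow> bool" where
  "gain m \<kappa> \<longleftrightarrow> 0 \<le> \<kappa> \<and> (\<forall>(F :: nat \<Rightarrow> real \<Rightarrow> complex) (A :: real) S j.
     (\<forall>n x. (F n has_vector_derivative F (Suc n) x) (at x)) \<longrightarrow> (\<forall>n\<le>m. \<exists>B. \<forall>x. cmod (F n x) \<le> B) \<longrightarrow>
     (\<forall>x. cmod (F m x) \<le> A) \<longrightarrow> (\<integral>\<^sup>+x. ennreal (cmod (F m x)) \<partial>lborel) \<le> ennreal (A * S) \<longrightarrow> 0 \<le> S \<longrightarrow>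
     (\<forall>x. cmod (conv (F 0) (kern 0 (cfun \<phi>) (2 powi j)) x) \<le> \<kappa> * A * 2 powr (- (of_int j * real m))) \<and>
     (\<integral>\<^sup>+x. ennreal (cmod (conv (F 0) (kern 0 (cfun \<phi>) (2 powi j)) x)) \<partial>lborel) \<le> ennreal (\<kappa> * A * 2 powr (- (of_int j * real m)) * S))"

lemma gainD:
  assumes "gain m \<kappa>" "\<And>n x. (F n has_vector_derivative F (Suc n) x) (at x)" "\<And>n. n \<le> m \<Longrightarrow> \<exists>B. \<forall>x. cmod (F n x) \<le> B"
    "\<And>x. cmod (F m x) \<le> A" "(\<integral>\<^sup>+x. ennreal (cmod (F m x)) \<partial>lborel) \<le> ennreal (A * S)" "0 \<le> S"
  shows "cmod (conv (F 0) (kern 0 (cfun \<phi>) (2 powi j)) x) \<le> \<kappa> * A * 2 powr (- (of_int j * real m))"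
    "(\<integral>\<^sup>+x. ennreal (cmod (conv (F 0) (kern 0 (cfun \<phi>) (2 powi j)) x)) \<partial>lborel) \<le> ennreal (\<kappa> * A * 2 powr (- (of_int j * real m)) * S)"
  using assms unfolding gain_def by metis+

text \<open>The constant is the L1 norm of the unit kernel whose symbol is \<open>\<phi>\<close>
  divided m times by \<open>\<i> * \<xi>\<close>.\<close>

lemma gain_ex: "\<exists>\<kappa>. gain m \<kappa>"
proof -
  let ?\<theta> = "(ddiv ^^ m) (cfun \<phi>)"
  have \<theta>: "?\<theta> \<in> test_funs" by (intro vanishing_test_funs_D ddiv_phi_vanishing)
  define \<kappa> where "\<kappa> = (\<integral>y. cmod (kern 0 ?\<theta> 1 y) \<partial>lborel)"
  have "gain m \<kappa>"
    unfolding gain_def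
  proof (intro conjI[of "0 \<le> \<kappa>"] allI impI)
    show "0 \<le> \<kappa>" by (simp add: \<kappa>_def integral_nonneg)
    fix F :: "nat \<Rightarrow> real \<Rightarrow> complex" and A S :: real and j :: int
    assume "\<forall>n x. (F n has_vector_derivative F (Suc n) x) (at x)" "\<forall>n\<le>m. \<exists>B. \<forall>x. cmod (F n x) \<le> B"
     "\<forall>x. cmod (F m x) \<le> A" and A2: "(\<integral>\<^sup>+x. ennreal (cmod (F m x)) \<partial>lborel) \<le> ennreal (A * S)" and S: "0 \<le> S"
    then have F: "\<And>n x. (F n has_vector_derivative F (Suc n) x) (at x)" "\<And>n. n \<le> m \<Longrightarrow> \<exists>B. \<forall>x. cmod (F n x) \<le> B"
      and A1: "\<And>x. cmod (F m x) \<le> A" by blast+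
    note A = A1 A2
    have l: "(0::real) < 2 powi j" by simp
    have "0 \<le> A" by (rule order_trans[OF norm_ge_zero A(1)])
    have Fm: "F m \<in> borel_measurable borel"
      by (meson F(1) continuous_imp_measurable_borel has_vector_derivative_continuous continuous_at_imp_continuous_on)
    have pw: "(1 / 2 powi j) ^ m = 2 powr (- (real_of_int j * real m))"
      by (simp add: powr_minus powr_powr[symmetric] powr_realpow powr_real_of_int' divide_inverse power_inverse del: powr_powr)
    have eq: "conv (F 0) (kern 0 (cfun \<phi>) (2 powi j)) x = of_real (2 powr (- (real_of_int j * real m))) * conv (F m) (kern 0 ?\<theta> (2 powi j)) x" for x
      unfolding pw[symmetric] by (rule conv_kern_ddiv_iterate[of "cfun \<phi>" "2 powi j" F m, OF phi_vanishing l F])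
    have 1: "cmod (conv (F 0) (kern 0 (cfun \<phi>) (2 powi j)) x) \<le> \<kappa> * A * 2 powr (- (of_int j * real m))" for x
    proof -
      have "cmod (conv (F m) (kern 0 ?\<theta> (2 powi j)) x) \<le> A * \<kappa>"
        unfolding \<kappa>_def by (rule norm_conv_kern_0_le[OF Fm A(1) \<theta> l])
      then have "2 powr (- (real_of_int j * real m)) * cmod (conv (F m) (kern 0 ?\<theta> (2 powi j)) x) \<le> 2 powr (- (real_of_int j * real m)) * (A * \<kappa>)"
        by (rule mult_left_mono) simp
      then show ?thesis by (simp add: eq norm_mult mult_ac)
    qed
    have [measurable]: "conv (F m) (kern 0 ?\<theta> (2 powi j)) \<in> borel_measurable borel"
      using kern_integrable[OF \<theta> l, of 0] by (intro conv_measurable Fm) auto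
    have "(\<integral>\<^sup>+x. ennreal (cmod (conv (F 0) (kern 0 (cfun \<phi>) (2 powi j)) x)) \<partial>lborel)
      = ennreal (2 powr (- (of_int j * real m))) * (\<integral>\<^sup>+x. ennreal (cmod (conv (F m) (kern 0 ?\<theta> (2 powi j)) x)) \<partial>lborel)"
      by (subst nn_integral_cmult[symmetric]) (auto simp: eq norm_mult ennreal_mult)
    also have "\<dots> \<le> ennreal (2 powr (- (of_int j * real m))) * ennreal (A * S * \<kappa>)"
      unfolding \<kappa>_def using \<open>0 \<le> A\<close> S by (intro mult_left_mono nn_integral_conv_kern_0_le[OF Fm A(2) \<theta> l]) auto
    also have "\<dots> = ennreal (\<kappa> * A * 2 powr (- (of_int j * real m)) * S)"
      by (subst ennreal_mult'[symmetric]) (auto simp: mult_ac)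
    finally have 2: "(\<integral>\<^sup>+x. ennreal (cmod (conv (F 0) (kern 0 (cfun \<phi>) (2 powi j)) x)) \<partial>lborel) \<le> ennreal (\<kappa> * A * 2 powr (- (of_int j * real m)) * S)" .
    show "(\<forall>x. cmod (conv (F 0) (kern 0 (cfun \<phi>) (2 powi j)) x) \<le> \<kappa> * A * 2 powr (- (of_int j * real m))) \<and>
     (\<integral>\<^sup>+x. ennreal (cmod (conv (F 0) (kern 0 (cfun \<phi>) (2 powi j)) x)) \<partial>lborel) \<le> ennreal (\<kappa> * A * 2 powr (- (of_int j * real m)) * S)"
      using 1 2 by blast
  qed
  then show ?thesis ..
qed

text \<open>Block j is estimated with one derivative for j < 0 and with m derivatives for
  \<open>j \<ge> 0\<close>. As \<open>1 < \<sigma> < m\<close>, the weighted blocks decay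
  geometrically in both directions. The function \<open>F 0\<close> may be merely bounded, as the
  solution is; decay enters through its derivatives of order 1 and m.\<close>

theorem hBesov_norm_le:
  assumes \<sigma>: "1 < \<sigma>" "\<sigma> < real m"
  obtains C where "0 < C" "\<And>p r F A. \<lbrakk>1 \<le> p; 1 \<le> r; \<And>n x. (F n has_real_derivative F (Suc n) x) (at x);
     \<And>n. n \<le> m \<Longrightarrow> \<exists>B. \<forall>x. \<bar>F n x\<bar> \<le> B; \<And>x. \<bar>F 1 x\<bar> \<le> A / (1 + x\<^sup>2); \<And>x. \<bar>F m x\<bar> \<le> A / (1 + x\<^sup>2); 0 \<le> A\<rbrakk> \<Longrightarrow>
     hBesov_norm \<phi> \<sigma> p r (rdistr (F 0)) \<le> ennreal (C * A)"
proof -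
  obtain \<kappa>1 \<kappa>m where \<kappa>1: "gain 1 \<kappa>1" and \<kappa>m: "gain m \<kappa>m" using gain_ex by blast
  then have \<kappa>_nonneg: "0 \<le> \<kappa>1" "0 \<le> \<kappa>m" by (simp_all add: gain_def)
  \<comment> \<open>The smaller of the two rates of decay, \<open>\<sigma> - 1\<close> towards low
    and \<open>m - \<sigma>\<close> towards high frequencies.\<close>
  define c where "c = min (\<sigma> - 1) (m - \<sigma>)"
  define q where "q = 2 powr (- c)"
  have c0: "0 < c" using \<sigma> by (simp add: c_def)
  have q: "0 < q" "q < 1" using c0 by (auto simp: q_def powr_less_one)
  define \<kappa> where "\<kappa> = \<kappa>1 + \<kappa>m + 1"
  have \<kappa>: "\<kappa>1 \<le> \<kappa>" "\<kappa>m \<le> \<kappa>" "0 < \<kappa>" using \<kappa>_nonneg by (auto simp: \<kappa>_def)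
  define Z where "Z = 2 / (1 - q)"
  have Z: "1 \<le> Z" using q by (simp add: Z_def field_simps)
  have m1: "1 \<le> m" using \<sigma> by simp
  show thesis
  proof (rule that[of "\<kappa> * I0 * Z"])
    show "0 < \<kappa> * I0 * Z" using \<kappa> Z I0_ge_1 by simp
    fix p r :: ennreal and F A
    assume p: "1 \<le> p" and r: "1 \<le> r" and F: "\<And>n x. (F n has_real_derivative F (Suc n) x) (at x)"
     "\<And>n. n \<le> m \<Longrightarrow> \<exists>B. \<forall>x. \<bar>F n x\<bar> \<le> B" "\<And>x. \<bar>F 1 x\<bar> \<le> A / (1 + x\<^sup>2)" "\<And>x. \<bar>F m x\<bar> \<le> A / (1 + x\<^sup>2)" and A: "0 \<le> A"
    let ?F = "\<lambda>n. cfun (F n)"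
    have F': "(?F n has_vector_derivative ?F (Suc n) x) (at x)" for n x
      by (intro has_vector_derivative_of_real F)
    have Fb: "\<exists>B. \<forall>x. cmod (?F n x) \<le> B" if "n \<le> m" for n using F(2)[OF that] by simp
    obtain B where B: "\<And>x. cmod (?F 0 x) \<le> B" using Fb[of 0] by auto
    have meas: "?F 0 \<in> borel_measurable borel"
      by (rule has_vderiv_measurable[OF F'])
    have A1: "\<bar>F 1 x\<bar> \<le> A" "\<bar>F m x\<bar> \<le> A" for x using decay_le[OF F(3) A] decay_le[OF F(4) A] by auto
    have nn: "(\<integral>\<^sup>+x. ennreal (cmod (?F n x)) \<partial>lborel) \<le> ennreal (A * I0)" if "n = 1 \<or> n = m" for n
    proof -
      have "(\<integral>\<^sup>+x. ennreal (cmod (?F n x)) \<partial>lborel) \<le> ennreal (A * (\<integral>x. 1 / (1 + x\<^sup>2) \<partial>lborel))"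
        by (rule nn_integral_inverse_1_plus_sq_le[OF _ A]) (use F(3,4) that in auto)
      also have "\<dots> \<le> ennreal (A * I0)"
        using A by (intro ennreal_leI mult_left_mono) (auto simp: I0_def)
      finally show ?thesis .
    qed
    have S: "0 \<le> I0" "0 < I0" using I0_ge_1 by auto
    have Ip: "I0 powr enn2real (1 / p) \<le> I0"
      using powr_mono[OF enn2real_recip(2)[OF p] I0_ge_1] S by simp
    have L: "Lp_distr p (hblock \<phi> j (distr_of (?F 0))) \<le> ennreal (\<kappa> * A * 2 powr (- (of_int j * real n)) * I0)"
      if n: "n = 1 \<or> n = m" for j n
    proof -
      obtain k where k: "0 \<le> k" "k \<le> \<kappa>" "gain n k"
        using n \<kappa>1 \<kappa>m \<kappa> \<kappa>_nonneg by blast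
      have n': "\<exists>B. \<forall>x. cmod (?F i x) \<le> B" if "i \<le> n" for i
        by (rule Fb) (use that n m1 in auto)
      have An: "cmod (?F n x) \<le> A" for x using n A1 by auto
      note g = gainD[of n k ?F A I0 j, OF k(3) F' n' An nn[OF n] S(1)]
      have "Lp_distr p (hblock \<phi> j (distr_of (?F 0))) \<le> ennreal (k * A * 2 powr (- (of_int j * real n)) * I0 powr enn2real (1 / p))"
        by (rule Lp_hblock_le[OF meas B p g S(2)])
      also have "\<dots> \<le> ennreal (\<kappa> * A * 2 powr (- (of_int j * real n)) * I0)"
        using k A Ip S by (intro ennreal_leI mult_mono) auto
      finally show ?thesis .
    qed
    let ?b = "\<lambda>j::int. ennreal (2 powr (of_int j * \<sigma>)) * Lp_distr p (hblock \<phi> j (distr_of (?F 0)))"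
    have b: "?b j \<le> ennreal (\<kappa> * A * I0 * q ^ nat \<bar>j\<bar>)" for j
    proof -
      define n where "n = (if j < 0 then 1 else m)"
      have "?b j \<le> ennreal (2 powr (of_int j * \<sigma>)) * ennreal (\<kappa> * A * 2 powr (- (of_int j * real n)) * I0)"
        by (intro mult_left_mono L) (auto simp: n_def)
      also have "\<dots> = ennreal (\<kappa> * A * I0 * 2 powr (of_int j * (\<sigma> - real n)))"
        using \<kappa>(3) A S by (simp add: algebra_simps powr_diff powr_minus divide_inverse flip: ennreal_mult)
      also have "\<dots> \<le> ennreal (\<kappa> * A * I0 * q ^ nat \<bar>j\<bar>)"
      proof (intro ennreal_leI mult_left_mono)
        have "q ^ nat \<bar>j\<bar> = 2 powr (- c * real (nat \<bar>j\<bar>))"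
          using q by (simp add: q_def powr_powr flip: powr_realpow)
        moreover have "of_int j * (\<sigma> - real n) \<le> - c * real (nat \<bar>j\<bar>)"
        proof (cases "j < 0")
          case True
          then have "of_int (- j) * c \<le> of_int (- j) * (\<sigma> - 1)"
            by (intro mult_left_mono) (auto simp: c_def)
          then show ?thesis using True by (simp add: n_def mult.commute)
        next
          case False
          then have "of_int j * c \<le> of_int j * (m - \<sigma>)"
            by (intro mult_left_mono) (auto simp: c_def)
          then show ?thesis using False by (simp add: n_def algebra_simps)
        qed
        ultimately show "2 powr (of_int j * (\<sigma> - real n)) \<le> q ^ nat \<bar>j\<bar>"
          by simp
      qed (use \<kappa>(3) A S in auto)
      finally show ?thesis .
    qed
    have K0: "0 \<le> \<kappa> * A * I0" using \<kappa>(3) A S by simp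
    have "hBesov_norm \<phi> \<sigma> p r (rdistr (F 0)) \<le> ennreal (\<kappa> * A * I0 * Z powr enn2real (1 / r))"
      unfolding hBesov_norm_def
    proof (rule lp_norm_interpolation[OF r])
      show "?b j \<le> ennreal (\<kappa> * A * I0)" for j
      proof (rule order_trans[OF b ennreal_leI])
        show "\<kappa> * A * I0 * q ^ nat \<bar>j\<bar> \<le> \<kappa> * A * I0"
          using K0 q by (intro mult_left_le) (auto intro: power_le_one)
      qed
      have "(\<integral>\<^sup>+j. ?b j \<partial>count_space UNIV) \<le> (\<integral>\<^sup>+j. ennreal (\<kappa> * A * I0) * ennreal (q ^ nat \<bar>j - 0\<bar>) \<partial>count_space UNIV)"
        using K0 q by (intro nn_integral_mono order_trans[OF b]) (simp add: ennreal_mult)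
      also have "\<dots> = ennreal (\<kappa> * A * I0) * (\<integral>\<^sup>+j. ennreal (q ^ nat \<bar>j - 0\<bar>) \<partial>count_space UNIV)"
        by (rule nn_integral_cmult) simp
      also have "\<dots> \<le> ennreal (\<kappa> * A * I0) * ennreal Z"
        unfolding Z_def by (intro mult_left_mono nn_integral_geometric_int q) simp
      finally show "(\<integral>\<^sup>+j. ?b j \<partial>count_space UNIV) \<le> ennreal (\<kappa> * A * I0 * Z)"
        using K0 Z by (simp flip: ennreal_mult)
    qed (use K0 Z in auto)
    also have "\<dots> \<le> ennreal (\<kappa> * I0 * Z * A)"
    proof (rule ennreal_leI)
      have "Z powr enn2real (1 / r) \<le> Z"
        using powr_mono[OF enn2real_recip(2)[OF r] Z] Z by simp
      from mult_left_mono[OF this K0] show "\<kappa> * A * I0 * Z powr enn2real (1 / r) \<le> \<kappa> * I0 * Z * A"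
        by (simp add: mult_ac)
    qed
    finally show "hBesov_norm \<phi> \<sigma> p r (rdistr (F 0)) \<le> ennreal (\<kappa> * I0 * Z * A)" .
  qed
qed

end

section \<open>Lacunary sums with small critical norm\<close>

text \<open>\<open>H 1\<close> plays the role of a wave packet; the sum has derivative \<open>N * a * H 2 0\<close> at 0, whereas its
  critical norm is only \<open>a * N powr (1 / r)\<close> because each block sees boundedly many terms.\<close>

definition lacunary :: "(nat \<Rightarrow> real \<Rightarrow> real) \<Rightarrow> nat \<Rightarrow> real \<Rightarrow> nat \<Rightarrow> real \<Rightarrow> real" where
  "lacunary H N a n x = (\<Sum>k=1..N. a / 2 ^ k * (2 ^ k) ^ n * H (Suc n) (2 ^ k * x))"

lemma has_real_derivative_scale:
  assumes "\<And>x. (f has_real_derivative f' x) (at x)"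
  shows "((\<lambda>x. f (c * x)) has_real_derivative c * f' (c * x)) (at x)"
proof -
  have "((\<lambda>x. c * x) has_real_derivative c) (at x)" by (auto intro!: derivative_eq_intros)
  from DERIV_chain2[where f=f and g="\<lambda>x. c * x" and x=x, OF assms[of "c * x"] this]
  show ?thesis by (simp add: mult.commute)
qed

lemma lacunary_deriv:
  assumes H: "\<And>n x. (H n has_real_derivative H (Suc n) x) (at x)"
  shows "(lacunary H N a n has_real_derivative lacunary H N a (Suc n) x) (at x)"
proof -
  have "((\<lambda>x. \<Sum>k=1..N. a / 2 ^ k * (2 ^ k) ^ n * H (Suc n) (2 ^ k * x)) has_real_derivative
     (\<Sum>k=1..N. a / 2 ^ k * (2 ^ k) ^ n * (2 ^ k * H (Suc (Suc n)) (2 ^ k * x)))) (at x)"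
    by (intro DERIV_sum DERIV_cmult has_real_derivative_scale H)
  then show ?thesis
    by (simp add: lacunary_def[abs_def] mult_ac)
qed

text \<open>The block estimate \<open>min (2 powr d) (2 powr (- 3 * d))\<close> has room to spare on
  both sides: for \<open>d \<ge> 0\<close> the exponent becomes (t - 3) d, for d < 0 it becomes (t +
  1) d, and both are at most \<open>- \<bar>d\<bar>\<close> when t lies in [0, 2].\<close>

lemma powr_min_le:
  fixes d t :: real
  assumes "0 \<le> t" "t \<le> 2"
  shows "2 powr (t * d) * min (2 powr d) (2 powr (- 3 * d)) \<le> 2 powr (- \<bar>d\<bar>)"
proof (cases "0 \<le> d")
  case True
  have "2 powr (t * d) * min (2 powr d) (2 powr (- 3 * d)) \<le> 2 powr (t * d) * 2 powr (- 3 * d)"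
    by (intro mult_left_mono) auto
  also have "\<dots> = 2 powr ((t - 3) * d)"
    by (simp add: left_diff_distrib flip: powr_add)
  also have "\<dots> \<le> 2 powr (- \<bar>d\<bar>)"
    using True assms mult_right_mono[of "t - 3" "-1" d] by (intro powr_mono) auto
  finally show ?thesis .
next
  case False
  have "2 powr (t * d) * min (2 powr d) (2 powr (- 3 * d)) \<le> 2 powr (t * d) * 2 powr d"
    by (intro mult_left_mono) auto
  also have "\<dots> = 2 powr ((t + 1) * d)"
    by (simp add: distrib_right flip: powr_add)
  also have "\<dots> \<le> 2 powr (- \<bar>d\<bar>)"
    using False assms mult_right_mono_neg[of 1 "t + 1" d] by (intro powr_mono) auto
  finally show ?thesis .
qed

context LP
begin

text \<open>The k-th packet lives near frequency \<open>2 ^ k\<close>. For blocks above it, three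
  derivatives of \<open>H 1\<close> give the factor \<open>2 powr (- 3 * (j - k))\<close>; for
  blocks below it, \<open>H 1\<close> is itself the derivative of \<open>H 0\<close>, which gives
  \<open>2 powr (j - k)\<close>. The L1 bounds carry the extra factor \<open>2 powr (- k)\<close>,
  the width of the packet.\<close>

lemma block_bounds:
  assumes H: "\<And>n x. (H n has_real_derivative H (Suc n) x) (at x)" "\<And>n x. n \<le> 4 \<Longrightarrow> \<bar>H n x\<bar> \<le> M / (1 + x\<^sup>2)"
    and M: "0 \<le> M"
  obtains C where "0 \<le> C" "\<And>(k::nat) j x. cmod (conv (\<lambda>x. of_real (H 1 (2 ^ k * x))) (kern 0 (cfun \<phi>) (2 powi j)) x)
      \<le> C * min (2 powr (of_int j - real k)) (2 powr (- 3 * (of_int j - real k)))"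
    "\<And>(k::nat) j. (\<integral>\<^sup>+x. ennreal (cmod (conv (\<lambda>x. of_real (H 1 (2 ^ k * x))) (kern 0 (cfun \<phi>) (2 powi j)) x)) \<partial>lborel)
      \<le> ennreal (C * min (2 powr (of_int j - real k)) (2 powr (- 3 * (of_int j - real k))) * 2 powr (- real k))"
proof -
  obtain \<kappa>3 where \<kappa>3: "gain 3 \<kappa>3" using gain_ex by blast
  have \<kappa>3n: "0 \<le> \<kappa>3" using \<kappa>3 by (simp add: gain_def)
  \<comment> \<open>Chosen so that \<open>ddiv ?\<theta>\<close> is \<open>\<phi>\<close>: reading
    \<open>conv_kern_ddiv\<close> backwards moves the derivative in \<open>H 1\<close> onto the
    kernel.\<close>
  let ?\<theta> = "\<lambda>\<xi>. (\<i> * of_real \<xi>) ^ 1 * cfun \<phi> \<xi>"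
  have \<theta>v: "?\<theta> \<in> vanishing_test_funs"
    using test_funs_power[OF phi_test, of \<i> 1] phi_eq_0 by (auto simp: vanishing_test_funs_def intro!: exI[of _ "3/4"])
  then have \<theta>: "?\<theta> \<in> test_funs" by (rule vanishing_test_funs_D)
  have dd: "ddiv ?\<theta> = cfun \<phi>"
    using phi_eq_0 by (auto simp: ddiv_def fun_eq_iff)
  define \<kappa>0 where "\<kappa>0 = (\<integral>y. cmod (kern 0 ?\<theta> 1 y) \<partial>lborel)"
  have \<kappa>0n: "0 \<le> \<kappa>0" by (simp add: \<kappa>0_def integral_nonneg)
  define \<kappa> where "\<kappa> = \<kappa>0 + \<kappa>3"
  define M' where "M' = M * I0"
  have M': "M \<le> M'" "0 \<le> M'"
    using M I0_ge_1 mult_left_mono[OF I0_ge_1 M] by (auto simp: M'_def)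
  have Hb: "\<bar>H n x\<bar> \<le> M" if "n \<le> 4" for n x
    by (rule decay_le[OF H(2)[OF that] M])
  have Hm: "H n \<in> borel_measurable borel" for n
    by (rule has_vderiv_measurable) (rule H(1)[unfolded has_real_derivative_iff_has_vector_derivative])
  have Hi: "(\<integral>\<^sup>+x. ennreal (cmod (of_real (H n (2 ^ k * x)))) \<partial>lborel) \<le> ennreal (M' * 2 powr (- real k))" if "n \<le> 4" for n k
  proof -
    have [measurable]: "H n \<in> borel_measurable borel" by (rule Hm)
    have "(\<integral>\<^sup>+x. ennreal (cmod (of_real (H n x))) \<partial>lborel) = ennreal (2 ^ k) * (\<integral>\<^sup>+x. ennreal (cmod (of_real (H n (0 + 2 ^ k * x)))) \<partial>lborel)"
      by (subst nn_integral_real_affine[of _ "2 ^ k" 0]) auto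
    then have eq: "ennreal (2 powr (- real k)) * (\<integral>\<^sup>+x. ennreal (cmod (of_real (H n x))) \<partial>lborel) = (\<integral>\<^sup>+x. ennreal (cmod (of_real (H n (2 ^ k * x)))) \<partial>lborel)"
      by (simp add: powr_minus powr_realpow flip: mult.assoc ennreal_mult)
    have "(\<integral>\<^sup>+x. ennreal (cmod (of_real (H n x))) \<partial>lborel) \<le> ennreal (M * (\<integral>x. 1 / (1 + x\<^sup>2) \<partial>lborel))"
      by (rule nn_integral_inverse_1_plus_sq_le[OF _ M]) (use H(2)[OF that] in simp)
    also have "\<dots> \<le> ennreal M'" unfolding M'_def I0_def using M by (intro ennreal_leI mult_left_mono) auto
    finally have "ennreal (2 powr (- real k)) * (\<integral>\<^sup>+x. ennreal (cmod (of_real (H n x))) \<partial>lborel) \<le> ennreal (2 powr (- real k)) * ennreal M'"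
      by (intro mult_left_mono) auto
    then show ?thesis using M' unfolding eq by (simp add: mult.commute flip: ennreal_mult)
  qed
  let ?f = "\<lambda>(k::nat) x. complex_of_real (H 1 (2 ^ k * x))"
  have scale: "((\<lambda>x. complex_of_real (c * H n (2 ^ k * x))) has_vector_derivative of_real (c * (2 ^ k * H (Suc n) (2 ^ k * x)))) (at x)" for n k c x
    by (intro has_vector_derivative_of_real DERIV_cmult has_real_derivative_scale H)
  have hi: "cmod (conv (?f k) (kern 0 (cfun \<phi>) (2 powi j)) x) \<le> \<kappa>3 * M' * 2 powr (- 3 * (of_int j - real k))" (is ?A)
    "(\<integral>\<^sup>+x. ennreal (cmod (conv (?f k) (kern 0 (cfun \<phi>) (2 powi j)) x)) \<partial>lborel) \<le> ennreal (\<kappa>3 * M' * 2 powr (- 3 * (of_int j - real k)) * 2 powr (- real k))" (is ?B)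
    for k j x
  proof -
    let ?F = "\<lambda>n x. complex_of_real ((2 ^ k) ^ n * H (Suc n) (2 ^ k * x))"
    have F: "(?F n has_vector_derivative ?F (Suc n) x) (at x)" for n x
      using scale[of "(2 ^ k) ^ n" "Suc n" k x] by (simp add: mult_ac)
    have Fb: "\<exists>B. \<forall>x. cmod (?F n x) \<le> B" if "n \<le> 3" for n
      using Hb[of "Suc n"] that by (intro exI[of _ "(2 ^ k) ^ n * M"]) (simp add: abs_mult norm_mult norm_power mult_left_mono)
    have p3: "(2 ^ k) ^ 3 = 2 powr (3 * real k)"
      by (simp add: powr_realpow[symmetric] powr_powr mult.commute flip: power_mult)
    have b: "cmod (?F 3 x) \<le> 2 powr (3 * real k) * M'" for x
      using order_trans[OF Hb[of 4 "2 ^ k * x"] M'(1)] p3 by (simp add: abs_mult norm_mult norm_power mult_left_mono)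
    have [measurable]: "H 4 \<in> borel_measurable borel" by (rule Hm)
    have "(\<integral>\<^sup>+x. ennreal (cmod (?F 3 x)) \<partial>lborel) = (\<integral>\<^sup>+x. ennreal (2 powr (3 * real k)) * ennreal (cmod (of_real (H 4 (2 ^ k * x)))) \<partial>lborel)"
      using p3 by (intro nn_integral_cong) (simp add: norm_mult norm_power abs_mult flip: ennreal_mult)
    also have "\<dots> = ennreal (2 powr (3 * real k)) * (\<integral>\<^sup>+x. ennreal (cmod (of_real (H 4 (2 ^ k * x)))) \<partial>lborel)"
      by (rule nn_integral_cmult) measurable
    also have "\<dots> \<le> ennreal (2 powr (3 * real k)) * ennreal (M' * 2 powr (- real k))"
      by (intro mult_left_mono Hi) auto
    finally have i: "(\<integral>\<^sup>+x. ennreal (cmod (?F 3 x)) \<partial>lborel) \<le> ennreal (2 powr (3 * real k) * M' * 2 powr (- real k))"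
      using M' by (simp add: mult.assoc flip: ennreal_mult)
    note g = gainD[of 3 \<kappa>3 ?F "2 powr (3 * real k) * M'" "2 powr (- real k)" j, OF \<kappa>3 F Fb b i]
    have e: "\<kappa>3 * (2 powr (3 * real k) * M') * 2 powr (- (of_int j * real 3)) = \<kappa>3 * M' * 2 powr (- 3 * (of_int j - real k))"
      by (simp add: algebra_simps flip: powr_add)
    show ?A ?B using g(1)[of x] g(2) unfolding e by simp_all
  qed
  have lo: "cmod (conv (?f k) (kern 0 (cfun \<phi>) (2 powi j)) x) \<le> \<kappa>0 * M' * 2 powr (of_int j - real k)" (is ?A)
    "(\<integral>\<^sup>+x. ennreal (cmod (conv (?f k) (kern 0 (cfun \<phi>) (2 powi j)) x)) \<partial>lborel) \<le> ennreal (\<kappa>0 * M' * 2 powr (of_int j - real k) * 2 powr (- real k))" (is ?B)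
    for k j x
  proof -
    let ?l = "2 powi j :: real"
    have l: "0 < ?l" "?l = 2 powr of_int j" by (simp_all add: powr_real_of_int')
    \<comment> \<open>Antiderivative of the packet. Its amplitude of order
      \<open>2 powr (- k)\<close>, multiplied by the factor \<open>2 powr j\<close> of the
      differentiated kernel, is the gain at low frequencies.\<close>
    let ?h = "\<lambda>x. complex_of_real (1 / 2 ^ k * H 0 (2 ^ k * x))"
    have hb: "cmod (?h x) \<le> M' * 2 powr (- real k)" for x
      using order_trans[OF Hb[of 0 "2 ^ k * x"] M'(1)] by (simp add: abs_mult norm_mult norm_divide norm_power powr_minus powr_realpow field_simps)
    have hm: "?h \<in> borel_measurable borel"
      by (rule has_vderiv_measurable[OF scale])
    have f'm: "?f k \<in> borel_measurable borel"
      by (rule has_vderiv_measurable[OF scale[of 1, unfolded mult_1]])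
    have "(?h has_vector_derivative ?f k x) (at x)" for x
      using scale[of "1 / 2 ^ k" 0 k x] by simp
    moreover have "cmod (?f k x) \<le> M" for x using Hb[of 1] by simp
    ultimately have "conv ?h (kern 0 ?\<theta> ?l) x = of_real (1 / ?l) * conv (?f k) (kern 0 (ddiv ?\<theta>) ?l) x" for x
      by (intro conv_kern_ddiv[OF \<theta>v l(1) _ hb _ f'm])
    then have eq: "conv (?f k) (kern 0 (cfun \<phi>) ?l) x = of_real ?l * conv ?h (kern 0 ?\<theta> ?l) x" for x
      unfolding dd using l(1) by simp
    have "cmod (conv ?h (kern 0 ?\<theta> ?l) x) \<le> M' * 2 powr (- real k) * \<kappa>0"
      unfolding \<kappa>0_def by (rule norm_conv_kern_0_le[OF hm hb \<theta> l(1)])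
    from mult_left_mono[OF this, of ?l]
    have "cmod (conv (?f k) (kern 0 (cfun \<phi>) ?l) x) \<le> ?l * (M' * 2 powr (- real k) * \<kappa>0)"
      using l(1) unfolding eq norm_mult by (simp add: norm_power_int)
    then show ?A unfolding l(2) by (simp add: powr_diff powr_minus field_simps)
    have "(\<integral>\<^sup>+x. ennreal (cmod (?h x)) \<partial>lborel) = (\<integral>\<^sup>+x. ennreal (2 powr (- real k)) * ennreal (cmod (of_real (H 0 (2 ^ k * x)))) \<partial>lborel)"
      by (intro nn_integral_cong) (simp add: norm_mult norm_inverse norm_power abs_mult powr_minus powr_realpow divide_inverse mult.commute flip: ennreal_mult)
    also have "\<dots> = ennreal (2 powr (- real k)) * (\<integral>\<^sup>+x. ennreal (cmod (of_real (H 0 (2 ^ k * x)))) \<partial>lborel)"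
    proof (rule nn_integral_cmult)
      have "(\<lambda>x. H 0 (2 ^ k * x)) \<in> borel_measurable borel"
        by (rule measurable_compose[OF _ Hm]) simp
      then show "(\<lambda>x. ennreal (cmod (of_real (H 0 (2 ^ k * x))))) \<in> borel_measurable lborel"
        by simp
    qed
    also have "\<dots> \<le> ennreal (2 powr (- real k)) * ennreal (M' * 2 powr (- real k))"
      by (intro mult_left_mono Hi) auto
    finally have hi: "(\<integral>\<^sup>+x. ennreal (cmod (?h x)) \<partial>lborel) \<le> ennreal (2 powr (- real k) * (M' * 2 powr (- real k)))"
      using M' by (simp flip: ennreal_mult)
    have [measurable]: "conv ?h (kern 0 ?\<theta> ?l) \<in> borel_measurable borel"
      using kern_integrable[OF \<theta> l(1), of 0] by (intro conv_measurable hm) auto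
    have "(\<integral>\<^sup>+x. ennreal (cmod (conv (?f k) (kern 0 (cfun \<phi>) ?l) x)) \<partial>lborel) = ennreal ?l * (\<integral>\<^sup>+x. ennreal (cmod (conv ?h (kern 0 ?\<theta> ?l) x)) \<partial>lborel)"
    proof -
      have "ennreal (cmod (of_real ?l * z)) = ennreal ?l * ennreal (cmod z)" for z :: complex
        using l(1) by (simp add: norm_mult ennreal_mult norm_power_int)
      then show ?thesis
        unfolding eq by (simp only:) (rule nn_integral_cmult, measurable)
    qed
    also have "\<dots> \<le> ennreal ?l * ennreal (2 powr (- real k) * (M' * 2 powr (- real k)) * \<kappa>0)"
      unfolding \<kappa>0_def using M' by (intro mult_left_mono nn_integral_conv_kern_0_le[OF hm hi \<theta> l(1)]) auto
    also have "\<dots> = ennreal (\<kappa>0 * M' * 2 powr (of_int j - real k) * 2 powr (- real k))"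
      using M' \<kappa>0n l(1) unfolding l(2) by (subst ennreal_mult[symmetric]) (auto simp: powr_diff powr_minus field_simps)
    finally show ?B .
  qed
  have fin: "y \<le> \<kappa> * M' * min (2 powr d) (2 powr (- 3 * d)) * z"
    if "y \<le> \<kappa>3 * M' * 2 powr (- 3 * d) * z" "y \<le> \<kappa>0 * M' * 2 powr d * z" "0 \<le> z" for y z d :: real
  proof -
    have "\<kappa>3 * M' * 2 powr (- 3 * d) * z \<le> \<kappa> * M' * 2 powr (- 3 * d) * z"
      using M' \<kappa>0n \<kappa>3n that(3) by (intro mult_right_mono) (auto simp: \<kappa>_def)
    moreover have "\<kappa>0 * M' * 2 powr d * z \<le> \<kappa> * M' * 2 powr d * z"
      using M' \<kappa>0n \<kappa>3n that(3) by (intro mult_right_mono) (auto simp: \<kappa>_def)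
    ultimately show ?thesis using that by (auto simp: min_def)
  qed
  show thesis
  proof (rule that[of "\<kappa> * M'"])
    show "0 \<le> \<kappa> * M'" using M' \<kappa>0n \<kappa>3n by (simp add: \<kappa>_def)
    show "cmod (conv (?f k) (kern 0 (cfun \<phi>) (2 powi j)) x) \<le> \<kappa> * M' * min (2 powr (of_int j - real k)) (2 powr (- 3 * (of_int j - real k)))" for k j x
      by (rule fin[where z=1, unfolded mult_1_right, OF hi(1) lo(1)]) simp
    show "(\<integral>\<^sup>+x. ennreal (cmod (conv (?f k) (kern 0 (cfun \<phi>) (2 powi j)) x)) \<partial>lborel) \<le>
       ennreal (\<kappa> * M' * min (2 powr (of_int j - real k)) (2 powr (- 3 * (of_int j - real k))) * 2 powr (- real k))" for k j
    proof (cases "\<integral>\<^sup>+x. ennreal (cmod (conv (?f k) (kern 0 (cfun \<phi>) (2 powi j)) x)) \<partial>lborel")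
      case (real y)
      have "y \<le> \<kappa>3 * M' * 2 powr (- 3 * (of_int j - real k)) * 2 powr (- real k)"
        using hi(2)[of k j] real M' \<kappa>3n by simp
      moreover have "y \<le> \<kappa>0 * M' * 2 powr (of_int j - real k) * 2 powr (- real k)"
        using lo(2)[of k j] real M' \<kappa>0n by simp
      ultimately show ?thesis
        unfolding real(2) by (intro ennreal_leI fin) auto
    next
      case top
      then show ?thesis using hi(2)[of k j] by (simp add: top_unique)
    qed
  qed
qed

lemma conv_sum:
  assumes "finite K" and [measurable]: "\<And>k. k \<in> K \<Longrightarrow> f k \<in> borel_measurable borel" and B: "\<And>k x. k \<in> K \<Longrightarrow> cmod (f k x) \<le> B k" and k: "integrable lborel h"
  shows "conv (\<lambda>x. \<Sum>k\<in>K. of_real (c k) * f k x) h x = (\<Sum>k\<in>K. of_real (c k) * conv (f k) h x)"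
proof -
  have "conv (\<lambda>x. \<Sum>k\<in>K. of_real (c k) * f k x) h x = (\<integral>y. (\<Sum>k\<in>K. of_real (c k) * (f k y * h (x - y))) \<partial>lborel)"
    by (simp add: conv_def sum_distrib_right mult.assoc)
  also have "\<dots> = (\<Sum>k\<in>K. \<integral>y. of_real (c k) * (f k y * h (x - y)) \<partial>lborel)"
    using assms by (intro Bochner_Integration.integral_sum integrable_mult_right integrable_conv_integrand) auto
  finally show ?thesis by (simp add: conv_def)
qed

text \<open>Block j sees the k-th packet with strength \<open>(1/2) ^ \<bar>j - k\<bar>\<close>.
  Hence \<open>e j\<close> is bounded independently of N while its sum over j is of order N, and
  interpolation in the sequence norm gives \<open>N powr (1 / r)\<close>. The estimate is made at
  order \<open>s + 1 / p\<close> for s in [0, 1] and used at s = 0 and s = 1. In the constant, M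
  accounts for the sup norm and \<open>4 * C0\<close> for each of the two seminorms.\<close>

theorem lacunary_norm_le:
  assumes H: "\<And>n x. (H n has_real_derivative H (Suc n) x) (at x)" "\<And>n x. n \<le> 4 \<Longrightarrow> \<bar>H n x\<bar> \<le> M / (1 + x\<^sup>2)"
    and M: "0 \<le> M"
  obtains C where "0 \<le> C" "\<And>p r N a. \<lbrakk>1 \<le> p; 1 \<le> r; 1 \<le> N; 0 \<le> a\<rbrakk> \<Longrightarrow>
    A_norm \<phi> p r (lacunary H N a 0) \<le> ennreal (C * a * real N powr enn2real (1 / r))"
proof -
  obtain C0 where C0: "0 \<le> C0" "\<And>(k::nat) j x. cmod (conv (\<lambda>x. of_real (H 1 (2 ^ k * x))) (kern 0 (cfun \<phi>) (2 powi j)) x)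
      \<le> C0 * min (2 powr (of_int j - real k)) (2 powr (- 3 * (of_int j - real k)))"
    "\<And>(k::nat) j. (\<integral>\<^sup>+x. ennreal (cmod (conv (\<lambda>x. of_real (H 1 (2 ^ k * x))) (kern 0 (cfun \<phi>) (2 powi j)) x)) \<partial>lborel)
      \<le> ennreal (C0 * min (2 powr (of_int j - real k)) (2 powr (- 3 * (of_int j - real k))) * 2 powr (- real k))"
    by (rule block_bounds[of H M]) (use assms in auto)
  have Hb: "\<bar>H n x\<bar> \<le> M" if "n \<le> 4" for n x
    by (rule decay_le[OF H(2)[OF that] M])
  have Hm: "(\<lambda>x. complex_of_real (H 1 (2 ^ k * x))) \<in> borel_measurable borel" for k :: nat
    by (rule has_vderiv_measurable[OF has_vector_derivative_of_real[OF has_real_derivative_scale[OF H(1)]]])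
  show thesis
  proof (rule that[of "M + 8 * C0"])
    show "0 \<le> M + 8 * C0" using M C0 by simp
    fix p r :: ennreal and N :: nat and a :: real
    assume p: "1 \<le> p" and r: "1 \<le> r" and N: "1 \<le> N" and a: "0 \<le> a"
    let ?u = "lacunary H N a 0"
    have u_eq: "cfun ?u x = (\<Sum>k=1..N. of_real (a * 2 powr (- real k)) * of_real (H 1 (2 ^ k * x)))" for x
      by (simp add: lacunary_def powr_minus powr_realpow divide_inverse)
    \<comment> \<open>The amplitudes \<open>2 powr (- k)\<close> are summable, so the sup norm of
      the sum does not grow with N.\<close>
    have geo: "(\<Sum>k=1..N. 2 powr (- real k)) \<le> 1"
    proof -
      have "(\<Sum>k=1..N. 2 powr (- real k)) = 1 - 2 powr (- real N)" for N
        by (induction N) (auto simp: powr_diff powr_minus powr_add field_simps)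
      then show ?thesis by simp
    qed
    have u_le: "\<bar>?u x\<bar> \<le> M * a" for x
    proof -
      have "\<bar>?u x\<bar> = cmod (cfun ?u x)" by simp
      also have "\<dots> \<le> (\<Sum>k=1..N. (a * 2 powr (- real k)) * M)"
        unfolding u_eq using Hb a by (intro sum_norm_le) (auto simp: norm_mult intro!: mult_left_mono)
      also have "\<dots> = M * a * (\<Sum>k=1..N. 2 powr (- real k))"
        by (simp add: sum_distrib_left mult_ac)
      also have "\<dots> \<le> M * a"
        using geo M a by (intro mult_left_le) auto
      finally show ?thesis .
    qed
    have um: "cfun ?u \<in> borel_measurable borel"
      by (rule has_vderiv_measurable[OF has_vector_derivative_of_real[OF lacunary_deriv[of H, OF H(1)]]])
    have urm [measurable]: "?u \<in> borel_measurable borel"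
      by (rule has_vderiv_measurable) (rule lacunary_deriv[of H, OF H(1), unfolded has_real_derivative_iff_has_vector_derivative])
    \<comment> \<open>Effective number of packets seen by block j.\<close>
    define e where "e = (\<lambda>j::int. \<Sum>k=1..N. (1/2) ^ nat \<bar>j - int k\<bar> :: real)"
    have e0: "0 \<le> e j" for j by (auto simp: e_def intro: sum_nonneg)
    have e_pw: "(1/2) ^ nat \<bar>j - int k\<bar> = (2::real) powr (- \<bar>of_int j - real k\<bar>)" for j k
    proof -
      have "\<bar>of_int j - real k\<bar> = real (nat \<bar>j - int k\<bar>)" by simp
      then show ?thesis
        by (simp only: powr_minus powr_realpow zero_less_numeral) (simp add: power_one_over inverse_eq_divide)
    qed
    have conv_eq: "conv (cfun ?u) (kern 0 (cfun \<phi>) (2 powi j)) x =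
      (\<Sum>k=1..N. of_real (a * 2 powr (- real k)) * conv (\<lambda>x. of_real (H 1 (2 ^ k * x))) (kern 0 (cfun \<phi>) (2 powi j)) x)" for j x
      unfolding u_eq using Hb Hm
      by (intro conv_sum[of _ _ "\<lambda>_. M"] kern_integrable phi_test) auto
    let ?m = "\<lambda>j k. min (2 powr (real_of_int j - real k)) (2 powr (- 3 * (of_int j - real k)))"
    have key: "2 powr (- real k) * ?m j k \<le> 2 powr (- (of_int j * s)) * (1/2) ^ nat \<bar>j - int k\<bar>"
      "2 powr (- real k) * (?m j k * 2 powr (- real k)) \<le> 2 powr (- (of_int j * s)) * 2 powr (- of_int j) * (1/2) ^ nat \<bar>j - int k\<bar>"
      if s: "0 \<le> s" "s \<le> 1" for s j k
    proof -
      have m0: "0 \<le> ?m j k" by simp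
      \<comment> \<open>Here \<open>s \<le> 1\<close> enters: the amplitude of a packet pays for at
        most one derivative.\<close>
      have "2 powr (- real k) \<le> 2 powr (- (real k * s))"
        using s by (intro powr_mono) (auto simp: mult_left_le)
      also have "\<dots> = 2 powr (- (of_int j * s)) * 2 powr (s * (of_int j - real k))"
        by (simp add: algebra_simps flip: powr_add)
      finally have 1: "2 powr (- real k) \<le> 2 powr (- (of_int j * s)) * 2 powr (s * (of_int j - real k))" .
      have "2 powr (- real k) * ?m j k \<le> 2 powr (- (of_int j * s)) * 2 powr (s * (of_int j - real k)) * ?m j k"
        by (rule mult_right_mono[OF 1 m0])
      also have "\<dots> \<le> 2 powr (- (of_int j * s)) * 2 powr (- \<bar>of_int j - real k\<bar>)"
        unfolding mult.assoc using s by (intro mult_left_mono powr_min_le) auto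
      finally show "2 powr (- real k) * ?m j k \<le> 2 powr (- (of_int j * s)) * (1/2) ^ nat \<bar>j - int k\<bar>"
        by (simp only: e_pw)
      have "2 powr (- real k) * (?m j k * 2 powr (- real k)) = (2 powr (- real k) * 2 powr (- real k)) * ?m j k" by simp
      also have "\<dots> \<le> (2 powr (- (of_int j * s)) * 2 powr (s * (of_int j - real k)) * 2 powr (- real k)) * ?m j k"
        by (intro mult_right_mono 1 m0) simp
      also have "2 powr (- (of_int j * s)) * 2 powr (s * (of_int j - real k)) * 2 powr (- real k)
         = 2 powr (- (of_int j * s)) * 2 powr (- of_int j) * 2 powr ((s + 1) * (of_int j - real k))"
        by (simp add: algebra_simps flip: powr_add)
      also have "\<dots> * ?m j k \<le> 2 powr (- (of_int j * s)) * 2 powr (- of_int j) * 2 powr (- \<bar>of_int j - real k\<bar>)"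
        unfolding mult.assoc[of _ "2 powr ((s + 1) * (of_int j - real k))"] using s by (intro mult_left_mono powr_min_le) auto
      finally show "2 powr (- real k) * (?m j k * 2 powr (- real k)) \<le> 2 powr (- (of_int j * s)) * 2 powr (- of_int j) * (1/2) ^ nat \<bar>j - int k\<bar>"
        by (simp only: e_pw)
    qed
    have Lp: "ennreal (2 powr (of_int j * (s + enn2real (1 / p)))) * Lp_distr p (hblock \<phi> j (rdistr ?u)) \<le> ennreal (a * C0 * e j)"
      if s: "0 \<le> s" "s \<le> 1" for s j
    proof -
      let ?c = "conv (cfun ?u) (kern 0 (cfun \<phi>) (2 powi j))" and ?ck = "\<lambda>k. conv (\<lambda>x. of_real (H 1 (2 ^ k * x))) (kern 0 (cfun \<phi>) (2 powi j))"
      \<comment> \<open>Sup bound of the block. Its L1 bound is \<open>A * 2 powr (- j)\<close>, so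
        interpolation yields the factor \<open>2 powr (- j / p)\<close>, which cancels the weight
        \<open>2 powr (j / p)\<close>.\<close>
      define A where "A = a * C0 * e j * 2 powr (- (of_int j * s))"
      have sup: "cmod (?c x) \<le> A" for x
      proof -
        have "cmod (?c x) \<le> (\<Sum>k=1..N. (a * 2 powr (- real k)) * (C0 * ?m j k))"
          unfolding conv_eq
        proof (rule sum_norm_le)
          fix k
          have "cmod (of_real (a * 2 powr (- real k)) * ?ck k x) = (a * 2 powr (- real k)) * cmod (?ck k x)"
            using a by (simp add: norm_mult)
          also have "\<dots> \<le> (a * 2 powr (- real k)) * (C0 * ?m j k)"
            using a by (intro mult_left_mono C0) auto
          finally show "cmod (of_real (a * 2 powr (- real k)) * ?ck k x) \<le> (a * 2 powr (- real k)) * (C0 * ?m j k)" .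
        qed
        also have "\<dots> = (\<Sum>k=1..N. a * C0 * (2 powr (- real k) * ?m j k))"
          by (simp add: mult_ac)
        also have "\<dots> \<le> (\<Sum>k=1..N. a * C0 * (2 powr (- (of_int j * s)) * (1/2) ^ nat \<bar>j - int k\<bar>))"
          using a C0(1) by (intro sum_mono mult_left_mono key s) auto
        also have "\<dots> = A" by (simp add: A_def e_def sum_distrib_left sum_distrib_right mult_ac)
        finally show ?thesis .
      qed
      have ckm [measurable]: "?ck k \<in> borel_measurable borel" for k
        using kern_integrable[OF phi_test, of "2 powi j" 0] by (intro conv_measurable Hm) auto
      have "(\<integral>\<^sup>+x. ennreal (cmod (?c x)) \<partial>lborel) \<le> (\<integral>\<^sup>+x. (\<Sum>k=1..N. ennreal (a * 2 powr (- real k)) * ennreal (cmod (?ck k x))) \<partial>lborel)"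
      proof (rule nn_integral_mono)
        fix x
        have "cmod (?c x) \<le> (\<Sum>k=1..N. (a * 2 powr (- real k)) * cmod (?ck k x))"
          unfolding conv_eq using a by (intro sum_norm_le) (auto simp: norm_mult)
        then show "ennreal (cmod (?c x)) \<le> (\<Sum>k=1..N. ennreal (a * 2 powr (- real k)) * ennreal (cmod (?ck k x)))"
          using a by (simp add: ennreal_leI flip: ennreal_mult)
      qed
      also have "\<dots> = (\<Sum>k=1..N. \<integral>\<^sup>+x. ennreal (a * 2 powr (- real k)) * ennreal (cmod (?ck k x)) \<partial>lborel)"
        by (rule nn_integral_sum) measurable
      also have "\<dots> = (\<Sum>k=1..N. ennreal (a * 2 powr (- real k)) * (\<integral>\<^sup>+x. ennreal (cmod (?ck k x)) \<partial>lborel))"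
        by (intro sum.cong refl nn_integral_cmult) measurable
      also have "\<dots> \<le> (\<Sum>k=1..N. ennreal (a * 2 powr (- real k)) * ennreal (C0 * ?m j k * 2 powr (- real k)))"
        by (intro sum_mono mult_left_mono C0) auto
      also have "\<dots> = ennreal (\<Sum>k=1..N. a * C0 * (2 powr (- real k) * (?m j k * 2 powr (- real k))))"
        using a C0(1) by (subst sum_ennreal[symmetric]) (auto intro!: sum.cong simp: mult_ac simp flip: ennreal_mult)
      also have "\<dots> \<le> ennreal (\<Sum>k=1..N. a * C0 * (2 powr (- (of_int j * s)) * 2 powr (- of_int j) * (1/2) ^ nat \<bar>j - int k\<bar>))"
        using a C0(1) by (intro ennreal_leI sum_mono mult_left_mono key s) auto
      also have "(\<Sum>k=1..N. a * C0 * (2 powr (- (of_int j * s)) * 2 powr (- of_int j) * (1/2) ^ nat \<bar>j - int k\<bar>)) = A * 2 powr (- of_int j)"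
        by (simp add: A_def e_def sum_distrib_left sum_distrib_right mult_ac)
      finally have int: "(\<integral>\<^sup>+x. ennreal (cmod (?c x)) \<partial>lborel) \<le> ennreal (A * 2 powr (- of_int j))" .
      have A0: "0 \<le> A" using a C0(1) e0 by (simp add: A_def)
      have "Lp_distr p (hblock \<phi> j (rdistr ?u)) \<le> ennreal (A * (2 powr (- of_int j)) powr enn2real (1 / p))"
        by (rule Lp_hblock_le[OF um _ p sup int, of "M * a"]) (use u_le in auto)
      then have "ennreal (2 powr (of_int j * (s + enn2real (1 / p)))) * Lp_distr p (hblock \<phi> j (rdistr ?u)) \<le>
        ennreal (2 powr (of_int j * (s + enn2real (1 / p)))) * ennreal (A * (2 powr (- of_int j)) powr enn2real (1 / p))"
        by (intro mult_left_mono) auto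
      also have "\<dots> = ennreal (2 powr (of_int j * (s + enn2real (1 / p))) * (A * (2 powr (- of_int j)) powr enn2real (1 / p)))"
        using A0 by (subst ennreal_mult) auto
      also have "2 powr (of_int j * (s + enn2real (1 / p))) * (A * (2 powr (- of_int j)) powr enn2real (1 / p)) = a * C0 * e j"
      proof -
        have "2 powr (of_int j * (s + enn2real (1 / p))) * ((2 powr (- (of_int j * s))) * (2 powr (- of_int j)) powr enn2real (1 / p)) = (1::real)"
          by (simp add: powr_powr distrib_left flip: powr_add)
        then show ?thesis by (simp add: A_def mult_ac)
      qed
      finally show ?thesis .
    qed
    have e_le: "e j \<le> 4" for j
    proof -
      have "ennreal (e j) = (\<Sum>k=1..N. ennreal ((1/2) ^ nat \<bar>int k - j\<bar>))"
        by (subst sum_ennreal) (auto simp: e_def abs_minus_commute)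
      also have "\<dots> = (\<integral>\<^sup>+i. ennreal ((1/2) ^ nat \<bar>i - j\<bar>) \<partial>count_space (int ` {1..N}))"
        by (subst nn_integral_count_space_finite) (auto simp: sum.reindex)
      also have "\<dots> \<le> (\<integral>\<^sup>+i. ennreal ((1/2) ^ nat \<bar>i - j\<bar>) \<partial>count_space UNIV)"
        by (subst nn_integral_count_space_indicator) (auto intro!: nn_integral_mono simp: indicator_def)
      also have "\<dots> \<le> ennreal (2 / (1 - 1/2))"
        by (rule nn_integral_geometric_int) auto
      finally show ?thesis by (subst (asm) ennreal_le_iff) auto
    qed
    have e_sum: "(\<integral>\<^sup>+j. ennreal (e j) \<partial>count_space UNIV) \<le> ennreal (4 * real N)"
    proof -
      have "(\<integral>\<^sup>+j. ennreal (e j) \<partial>count_space UNIV) = (\<integral>\<^sup>+j. (\<Sum>k=1..N. ennreal ((1/2) ^ nat \<bar>j - int k\<bar>)) \<partial>count_space UNIV)"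
        by (intro nn_integral_cong) (simp add: e_def)
      also have "\<dots> = (\<Sum>k=1..N. \<integral>\<^sup>+j. ennreal ((1/2) ^ nat \<bar>j - int k\<bar>) \<partial>count_space UNIV)"
        by (rule nn_integral_sum) simp
      also have "\<dots> \<le> (\<Sum>k=1..N. ennreal (2 / (1 - 1/2)))"
        by (intro sum_mono nn_integral_geometric_int) auto
      also have "\<dots> = ennreal (4 * real N)"
        by (simp add: ennreal_of_nat_eq_real_of_nat mult.commute ennreal_mult)
      finally show ?thesis .
    qed
    have hB: "hBesov_norm \<phi> (s + enn2real (1 / p)) p r (rdistr ?u) \<le> ennreal (4 * C0 * a * real N powr enn2real (1 / r))"
      if s: "0 \<le> s" "s \<le> 1" for s
    proof -
      have "hBesov_norm \<phi> (s + enn2real (1 / p)) p r (rdistr ?u) \<le> ennreal ((a * C0 * 4) * real N powr enn2real (1 / r))"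
        unfolding hBesov_norm_def
      proof (rule lp_norm_interpolation[OF r])
        let ?b = "\<lambda>j::int. ennreal (2 powr (of_int j * (s + enn2real (1 / p)))) * Lp_distr p (hblock \<phi> j (rdistr ?u))"
        show "?b j \<le> ennreal (a * C0 * 4)" for j
          by (rule order_trans[OF Lp[OF s] ennreal_leI]) (use a C0(1) e_le in \<open>auto intro!: mult_left_mono\<close>)
        have "(\<integral>\<^sup>+j. ?b j \<partial>count_space UNIV) \<le> (\<integral>\<^sup>+j. ennreal (a * C0) * ennreal (e j) \<partial>count_space UNIV)"
          using a C0(1) e0 by (intro nn_integral_mono order_trans[OF Lp[OF s]]) (simp flip: ennreal_mult)
        also have "\<dots> = ennreal (a * C0) * (\<integral>\<^sup>+j. ennreal (e j) \<partial>count_space UNIV)"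
          by (rule nn_integral_cmult) simp
        also have "\<dots> \<le> ennreal (a * C0) * ennreal (4 * real N)"
          by (intro mult_left_mono e_sum) simp
        finally show "(\<integral>\<^sup>+j. ?b j \<partial>count_space UNIV) \<le> ennreal (a * C0 * 4 * real N)"
          using a C0(1) by (simp add: mult.assoc flip: ennreal_mult)
      qed (use a C0 N in auto)
      then show ?thesis by (simp add: mult_ac)
    qed
    have Linf: "Linf_norm ?u \<le> ennreal (M * a)"
      unfolding Linf_norm_def lp_norm_def using u_le by (auto intro!: esssup_I ennreal_leI)
    have "1 \<le> real N powr enn2real (1 / r)"
      using N enn2real_recip(1)[OF r] by (intro ge_one_powr_ge_zero) auto
    then have "M * a \<le> M * a * real N powr enn2real (1 / r)"
      using mult_left_mono[of 1 "real N powr enn2real (1 / r)" "M * a"] M a by simp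
    then have "Linf_norm ?u \<le> ennreal (M * a * real N powr enn2real (1 / r))"
      by (intro order_trans[OF Linf] ennreal_leI)
    then have "A_norm \<phi> p r ?u \<le> ennreal (M * a * real N powr enn2real (1 / r)) + ennreal (4 * C0 * a * real N powr enn2real (1 / r))
       + ennreal (4 * C0 * a * real N powr enn2real (1 / r))"
      unfolding A_norm_def using hB[of 0] hB[of 1] by (intro add_mono) auto
    also have "\<dots> = ennreal ((M + 8 * C0) * a * real N powr enn2real (1 / r))"
      using M a C0(1) by (simp add: algebra_simps flip: ennreal_plus)
    finally show "A_norm \<phi> p r ?u \<le> ennreal ((M + 8 * C0) * a * real N powr enn2real (1 / r))" .
  qed
qed

end

section \<open>Regularity and uniqueness of solutions\<close>

text \<open>Continuity in time with values in the functions of x under the sup norm.\<close>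

definition ucont_on :: "real \<Rightarrow> (real \<Rightarrow> real \<Rightarrow> real) \<Rightarrow> bool" where
  "ucont_on b f \<longleftrightarrow> (\<forall>t\<in>{0..b}. \<forall>e>0. \<forall>\<^sub>F \<tau> in at t within {0..b}. \<forall>x. \<bar>f \<tau> x - f t x\<bar> \<le> e)"

lemma ucont_onD: "ucont_on b f \<Longrightarrow> t \<in> {0..b} \<Longrightarrow> 0 < e \<Longrightarrow> \<forall>\<^sub>F \<tau> in at t within {0..b}. \<forall>x. \<bar>f \<tau> x - f t x\<bar> \<le> e"
  by (simp add: ucont_on_def)

lemma ucont_on_mult:
  assumes f: "ucont_on b f" "\<And>t x. t \<in> {0..b} \<Longrightarrow> \<bar>f t x\<bar> \<le> K"
    and g: "ucont_on b g" "\<And>t x. t \<in> {0..b} \<Longrightarrow> \<bar>g t x\<bar> \<le> L" and KL: "0 < K" "0 < L"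
  shows "ucont_on b (\<lambda>t x. f t x * g t x)"
  unfolding ucont_on_def
proof (intro ballI allI impI)
  fix t e :: real assume t: "t \<in> {0..b}" and e: "0 < e"
  have "\<forall>\<^sub>F \<tau> in at t within {0..b}. \<tau> \<in> {0..b}" by (simp add: eventually_at_filter)
  moreover have "\<forall>\<^sub>F \<tau> in at t within {0..b}. \<forall>x. \<bar>f \<tau> x - f t x\<bar> \<le> e / (2 * L)"
    by (rule ucont_onD[OF f(1) t]) (use KL e in simp)
  moreover have "\<forall>\<^sub>F \<tau> in at t within {0..b}. \<forall>x. \<bar>g \<tau> x - g t x\<bar> \<le> e / (2 * K)"
    by (rule ucont_onD[OF g(1) t]) (use KL e in simp)
  ultimately show "\<forall>\<^sub>F \<tau> in at t within {0..b}. \<forall>x. \<bar>f \<tau> x * g \<tau> x - f t x * g t x\<bar> \<le> e"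
  proof (eventually_elim, intro allI)
    fix \<tau> x assume 1: "\<forall>x. \<bar>f \<tau> x - f t x\<bar> \<le> e / (2 * L)" and 2: "\<forall>x. \<bar>g \<tau> x - g t x\<bar> \<le> e / (2 * K)" and \<tau>: "\<tau> \<in> {0..b}"
    have "f \<tau> x * g \<tau> x - f t x * g t x = (f \<tau> x - f t x) * g \<tau> x + f t x * (g \<tau> x - g t x)"
      by (simp add: algebra_simps)
    also have "\<bar>\<dots>\<bar> \<le> \<bar>f \<tau> x - f t x\<bar> * \<bar>g \<tau> x\<bar> + \<bar>f t x\<bar> * \<bar>g \<tau> x - g t x\<bar>"
      by (simp add: abs_mult[symmetric] abs_triangle_ineq)
    also have "\<dots> \<le> e / (2 * L) * L + K * (e / (2 * K))"
      using 1 2 f(2)[OF t] g(2)[OF \<tau>] KL e by (intro add_mono mult_mono) auto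
    also have "\<dots> = e" using KL by simp
    finally show "\<bar>f \<tau> x * g \<tau> x - f t x * g t x\<bar> \<le> e" .
  qed
qed

lemma ucont_on_continuous: "ucont_on b f \<Longrightarrow> continuous_on {0..b} (\<lambda>t. f t x)"
proof -
  assume f: "ucont_on b f"
  have "((\<lambda>\<tau>. f \<tau> x) \<longlongrightarrow> f t x) (at t within {0..b})" if "t \<in> {0..b}" for t
  proof (rule tendstoI)
    fix e :: real assume "0 < e"
    then have "\<forall>\<^sub>F \<tau> in at t within {0..b}. \<forall>x. \<bar>f \<tau> x - f t x\<bar> \<le> e / 2"
      by (intro ucont_onD[OF f that]) simp
    then show "\<forall>\<^sub>F \<tau> in at t within {0..b}. dist (f \<tau> x) (f t x) < e"
    proof eventually_elim
      case (elim \<tau>)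
      then have "\<bar>f \<tau> x - f t x\<bar> \<le> e / 2" by blast
      then show ?case using \<open>0 < e\<close> by (simp add: dist_real_def)
    qed
  qed
  then show ?thesis by (simp add: continuous_on_def)
qed

text \<open>The supremum changes by at most the uniform distance, so it is continuous in time and,
  on a compact interval, bounded.\<close>

lemma ucont_on_SUP:
  assumes f: "ucont_on b f" and B: "\<And>t. t \<in> {0..b} \<Longrightarrow> \<exists>B. \<forall>x. \<bar>f t x\<bar> \<le> B"
  shows "continuous_on {0..b} (\<lambda>t. SUP x. \<bar>f t x\<bar>)"
    and "\<exists>K>0. \<forall>t\<in>{0..b}. \<forall>x. \<bar>f t x\<bar> \<le> K"
    and "\<And>t x. t \<in> {0..b} \<Longrightarrow> \<bar>f t x\<bar> \<le> (SUP x. \<bar>f t x\<bar>)"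
proof -
  have bdd: "bdd_above (range (\<lambda>x. \<bar>f t x\<bar>))" if "t \<in> {0..b}" for t
    using B[OF that] by (auto simp: bdd_above_def)
  show up: "\<bar>f t x\<bar> \<le> (SUP x. \<bar>f t x\<bar>)" if "t \<in> {0..b}" for t x
    by (rule cSUP_upper[OF UNIV_I bdd[OF that]])
  have le: "(SUP x. \<bar>f t x\<bar>) \<le> (SUP x. \<bar>f s x\<bar>) + e" if "t \<in> {0..b}" "s \<in> {0..b}" "\<And>x. \<bar>f t x - f s x\<bar> \<le> e" for t s e
  proof (rule cSUP_least)
    fix x
    show "\<bar>f t x\<bar> \<le> (SUP x. \<bar>f s x\<bar>) + e"
      using up[OF that(2), of x] that(3)[of x] by linarith
  qed simp
  show c: "continuous_on {0..b} (\<lambda>t. SUP x. \<bar>f t x\<bar>)"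
    unfolding continuous_on_def
  proof (intro ballI tendstoI)
    fix t e :: real assume t: "t \<in> {0..b}" and e: "0 < e"
    have "\<forall>\<^sub>F \<tau> in at t within {0..b}. \<tau> \<in> {0..b}" by (simp add: eventually_at_filter)
    moreover have "\<forall>\<^sub>F \<tau> in at t within {0..b}. \<forall>x. \<bar>f \<tau> x - f t x\<bar> \<le> e/2"
      by (rule ucont_onD[OF f t]) (use e in simp)
    ultimately show "\<forall>\<^sub>F \<tau> in at t within {0..b}. dist (SUP x. \<bar>f \<tau> x\<bar>) (SUP x. \<bar>f t x\<bar>) < e"
    proof eventually_elim
      fix \<tau> assume 1: "\<forall>x. \<bar>f \<tau> x - f t x\<bar> \<le> e/2" and \<tau>: "\<tau> \<in> {0..b}"
      have 2: "\<bar>f t x - f \<tau> x\<bar> \<le> e/2" for x using spec[OF 1, of x] by linarith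
      have "(SUP x. \<bar>f \<tau> x\<bar>) \<le> (SUP x. \<bar>f t x\<bar>) + e/2" by (rule le[OF \<tau> t]) (use 1 in blast)
      moreover have "(SUP x. \<bar>f t x\<bar>) \<le> (SUP x. \<bar>f \<tau> x\<bar>) + e/2" by (rule le[OF t \<tau>]) (rule 2)
      ultimately show "dist (SUP x. \<bar>f \<tau> x\<bar>) (SUP x. \<bar>f t x\<bar>) < e" using e by (simp add: dist_real_def abs_le_iff)
    qed
  qed
  have "bounded ((\<lambda>t. SUP x. \<bar>f t x\<bar>) ` {0..b})"
    by (intro compact_imp_bounded compact_continuous_image c) simp
  then obtain K where "\<forall>y\<in>(\<lambda>t. SUP x. \<bar>f t x\<bar>) ` {0..b}. \<bar>y\<bar> \<le> K" by (auto simp: bounded_iff)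
  then have "\<bar>f t x\<bar> \<le> K" if "t \<in> {0..b}" for t x using up[OF that, of x] that by force
  then show "\<exists>K>0. \<forall>t\<in>{0..b}. \<forall>x. \<bar>f t x\<bar> \<le> K"
    by (intro exI[of _ "max K 1"]) (auto intro: max.coboundedI1)
qed

section \<open>From almost everywhere to everywhere, and integrals over half-lines\<close>

lemma continuous_AE_imp_all:
  fixes P :: "real \<Rightarrow> bool"
  assumes "AE x in lborel. P x" "closed {x. P x}"
  shows "P x"
proof (rule ccontr)
  assume "\<not> P x"
  then have ne: "- {x. P x} \<noteq> {}" by auto
  have op: "open (- {x. P x})" using assms(2) by (simp add: open_Compl)
  have eq: "{x \<in> space lborel. \<not> P x} = - {x. P x}" by auto
  have "- {x. P x} \<in> null_sets lborel"
    using AE_iff_null[of lborel P] assms(1) borel_open[OF op] unfolding eq by simp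
  then have "negligible (- {x. P x})"
    by (simp add: negligible_iff_null_sets null_sets_completionI)
  then show False using open_not_negligible[OF op ne] by simp
qed

lemma AE_eq_continuous_imp_eq:
  fixes f g :: "real \<Rightarrow> real"
  assumes "AE x in lborel. f x = g x" "continuous_on UNIV f" "continuous_on UNIV g"
  shows "f x = g x"
  by (rule continuous_AE_imp_all[OF assms(1)]) (intro closed_Collect_eq assms)

lemma AE_le_continuous_imp_le:
  fixes f g :: "real \<Rightarrow> real"
  assumes "AE x in lborel. f x \<le> g x" "continuous_on UNIV f" "continuous_on UNIV g"
  shows "f x \<le> g x"
  by (rule continuous_AE_imp_all[OF assms(1)]) (intro closed_Collect_le assms)

lemma set_integral_atMost_has_derivative:
  fixes f :: "real \<Rightarrow> real"
  assumes f: "continuous_on UNIV f" and i: "\<And>x. set_integrable lborel {..x} f"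
  shows "((\<lambda>x. LINT z:{..x}|lborel. f z) has_real_derivative f x) (at x)"
    and "a \<le> c \<Longrightarrow> (LINT z:{..c}|lborel. f z) = (LINT z:{..a}|lborel. f z) + integral {a..c} f"
proof -
  show split: "(LINT z:{..c}|lborel. f z) = (LINT z:{..a}|lborel. f z) + integral {a..c} f" if "a \<le> c" for a c
  proof -
    have si: "set_integrable lborel {a..c} f"
      by (rule borel_integrable_atLeastAtMost') (rule continuous_on_subset[OF f], simp)
    have si': "set_integrable lborel {a<..c} f"
      by (rule set_integrable_subset[OF si]) auto
    have "{..c} = {..a} \<union> {a<..c}" using that by auto
    then have "(LINT z:{..c}|lborel. f z) = (LINT z:{..a}|lborel. f z) + (LINT z:{a<..c}|lborel. f z)"
      by (simp only:) (rule set_integral_Un[OF _ i si'], auto)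
    also have "(LINT z:{a<..c}|lborel. f z) = (LINT z:{a..c}|lborel. f z)"
      unfolding set_lebesgue_integral_def
      by (rule integral_cong_AE)
         (use si si' AE_lborel_singleton[of a] in \<open>auto simp: set_integrable_def indicator_def elim: eventually_mono\<close>)
    also have "\<dots> = integral {a..c} f" by (rule set_borel_integral_eq_integral(2)[OF si])
    finally show ?thesis .
  qed
  have "((\<lambda>u. integral {x - 1..u} f) has_real_derivative f x) (at x within {x - 1..x + 1})"
    by (rule integral_has_real_derivative) (auto intro: continuous_on_subset[OF f])
  then have "((\<lambda>u. integral {x - 1..u} f) has_real_derivative f x) (at x)"
    by (subst (asm) at_within_interior) (auto simp: interior_atLeastAtMost_real)
  from DERIV_add[OF DERIV_const this, of "LINT z:{..x - 1}|lborel. f z"]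
  have "((\<lambda>u. (LINT z:{..x - 1}|lborel. f z) + integral {x - 1..u} f) has_real_derivative f x) (at x)" by simp
  then show "((\<lambda>x. LINT z:{..x}|lborel. f z) has_real_derivative f x) (at x)"
  proof (rule has_field_derivative_transform_within_open[of _ _ _ "{x - 1<..}"])
    show "(LINT z:{..x - 1}|lborel. f z) + integral {x - 1..u} f = (LINT z:{..u}|lborel. f z)" if "u \<in> {x - 1<..}" for u
      using split[of "x - 1" u] that by simp
  qed auto
qed

lemma set_integral_atMost_tendsto_0:
  fixes f :: "real \<Rightarrow> real"
  assumes i: "set_integrable lborel {..0} f"
  shows "(\<lambda>n. LINT z:{..- real n}|lborel. f z) \<longlonglongrightarrow> 0"
proof -
  have m: "(\<lambda>z. indicator {..0} z *\<^sub>R f z) \<in> borel_measurable lborel"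
    using i by (auto simp: set_integrable_def)
  have eq: "indicator {..- real n} z *\<^sub>R f z = indicator {..- real n} z *\<^sub>R (indicator {..0} z *\<^sub>R f z)" for n z
    by (auto simp: indicator_def)
  have "(\<lambda>n. \<integral>z. indicator {..- real n} z *\<^sub>R (indicator {..0} z *\<^sub>R f z) \<partial>lborel) \<longlonglongrightarrow> integral\<^sup>L lborel (\<lambda>z::real. 0::real)"
  proof (rule integral_dominated_convergence[where w="\<lambda>z. \<bar>indicator {..0} z *\<^sub>R f z\<bar>" and f="\<lambda>_. 0::real"])
    show "integrable lborel (\<lambda>z. \<bar>indicator {..0} z *\<^sub>R f z\<bar>)"
      using i unfolding set_integrable_def by (rule integrable_abs)
    show "AE z in lborel. (\<lambda>n. indicator {..- real n} z *\<^sub>R (indicator {..0} z *\<^sub>R f z)) \<longlonglongrightarrow> 0"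
    proof (rule AE_I2)
      fix z :: real
      obtain N :: nat where N: "- z < real N" using reals_Archimedean2 by blast
      show "(\<lambda>n. indicator {..- real n} z *\<^sub>R (indicator {..0} z *\<^sub>R f z)) \<longlonglongrightarrow> 0"
      proof (rule tendsto_eventually, rule eventually_sequentiallyI[of N])
        fix n assume "N \<le> n"
        then have "real N \<le> real n" by simp
        with N have "z \<notin> {..- real n}" by auto
        then show "indicator {..- real n} z *\<^sub>R (indicator {..0} z *\<^sub>R f z) = 0" by simp
      qed
    qed
    show "(\<lambda>z. indicator {..- real n} z *\<^sub>R (indicator {..0} z *\<^sub>R f z)) \<in> borel_measurable lborel" for n
      by (rule borel_measurable_scaleR[OF _ m]) simp
    show "AE z in lborel. norm (indicator {..- real n} z *\<^sub>R (indicator {..0} z *\<^sub>R f z)) \<le> \<bar>indicator {..0} z *\<^sub>R f z\<bar>" for n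
      by (rule AE_I2) (simp add: indicator_def)
  qed simp
  then have "(\<lambda>n. \<integral>z. indicator {..- real n} z *\<^sub>R (indicator {..0} z *\<^sub>R f z) \<partial>lborel) \<longlonglongrightarrow> 0"
    by (simp only: Bochner_Integration.integral_zero)
  then show ?thesis unfolding set_lebesgue_integral_def by (simp only: eq)
qed

text \<open>M will be a maximum of suprema, so only its forward increments are controlled and no
  derivative is at hand. The barrier \<open>B s = e * exp ((C + 1) * s)\<close> is compared with M
  at the infimum \<open>t0\<close> of the times where M exceeds it: continuity gives
  \<open>M t0 \<le> B t0\<close>, and \<open>step\<close> keeps M below B for a short while after
  \<open>t0\<close>, a contradiction.\<close>

lemma Gronwall_Dini:
  fixes M :: "real \<Rightarrow> real"
  assumes cont: "continuous_on {0..b} M" and M0: "M 0 \<le> 0" and C: "0 \<le> C"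
    and step: "\<And>t e. t \<in> {0..<b} \<Longrightarrow> 0 < e \<Longrightarrow> \<exists>d>0. \<forall>\<tau>\<in>{0..b}. t < \<tau> \<and> \<tau> < t + d \<longrightarrow> M \<tau> \<le> M t + (C * M t + e) * (\<tau> - t)"
    and t: "t \<in> {0..b}"
  shows "M t \<le> 0"
proof (rule field_le_epsilon)
  fix \<epsilon> :: real assume "0 < \<epsilon>"
  \<comment> \<open>Makes the barrier equal to \<open>\<epsilon>\<close> at the time t of
    interest.\<close>
  define e where "e = \<epsilon> / exp ((C + 1) * t)"
  have e: "0 < e" using \<open>0 < \<epsilon>\<close> by (simp add: e_def)
  define B where "B = (\<lambda>t. e * exp ((C + 1) * t))"
  define S where "S = {s \<in> {0..b}. B s < M s}"
  have Bc: "continuous_on A B" for A unfolding B_def by (intro continuous_intros)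
  have "S = {}"
  proof (rule ccontr)
    assume ne: "S \<noteq> {}"
    have bdd: "bdd_below S" by (auto simp: S_def bdd_below_def)
    define t0 where "t0 = Inf S"
    have t0: "0 \<le> t0" unfolding t0_def using ne by (intro cInf_greatest) (auto simp: S_def)
    obtain s0 where s0: "s0 \<in> S" using ne by auto
    have t0s: "t0 \<le> s" if "s \<in> S" for s unfolding t0_def by (rule cInf_lower[OF that bdd])
    have t0b: "t0 \<in> {0..b}" using t0 t0s[OF s0] s0 by (auto simp: S_def)
    have le: "M s \<le> B s" if "0 \<le> s" "s < t0" for s
      using that t0b t0s[of s] by (auto simp: S_def not_le[symmetric])
    have Mt0: "M t0 \<le> B t0"
    proof (cases "t0 = 0")
      case True
      then show ?thesis using M0 e by (simp add: B_def)
    next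
      case False
      have "((\<lambda>s. B s - M s) \<longlongrightarrow> B t0 - M t0) (at t0 within {0..<t0})"
      proof -
        have "((\<lambda>s. B s - M s) \<longlongrightarrow> B t0 - M t0) (at t0 within {0..b})"
          using continuous_on_diff[OF Bc cont] t0b unfolding continuous_on_def by blast
        then show ?thesis by (rule tendsto_within_subset) (use t0b in auto)
      qed
      moreover have "\<forall>\<^sub>F s in at t0 within {0..<t0}. 0 \<le> B s - M s"
        using le by (auto simp: eventually_at_filter)
      moreover have "at t0 within {0..<t0} \<noteq> bot"
        using False t0 by (simp add: trivial_limit_within islimpt_Ico)
      ultimately have "0 \<le> B t0 - M t0" by (rule tendsto_lowerbound)
      then show ?thesis by simp
    qed
    then have "t0 \<notin> S" by (simp add: S_def)
    then have "t0 < s0" using t0s[OF s0] s0 by (cases "t0 = s0") auto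
    then have "t0 \<in> {0..<b}" using t0 s0 by (auto simp: S_def)
    from step[OF this e] obtain d where d: "0 < d" "\<And>\<tau>. \<tau> \<in> {0..b} \<Longrightarrow> t0 < \<tau> \<Longrightarrow> \<tau> < t0 + d \<Longrightarrow> M \<tau> \<le> M t0 + (C * M t0 + e) * (\<tau> - t0)" by blast
    obtain s where s: "s \<in> S" "s < t0 + d"
      using cInf_lessD[OF ne, of "t0 + d"] d(1) by (auto simp: t0_def)
    then have s': "s \<in> {0..b}" "t0 < s" "B s < M s" using t0s[OF s(1)] \<open>t0 \<notin> S\<close> by (auto simp: S_def less_le)
    have "M s \<le> M t0 + (C * M t0 + e) * (s - t0)" by (rule d(2)[OF s'(1,2) s(2)])
    \<comment> \<open>The error e is at most \<open>B t0\<close>; the extra 1 in the rate C + 1 of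
      the barrier absorbs it.\<close>
    also have "\<dots> \<le> B t0 + (C * B t0 + B t0) * (s - t0)"
      using Mt0 C s'(2) t0 e by (intro add_mono mult_right_mono mult_left_mono) (auto simp: B_def)
    also have "\<dots> = B t0 * (1 + (C + 1) * (s - t0))" by (simp add: algebra_simps)
    also have "\<dots> \<le> B t0 * exp ((C + 1) * (s - t0))"
      using e by (intro mult_left_mono exp_ge_add_one_self) (auto simp: B_def)
    also have "\<dots> = B s" by (simp add: B_def mult.assoc algebra_simps flip: exp_add)
    finally show False using s'(3) by simp
  qed
  then have "M t \<le> B t" using t by (auto simp: S_def not_less[symmetric])
  then show "M t \<le> 0 + \<epsilon>" by (simp add: B_def e_def)
qed

text \<open>\<open>z x - h * z1 x\<close> is the value of z at the shifted point x - h up to a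
  quadratic error. In the sup norm a transport term therefore costs nothing to first order, although
  it contains a derivative of z.\<close>

lemma taylor_shift_le:
  fixes z z1 :: "real \<Rightarrow> real"
  assumes z: "\<And>x. (z has_real_derivative z1 x) (at x)" and L: "\<And>x y. \<bar>z1 x - z1 y\<bar> \<le> L * \<bar>x - y\<bar>"
    and Z: "\<And>x. \<bar>z x\<bar> \<le> Z" and h: "\<bar>h\<bar> \<le> A"
  shows "\<bar>z x - h * z1 x\<bar> \<le> Z + L * A\<^sup>2"
proof -
  have L0: "0 \<le> L" using order_trans[OF abs_ge_zero L[of 1 0]] by simp
  have "\<bar>z (x - h) - (z x - h * z1 x)\<bar> \<le> L * A\<^sup>2"
  proof -
    define k where "k = (\<lambda>y. z y - z1 x * y)"
    have k: "(k has_real_derivative z1 y - z1 x) (at y)" for y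
      unfolding k_def by (auto intro!: derivative_eq_intros z)
    have "norm (k (x - h) - k x) \<le> L * \<bar>h\<bar> * norm (x - h - x)"
    proof (rule field_differentiable_bound[of "cball x \<bar>h\<bar>" k "\<lambda>y. z1 y - z1 x"])
      show "norm (z1 y - z1 x) \<le> L * \<bar>h\<bar>" if "y \<in> cball x \<bar>h\<bar>" for y
        using L[of y x] mult_left_mono[OF _ L0, of "\<bar>y - x\<bar>" "\<bar>h\<bar>"] that by (auto simp: dist_real_def abs_minus_commute)
    qed (auto intro: has_field_derivative_at_within k simp: dist_real_def)
    also have "\<dots> = L * \<bar>h\<bar>\<^sup>2" by (simp add: power2_eq_square)
    also have "\<dots> \<le> L * A\<^sup>2" using h by (intro mult_left_mono L0 power_mono) auto
    finally show ?thesis by (simp add: k_def algebra_simps)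
  qed
  then show ?thesis using Z[of "x - h"] by linarith
qed

text \<open>What a solution becomes once representatives are chosen: \<open>U t i\<close> is the
  i-th derivative in x, H the energy to the left of x, and the equation holds as a time derivative
  uniformly in x. Uniqueness is proved at this level, with three derivatives bounded by one constant
  K.\<close>

locale regular_flow =
  fixes b :: real and g :: "real \<Rightarrow> real" and U :: "real \<Rightarrow> nat \<Rightarrow> real \<Rightarrow> real" and H :: "real \<Rightarrow> real \<Rightarrow> real" and K :: real
  assumes b: "0 \<le> b"
    and deriv: "\<And>t i x. t \<in> {0..b} \<Longrightarrow> i < 3 \<Longrightarrow> (U t i has_real_derivative U t (Suc i) x) (at x)"
    and bound: "\<And>t i x. t \<in> {0..b} \<Longrightarrow> i \<le> 3 \<Longrightarrow> \<bar>U t i x\<bar> \<le> K"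
    and ucont: "\<And>i. i \<le> 3 \<Longrightarrow> ucont_on b (\<lambda>t. U t i)"
    and energy: "\<And>t x. t \<in> {0..b} \<Longrightarrow> set_integrable lborel {..x} (\<lambda>z. (U t 1 z)\<^sup>2 / 2)"
    and H_eq: "\<And>t x. t \<in> {0..b} \<Longrightarrow> H t x = (LINT z:{..x}|lborel. (U t 1 z)\<^sup>2 / 2)"
    and evol: "\<And>t e. t \<in> {0..b} \<Longrightarrow> 0 < e \<Longrightarrow> \<forall>\<^sub>F \<tau> in at t within {0..b}. \<forall>x.
        \<bar>(U \<tau> 0 x - U t 0 x) / (\<tau> - t) - (H t x + g t - U t 0 x * U t 1 x)\<bar> \<le> e"
    and H_bounded: "\<And>t. t \<in> {0..b} \<Longrightarrow> \<exists>B. \<forall>x. \<bar>H t x\<bar> \<le> B"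
    and K: "0 < K"
begin

section \<open>Energy balance of a regular flow\<close>

lemma U_deriv: "t \<in> {0..b} \<Longrightarrow> (U t 0 has_real_derivative U t 1 x) (at x)"
  "t \<in> {0..b} \<Longrightarrow> (U t 1 has_real_derivative U t 2 x) (at x)"
  "t \<in> {0..b} \<Longrightarrow> (U t 2 has_real_derivative U t 3 x) (at x)"
  using deriv[of t 0 x] deriv[of t 1 x] deriv[of t 2 x] by (simp_all add: numeral_2_eq_2 numeral_3_eq_3)

lemma U_cont: "t \<in> {0..b} \<Longrightarrow> i \<le> 2 \<Longrightarrow> continuous_on A (U t i)"
  using deriv[of t i] by (intro DERIV_continuous_on[where D="U t (Suc i)"]) (auto intro: has_field_derivative_at_within)

lemma H_deriv:
  assumes t: "t \<in> {0..b}" shows "(H t has_real_derivative (U t 1 x)\<^sup>2 / 2) (at x)"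
proof -
  have "continuous_on UNIV (\<lambda>z. (U t 1 z)\<^sup>2 / 2)" using U_cont[OF t, of 1] by (intro continuous_intros) auto
  from set_integral_atMost_has_derivative(1)[OF this energy[OF t]]
  have "((\<lambda>x. LINT z:{..x}|lborel. (U t 1 z)\<^sup>2 / 2) has_real_derivative (U t 1 x)\<^sup>2 / 2) (at x)" .
  moreover have "H t = (\<lambda>x. LINT z:{..x}|lborel. (U t 1 z)\<^sup>2 / 2)" using H_eq[OF t] by auto
  ultimately show ?thesis by simp
qed

text \<open>Finite energy on the left together with a Lipschitz energy density forces the slope to
  vanish: the energy in the interval of length d to the left of -n is at least d times the density
  at -n, minus \<open>K\<^sup>2 * d\<^sup>2\<close>, and it is bounded by \<open>H t (- n)\<close>,
  which tends to 0.\<close>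

lemma U1_lim:
  assumes t: "t \<in> {0..b}" shows "(\<lambda>n. U t 1 (- real n)) \<longlonglongrightarrow> 0"
proof -
  let ?f = "\<lambda>x. (U t 1 x)\<^sup>2 / 2"
  have H0: "(\<lambda>n. H t (- real n)) \<longlonglongrightarrow> 0"
    unfolding H_eq[OF t] by (rule set_integral_atMost_tendsto_0[OF energy[OF t]])
  have Hd: "H t (- real n - d) \<le> H t (- real n) - d * ?f (- real n) + K\<^sup>2 * d\<^sup>2" if d: "0 \<le> d" for n d
  proof -
    let ?k = "\<lambda>s. H t (- real n - s) - H t (- real n) + s * ?f (- real n) - K\<^sup>2 * s\<^sup>2"
    have "?k d \<le> ?k 0"
    proof (rule DERIV_nonpos_imp_nonincreasing[OF d])
      fix s assume s: "0 \<le> s" "s \<le> d"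
      have "(?k has_real_derivative (- ?f (- real n - s) + ?f (- real n) - 2 * K\<^sup>2 * s)) (at s)"
        by (auto intro!: derivative_eq_intros DERIV_chain2[OF H_deriv[OF t]])
      moreover have "\<bar>?f (- real n) - ?f (- real n - s)\<bar> \<le> K\<^sup>2 * s"
      proof -
        have "norm (?f (- real n) - ?f (- real n - s)) \<le> K\<^sup>2 * norm (- real n - (- real n - s))"
        proof (rule field_differentiable_bound[of UNIV ?f "\<lambda>y. U t 1 y * U t 2 y"])
          show "(?f has_field_derivative U t 1 y * U t 2 y) (at y within UNIV)" for y
            using U_deriv(2)[OF t, of y] by (auto intro!: derivative_eq_intros simp del: One_nat_def)
          show "norm (U t 1 y * U t 2 y) \<le> K\<^sup>2" for y
            using bound[OF t, of 1 y] bound[OF t, of 2 y] by (auto simp: abs_mult power2_eq_square intro!: mult_mono)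
        qed auto
        then show ?thesis using s by simp
      qed
      moreover have "0 \<le> K\<^sup>2 * s" using s by simp
      ultimately show "\<exists>y. (?k has_real_derivative y) (at s) \<and> y \<le> 0"
        by (intro exI[of _ "- ?f (- real n - s) + ?f (- real n) - 2 * K\<^sup>2 * s"] conjI) (auto simp: abs_le_iff)
    qed
    then show ?thesis by simp
  qed
  have Hnn: "0 \<le> H t x" for x
    unfolding H_eq[OF t] set_lebesgue_integral_def by (intro Bochner_Integration.integral_nonneg) (auto simp: indicator_def)
  have f_le: "?f (- real n) \<le> H t (- real n) / d + K\<^sup>2 * d" if "0 < d" for n d
  proof -
    have "d * ?f (- real n) \<le> H t (- real n) + K\<^sup>2 * d\<^sup>2"
      using Hd[of d n] Hnn[of "- real n - d"] that by linarith
    then show ?thesis using that by (simp add: field_simps power2_eq_square)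
  qed
  have "(\<lambda>n. ?f (- real n)) \<longlonglongrightarrow> 0"
  proof (rule LIMSEQ_I)
    fix e :: real assume e: "0 < e"
    \<comment> \<open>Makes the second term of \<open>f_le\<close> equal to e / 2; with d fixed, the
      energy term tends to 0.\<close>
    define d where "d = e / (2 * K\<^sup>2)"
    have d: "0 < d" "K\<^sup>2 * d = e / 2" using e K by (auto simp: d_def)
    obtain N where N: "\<And>n. n \<ge> N \<Longrightarrow> norm (H t (- real n) - 0) < d * (e / 2)"
      using LIMSEQ_D[OF H0, of "d * (e / 2)"] d e by auto
    have "norm (?f (- real n) - 0) < e" if "n \<ge> N" for n
    proof -
      have "H t (- real n) / d < e / 2" using N[OF that] d Hnn[of "- real n"] by (simp add: field_simps)
      then show ?thesis using f_le[OF d(1), of n] d(2) by simp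
    qed
    then show "\<exists>N. \<forall>n\<ge>N. norm (?f (- real n) - 0) < e" by blast
  qed
  then have "(\<lambda>n. sqrt (2 * ?f (- real n))) \<longlonglongrightarrow> sqrt (2 * 0)" by (intro tendsto_intros)
  then have "(\<lambda>n. \<bar>U t 1 (- real n)\<bar>) \<longlonglongrightarrow> 0" by simp
  then show ?thesis by (rule tendsto_rabs_zero_cancel)
qed

text \<open>Flux of the conservation law
  \<open>(u_x\<^sup>2 / 2)_t + (u * u_x\<^sup>2 / 2)_x = 0\<close>, which follows from the equation
  differentiated in x.\<close>

definition flux :: "real \<Rightarrow> real \<Rightarrow> real" where
  "flux t x = U t 0 x * (U t 1 x)\<^sup>2 / 2"

lemma flux_bound: "t \<in> {0..b} \<Longrightarrow> \<bar>flux t x\<bar> \<le> K ^ 3 / 2"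
proof -
  assume t: "t \<in> {0..b}"
  have "\<bar>U t 0 x\<bar> * \<bar>U t 1 x\<bar>\<^sup>2 \<le> K * K\<^sup>2"
    using bound[OF t, of 0 x] bound[OF t, of 1 x] K by (intro mult_mono power_mono) auto
  then show ?thesis by (simp add: flux_def abs_mult power3_eq_cube power2_eq_square)
qed

lemma flux_ucont: "ucont_on b flux"
proof -
  have "ucont_on b (\<lambda>t x. U t 1 x * U t 1 x)"
    by (rule ucont_on_mult[of _ _ K _ K]) (use ucont[of 1] bound[of _ 1] K in \<open>auto simp del: One_nat_def\<close>)
  moreover have "\<bar>U t 1 x * U t 1 x\<bar> \<le> K * K" if "t \<in> {0..b}" for t x
    using bound[OF that, of 1 x] K unfolding abs_mult by (intro mult_mono) auto
  ultimately have "ucont_on b (\<lambda>t x. U t 0 x * (U t 1 x * U t 1 x))"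
    by (rule ucont_on_mult[of _ _ K _ "K * K", rotated 2])
       (use ucont[of 0] bound[of _ 0] K in \<open>auto simp del: One_nat_def\<close>)
  then show ?thesis
    unfolding ucont_on_def
  proof (intro ballI allI impI)
    fix t e :: real assume t: "t \<in> {0..b}" "0 < e" and u: "\<forall>t\<in>{0..b}. \<forall>e>0. \<forall>\<^sub>F \<tau> in at t within {0..b}. \<forall>x. \<bar>U \<tau> 0 x * (U \<tau> 1 x * U \<tau> 1 x) - U t 0 x * (U t 1 x * U t 1 x)\<bar> \<le> e"
    then have "\<forall>\<^sub>F \<tau> in at t within {0..b}. \<forall>x. \<bar>U \<tau> 0 x * (U \<tau> 1 x * U \<tau> 1 x) - U t 0 x * (U t 1 x * U t 1 x)\<bar> \<le> 2 * e" by auto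
    then show "\<forall>\<^sub>F \<tau> in at t within {0..b}. \<forall>x. \<bar>flux \<tau> x - flux t x\<bar> \<le> e"
    proof (rule eventually_mono, intro allI)
      fix \<tau> x assume *: "\<forall>x. \<bar>U \<tau> 0 x * (U \<tau> 1 x * U \<tau> 1 x) - U t 0 x * (U t 1 x * U t 1 x)\<bar> \<le> 2 * e"
      have "flux \<tau> x - flux t x = (U \<tau> 0 x * (U \<tau> 1 x * U \<tau> 1 x) - U t 0 x * (U t 1 x * U t 1 x)) / 2"
        by (simp add: flux_def power2_eq_square diff_divide_distrib)
      with spec[OF *, of x] show "\<bar>flux \<tau> x - flux t x\<bar> \<le> e" by simp
    qed
  qed
qed

text \<open>On a bounded interval the time derivative of the energy is found by integrating by parts, so that
  only \<open>U 0\<close> is differentiated in time; the boundary term at \<open>-\<infinity>\<close> vanishes in the limit.\<close>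

lemma local_energy_deriv:
  assumes t: "t \<in> {0..b}" and ac: "a \<le> c"
  shows "((\<lambda>t. integral {a..c} (\<lambda>z. (U t 1 z)\<^sup>2 / 2)) has_real_derivative (flux t a - flux t c)) (at t within {0..b})"
proof -
  define V where "V = (\<lambda>x. H t x + g t - U t 0 x * U t 1 x)"
  define D where "D = (\<lambda>\<tau> x. (U \<tau> 0 x - U t 0 x) / (\<tau> - t))"
  have cont: "continuous_on {a..c} (U s i)" if "s \<in> {0..b}" "i \<le> 2" for s i
    using U_cont[OF that] .
  have Hc: "continuous_on {a..c} (H t)"
    by (rule DERIV_continuous_on[OF has_field_derivative_at_within[OF H_deriv[OF t]]])
  have Vc: "continuous_on {a..c} V"
    unfolding V_def by (intro continuous_on_add continuous_on_diff continuous_on_mult continuous_on_const Hc cont t) auto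
  \<comment> \<open>The difference quotient of the squared slopes is the x-derivative of
    \<open>D \<tau>\<close> times the mean of the two slopes. Integration by parts leaves
    \<open>D \<tau>\<close> itself, whose limit is known.\<close>
  have quot: "(integral {a..c} (\<lambda>z. (U \<tau> 1 z)\<^sup>2 / 2) - integral {a..c} (\<lambda>z. (U t 1 z)\<^sup>2 / 2)) / (\<tau> - t) =
     (D \<tau> c * (U \<tau> 1 c + U t 1 c) - D \<tau> a * (U \<tau> 1 a + U t 1 a)) / 2 - integral {a..c} (\<lambda>z. D \<tau> z * (U \<tau> 2 z + U t 2 z) / 2)"
    if \<tau>: "\<tau> \<in> {0..b}" "\<tau> \<noteq> t" for \<tau>
  proof -
    let ?q = "\<lambda>z. ((U \<tau> 1 z)\<^sup>2 / 2 - (U t 1 z)\<^sup>2 / 2) / (\<tau> - t)"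
    have I: "((\<lambda>z. ?q z + D \<tau> z * (U \<tau> 2 z + U t 2 z) / 2) has_integral
       (D \<tau> c * (U \<tau> 1 c + U t 1 c) / 2 - D \<tau> a * (U \<tau> 1 a + U t 1 a) / 2)) {a..c}"
    proof (rule fundamental_theorem_of_calculus[OF ac])
      fix z assume "z \<in> {a..c}"
      have d: "(D \<tau> has_real_derivative (U \<tau> 1 z - U t 1 z) / (\<tau> - t)) (at z)"
        unfolding D_def by (intro DERIV_cdivide DERIV_diff U_deriv \<tau> t)
      have "((\<lambda>z. D \<tau> z * (U \<tau> 1 z + U t 1 z) / 2) has_real_derivative
          ((U \<tau> 1 z - U t 1 z) / (\<tau> - t) * (U \<tau> 1 z + U t 1 z) + (U \<tau> 2 z + U t 2 z) * D \<tau> z) / 2) (at z)"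
        by (intro DERIV_cdivide DERIV_mult DERIV_add d U_deriv \<tau> t)
      also have "((U \<tau> 1 z - U t 1 z) / (\<tau> - t) * (U \<tau> 1 z + U t 1 z) + (U \<tau> 2 z + U t 2 z) * D \<tau> z) / 2
          = ?q z + D \<tau> z * (U \<tau> 2 z + U t 2 z) / 2"
        using \<tau> by (simp add: field_simps power2_eq_square)
      finally show "((\<lambda>z. D \<tau> z * (U \<tau> 1 z + U t 1 z) / 2) has_vector_derivative ?q z + D \<tau> z * (U \<tau> 2 z + U t 2 z) / 2) (at z within {a..c})"
        by (simp add: has_real_derivative_iff_has_vector_derivative has_vector_derivative_at_within)
    qed
    have i1: "(\<lambda>z. D \<tau> z * (U \<tau> 2 z + U t 2 z) / 2) integrable_on {a..c}"
      unfolding D_def using cont[OF t] cont[OF \<tau>(1)] \<tau>(2) by (intro integrable_continuous_interval continuous_intros) auto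
    have i2: "(\<lambda>z. (U s 1 z)\<^sup>2 / 2) integrable_on {a..c}" if "s \<in> {0..b}" for s
      using cont[OF that, of 1] by (intro integrable_continuous_interval continuous_intros) auto
    have qi: "?q integrable_on {a..c}"
      using cont[OF t] cont[OF \<tau>(1)] \<tau>(2) by (intro integrable_continuous_interval continuous_intros) auto
    have qint: "integral {a..c} ?q = (integral {a..c} (\<lambda>z. (U \<tau> 1 z)\<^sup>2 / 2) - integral {a..c} (\<lambda>z. (U t 1 z)\<^sup>2 / 2)) / (\<tau> - t)"
      using i2[OF t] i2[OF \<tau>(1)] by (simp only: integral_divide Henstock_Kurzweil_Integration.integral_diff)
    have "A = (X - Y) / 2 - B" if "A + B = X / 2 - Y / 2" for A B X Y :: real
      using that by argo
    moreover have "integral {a..c} ?q + integral {a..c} (\<lambda>z. D \<tau> z * (U \<tau> 2 z + U t 2 z) / 2) =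
       D \<tau> c * (U \<tau> 1 c + U t 1 c) / 2 - D \<tau> a * (U \<tau> 1 a + U t 1 a) / 2"
      using integral_unique[OF I] Henstock_Kurzweil_Integration.integral_add[OF qi i1] by (rule trans[OF sym, rotated])
    ultimately show ?thesis unfolding qint[symmetric] by blast
  qed
  have lim_U: "((\<lambda>\<tau>. U \<tau> i x) \<longlongrightarrow> U t i x) (at t within {0..b})" if "i \<le> 3" for i x
    using ucont_on_continuous[OF ucont[OF that], of x] t by (simp add: continuous_on_def)
  have lim_D: "((\<lambda>\<tau>. D \<tau> x) \<longlongrightarrow> V x) (at t within {0..b})" for x
  proof (rule tendstoI)
    fix e :: real assume "0 < e"
    then have "\<forall>\<^sub>F \<tau> in at t within {0..b}. \<forall>x. \<bar>D \<tau> x - V x\<bar> \<le> e / 2"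
      unfolding D_def V_def by (intro evol t) simp
    then show "\<forall>\<^sub>F \<tau> in at t within {0..b}. dist (D \<tau> x) (V x) < e"
    proof eventually_elim
      case (elim \<tau>)
      then have "\<bar>D \<tau> x - V x\<bar> \<le> e / 2" by blast
      then show ?case using \<open>0 < e\<close> by (simp add: dist_real_def)
    qed
  qed
  have lim_int: "((\<lambda>\<tau>. integral {a..c} (\<lambda>z. D \<tau> z * (U \<tau> 2 z + U t 2 z) / 2)) \<longlongrightarrow> integral {a..c} (\<lambda>z. V z * U t 2 z)) (at t within {0..b})"
  proof -
    have "bounded (V ` {a..c})"
      by (intro compact_imp_bounded compact_continuous_image Vc) simp
    then obtain BV where "\<forall>x\<in>{a..c}. \<bar>V x\<bar> \<le> BV" by (auto simp: bounded_iff)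
    then have BV: "\<And>x. x \<in> {a..c} \<Longrightarrow> \<bar>V x\<bar> \<le> BV" by blast
    have BV0: "0 \<le> BV" using BV[of a] ac by force
    have "uniform_limit {a..c} (\<lambda>\<tau> z. D \<tau> z * (U \<tau> 2 z + U t 2 z) / 2) (\<lambda>z. V z * U t 2 z) (at t within {0..b})"
    proof (rule uniform_limitI)
      fix e :: real assume e: "0 < e"
      define e1 where "e1 = min 1 (e / (2 * (K + BV + 1)))"
      have den: "0 < K + BV + 1" using K BV0 by simp
      have e1: "0 < e1" "e1 \<le> 1" "e1 * (K + BV + 1) \<le> e / 2"
      proof -
        show "0 < e1" "e1 \<le> 1" using e den by (auto simp: e1_def)
        have "e1 * (K + BV + 1) \<le> e / (2 * (K + BV + 1)) * (K + BV + 1)"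
          using den by (intro mult_right_mono) (auto simp: e1_def)
        also have "\<dots> = e / 2"
        proof -
          have "e / (2 * y) * y = e / 2" if "0 < y" for y :: real using that by simp
          from this[OF den] show ?thesis .
        qed
        finally show "e1 * (K + BV + 1) \<le> e / 2" .
      qed
      have "\<forall>\<^sub>F \<tau> in at t within {0..b}. \<tau> \<in> {0..b}" by (simp add: eventually_at_filter)
      moreover have "\<forall>\<^sub>F \<tau> in at t within {0..b}. \<forall>x. \<bar>D \<tau> x - V x\<bar> \<le> e1"
        unfolding D_def V_def by (intro evol t e1)
      moreover have "\<forall>\<^sub>F \<tau> in at t within {0..b}. \<forall>x. \<bar>U \<tau> 2 x - U t 2 x\<bar> \<le> e1"
        by (intro ucont_onD[OF ucont] t e1) simp
      ultimately show "\<forall>\<^sub>F \<tau> in at t within {0..b}. \<forall>z\<in>{a..c}. dist (D \<tau> z * (U \<tau> 2 z + U t 2 z) / 2) (V z * U t 2 z) < e"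
      proof eventually_elim
        case (elim \<tau>)
        show ?case
        proof
          fix z assume z: "z \<in> {a..c}"
          have 1: "\<bar>D \<tau> z - V z\<bar> \<le> e1" and 2: "\<bar>U \<tau> 2 z - U t 2 z\<bar> \<le> e1" using elim by auto
          have "D \<tau> z * (U \<tau> 2 z + U t 2 z) / 2 - V z * U t 2 z =
            (D \<tau> z - V z) * ((U \<tau> 2 z + U t 2 z) / 2) + V z * ((U \<tau> 2 z - U t 2 z) / 2)"
            by (simp add: algebra_simps add_divide_distrib diff_divide_distrib)
          also have "\<bar>\<dots>\<bar> \<le> \<bar>D \<tau> z - V z\<bar> * \<bar>(U \<tau> 2 z + U t 2 z) / 2\<bar> + \<bar>V z\<bar> * \<bar>(U \<tau> 2 z - U t 2 z) / 2\<bar>"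
            by (simp only: abs_mult[symmetric] abs_triangle_ineq)
          also have "\<dots> \<le> e1 * K + BV * e1"
          proof (intro add_mono mult_mono 1 BV z)
            show "\<bar>(U \<tau> 2 z + U t 2 z) / 2\<bar> \<le> K"
              using bound[OF elim(1), of 2 z] bound[OF t, of 2 z] by (auto simp: abs_le_iff)
            show "\<bar>(U \<tau> 2 z - U t 2 z) / 2\<bar> \<le> e1" using 2 by (auto simp: abs_le_iff)
          qed (use e1 BV0 in auto)
          also have "\<dots> \<le> e1 * (K + BV + 1)" using e1(1) by (simp add: algebra_simps)
          also have "\<dots> < e" using e1(3) e by linarith
          finally show "dist (D \<tau> z * (U \<tau> 2 z + U t 2 z) / 2) (V z * U t 2 z) < e" by (simp add: dist_real_def)
        qed
      qed
    qed
    \<comment> \<open>\<open>uniform_limit_integral\<close> asks for continuity in z at every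
      \<open>\<tau>\<close>, so the integrand is replaced by 0 outside [0, b], where nothing is
      known. At \<open>\<tau> = t\<close> the division by zero makes \<open>D \<tau>\<close>
      vanish.\<close>
    then have ul: "uniform_limit {a..c} (\<lambda>\<tau> z. if \<tau> \<in> {0..b} then D \<tau> z * (U \<tau> 2 z + U t 2 z) / 2 else 0) (\<lambda>z. V z * U t 2 z) (at t within {0..b})"
      by (rule uniform_limit_cong[THEN iffD1, rotated 2]) (auto simp: eventually_at_filter)
    show ?thesis
    proof (cases "at t within {0..b} = bot")
      case False
      have c: "continuous_on {a..c} (\<lambda>z. if \<tau> \<in> {0..b} then D \<tau> z * (U \<tau> 2 z + U t 2 z) / 2 else 0)" for \<tau>
      proof (cases "\<tau> \<in> {0..b} \<and> \<tau> \<noteq> t")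
        case True
        then have "continuous_on {a..c} (\<lambda>z. D \<tau> z * (U \<tau> 2 z + U t 2 z) / 2)"
          unfolding D_def using cont[OF t] cont[of \<tau>] by (intro continuous_intros) auto
        then show ?thesis using True by simp
      next
        case False
        then have "(\<lambda>z. if \<tau> \<in> {0..b} then D \<tau> z * (U \<tau> 2 z + U t 2 z) / 2 else 0) = (\<lambda>z. 0)"
          by (auto simp: D_def)
          then show ?thesis by (simp only: continuous_on_const)
      qed
      obtain I J where IJ: "\<And>\<tau>. ((\<lambda>z. if \<tau> \<in> {0..b} then D \<tau> z * (U \<tau> 2 z + U t 2 z) / 2 else 0) has_integral I \<tau>) {a..c}"
        "((\<lambda>z. V z * U t 2 z) has_integral J) {a..c}" "(I \<longlongrightarrow> J) (at t within {0..b})"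
        using uniform_limit_integral[OF ul c False] by blast
      have "I \<tau> = integral {a..c} (\<lambda>z. D \<tau> z * (U \<tau> 2 z + U t 2 z) / 2)" if "\<tau> \<in> {0..b}" for \<tau>
      proof -
        have "((\<lambda>z. D \<tau> z * (U \<tau> 2 z + U t 2 z) / 2) has_integral I \<tau>) {a..c}"
          using IJ(1)[of \<tau>] by (simp only: that if_True)
        then show ?thesis by (rule integral_unique[symmetric])
      qed
      moreover have "J = integral {a..c} (\<lambda>z. V z * U t 2 z)" using IJ(2) by (simp add: integral_unique)
      ultimately show ?thesis
        using IJ(3) by (auto intro: Lim_transform_eventually simp: eventually_at_filter)
    qed simp
  qed
  \<comment> \<open>\<open>V * U t 1 + flux t\<close> is an antiderivative of
    \<open>V * U t 2\<close>, because \<open>V' * U t 1\<close> and the derivative of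
    \<open>flux t\<close> cancel; thus the boundary terms containing V drop out.\<close>
  have FTC: "V c * U t 1 c - V a * U t 1 a - integral {a..c} (\<lambda>z. V z * U t 2 z) = flux t a - flux t c"
  proof -
    have "((\<lambda>z. V z * U t 2 z) has_integral ((V c * U t 1 c + flux t c) - (V a * U t 1 a + flux t a))) {a..c}"
    proof (rule fundamental_theorem_of_calculus[OF ac])
      fix z assume "z \<in> {a..c}"
      have dV: "(V has_real_derivative ((U t 1 z)\<^sup>2 / 2 + 0) - (U t 1 z * U t 1 z + U t 2 z * U t 0 z)) (at z)"
        unfolding V_def by (intro DERIV_diff DERIV_add DERIV_mult DERIV_const H_deriv U_deriv t)
      have "((\<lambda>z. U t 0 z * (U t 1 z * U t 1 z) / 2) has_real_derivative
          (U t 1 z * (U t 1 z * U t 1 z) + (U t 2 z * U t 1 z + U t 2 z * U t 1 z) * U t 0 z) / 2) (at z)"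
        by (intro DERIV_cdivide DERIV_mult U_deriv t)
      moreover have "flux t = (\<lambda>z. U t 0 z * (U t 1 z * U t 1 z) / 2)"
        by (simp add: flux_def[abs_def] power2_eq_square)
      ultimately have dF: "(flux t has_real_derivative
          (U t 1 z * (U t 1 z * U t 1 z) + (U t 2 z * U t 1 z + U t 2 z * U t 1 z) * U t 0 z) / 2) (at z)" by simp
      have "((\<lambda>z. V z * U t 1 z + flux t z) has_real_derivative
         (((U t 1 z)\<^sup>2 / 2 + 0) - (U t 1 z * U t 1 z + U t 2 z * U t 0 z)) * U t 1 z + U t 2 z * V z +
         (U t 1 z * (U t 1 z * U t 1 z) + (U t 2 z * U t 1 z + U t 2 z * U t 1 z) * U t 0 z) / 2) (at z)"
        by (intro DERIV_add DERIV_mult dV dF U_deriv t)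
      also have "(((U t 1 z)\<^sup>2 / 2 + 0) - (U t 1 z * U t 1 z + U t 2 z * U t 0 z)) * U t 1 z + U t 2 z * V z +
         (U t 1 z * (U t 1 z * U t 1 z) + (U t 2 z * U t 1 z + U t 2 z * U t 1 z) * U t 0 z) / 2 = V z * U t 2 z"
        by (simp add: field_simps power2_eq_square)
      finally show "((\<lambda>z. V z * U t 1 z + flux t z) has_vector_derivative V z * U t 2 z) (at z within {a..c})"
        by (simp add: has_real_derivative_iff_has_vector_derivative has_vector_derivative_at_within)
    qed
    then show ?thesis by (simp add: integral_unique)
  qed
  have "((\<lambda>\<tau>. (D \<tau> c * (U \<tau> 1 c + U t 1 c) - D \<tau> a * (U \<tau> 1 a + U t 1 a)) / 2 - integral {a..c} (\<lambda>z. D \<tau> z * (U \<tau> 2 z + U t 2 z) / 2)) \<longlongrightarrow>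
    (V c * (U t 1 c + U t 1 c) - V a * (U t 1 a + U t 1 a)) / 2 - integral {a..c} (\<lambda>z. V z * U t 2 z)) (at t within {0..b})"
    by (intro tendsto_intros lim_int lim_D lim_U) auto
  also have "(V c * (U t 1 c + U t 1 c) - V a * (U t 1 a + U t 1 a)) / 2 - integral {a..c} (\<lambda>z. V z * U t 2 z) = flux t a - flux t c"
    using FTC by (simp add: algebra_simps diff_divide_distrib add_divide_distrib)
  finally have "((\<lambda>\<tau>. (integral {a..c} (\<lambda>z. (U \<tau> 1 z)\<^sup>2 / 2) - integral {a..c} (\<lambda>z. (U t 1 z)\<^sup>2 / 2)) / (\<tau> - t)) \<longlongrightarrow> flux t a - flux t c) (at t within {0..b})"
    by (rule Lim_transform_eventually) (use quot in \<open>auto simp: eventually_at_filter\<close>)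
  then show ?thesis by (simp add: has_field_derivative_iff)
qed

text \<open>The balance on [a, x] integrated over time, with a sent to \<open>-\<infinity>\<close>:
  there the energy and the slope vanish, and the flux is dominated by
  \<open>K ^ 3 / 2\<close>.\<close>

lemma H_increment:
  assumes t: "t \<in> {0..b}" "\<tau> \<in> {0..b}" "t \<le> \<tau>"
  shows "H \<tau> x - H t x = - integral {t..\<tau>} (\<lambda>s. flux s x)" "(\<lambda>s. flux s x) integrable_on {t..\<tau>}"
proof -
  have sub: "{t..\<tau>} \<subseteq> {0..b}" using t by auto
  have fc: "continuous_on {t..\<tau>} (\<lambda>s. flux s y)" for y
    by (rule continuous_on_subset[OF ucont_on_continuous[OF flux_ucont] sub])
  have fi: "(\<lambda>s. flux s y) integrable_on {t..\<tau>}" for y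
    by (intro integrable_continuous_interval fc)
  show "(\<lambda>s. flux s x) integrable_on {t..\<tau>}" by (rule fi)
  have inc: "(H \<tau> x - H \<tau> a) - (H t x - H t a) = integral {t..\<tau>} (\<lambda>s. flux s a) - integral {t..\<tau>} (\<lambda>s. flux s x)" if "a \<le> x" for a
  proof -
    have HH: "H s x - H s a = integral {a..x} (\<lambda>z. (U s 1 z)\<^sup>2 / 2)" if "s \<in> {0..b}" for s
    proof -
      have "continuous_on UNIV (\<lambda>z. (U s 1 z)\<^sup>2 / 2)" using U_cont[OF that, of 1] by (intro continuous_intros) auto
      from set_integral_atMost_has_derivative(2)[OF this energy[OF that] \<open>a \<le> x\<close>]
      show ?thesis using H_eq[OF that] by simp
    qed
    have "((\<lambda>s. flux s a - flux s x) has_integral (integral {a..x} (\<lambda>z. (U \<tau> 1 z)\<^sup>2 / 2) - integral {a..x} (\<lambda>z. (U t 1 z)\<^sup>2 / 2))) {t..\<tau>}"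
    proof (rule fundamental_theorem_of_calculus[OF t(3)])
      fix s assume "s \<in> {t..\<tau>}"
      then have "s \<in> {0..b}" using sub by auto
      from local_energy_deriv[OF this that]
      show "((\<lambda>t. integral {a..x} (\<lambda>z. (U t 1 z)\<^sup>2 / 2)) has_vector_derivative flux s a - flux s x) (at s within {t..\<tau>})"
        using sub by (auto simp: has_real_derivative_iff_has_vector_derivative intro: has_vector_derivative_within_subset)
    qed
    then have "integral {t..\<tau>} (\<lambda>s. flux s a - flux s x) = (integral {a..x} (\<lambda>z. (U \<tau> 1 z)\<^sup>2 / 2) - integral {a..x} (\<lambda>z. (U t 1 z)\<^sup>2 / 2))"
      by (rule integral_unique)
    then show ?thesis using HH[OF t(1)] HH[OF t(2)] fi by (simp add: Henstock_Kurzweil_Integration.integral_diff)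
  qed
  have "(\<lambda>n. integral {t..\<tau>} (\<lambda>s. flux s (- real n))) \<longlonglongrightarrow> integral {t..\<tau>} (\<lambda>s. 0)"
  proof (rule dominated_convergence(2)[where h="\<lambda>_. K ^ 3 / 2"])
    show "norm (flux s (- real n)) \<le> K ^ 3 / 2" if "s \<in> {t..\<tau>}" for n s
      using flux_bound[of s] that sub by auto
    show "(\<lambda>n. flux s (- real n)) \<longlonglongrightarrow> 0" if "s \<in> {t..\<tau>}" for s
    proof -
      have s: "s \<in> {0..b}" using that sub by auto
      have "(\<lambda>n. K * (U s 1 (- real n))\<^sup>2 / 2) \<longlonglongrightarrow> K * 0\<^sup>2 / 2" by (intro tendsto_intros U1_lim s) simp
      moreover have "norm (flux s (- real n)) \<le> K * (U s 1 (- real n))\<^sup>2 / 2" for n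
        using bound[OF s, of 0 "- real n"] by (simp add: flux_def abs_mult mult_right_mono)
      ultimately show ?thesis by (intro Lim_null_comparison[of "\<lambda>n. flux s (- real n)" "\<lambda>n. K * (U s 1 (- real n))\<^sup>2 / 2"]) auto
    qed
  qed (use fi in auto)
  then have l1: "(\<lambda>n. integral {t..\<tau>} (\<lambda>s. flux s (- real n)) - integral {t..\<tau>} (\<lambda>s. flux s x)) \<longlonglongrightarrow> 0 - integral {t..\<tau>} (\<lambda>s. flux s x)"
    by (intro tendsto_intros) simp
  have H0: "(\<lambda>n. H s (- real n)) \<longlonglongrightarrow> 0" if "s \<in> {0..b}" for s
    unfolding H_eq[OF that] by (rule set_integral_atMost_tendsto_0[OF energy[OF that]])
  have l2: "(\<lambda>n. (H \<tau> x - H \<tau> (- real n)) - (H t x - H t (- real n))) \<longlonglongrightarrow> (H \<tau> x - 0) - (H t x - 0)"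
    by (intro tendsto_intros H0 t)
  obtain N :: nat where N: "- x \<le> real N" using real_arch_simple by blast
  have "(\<lambda>n. (H \<tau> x - H \<tau> (- real n)) - (H t x - H t (- real n))) \<longlonglongrightarrow> 0 - integral {t..\<tau>} (\<lambda>s. flux s x)"
    by (rule Lim_transform_eventually[OF l1]) (use inc N in \<open>auto simp: eventually_sequentially intro!: exI[of _ N]\<close>)
  from LIMSEQ_unique[OF this l2] show "H \<tau> x - H t x = - integral {t..\<tau>} (\<lambda>s. flux s x)" by simp
qed

text \<open>First-order expansion of the energy in time with an error uniform in x, the form of
  forward increment that \<open>Gronwall_Dini\<close> takes.\<close>

lemma H_evol:
  assumes t: "t \<in> {0..b}" and e: "0 < e"
  obtains d where "0 < d" "\<And>\<tau> x. \<tau> \<in> {0..b} \<Longrightarrow> t < \<tau> \<Longrightarrow> \<tau> < t + d \<Longrightarrow> \<bar>H \<tau> x - H t x + (\<tau> - t) * flux t x\<bar> \<le> e * (\<tau> - t)"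
proof -
  obtain d where d: "0 < d" "\<And>s. s \<in> {0..b} \<Longrightarrow> s \<noteq> t \<Longrightarrow> dist s t < d \<Longrightarrow> \<forall>x. \<bar>flux s x - flux t x\<bar> \<le> e"
    using ucont_onD[OF flux_ucont t e] by (auto simp: eventually_at)
  show thesis
  proof (rule that[OF d(1)])
    fix \<tau> x assume \<tau>: "\<tau> \<in> {0..b}" "t < \<tau>" "\<tau> < t + d"
    have "norm (integral {t..\<tau>} (\<lambda>s. flux s x - flux t x)) \<le> integral {t..\<tau>} (\<lambda>s. e)"
    proof (rule integral_norm_bound_integral)
      show "(\<lambda>s. flux s x - flux t x) integrable_on {t..\<tau>}"
        using H_increment(2)[OF t \<tau>(1), of x] \<tau> by (intro Henstock_Kurzweil_Integration.integrable_diff) auto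
      show "norm (flux s x - flux t x) \<le> e" if "s \<in> {t..\<tau>}" for s
        using d(2)[of s] that t \<tau> e by (cases "s = t") (auto simp: dist_real_def)
    qed auto
    moreover have "integral {t..\<tau>} (\<lambda>s. flux s x - flux t x) = integral {t..\<tau>} (\<lambda>s. flux s x) - (\<tau> - t) * flux t x"
      using H_increment(2)[OF t \<tau>(1), of x] \<tau> by (subst Henstock_Kurzweil_Integration.integral_diff) auto
    ultimately show "\<bar>H \<tau> x - H t x + (\<tau> - t) * flux t x\<bar> \<le> e * (\<tau> - t)"
      using H_increment(1)[OF t \<tau>(1), of x] \<tau> by (simp add: mult.commute)
  qed
qed

lemma H_ucont: "ucont_on b H"
  unfolding ucont_on_def
proof (intro ballI allI impI)
  fix t e :: real assume t: "t \<in> {0..b}" and e: "0 < e"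
  have lip: "\<bar>H \<tau> x - H s x\<bar> \<le> K ^ 3 / 2 * \<bar>\<tau> - s\<bar>" if "s \<in> {0..b}" "\<tau> \<in> {0..b}" "s \<le> \<tau>" for s \<tau> x
  proof -
    have "norm (integral {s..\<tau>} (\<lambda>r. flux r x)) \<le> integral {s..\<tau>} (\<lambda>r. K ^ 3 / 2)"
      by (rule integral_norm_bound_integral[OF H_increment(2)[OF that]]) (use flux_bound that in auto)
    then show ?thesis using H_increment(1)[OF that, of x] that by (simp add: mult.commute)
  qed
  then have lip': "\<bar>H \<tau> x - H t x\<bar> \<le> K ^ 3 / 2 * \<bar>\<tau> - t\<bar>" if "\<tau> \<in> {0..b}" for \<tau> x
    using lip[OF t that, of x] lip[OF that t, of x] by (cases "t \<le> \<tau>") (auto simp: abs_minus_commute)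
  have K3: "0 < K ^ 3 / 2" using K by simp
  show "\<forall>\<^sub>F \<tau> in at t within {0..b}. \<forall>x. \<bar>H \<tau> x - H t x\<bar> \<le> e"
    unfolding eventually_at
  proof (intro exI[of _ "e / (K ^ 3 / 2)"] conjI ballI impI allI)
    fix \<tau> x assume "\<tau> \<in> {0..b}" "\<tau> \<noteq> t \<and> dist \<tau> t < e / (K ^ 3 / 2)"
    then show "\<bar>H \<tau> x - H t x\<bar> \<le> e"
      using lip'[of \<tau> x] K3 by (auto simp: dist_real_def field_simps)
  qed (use e K3 in auto)
qed

end

lemma ucont_on_diff:
  assumes f: "ucont_on b f" and g: "ucont_on b g"
  shows "ucont_on b (\<lambda>t x. f t x - g t x)"
  unfolding ucont_on_def
proof (intro ballI allI impI)
  fix t e :: real assume t: "t \<in> {0..b}" and e: "0 < e"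
  have "\<forall>\<^sub>F \<tau> in at t within {0..b}. \<forall>x. \<bar>f \<tau> x - f t x\<bar> \<le> e / 2" by (rule ucont_onD[OF f t]) (use e in simp)
  moreover have "\<forall>\<^sub>F \<tau> in at t within {0..b}. \<forall>x. \<bar>g \<tau> x - g t x\<bar> \<le> e / 2" by (rule ucont_onD[OF g t]) (use e in simp)
  ultimately show "\<forall>\<^sub>F \<tau> in at t within {0..b}. \<forall>x. \<bar>f \<tau> x - g \<tau> x - (f t x - g t x)\<bar> \<le> e"
  proof (eventually_elim, intro allI)
    fix \<tau> x assume "\<forall>x. \<bar>f \<tau> x - f t x\<bar> \<le> e / 2" "\<forall>x. \<bar>g \<tau> x - g t x\<bar> \<le> e / 2"
    then have "\<bar>f \<tau> x - f t x\<bar> \<le> e / 2" "\<bar>g \<tau> x - g t x\<bar> \<le> e / 2" by blast+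
    then show "\<bar>f \<tau> x - g \<tau> x - (f t x - g t x)\<bar> \<le> e" by linarith
  qed
qed

text \<open>The differences \<open>z\<close> of two solutions and \<open>h\<close> of their energies satisfy a linear transport system along
  one of the solutions whose coefficients are bounded, so no derivative is lost in the sup norm.\<close>

theorem regular_flow_unique:
  assumes fU: "regular_flow b g U H K" and fV: "regular_flow b g V I L" and init: "\<And>x. U 0 0 x = V 0 0 x"
    and t: "t \<in> {0..b}"
  shows "U t 0 x = V t 0 x"
proof -
  interpret A: regular_flow b g U H K by fact
  interpret B: regular_flow b g V I L by fact
  define k where "k = K + L + 1"
  have k: "1 \<le> k" "0 < k" using A.K B.K by (auto simp: k_def)
  have Ub: "\<bar>U s i y\<bar> \<le> k" and Vb: "\<bar>V s i y\<bar> \<le> k" if "s \<in> {0..b}" "i \<le> 3" for s i y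
    using A.bound[OF that, of y] B.bound[OF that, of y] A.K B.K by (auto simp: k_def)
  define z where "z = (\<lambda>s y. V s 0 y - U s 0 y)"
  define h where "h = (\<lambda>s y. I s y - H s y)"
  have zu: "ucont_on b z" unfolding z_def by (intro ucont_on_diff A.ucont B.ucont) auto
  have hu: "ucont_on b h" unfolding h_def by (intro ucont_on_diff A.H_ucont B.H_ucont)
  have zb: "\<exists>B. \<forall>y. \<bar>z s y\<bar> \<le> B" if "s \<in> {0..b}" for s
  proof (intro exI[of _ "k + k"] allI)
    show "\<bar>z s y\<bar> \<le> k + k" for y using Ub[OF that, of 0 y] Vb[OF that, of 0 y] by (simp add: z_def)
  qed
  have hb: "\<exists>B. \<forall>y. \<bar>h s y\<bar> \<le> B" if s: "s \<in> {0..b}" for s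
  proof -
    obtain B1 B2 where B12: "\<And>y. \<bar>H s y\<bar> \<le> B1" "\<And>y. \<bar>I s y\<bar> \<le> B2"
      using A.H_bounded[OF s] B.H_bounded[OF s] by blast
    have "\<bar>h s y\<bar> \<le> B1 + B2" for y unfolding h_def using B12(1)[of y] B12(2)[of y] by linarith
    then show ?thesis by blast
  qed
  have Sz: "continuous_on {0..b} (\<lambda>s. SUP y. \<bar>z s y\<bar>)" "\<And>s y. s \<in> {0..b} \<Longrightarrow> \<bar>z s y\<bar> \<le> (SUP y. \<bar>z s y\<bar>)"
    and Sh: "continuous_on {0..b} (\<lambda>s. SUP y. \<bar>h s y\<bar>)" "\<And>s y. s \<in> {0..b} \<Longrightarrow> \<bar>h s y\<bar> \<le> (SUP y. \<bar>h s y\<bar>)"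
    using ucont_on_SUP(1,3)[OF zu zb] ucont_on_SUP(1,3)[OF hu hb] by blast+
  define M where "M = (\<lambda>s. max (SUP y. \<bar>z s y\<bar>) (SUP y. \<bar>h s y\<bar>))"
  have zM: "\<bar>z s y\<bar> \<le> M s" and hM: "\<bar>h s y\<bar> \<le> M s" if "s \<in> {0..b}" for s y
    using Sz(2)[OF that, of y] Sh(2)[OF that, of y] by (auto simp: M_def)
  have M_le: "M s \<le> c" if "\<And>y. \<bar>z s y\<bar> \<le> c" "\<And>y. \<bar>h s y\<bar> \<le> c" for s c
    unfolding M_def by (intro max.boundedI cSUP_least that) auto
  have M_nonneg: "0 \<le> M s" if "s \<in> {0..b}" for s
    using order_trans[OF abs_ge_zero zM[OF that]] .
  have z_deriv: "(z s has_real_derivative V s 1 y - U s 1 y) (at y)" if "s \<in> {0..b}" for s y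
    unfolding z_def by (intro DERIV_diff A.U_deriv B.U_deriv that)
  have h_deriv: "(h s has_real_derivative (V s 1 y)\<^sup>2 / 2 - (U s 1 y)\<^sup>2 / 2) (at y)" if "s \<in> {0..b}" for s y
    unfolding h_def by (intro DERIV_diff A.H_deriv B.H_deriv that)
  have "M t \<le> 0"
  \<comment> \<open>Contributions to the rate: 1 from h in the equation of z, k from z times a slope
    there, and \<open>k\<^sup>2\<close> from z times a squared slope in the equation of h.\<close>
  proof (rule Gronwall_Dini[of b M "1 + k + k\<^sup>2"])
    show "continuous_on {0..b} M" unfolding M_def by (intro continuous_intros Sz(1) Sh(1))
    show "M 0 \<le> 0"
    proof (rule M_le)
      have 0: "0 \<in> {0..b}" using A.b by simp
      have "V 0 0 = U 0 0" using init by auto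
      then have "(U 0 0 has_real_derivative V 0 1 y) (at y)" for y using B.U_deriv(1)[OF 0, of y] by simp
      then have "V 0 1 y = U 0 1 y" for y using A.U_deriv(1)[OF 0, of y] DERIV_unique by blast
      then show "\<bar>h 0 y\<bar> \<le> 0" for y by (simp add: h_def A.H_eq[OF 0] B.H_eq[OF 0])
      show "\<bar>z 0 y\<bar> \<le> 0" for y by (simp add: z_def init)
    qed
    show "0 \<le> 1 + k + k\<^sup>2" using k by simp
    show "t \<in> {0..b}" by fact
    fix s e :: real assume s': "s \<in> {0..<b}" and e: "0 < e"
    then have s: "s \<in> {0..b}" by auto
    have e4: "0 < e / 4" using e by simp
    obtain d1 where d1: "0 < d1" "\<And>\<tau>. \<tau> \<in> {0..b} \<Longrightarrow> \<tau> \<noteq> s \<Longrightarrow> dist \<tau> s < d1 \<Longrightarrow> \<forall>y. \<bar>(U \<tau> 0 y - U s 0 y) / (\<tau> - s) - (H s y + g s - U s 0 y * U s 1 y)\<bar> \<le> e / 4"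
      using A.evol[OF s e4] by (auto simp: eventually_at)
    obtain d2 where d2: "0 < d2" "\<And>\<tau>. \<tau> \<in> {0..b} \<Longrightarrow> \<tau> \<noteq> s \<Longrightarrow> dist \<tau> s < d2 \<Longrightarrow> \<forall>y. \<bar>(V \<tau> 0 y - V s 0 y) / (\<tau> - s) - (I s y + g s - V s 0 y * V s 1 y)\<bar> \<le> e / 4"
      using B.evol[OF s e4] by (auto simp: eventually_at)
    obtain d3 where d3: "0 < d3" "\<And>\<tau> x. \<tau> \<in> {0..b} \<Longrightarrow> s < \<tau> \<Longrightarrow> \<tau> < s + d3 \<Longrightarrow> \<bar>H \<tau> x - H s x + (\<tau> - s) * A.flux s x\<bar> \<le> e / 4 * (\<tau> - s)"
      using A.H_evol[OF s e4] by blast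
    obtain d4 where d4: "0 < d4" "\<And>\<tau> x. \<tau> \<in> {0..b} \<Longrightarrow> s < \<tau> \<Longrightarrow> \<tau> < s + d4 \<Longrightarrow> \<bar>I \<tau> x - I s x + (\<tau> - s) * B.flux s x\<bar> \<le> e / 4 * (\<tau> - s)"
      using B.H_evol[OF s e4] by blast
    \<comment> \<open>The last entry makes the quadratic Taylor errors, at most
      \<open>2 * k ^ 4 * \<delta>\<^sup>2\<close>, smaller than \<open>e / 4 * \<delta>\<close>;
      together with the two expansion errors the total stays below
      \<open>e * \<delta>\<close>.\<close>
    define d where "d = Min {d1, d2, d3, d4, e / (8 * k ^ 4)}"
    have d: "0 < d" "d \<le> d1" "d \<le> d2" "d \<le> d3" "d \<le> d4" "d \<le> e / (8 * k ^ 4)"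
      using d1(1) d2(1) d3(1) d4(1) e k by (auto simp: d_def)
    show "\<exists>d>0. \<forall>\<tau>\<in>{0..b}. s < \<tau> \<and> \<tau> < s + d \<longrightarrow> M \<tau> \<le> M s + ((1 + k + k\<^sup>2) * M s + e) * (\<tau> - s)"
    proof (intro exI[of _ d] conjI ballI impI d)
      fix \<tau> assume \<tau>: "\<tau> \<in> {0..b}" and "s < \<tau> \<and> \<tau> < s + d"
      define \<delta> where "\<delta> = \<tau> - s"
      have \<delta>: "0 < \<delta>" "\<delta> < d" "\<tau> \<noteq> s" "dist \<tau> s = \<delta>" "s < \<tau>" "\<tau> - s = \<delta>"
        using \<open>s < \<tau> \<and> \<tau> < s + d\<close> by (auto simp: \<delta>_def dist_real_def)
      have quad: "8 * k ^ 4 * \<delta> \<le> e"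
      proof -
        have "8 * k ^ 4 * \<delta> \<le> 8 * k ^ 4 * (e / (8 * k ^ 4))"
          using \<delta>(2) d(6) k by (intro mult_left_mono) auto
        then show ?thesis using k by simp
      qed
      have kp: "k ^ 3 \<le> k ^ 4" using k by (intro power_increasing) auto
      have M0: "0 \<le> M s" by (rule M_nonneg[OF s])
      have zl: "\<bar>(V s 1 x - U s 1 x) - (V s 1 y - U s 1 y)\<bar> \<le> 2 * k * \<bar>x - y\<bar>" for x y
      proof -
        have "norm ((V s 1 x - U s 1 x) - (V s 1 y - U s 1 y)) \<le> 2 * k * norm (x - y)"
        proof (rule field_differentiable_bound[of UNIV "\<lambda>x. V s 1 x - U s 1 x" "\<lambda>x. V s 2 x - U s 2 x"])
          show "((\<lambda>x. V s 1 x - U s 1 x) has_field_derivative V s 2 y - U s 2 y) (at y within UNIV)" for y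
            by (intro DERIV_diff A.U_deriv B.U_deriv s)
          show "norm (V s 2 y - U s 2 y) \<le> 2 * k" for y
            using Ub[OF s, of 2 y] Vb[OF s, of 2 y] by simp
        qed auto
        then show ?thesis by simp
      qed
      have hl: "\<bar>((V s 1 x)\<^sup>2 / 2 - (U s 1 x)\<^sup>2 / 2) - ((V s 1 y)\<^sup>2 / 2 - (U s 1 y)\<^sup>2 / 2)\<bar> \<le> 2 * k\<^sup>2 * \<bar>x - y\<bar>" for x y
      proof -
        have "norm (((V s 1 x)\<^sup>2 / 2 - (U s 1 x)\<^sup>2 / 2) - ((V s 1 y)\<^sup>2 / 2 - (U s 1 y)\<^sup>2 / 2)) \<le> 2 * k\<^sup>2 * norm (x - y)"
        proof (rule field_differentiable_bound[of UNIV "\<lambda>x. (V s 1 x)\<^sup>2 / 2 - (U s 1 x)\<^sup>2 / 2" "\<lambda>x. V s 1 x * V s 2 x - U s 1 x * U s 2 x"])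
          show "((\<lambda>x. (V s 1 x)\<^sup>2 / 2 - (U s 1 x)\<^sup>2 / 2) has_field_derivative V s 1 y * V s 2 y - U s 1 y * U s 2 y) (at y within UNIV)" for y
            using A.U_deriv(2)[OF s, of y] B.U_deriv(2)[OF s, of y] by (auto intro!: derivative_eq_intros simp del: One_nat_def)
          have p: "\<bar>a * c\<bar> \<le> k\<^sup>2" if "\<bar>a\<bar> \<le> k" "\<bar>c\<bar> \<le> k" for a c
            using that unfolding abs_mult power2_eq_square by (intro mult_mono) auto
          show "norm (V s 1 y * V s 2 y - U s 1 y * U s 2 y) \<le> 2 * k\<^sup>2" for y
            using p[OF Vb[OF s, of 1 y] Vb[OF s, of 2 y]] p[OF Ub[OF s, of 1 y] Ub[OF s, of 2 y]] by simp
        qed auto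
        then show ?thesis by simp
      qed
      have sh: "\<bar>\<delta> * V s 0 y\<bar> \<le> \<delta> * k" for y
        using Vb[OF s, of 0 y] \<delta> by (simp add: abs_mult)
      have "\<bar>z \<tau> y\<bar> \<le> M s + ((1 + k + k\<^sup>2) * M s + e) * \<delta>" for y
      proof -
        have a: "\<bar>U \<tau> 0 y - U s 0 y - \<delta> * (H s y + g s - U s 0 y * U s 1 y)\<bar> \<le> e / 4 * \<delta>"
        proof -
          have "\<bar>(U \<tau> 0 y - U s 0 y) / \<delta> - (H s y + g s - U s 0 y * U s 1 y)\<bar> * \<delta> \<le> e / 4 * \<delta>"
            using d1(2)[OF \<tau> \<delta>(3)] \<delta> d by (intro mult_right_mono) auto
          moreover have "\<bar>(U \<tau> 0 y - U s 0 y) / \<delta> - X\<bar> * \<delta> = \<bar>U \<tau> 0 y - U s 0 y - \<delta> * X\<bar>" for X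
          proof -
            have "\<bar>(U \<tau> 0 y - U s 0 y) / \<delta> - X\<bar> * \<delta> = \<bar>((U \<tau> 0 y - U s 0 y) / \<delta> - X) * \<delta>\<bar>" using \<delta>(1) by (simp add: abs_mult)
            also have "((U \<tau> 0 y - U s 0 y) / \<delta> - X) * \<delta> = U \<tau> 0 y - U s 0 y - \<delta> * X" using \<delta>(1) by (simp add: field_simps)
            finally show ?thesis .
          qed
          ultimately show ?thesis by simp
        qed
        have c: "\<bar>V \<tau> 0 y - V s 0 y - \<delta> * (I s y + g s - V s 0 y * V s 1 y)\<bar> \<le> e / 4 * \<delta>"
        proof -
          have "\<bar>(V \<tau> 0 y - V s 0 y) / \<delta> - (I s y + g s - V s 0 y * V s 1 y)\<bar> * \<delta> \<le> e / 4 * \<delta>"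
            using d2(2)[OF \<tau> \<delta>(3)] \<delta> d by (intro mult_right_mono) auto
          moreover have "\<bar>(V \<tau> 0 y - V s 0 y) / \<delta> - X\<bar> * \<delta> = \<bar>V \<tau> 0 y - V s 0 y - \<delta> * X\<bar>" for X
          proof -
            have "\<bar>(V \<tau> 0 y - V s 0 y) / \<delta> - X\<bar> * \<delta> = \<bar>((V \<tau> 0 y - V s 0 y) / \<delta> - X) * \<delta>\<bar>" using \<delta>(1) by (simp add: abs_mult)
            also have "((V \<tau> 0 y - V s 0 y) / \<delta> - X) * \<delta> = V \<tau> 0 y - V s 0 y - \<delta> * X" using \<delta>(1) by (simp add: field_simps)
            finally show ?thesis .
          qed
          ultimately show ?thesis by simp
        qed
        \<comment> \<open>The transport is taken along V, so that the remaining term, z times the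
          slope of U, contains no derivative of z.\<close>
        have eq: "z \<tau> y = (z s y - (\<delta> * V s 0 y) * (V s 1 y - U s 1 y)) + \<delta> * h s y - \<delta> * (z s y * U s 1 y)
          + (V \<tau> 0 y - V s 0 y - \<delta> * (I s y + g s - V s 0 y * V s 1 y)) - (U \<tau> 0 y - U s 0 y - \<delta> * (H s y + g s - U s 0 y * U s 1 y))"
          by (simp add: z_def h_def algebra_simps)
        have 1: "\<bar>z s y - (\<delta> * V s 0 y) * (V s 1 y - U s 1 y)\<bar> \<le> M s + 2 * k * (\<delta> * k)\<^sup>2"
          by (rule taylor_shift_le[OF z_deriv[OF s] zl zM[OF s] sh])
        have "2 * k * (\<delta> * k)\<^sup>2 = (2 * k ^ 3 * \<delta>) * \<delta>" by (simp add: power2_eq_square power3_eq_cube)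
        also have "\<dots> \<le> (e / 4) * \<delta>"
        proof (rule mult_right_mono)
          have "k ^ 3 * \<delta> \<le> k ^ 4 * \<delta>" using kp \<delta>(1) by (intro mult_right_mono) auto
          then show "2 * k ^ 3 * \<delta> \<le> e / 4" using quad by linarith
        qed (use \<delta> in simp)
        finally have 2: "2 * k * (\<delta> * k)\<^sup>2 \<le> (e / 4) * \<delta>" .
        have 3: "\<bar>\<delta> * h s y\<bar> \<le> M s * \<delta>"
          using mult_left_mono[OF hM[OF s, of y], of \<delta>] \<delta>(1) by (simp add: abs_mult mult.commute)
        have 4: "\<bar>\<delta> * (z s y * U s 1 y)\<bar> \<le> k * M s * \<delta>"
        proof -
          have "\<bar>z s y\<bar> * \<bar>U s 1 y\<bar> \<le> M s * k" using zM[OF s, of y] Ub[OF s, of 1 y] M0 by (intro mult_mono) auto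
          then have "\<delta> * (\<bar>z s y\<bar> * \<bar>U s 1 y\<bar>) \<le> \<delta> * (M s * k)" using \<delta>(1) by (intro mult_left_mono) auto
          then show ?thesis using \<delta>(1) by (simp add: abs_mult mult_ac)
        qed
        have "0 \<le> k\<^sup>2 * M s * \<delta>" using M0 \<delta>(1) by simp
        moreover have "0 \<le> e * \<delta>" using e \<delta>(1) by simp
        moreover have "((1 + k + k\<^sup>2) * M s + e) * \<delta> = M s * \<delta> + k * M s * \<delta> + k\<^sup>2 * M s * \<delta> + e * \<delta>"
          by (simp add: algebra_simps)
        ultimately show ?thesis
          unfolding eq using 1 2 3 4 a c by linarith
      qed
      moreover have "\<bar>h \<tau> y\<bar> \<le> M s + ((1 + k + k\<^sup>2) * M s + e) * \<delta>" for y
      proof -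
        have a: "\<bar>H \<tau> y - H s y + \<delta> * A.flux s y\<bar> \<le> e / 4 * \<delta>"
          using d3(2)[OF \<tau> \<delta>(5), of y] \<delta> d by simp
        have c: "\<bar>I \<tau> y - I s y + \<delta> * B.flux s y\<bar> \<le> e / 4 * \<delta>"
          using d4(2)[OF \<tau> \<delta>(5), of y] \<delta> d by simp
        have eq: "h \<tau> y = (h s y - (\<delta> * V s 0 y) * ((V s 1 y)\<^sup>2 / 2 - (U s 1 y)\<^sup>2 / 2)) - \<delta> * (z s y * (U s 1 y)\<^sup>2 / 2)
          + (I \<tau> y - I s y + \<delta> * B.flux s y) - (H \<tau> y - H s y + \<delta> * A.flux s y)"
          by (simp add: z_def h_def A.flux_def B.flux_def field_simps)
        have 1: "\<bar>h s y - (\<delta> * V s 0 y) * ((V s 1 y)\<^sup>2 / 2 - (U s 1 y)\<^sup>2 / 2)\<bar> \<le> M s + 2 * k\<^sup>2 * (\<delta> * k)\<^sup>2"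
          by (rule taylor_shift_le[OF h_deriv[OF s] hl hM[OF s] sh])
        have "2 * k\<^sup>2 * (\<delta> * k)\<^sup>2 = (2 * k ^ 4 * \<delta>) * \<delta>" by (simp add: power2_eq_square power4_eq_xxxx mult_ac)
        also have "\<dots> \<le> (e / 4) * \<delta>"
          using quad \<delta>(1) by (intro mult_right_mono) auto
        finally have 2: "2 * k\<^sup>2 * (\<delta> * k)\<^sup>2 \<le> (e / 4) * \<delta>" .
        have 4: "\<bar>\<delta> * (z s y * (U s 1 y)\<^sup>2 / 2)\<bar> \<le> k\<^sup>2 * M s * \<delta>"
        proof -
          have "\<bar>U s 1 y\<bar>\<^sup>2 \<le> k\<^sup>2" using Ub[OF s, of 1 y] by (intro power_mono) auto
          then have "\<bar>z s y\<bar> * (U s 1 y)\<^sup>2 \<le> M s * k\<^sup>2" using zM[OF s, of y] M0 by (intro mult_mono) auto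
          moreover have "0 \<le> M s * k\<^sup>2" using M0 by simp
          ultimately have "\<bar>z s y\<bar> * (U s 1 y)\<^sup>2 / 2 \<le> M s * k\<^sup>2" by linarith
          then have "\<delta> * (\<bar>z s y\<bar> * (U s 1 y)\<^sup>2 / 2) \<le> \<delta> * (M s * k\<^sup>2)" using \<delta>(1) M0 by (intro mult_left_mono) auto
          then show ?thesis using \<delta>(1) by (simp add: abs_mult mult_ac)
        qed
        have "0 \<le> k * M s * \<delta>" "0 \<le> M s * \<delta>" using M0 k \<delta>(1) by simp_all
        moreover have "0 \<le> e * \<delta>" using e \<delta>(1) by simp
        moreover have "((1 + k + k\<^sup>2) * M s + e) * \<delta> = M s * \<delta> + k * M s * \<delta> + k\<^sup>2 * M s * \<delta> + e * \<delta>"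
          by (simp add: algebra_simps)
        ultimately show ?thesis
          unfolding eq using 1 2 4 a c by linarith
      qed
      ultimately show "M \<tau> \<le> M s + ((1 + k + k\<^sup>2) * M s + e) * (\<tau> - s)"
        unfolding \<delta>(6) by (rule M_le)
    qed
  qed
  then have "\<bar>z t x\<bar> \<le> 0" using zM[OF t, of x] by linarith
  then show ?thesis by (simp add: z_def)
qed

section \<open>Weak derivatives and smooth representatives of solutions\<close>

lemma schwartz_vderiv: "\<psi> \<in> schwartz \<Longrightarrow> vderiv \<psi> \<in> schwartz"
proof -
  assume \<psi>: "\<psi> \<in> schwartz"
  have eq: "(vderiv ^^ n) (vderiv \<psi>) = (vderiv ^^ Suc n) \<psi>" for n by (simp add: funpow_swap1)
  have "bounded (range (\<lambda>x. x ^ m *\<^sub>R (vderiv ^^ Suc n) \<psi> x))" for m n using \<psi> unfolding schwartz_def by blast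
  then show ?thesis using \<psi> smooth_vderiv unfolding schwartz_def by (auto simp: eq simp del: funpow.simps)
qed

lemma tendsto_0_inverse_1_plus_sq:
  fixes f :: "real \<Rightarrow> complex"
  assumes "\<And>x. cmod (f x) \<le> C / (1 + x\<^sup>2)"
  shows "(f \<longlongrightarrow> 0) at_top" "(f \<longlongrightarrow> 0) at_bot"
proof -
  have "((\<lambda>x. C / (1 + x\<^sup>2)) \<longlongrightarrow> 0) at_top" "((\<lambda>x. C / (1 + x\<^sup>2)) \<longlongrightarrow> 0) at_bot" by real_asymp+
  then show "(f \<longlongrightarrow> 0) at_top" "(f \<longlongrightarrow> 0) at_bot"
    using assms by (auto intro: Lim_null_comparison[rotated])
qed

text \<open>Integration by parts against Schwartz functions; u may differ from the differentiable f
  on a null set, as a representative of a bounded function does.\<close>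

lemma is_fun_deriv_distr:
  assumes f: "\<And>x. (f has_real_derivative f' x) (at x)" "\<And>x. \<bar>f x\<bar> \<le> B" "\<And>x. \<bar>f' x\<bar> \<le> B'"
    and [measurable]: "f' \<in> borel_measurable borel" "u \<in> borel_measurable borel" and u: "AE x in lborel. u x = f x"
  shows "is_fun (deriv_distr (rdistr u)) (cfun f')"
  unfolding is_fun_def
proof (intro conjI ballI)
  have t': "tempered_fun (cfun f')"
    by (rule tempered_fun_bounded[of _ B']) (use f in auto)
  then show "tempered_fun (cfun f')" .
  have fv: "(cfun f has_vector_derivative of_real (f' x)) (at x)" for x by (intro has_vector_derivative_of_real f)
  have [measurable]: "cfun f \<in> borel_measurable borel" by (rule has_vderiv_measurable[OF fv])
  have t: "tempered_fun (cfun f)"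
    by (rule tempered_fun_bounded[of _ B]) (use f in auto)
  fix \<psi> :: "real \<Rightarrow> complex" assume \<psi>: "\<psi> \<in> schwartz"
  note [measurable] = schwartz_measurable[OF schwartz_vderiv[OF \<psi>]]
  have i1: "integrable lborel (\<lambda>x. cfun f x * vderiv \<psi> x)"
    using t schwartz_vderiv[OF \<psi>] by (simp add: tempered_fun_def)
  have i2: "integrable lborel (\<lambda>x. cfun f' x * \<psi> x)"
    using t' \<psi> by (simp add: tempered_fun_def)
  obtain C where C: "\<And>x. cmod (\<psi> x) \<le> C / (1 + x\<^sup>2)" using schwartz_le[OF \<psi>] by blast
  have le: "cmod (cfun f x * \<psi> x) \<le> (B * C) / (1 + x\<^sup>2)" for x
  proof -
    have "cmod (cfun f x * \<psi> x) \<le> B * (C / (1 + x\<^sup>2))"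
      unfolding norm_mult using f(2)[of x] C[of x] order_trans[OF abs_ge_zero f(2)[of x]] by (intro mult_mono) auto
    then show ?thesis by simp
  qed
  have "(\<integral>x. cfun f x * vderiv \<psi> x + cfun f' x * \<psi> x \<partial>lborel) = 0"
    by (rule integral_derivative_eq_0[OF has_vector_derivative_mult[OF fv smooth_vderiv_at[OF schwartz_smooth[OF \<psi>]]]])
       (use i1 i2 tendsto_0_inverse_1_plus_sq[OF le] in auto)
  then have "(\<integral>x. cfun f x * vderiv \<psi> x \<partial>lborel) + (\<integral>x. cfun f' x * \<psi> x \<partial>lborel) = 0"
    by (simp add: Bochner_Integration.integral_add[OF i1 i2])
  moreover have "(\<integral>x. cfun u x * vderiv \<psi> x \<partial>lborel) = (\<integral>x. cfun f x * vderiv \<psi> x \<partial>lborel)"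
    by (rule integral_cong_AE) (use u in \<open>auto elim: eventually_mono\<close>)
  ultimately show "deriv_distr (rdistr u) \<psi> = distr_of (cfun f') \<psi>"
    by (simp add: deriv_distr_def distr_of_def add_eq_0_iff)
qed

lemma Linf_norm_AE:
  assumes "Linf_norm f \<le> ennreal e" "0 \<le> e"
  shows "AE x in lborel. \<bar>f x\<bar> \<le> e"
proof -
  have "AE x in lborel. ennreal \<bar>f x\<bar> \<le> Linf_norm f"
    unfolding Linf_norm_def lp_norm_def using esssup_AE[where M=lborel and f="\<lambda>x. ennreal \<bar>f x\<bar>"] by simp
  then show ?thesis
  proof eventually_elim
    case (elim x)
    then have "ennreal \<bar>f x\<bar> \<le> ennreal e" using assms(1) by (rule order_trans)
    then show ?case using assms(2) by simp
  qed
qed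

context LP
begin

text \<open>Identifies the weak derivative w of a solution with the classical derivative of its
  smooth representative. The difference of f and g has vanishing integral against all transforms of
  test functions.\<close>

lemma is_fun_unique:
  assumes "is_fun W f" "is_fun W g"
  shows "AE x in lborel. f x = g x"
proof -
  have m: "f \<in> borel_measurable lborel" "g \<in> borel_measurable lborel" and
    i: "\<And>\<psi>. \<psi> \<in> schwartz \<Longrightarrow> integrable lborel (\<lambda>x. f x * \<psi> x)" "\<And>\<psi>. \<psi> \<in> schwartz \<Longrightarrow> integrable lborel (\<lambda>x. g x * \<psi> x)"
    using assms by (auto simp: is_fun_def tempered_fun_def)
  have eq: "(\<integral>x. (f x - g x) * \<psi> x \<partial>lborel) = 0" if "\<psi> \<in> schwartz" for \<psi>
    using assms that Bochner_Integration.integral_diff[OF i(1,2)[OF that]] by (simp add: is_fun_def distr_of_def left_diff_distrib)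
  have "AE x in lborel. f x - g x = 0"
  proof (rule tempered_fun_eq_0[OF _ _ chi_test fourier_chi_neq_0])
    show "tempered_fun (\<lambda>x. f x - g x)"
      unfolding tempered_fun_def using m i by (auto simp: left_diff_distrib)
    show "(\<integral>x. (f x - g x) * fourier \<theta> x \<partial>lborel) = 0" if "\<theta> \<in> test_funs" for \<theta>
      by (rule eq[OF fourier_test_funs_schwartz[OF that]])
  qed
  then show ?thesis by simp
qed

text \<open>On a Schwartz function a block integrates f against a measurable function, so it does
  not see null sets, and the seminorm depends on these values only.\<close>

lemma hBesov_norm_cong_AE:
  assumes [measurable]: "f \<in> borel_measurable borel" "h \<in> borel_measurable borel" and ae: "AE x in lborel. f x = h x"
  shows "hBesov_norm \<phi> s p r (rdistr f) = hBesov_norm \<phi> s p r (rdistr h)"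
proof -
  have "hblock \<phi> j (rdistr f) \<psi> = hblock \<phi> j (rdistr h) \<psi>" if \<psi>: "\<psi> \<in> schwartz" for j \<psi>
  proof -
    have t: "cfun (\<lambda>\<xi>. \<phi> (\<xi> / 2 powi j)) \<in> test_funs"
      using test_funs_scale[OF phi_test, of "2 powi j"] by simp
    note [measurable] = schwartz_measurable[OF \<psi>] inv_fourier_test_funs_measurable[OF t]
    let ?G = "fourier (\<lambda>\<xi>. cfun (\<lambda>\<xi>. \<phi> (\<xi> / 2 powi j)) \<xi> * inv_fourier \<psi> \<xi>)"
    have "?G = (\<lambda>x. \<integral>y. \<psi> y * inv_fourier (cfun (\<lambda>\<xi>. \<phi> (\<xi> / 2 powi j))) (y - x) \<partial>lborel)"
      by (rule ext, rule fourier_mult_inv_fourier[OF t schwartz_integrable[OF \<psi>]])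
    also have "\<dots> \<in> borel_measurable borel" by measurable
    finally have [measurable]: "?G \<in> borel_measurable borel" .
    have "(\<integral>x. cfun f x * ?G x \<partial>lborel) = (\<integral>x. cfun h x * ?G x \<partial>lborel)"
      by (rule integral_cong_AE) (use ae in \<open>auto elim: eventually_mono\<close>)
    then show ?thesis unfolding hblock_eq mult_op_apply distr_of_def .
  qed
  then have "is_fun (hblock \<phi> j (rdistr f)) k \<longleftrightarrow> is_fun (hblock \<phi> j (rdistr h)) k" for j k
    by (simp add: is_fun_def)
  then show ?thesis by (simp add: hBesov_norm_def Lp_distr_def)
qed

text \<open>The sup norm bounds f almost everywhere, while \<open>smooth_representative\<close>
  wants a bound at every point; truncation at height R changes f on a null set only. The bound is
  linear in R, so the same constant serves for differences.\<close>

lemma E_norm_representative: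
  obtains C where "0 < C" "\<And>p r f R. \<lbrakk>1 \<le> p; 1 \<le> r; f \<in> borel_measurable borel; E_norm \<phi> p r 6 f \<le> ennreal R; 0 \<le> R\<rbrakk> \<Longrightarrow>
    \<exists>F::nat \<Rightarrow> real \<Rightarrow> real. (AE x in lborel. f x = F 0 x) \<and>
      (\<forall>i\<le>3. \<forall>x. \<bar>F i x\<bar> \<le> C * R) \<and> (\<forall>i<3. \<forall>x. (F i has_real_derivative F (Suc i) x) (at x))"
proof -
  show thesis
  proof (rule smooth_representative)
    fix C assume C: "0 < C" "\<And>p r f B R. \<lbrakk>1 \<le> p; 1 \<le> r; f \<in> borel_measurable borel; \<And>x. \<bar>f x\<bar> \<le> B;
        hBesov_norm \<phi> 6 p r (rdistr f) \<le> ennreal R; 0 \<le> R\<rbrakk> \<Longrightarrow>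
      \<exists>F::nat \<Rightarrow> real \<Rightarrow> real. (AE x in lborel. f x = F 0 x) \<and>
        (\<forall>i\<le>3. \<forall>x. \<bar>F i x\<bar> \<le> C * (B + R)) \<and> (\<forall>i<3. \<forall>x. (F i has_real_derivative F (Suc i) x) (at x))"
    show thesis
    proof (rule that[of "2 * C"])
      fix p r :: ennreal and f R
      assume p: "1 \<le> p" and r: "1 \<le> r" and f[measurable]: "f \<in> borel_measurable borel" and E: "E_norm \<phi> p r 6 f \<le> ennreal R" and R: "0 \<le> R"
      have Li: "Linf_norm f \<le> ennreal R"
        using order_trans[OF _ E] by (simp add: E_norm_def add_increasing2)
      have hB: "hBesov_norm \<phi> 6 p r (rdistr f) \<le> ennreal R"
      proof (rule order_trans[OF _ E])
        show "hBesov_norm \<phi> 6 p r (rdistr f) \<le> E_norm \<phi> p r 6 f"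
          unfolding E_norm_def by (metis add.assoc add.commute le_iff_add)
      qed
      define h where "h = (\<lambda>x. max (- R) (min R (f x)))"
      have hm [measurable]: "h \<in> borel_measurable borel" unfolding h_def by measurable
      have ae: "AE x in lborel. f x = h x"
        using Linf_norm_AE[OF Li R] by eventually_elim (auto simp: h_def abs_le_iff)
      have "\<bar>h x\<bar> \<le> R" for x using R by (auto simp: h_def)
      from C(2)[OF p r hm this _ R] hB[unfolded hBesov_norm_cong_AE[OF f hm ae]]
      obtain F :: "nat \<Rightarrow> real \<Rightarrow> real" where F: "AE x in lborel. h x = F 0 x" "\<forall>i\<le>3. \<forall>x. \<bar>F i x\<bar> \<le> C * (R + R)" "\<forall>i<3. \<forall>x. (F i has_real_derivative F (Suc i) x) (at x)"
        by auto
      have "AE x in lborel. f x = F 0 x" using ae F(1) by eventually_elim simp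
      then show "\<exists>F::nat \<Rightarrow> real \<Rightarrow> real. (AE x in lborel. f x = F 0 x) \<and>
        (\<forall>i\<le>3. \<forall>x. \<bar>F i x\<bar> \<le> 2 * C * R) \<and> (\<forall>i<3. \<forall>x. (F i has_real_derivative F (Suc i) x) (at x))"
        using F(2,3) by (intro exI[of _ F]) (simp add: mult.commute mult.left_commute)
    qed (use C in simp)
  qed
qed

text \<open>Each \<open>u t\<close> gets a smooth representative from the norm of order 6. The same
  estimate applied to \<open>u \<tau> - u t\<close> makes the derivatives up to order 3 continuous
  in time uniformly in x, since continuous functions that agree almost everywhere agree together
  with their derivatives. The equation, known almost everywhere, then holds at every point by
  continuity in x.\<close>

theorem solution_regular:
  assumes p: "1 \<le> p" and r: "1 \<le> r" and sol: "is_solution \<phi> p r g u0 T u" and b: "0 \<le> b" "b < T"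
  obtains U H K where "regular_flow b g U H K" "\<And>t. t \<in> {0..b} \<Longrightarrow> AE x in lborel. u t x = U t 0 x"
proof -
  obtain v w where C01: "\<forall>s>2. \<forall>b. 0 \<le> b \<and> b < T \<longrightarrow> C0_into (E_norm \<phi> p r s) b u \<and> C1_into (Ebar_norm \<phi> p r s) b u v"
    and eqns: "\<forall>t. 0 \<le> t \<and> t < T \<longrightarrow> is_fun (deriv_distr (rdistr (u t))) (cfun (w t)) \<and>
           (\<forall>x. set_integrable lborel {..x} (\<lambda>z. (w t z)\<^sup>2 / 2)) \<and>
           (AE x in lborel. v t x + u t x * w t x = (LINT z:{..x}|lborel. (w t z)\<^sup>2 / 2) + g t)"
    using sol unfolding is_solution_def by (elim exE conjE) (rule that; assumption)
  note eqn = eqns[rule_format, OF conjI]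
  have C0: "C0_into (E_norm \<phi> p r 6) b u" and C1: "C1_into (Ebar_norm \<phi> p r 6) b u v"
    using C01[rule_format, of 6 b] b by simp_all
  have um: "u t \<in> borel_measurable borel" if "t \<in> {0..b}" for t
    using C0 that by (simp add: C0_into_def)
  obtain C where C: "0 < C" "\<And>f R. \<lbrakk>f \<in> borel_measurable borel; E_norm \<phi> p r 6 f \<le> ennreal R; 0 \<le> R\<rbrakk> \<Longrightarrow>
    \<exists>F::nat \<Rightarrow> real \<Rightarrow> real. (AE x in lborel. f x = F 0 x) \<and>
      (\<forall>i\<le>3. \<forall>x. \<bar>F i x\<bar> \<le> C * R) \<and> (\<forall>i<3. \<forall>x. (F i has_real_derivative F (Suc i) x) (at x))"
  proof (rule E_norm_representative)
    fix C assume C: "0 < C" "\<And>p r f R. \<lbrakk>1 \<le> p; 1 \<le> r; f \<in> borel_measurable borel; E_norm \<phi> p r 6 f \<le> ennreal R; 0 \<le> R\<rbrakk> \<Longrightarrow>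
      \<exists>F::nat \<Rightarrow> real \<Rightarrow> real. (AE x in lborel. f x = F 0 x) \<and>
      (\<forall>i\<le>3. \<forall>x. \<bar>F i x\<bar> \<le> C * R) \<and> (\<forall>i<3. \<forall>x. (F i has_real_derivative F (Suc i) x) (at x))"
    show thesis by (rule that[OF C(1) C(2)[OF p r]])
  qed
  have "\<exists>F::nat \<Rightarrow> real \<Rightarrow> real. (AE x in lborel. u t x = F 0 x) \<and>
      (\<forall>i\<le>3. \<exists>B. \<forall>x. \<bar>F i x\<bar> \<le> B) \<and> (\<forall>i<3. \<forall>x. (F i has_real_derivative F (Suc i) x) (at x))" if t: "t \<in> {0..b}" for t
  proof -
    have "E_norm \<phi> p r 6 (u t) < \<infinity>" using C0 t by (simp add: C0_into_def)
    then obtain R where "E_norm \<phi> p r 6 (u t) = ennreal R" "0 \<le> R"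
      by (cases "E_norm \<phi> p r 6 (u t)") auto
    with C(2)[OF um[OF t], of R] show ?thesis by (metis order_refl)
  qed
  then obtain U where U: "\<And>t. t \<in> {0..b} \<Longrightarrow> AE x in lborel. u t x = U t 0 x"
      "\<And>t i. t \<in> {0..b} \<Longrightarrow> i \<le> 3 \<Longrightarrow> \<exists>B. \<forall>x. \<bar>U t i x\<bar> \<le> (B::real)"
      "\<And>t i x. t \<in> {0..b} \<Longrightarrow> i < 3 \<Longrightarrow> (U t i has_real_derivative U t (Suc i) x) (at x)"
    by metis
  have Uc: "continuous_on UNIV (U t i)" if "t \<in> {0..b}" "i < 3" for t i
    by (rule DERIV_continuous_on[OF has_field_derivative_at_within[OF U(3)[OF that]]])
  have ucont: "ucont_on b (\<lambda>t. U t i)" if i: "i \<le> 3" for i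
    unfolding ucont_on_def
  proof (intro ballI allI impI)
    fix t e :: real assume t: "t \<in> {0..b}" and e: "0 < e"
    have "((\<lambda>\<tau>. E_norm \<phi> p r 6 (\<lambda>x. u \<tau> x - u t x)) \<longlongrightarrow> 0) (at t within {0..b})"
      using C0 t by (simp add: C0_into_def)
    then have "\<forall>\<^sub>F \<tau> in at t within {0..b}. E_norm \<phi> p r 6 (\<lambda>x. u \<tau> x - u t x) < ennreal (e / C)"
      by (rule order_tendstoD) (use e C(1) in simp)
    moreover have "\<forall>\<^sub>F \<tau> in at t within {0..b}. \<tau> \<in> {0..b}" by (simp add: eventually_at_filter)
    ultimately show "\<forall>\<^sub>F \<tau> in at t within {0..b}. \<forall>x. \<bar>U \<tau> i x - U t i x\<bar> \<le> e"
    proof eventually_elim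
      case (elim \<tau>)
      then have \<tau>: "\<tau> \<in> {0..b}" by simp
      have "(\<lambda>x. u \<tau> x - u t x) \<in> borel_measurable borel" using um[OF t] um[OF \<tau>] by measurable
      from C(2)[OF this, of "e / C"] elim e C(1)
      obtain F :: "nat \<Rightarrow> real \<Rightarrow> real" where F: "AE x in lborel. u \<tau> x - u t x = F 0 x" "\<And>i x. i \<le> 3 \<Longrightarrow> \<bar>F i x\<bar> \<le> C * (e / C)"
        "\<And>i x. i < 3 \<Longrightarrow> (F i has_real_derivative F (Suc i) x) (at x)" by (auto simp: less_imp_le)
      have ae: "AE x in lborel. F 0 x = U \<tau> 0 x - U t 0 x"
        using F(1) U(1)[OF t] U(1)[OF \<tau>] by eventually_elim simp
      have "i \<le> 3 \<Longrightarrow> F i x = U \<tau> i x - U t i x" for i x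
      proof (induction i arbitrary: x)
        case 0
        show ?case
          by (rule AE_eq_continuous_imp_eq[OF ae])
             (intro continuous_on_diff Uc t \<tau> DERIV_continuous_on[OF has_field_derivative_at_within[OF F(3)]]; simp)+
      next
        case (Suc i)
        then have i: "i < 3" "F i = (\<lambda>x. U \<tau> i x - U t i x)" by auto
        have "(F i has_real_derivative U \<tau> (Suc i) x - U t (Suc i) x) (at x)"
          unfolding i(2) by (intro DERIV_diff U t \<tau> i)
        then show ?case using DERIV_unique[OF F(3)[OF i(1)]] by blast
      qed
      then show ?case using F(2)[OF i] i C(1) by simp
    qed
  qed
  have "\<exists>K>0. \<forall>t\<in>{0..b}. \<forall>x. \<bar>U t i x\<bar> \<le> K" if "i \<le> 3" for i
    by (rule ucont_on_SUP(2)[OF ucont[OF that] U(2)[OF _ that]])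
  then obtain k where k: "\<And>i. i \<le> 3 \<Longrightarrow> 0 < k i" "\<And>i t x. i \<le> 3 \<Longrightarrow> t \<in> {0..b} \<Longrightarrow> \<bar>U t i x\<bar> \<le> k i" by metis
  define K where "K = (\<Sum>i\<le>3. k i)"
  have kK: "k i \<le> K" if "i \<le> 3" for i
    unfolding K_def by (rule member_le_sum) (use that k(1) in \<open>auto intro: less_imp_le\<close>)
  have K: "0 < K" using kK[of 0] k(1)[of 0] by simp
  have bound: "\<bar>U t i x\<bar> \<le> K" if "t \<in> {0..b}" "i \<le> 3" for t i x
    using k(2)[OF that(2,1), of x] kK[OF that(2)] by simp
  define H where "H = (\<lambda>t x. LINT z:{..x}|lborel. (U t 1 z)\<^sup>2 / 2)"
  have Um: "U t i \<in> borel_measurable borel" if "t \<in> {0..b}" "i < 3" for t i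
    by (rule continuous_imp_measurable_borel[OF Uc[OF that]])
  have w: "AE x in lborel. w t x = U t 1 x" "w t \<in> borel_measurable borel" if t: "t \<in> {0..b}" for t
  proof -
    have f1: "is_fun (deriv_distr (rdistr (u t))) (cfun (w t))" using eqn[of t] t b by auto
    have f2: "is_fun (deriv_distr (rdistr (u t))) (cfun (U t 1))"
      by (rule is_fun_deriv_distr[of "U t 0" "U t 1" K K]) (use U(3)[OF t, of 0] bound[OF t] um[OF t] U(1)[OF t] Um[OF t, of 1] in auto)
    from is_fun_unique[OF f1 f2] show "AE x in lborel. w t x = U t 1 x" by simp
    have "cfun (w t) \<in> borel_measurable borel" using f1 by (simp add: is_fun_def tempered_fun_def)
    then have "(\<lambda>x. Re (cfun (w t) x)) \<in> borel_measurable borel" by measurable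
    then show "w t \<in> borel_measurable borel" by simp
  qed
  have wint: "set_integrable lborel {..x} (\<lambda>z. (U t 1 z)\<^sup>2 / 2)" "(LINT z:{..x}|lborel. (w t z)\<^sup>2 / 2) = H t x" if t: "t \<in> {0..b}" for t x
  proof -
    note [measurable] = w(2)[OF t] Um[OF t, of 1]
    have U1 [measurable]: "U t 1 \<in> borel_measurable borel" using Um[OF t, of 1] by simp
    have "set_integrable lborel {..x} (\<lambda>z. (w t z)\<^sup>2 / 2)" using eqn[of t] t b by auto
    then show "set_integrable lborel {..x} (\<lambda>z. (U t 1 z)\<^sup>2 / 2)"
      unfolding set_integrable_def
      by (rule integrable_cong_AE_imp) (use U1 w(1)[OF t] in \<open>auto elim!: eventually_mono simp del: One_nat_def\<close>)
    show "(LINT z:{..x}|lborel. (w t z)\<^sup>2 / 2) = H t x"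
      unfolding H_def set_lebesgue_integral_def
      by (rule integral_cong_AE) (use U1 w(1)[OF t] in \<open>auto elim!: eventually_mono simp del: One_nat_def\<close>)
  qed
  have Hc: "continuous_on UNIV (H t)" if t: "t \<in> {0..b}" for t
  proof -
    have "continuous_on UNIV (\<lambda>z. (U t 1 z)\<^sup>2 / 2)" using Uc[OF t, of 1] by (intro continuous_intros) auto
    note set_integral_atMost_has_derivative(1)[OF this wint(1)[OF t]]
    from DERIV_continuous_on[OF has_field_derivative_at_within[OF this]] show ?thesis
      unfolding H_def .
  qed
  have v: "AE x in lborel. v t x = H t x + g t - U t 0 x * U t 1 x" if t: "t \<in> {0..b}" for t
  proof -
    have "AE x in lborel. v t x + u t x * w t x = (LINT z:{..x}|lborel. (w t z)\<^sup>2 / 2) + g t" using eqn[of t] t b by auto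
    with U(1)[OF t] w(1)[OF t] show ?thesis
      unfolding wint(2)[OF t] by eventually_elim (simp add: algebra_simps del: One_nat_def)
  qed
  have "regular_flow b g U H K"
  proof
    \<comment> \<open>The energy is bounded by means of the equation itself: H equals
      \<open>v + u * u_x - g\<close>, and v has finite sup norm.\<close>
    show "\<exists>B. \<forall>x. \<bar>H t x\<bar> \<le> B" if t: "t \<in> {0..b}" for t
    proof -
      have "Ebar_norm \<phi> p r 6 (v t) < \<infinity>" using C1 t by (simp add: C1_into_def C0_into_def)
      then have "Linf_norm (v t) < \<infinity>" by (simp add: Ebar_norm_def)
      then obtain B where B: "Linf_norm (v t) \<le> ennreal B" "0 \<le> B" by (cases "Linf_norm (v t)") auto
      have "AE x in lborel. \<bar>H t x\<bar> \<le> B + \<bar>g t\<bar> + K * K"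
        using Linf_norm_AE[OF B] v[OF t]
      proof eventually_elim
        case (elim x)
        have "\<bar>U t 0 x * U t 1 x\<bar> \<le> K * K"
          unfolding abs_mult using bound[OF t, of 0 x] bound[OF t, of 1 x] by (intro mult_mono) auto
        with elim show ?case by linarith
      qed
      then have "\<bar>H t x\<bar> \<le> B + \<bar>g t\<bar> + K * K" for x
        by (rule AE_le_continuous_imp_le) (intro continuous_intros Hc t)+
      then show ?thesis by blast
    qed
    show "\<forall>\<^sub>F \<tau> in at t within {0..b}. \<forall>x. \<bar>(U \<tau> 0 x - U t 0 x) / (\<tau> - t) - (H t x + g t - U t 0 x * U t 1 x)\<bar> \<le> e"
      if t: "t \<in> {0..b}" and e: "0 < e" for t e
    proof -
      have "((\<lambda>\<tau>. Ebar_norm \<phi> p r 6 (\<lambda>x. (u \<tau> x - u t x) / (\<tau> - t) - v t x)) \<longlongrightarrow> 0) (at t within {0..b})"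
        using C1 t by (simp add: C1_into_def)
      then have "\<forall>\<^sub>F \<tau> in at t within {0..b}. Ebar_norm \<phi> p r 6 (\<lambda>x. (u \<tau> x - u t x) / (\<tau> - t) - v t x) < ennreal e"
        by (rule order_tendstoD) (use e in simp)
      moreover have "\<forall>\<^sub>F \<tau> in at t within {0..b}. \<tau> \<in> {0..b} \<and> \<tau> \<noteq> t" by (simp add: eventually_at_filter)
      ultimately show ?thesis
      proof (eventually_elim, intro allI)
        fix \<tau> x assume *: "Ebar_norm \<phi> p r 6 (\<lambda>x. (u \<tau> x - u t x) / (\<tau> - t) - v t x) < ennreal e" and \<tau>: "\<tau> \<in> {0..b} \<and> \<tau> \<noteq> t"
        have "Linf_norm (\<lambda>x. (u \<tau> x - u t x) / (\<tau> - t) - v t x) \<le> Ebar_norm \<phi> p r 6 (\<lambda>x. (u \<tau> x - u t x) / (\<tau> - t) - v t x)"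
          by (simp add: Ebar_norm_def)
        with * have "Linf_norm (\<lambda>x. (u \<tau> x - u t x) / (\<tau> - t) - v t x) \<le> ennreal e" by simp
        from Linf_norm_AE[OF this] e
        have "AE x in lborel. \<bar>(u \<tau> x - u t x) / (\<tau> - t) - v t x\<bar> \<le> e" by simp
        with v[OF t] U(1)[OF t] U(1)[of \<tau>] \<tau>
        have ae: "AE x in lborel. \<bar>(U \<tau> 0 x - U t 0 x) / (\<tau> - t) - (H t x + g t - U t 0 x * U t 1 x)\<bar> \<le> e"
          by auto
        show "\<bar>(U \<tau> 0 x - U t 0 x) / (\<tau> - t) - (H t x + g t - U t 0 x * U t 1 x)\<bar> \<le> e"
          by (rule AE_le_continuous_imp_le[OF ae])
             (use \<tau> in \<open>auto intro!: continuous_intros Hc t Uc\<close>)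
      qed
    qed
  qed (use b U(3) bound ucont wint(1) K in \<open>auto simp: H_def\<close>)
  with U(1) show thesis by (intro that) auto
qed

text \<open>Regularity turns both solutions into regular flows on [0, t] with the same initial
  values.\<close>

theorem solution_unique:
  assumes p: "1 \<le> p" and r: "1 \<le> r" and u: "is_solution \<phi> p r g u0 T u" and v: "is_solution \<phi> p r g u0 T' v"
    and t: "0 \<le> t" "t < min T T'"
  shows "AE x in lborel. v t x = u t x"
proof -
  obtain U H K where U: "regular_flow t g U H K" "\<And>s. s \<in> {0..t} \<Longrightarrow> AE x in lborel. u s x = U s 0 x"
    using solution_regular[OF p r u t(1)] t by auto
  obtain V I L where V: "regular_flow t g V I L" "\<And>s. s \<in> {0..t} \<Longrightarrow> AE x in lborel. v s x = V s 0 x"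
    using solution_regular[OF p r v t(1)] t by auto
  interpret A: regular_flow t g U H K by fact
  interpret B: regular_flow t g V I L by fact
  have 0: "0 \<in> {0..t}" and tt: "t \<in> {0..t}" using t by auto
  have "AE x in lborel. u 0 x = u0 x" "AE x in lborel. v 0 x = u0 x" using u v unfolding is_solution_def by blast+
  with U(2)[OF 0] V(2)[OF 0] have "AE x in lborel. U 0 0 x = V 0 0 x" by eventually_elim simp
  then have "U 0 0 x = V 0 0 x" for x
    by (rule AE_eq_continuous_imp_eq) (use A.U_cont[OF 0] B.U_cont[OF 0] in auto)
  from regular_flow_unique[OF U(1) V(1) this tt]
  have eq: "U t 0 x = V t 0 x" for x .
  show ?thesis using U(2)[OF tt] V(2)[OF tt] by eventually_elim (simp add: eq)
qed

end

section \<open>Families of functions with decaying derivatives\<close>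

text \<open>The weight of the \<open>n\<close>-th derivative of a solution: the derivatives decay, \<open>u\<close> itself is only bounded.\<close>

definition kw :: "nat \<Rightarrow> real \<Rightarrow> real" where
  "kw n x = (if n = 0 then 1 else 1 / (1 + x\<^sup>2))"

lemma kw_le_1: "kw n x \<le> 1" and kw_pos: "0 < kw n x"
  by (auto simp: kw_def add_pos_nonneg)

text \<open>The flow moves points by a bounded distance; with this comparison the decay of
  derivatives passes from the Lagrangian to the Eulerian variable.\<close>

lemma kw_shift_le:
  assumes "\<bar>y - x\<bar> \<le> C" "0 \<le> C"
  shows "kw n y \<le> (2 + 2 * C\<^sup>2) * kw n x"
proof (cases "n = 0")
  case True then show ?thesis by (simp add: kw_def add_increasing2)
next
  case False
  have "(y - x)\<^sup>2 \<le> C\<^sup>2" using assms by (rule power2_le_iff_abs_le[THEN iffD2, rotated])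
  have "x\<^sup>2 \<le> 2 * y\<^sup>2 + 2 * (y - x)\<^sup>2"
    using zero_le_power2[of "2 * y - x"] by (simp add: power2_eq_square algebra_simps)
  with \<open>(y - x)\<^sup>2 \<le> C\<^sup>2\<close> have *: "1 + x\<^sup>2 \<le> 2 * y\<^sup>2 + 2 * C\<^sup>2 + 1" by linarith
  have "0 \<le> C\<^sup>2 * y\<^sup>2" by simp
  moreover have "(2 + 2 * C\<^sup>2) * (1 + y\<^sup>2) = 2 + 2 * C\<^sup>2 + 2 * y\<^sup>2 + 2 * (C\<^sup>2 * y\<^sup>2)" by (simp add: algebra_simps)
  ultimately have "1 + x\<^sup>2 \<le> (2 + 2 * C\<^sup>2) * (1 + y\<^sup>2)" using * by linarith
  then show ?thesis using False by (simp add: kw_def divide_simps add_pos_nonneg not_less sum_power2_eq_zero_iff)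
qed

context LP
begin

text \<open>Both seminorms come from \<open>hBesov_norm_le\<close> with one m above s, which applies
  since s - 1 > 1; the norm of the derivative in the conjugate exponent is interpolated between its
  sup and its integral. The bound is linear in A and hence usable for limits.\<close>

lemma E_norm_le:
  assumes s: "2 < s"
  obtains C m where "0 < C" "\<And>p r F A. \<lbrakk>1 \<le> p; 1 \<le> r; \<And>n x. (F n has_real_derivative F (Suc n) x) (at x);
     \<And>n x. n \<le> m \<Longrightarrow> \<bar>F n x\<bar> \<le> A * kw n x; 0 \<le> A\<rbrakk> \<Longrightarrow> E_norm \<phi> p r s (F 0) \<le> ennreal (C * A)"
proof -
  define m where "m = nat \<lceil>s\<rceil> + 1"
  have m: "s < real m" "s - 1 < real m" "1 < s" "1 < s - 1" "1 \<le> m" using s by (auto simp: m_def) linarith+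
  show thesis
  proof (rule hBesov_norm_le[OF m(3,1)], rule hBesov_norm_le[OF m(4,2)])
    fix C1 C2
    assume C1: "0 < C1" "\<And>p r F A. \<lbrakk>1 \<le> p; 1 \<le> r; \<And>n x. (F n has_real_derivative F (Suc n) x) (at x);
     \<And>n. n \<le> m \<Longrightarrow> \<exists>B. \<forall>x. \<bar>F n x\<bar> \<le> B; \<And>x. \<bar>F 1 x\<bar> \<le> A / (1 + x\<^sup>2); \<And>x. \<bar>F m x\<bar> \<le> A / (1 + x\<^sup>2); 0 \<le> A\<rbrakk> \<Longrightarrow>
     hBesov_norm \<phi> s p r (rdistr (F 0)) \<le> ennreal (C1 * A)"
    and C2: "0 < C2" "\<And>p r F A. \<lbrakk>1 \<le> p; 1 \<le> r; \<And>n x. (F n has_real_derivative F (Suc n) x) (at x);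
     \<And>n. n \<le> m \<Longrightarrow> \<exists>B. \<forall>x. \<bar>F n x\<bar> \<le> B; \<And>x. \<bar>F 1 x\<bar> \<le> A / (1 + x\<^sup>2); \<And>x. \<bar>F m x\<bar> \<le> A / (1 + x\<^sup>2); 0 \<le> A\<rbrakk> \<Longrightarrow>
     hBesov_norm \<phi> (s - 1) p r (rdistr (F 0)) \<le> ennreal (C2 * A)"
    define S where "S = max 1 (\<integral>x. 1 / (1 + (x::real)\<^sup>2) \<partial>lborel)"
    have S: "1 \<le> S" by (simp add: S_def)
    show thesis
    proof (rule that[of "1 + C1 + C2 + S"])
      fix p r :: ennreal and F :: "nat \<Rightarrow> real \<Rightarrow> real" and A :: real
      assume p: "1 \<le> p" and r: "1 \<le> r" and F: "\<And>n x. (F n has_real_derivative F (Suc n) x) (at x)"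
        and FA: "\<And>n x. n \<le> m \<Longrightarrow> \<bar>F n x\<bar> \<le> A * kw n x" and A: "0 \<le> A"
      have b: "\<bar>F n x\<bar> \<le> A" if "n \<le> m" for n x
        using order_trans[OF FA[OF that] mult_left_mono[OF kw_le_1 A]] by simp
      have d: "\<bar>F n x\<bar> \<le> A / (1 + x\<^sup>2)" if "n \<le> m" "1 \<le> n" for n x
        using FA[OF that(1), of x] that(2) by (simp add: kw_def)
      have Fc: "continuous_on UNIV (F n)" for n
        by (rule DERIV_continuous_on[OF has_field_derivative_at_within[OF F]])
      have Fm [measurable]: "F n \<in> borel_measurable borel" for n
        by (rule continuous_imp_measurable_borel[OF Fc])
      have 1: "Linf_norm (F 0) \<le> ennreal A"
        unfolding Linf_norm_def lp_norm_def using b[of 0] by (auto intro!: esssup_I ennreal_leI)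
      have 2: "hBesov_norm \<phi> s p r (rdistr (F 0)) \<le> ennreal (C1 * A)"
        by (rule C1(2)[where F=F, OF p r F]) (use b d m A in \<open>auto simp del: One_nat_def\<close>)
      have 3: "hBesov_norm \<phi> (s - 1) p r (rdistr (F 0)) \<le> ennreal (C2 * A)"
        by (rule C2(2)[where F=F, OF p r F]) (use b d m A in \<open>auto simp del: One_nat_def\<close>)
      have cp: "1 \<le> conj_exp p"
      proof (rule ccontr)
        assume n: "\<not> 1 \<le> conj_exp p"
        have le: "1 / conj_exp p \<le> 1" using conj_exp[OF p] by (metis add.commute le_iff_add)
        show False
        proof (cases "conj_exp p")
          case (real c)
          with n have c: "0 \<le> c" "c < 1" by (auto simp: not_le)
          have "c \<noteq> 0" using le real by (auto simp: top_unique)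
          with c have "1 < 1 / c" by simp
          moreover have "1 / conj_exp p = ennreal (1 / c)" using c \<open>c \<noteq> 0\<close> real divide_ennreal[of 1 c] by simp
          ultimately show False using le by simp
        qed (use n in simp)
      qed
      have e1: "enn2real (1 / conj_exp p) \<le> 1"
        using conj_exp[OF p] by (metis enn2real_mono enn2real_1 ennreal_one_less_top add.commute le_iff_add)
      have "lp_norm lborel (conj_exp p) (\<lambda>x. ennreal (cmod (cfun (F 1) x))) \<le> ennreal (A * S powr enn2real (1 / conj_exp p))"
      proof (rule lp_norm_interpolation[OF cp])
        show "ennreal (cmod (cfun (F 1) x)) \<le> ennreal A" for x using b[of 1 x] m by (simp add: ennreal_leI del: One_nat_def)
        have "(\<integral>\<^sup>+x. ennreal (cmod (cfun (F 1) x)) \<partial>lborel) \<le> (\<integral>\<^sup>+x. ennreal (A * (1 / (1 + x\<^sup>2))) \<partial>lborel)"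
          by (intro nn_integral_mono ennreal_leI) (use d[of 1] m in \<open>simp del: One_nat_def\<close>)
        also have "\<dots> = ennreal (A * (\<integral>x. 1 / (1 + x\<^sup>2) \<partial>lborel))"
          using A by (subst nn_integral_eq_integral) (auto intro!: integrable_mult_right integrable_inverse_1_plus_sq simp del: times_divide_eq_right)
        also have "\<dots> \<le> ennreal (A * S)" using A by (intro ennreal_leI mult_left_mono) (auto simp: S_def)
        finally show "(\<integral>\<^sup>+x. ennreal (cmod (cfun (F 1) x)) \<partial>lborel) \<le> ennreal (A * S)" .
      qed (use A S in auto)
      also have "\<dots> \<le> ennreal (S * A)"
        using powr_mono[OF e1 S] A S by (intro ennreal_leI) (simp add: mult.commute mult_left_mono)
      finally have "lp_norm lborel (conj_exp p) (\<lambda>x. ennreal (cmod (cfun (F 1) x))) \<le> ennreal (S * A)" .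
      moreover have "is_fun (deriv_distr (rdistr (F 0))) (cfun (F 1))"
        by (rule is_fun_deriv_distr[of "F 0" "F 1" A A]) (use F[of 0] b m in \<open>auto simp del: One_nat_def simp: One_nat_def[symmetric]\<close>)
      ultimately have 4: "Lp_distr (conj_exp p) (deriv_distr (rdistr (F 0))) \<le> ennreal (S * A)"
        using Lp_distr_le order_trans by blast
      have "E_norm \<phi> p r s (F 0) \<le> ennreal A + ennreal (C1 * A) + ennreal (C2 * A) + ennreal (S * A)"
        unfolding E_norm_def by (intro add_mono 1 2 3 4)
      also have "\<dots> = ennreal ((1 + C1 + C2 + S) * A)"
        using A C1(1) C2(1) S by (simp flip: ennreal_plus add: algebra_simps)
      finally show "E_norm \<phi> p r s (F 0) \<le> ennreal ((1 + C1 + C2 + S) * A)" .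
    qed (use C1(1) C2(1) S in simp)
  qed
qed

lemma Ebar_norm_le_E_norm: "Ebar_norm \<phi> p r s f \<le> E_norm \<phi> p r s f"
  proof -
  have "Ebar_norm \<phi> p r s f \<le> Ebar_norm \<phi> p r s f + (hBesov_norm \<phi> s p r (rdistr f) + Lp_distr (conj_exp p) (deriv_distr (rdistr f)))"
    by simp
  also have "\<dots> = E_norm \<phi> p r s f" unfolding Ebar_norm_def E_norm_def by (simp only: add_ac)
  finally show ?thesis .
qed

text \<open>For fixed s only the derivatives up to the m of \<open>E_norm_le\<close> matter, so the
  eventual bounds for the single n can be combined.\<close>

lemma E_norm_tendsto_0:
  assumes s: "2 < s" and p: "1 \<le> p" and r: "1 \<le> r"
    and G: "\<forall>\<^sub>F \<tau> in X. \<forall>n x. (G \<tau> n has_real_derivative G \<tau> (Suc n) x) (at x)"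
    and lim: "\<And>n e. 0 < e \<Longrightarrow> \<forall>\<^sub>F \<tau> in X. \<forall>x. \<bar>G \<tau> n x\<bar> \<le> e * kw n x"
  shows "((\<lambda>\<tau>. E_norm \<phi> p r s (G \<tau> 0)) \<longlongrightarrow> 0) X" and "((\<lambda>\<tau>. Ebar_norm \<phi> p r s (G \<tau> 0)) \<longlongrightarrow> 0) X"
proof -
  show E: "((\<lambda>\<tau>. E_norm \<phi> p r s (G \<tau> 0)) \<longlongrightarrow> 0) X"
  proof (rule E_norm_le[OF s])
    fix C m
    assume C: "0 < C" "\<And>p r F A. \<lbrakk>1 \<le> p; 1 \<le> r; \<And>n x. (F n has_real_derivative F (Suc n) x) (at x);
     \<And>n x. n \<le> m \<Longrightarrow> \<bar>F n x\<bar> \<le> A * kw n x; 0 \<le> A\<rbrakk> \<Longrightarrow> E_norm \<phi> p r s (F 0) \<le> ennreal (C * A)"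
    show ?thesis
    proof (rule order_tendstoI)
      fix y :: ennreal assume "0 < y"
      then obtain e where e: "0 < e" "ennreal e < y"
      proof -
        obtain z where z: "0 < z" "z < y" using dense[OF \<open>0 < y\<close>] by blast
        show thesis
        proof (cases z)
          case (real a)
          with z have "0 < a" "ennreal a < y" by simp_all
          then show thesis by (rule that)
        qed (use z in simp)
      qed
      have "\<forall>\<^sub>F \<tau> in X. \<forall>n\<in>{..m}. \<forall>x. \<bar>G \<tau> n x\<bar> \<le> (e / C) * kw n x"
        using e C(1) by (intro eventually_ball_finite ballI lim) auto
      with G show "\<forall>\<^sub>F \<tau> in X. E_norm \<phi> p r s (G \<tau> 0) < y"
      proof eventually_elim
        case (elim \<tau>)
        have "E_norm \<phi> p r s (G \<tau> 0) \<le> ennreal (C * (e / C))"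
          by (rule C(2)[OF p r]) (use elim e C(1) in auto)
        with e C(1) show ?case by simp
      qed
    qed simp
  qed
  show "((\<lambda>\<tau>. Ebar_norm \<phi> p r s (G \<tau> 0)) \<longlongrightarrow> 0) X"
    by (rule tendsto_sandwich[OF _ _ tendsto_const E]) (simp_all add: Ebar_norm_le_E_norm)
qed

lemma E_norm_finite:
  assumes s: "2 < s" and p: "1 \<le> p" and r: "1 \<le> r"
    and F: "\<And>n x. (F n has_real_derivative F (Suc n) x) (at x)" and M: "\<And>n. \<exists>M. \<forall>x. \<bar>F n x\<bar> \<le> M * kw n x"
  shows "E_norm \<phi> p r s (F 0) < \<infinity>" "Ebar_norm \<phi> p r s (F 0) < \<infinity>"
proof -
  show "E_norm \<phi> p r s (F 0) < \<infinity>"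
  proof (rule E_norm_le[OF s])
    fix C m
    assume C: "0 < C" "\<And>p r F A. \<lbrakk>1 \<le> p; 1 \<le> r; \<And>n x. (F n has_real_derivative F (Suc n) x) (at x);
     \<And>n x. n \<le> m \<Longrightarrow> \<bar>F n x\<bar> \<le> A * kw n x; 0 \<le> A\<rbrakk> \<Longrightarrow> E_norm \<phi> p r s (F 0) \<le> ennreal (C * A)"
    obtain M where M: "\<And>n x. \<bar>F n x\<bar> \<le> M n * kw n x" using M by metis
    have "E_norm \<phi> p r s (F 0) \<le> ennreal (C * (\<Sum>n\<le>m. \<bar>M n\<bar>))"
    proof (rule C(2)[where F=F, OF p r F])
      fix n x assume "n \<le> m"
      then have "\<bar>M n\<bar> \<le> (\<Sum>n\<le>m. \<bar>M n\<bar>)" by (intro member_le_sum) auto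
      then have "M n * kw n x \<le> (\<Sum>n\<le>m. \<bar>M n\<bar>) * kw n x" using kw_pos[of n x] by (intro mult_right_mono) auto
      with M[of n x] show "\<bar>F n x\<bar> \<le> (\<Sum>n\<le>m. \<bar>M n\<bar>) * kw n x" by linarith
    qed (simp add: sum_nonneg)
    also have "\<dots> < \<infinity>" by simp
    finally show ?thesis .
  qed
  then show "Ebar_norm \<phi> p r s (F 0) < \<infinity>" using Ebar_norm_le_E_norm le_less_trans by blast
qed

lemma C0_intoI:
  assumes s: "2 < s" and p: "1 \<le> p" and r: "1 \<le> r"
    and F: "\<And>t n x. t \<in> {0..b} \<Longrightarrow> (F t n has_real_derivative F t (Suc n) x) (at x)"
    and M: "\<And>t n. t \<in> {0..b} \<Longrightarrow> \<exists>M. \<forall>x. \<bar>F t n x\<bar> \<le> M * kw n x"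
    and lim: "\<And>t n e. t \<in> {0..b} \<Longrightarrow> 0 < e \<Longrightarrow> \<forall>\<^sub>F \<tau> in at t within {0..b}. \<forall>x. \<bar>F \<tau> n x - F t n x\<bar> \<le> e * kw n x"
  shows "C0_into (E_norm \<phi> p r s) b (\<lambda>t. F t 0)" "C0_into (Ebar_norm \<phi> p r s) b (\<lambda>t. F t 0)"
proof -
  have ev: "\<forall>\<^sub>F \<tau> in at t within {0..b}. \<tau> \<in> {0..b}" for t by (simp add: eventually_at_filter)
  have m: "F t 0 \<in> borel_measurable lborel" if "t \<in> {0..b}" for t
    using continuous_imp_measurable_borel[OF DERIV_continuous_on[OF has_field_derivative_at_within[OF F[OF that]]]] by simp
  have t: "((\<lambda>\<tau>. E_norm \<phi> p r s (\<lambda>x. F \<tau> 0 x - F t 0 x)) \<longlongrightarrow> 0) (at t within {0..b})"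
    "((\<lambda>\<tau>. Ebar_norm \<phi> p r s (\<lambda>x. F \<tau> 0 x - F t 0 x)) \<longlongrightarrow> 0) (at t within {0..b})" if "t \<in> {0..b}" for t
    by (rule E_norm_tendsto_0[OF s p r, of "\<lambda>\<tau> n x. F \<tau> n x - F t n x"];
        use lim[OF that] in \<open>auto intro!: eventually_mono[OF ev] DERIV_diff F that\<close>)+
  show "C0_into (E_norm \<phi> p r s) b (\<lambda>t. F t 0)" "C0_into (Ebar_norm \<phi> p r s) b (\<lambda>t. F t 0)"
    unfolding C0_into_def using m t E_norm_finite[where F="F t" for t, OF s p r F M] by blast+
qed

text \<open>By the mean value theorem the difference quotient is \<open>G z n x\<close> at an
  intermediate time z depending on x and n. Continuity of G in time is uniform in x, so this
  dependence does no harm.\<close>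

lemma C1_intoI:
  assumes s: "2 < s" and p: "1 \<le> p" and r: "1 \<le> r"
    and F: "\<And>t n x. t \<in> {0..b} \<Longrightarrow> (F t n has_real_derivative F t (Suc n) x) (at x)"
    and G: "\<And>t n x. t \<in> {0..b} \<Longrightarrow> (G t n has_real_derivative G t (Suc n) x) (at x)"
    and M: "\<And>t n. t \<in> {0..b} \<Longrightarrow> \<exists>M. \<forall>x. \<bar>F t n x\<bar> \<le> M * kw n x"
    and N: "\<And>t n. t \<in> {0..b} \<Longrightarrow> \<exists>M. \<forall>x. \<bar>G t n x\<bar> \<le> M * kw n x"
    and lim: "\<And>t n e. t \<in> {0..b} \<Longrightarrow> 0 < e \<Longrightarrow> \<forall>\<^sub>F \<tau> in at t within {0..b}. \<forall>x. \<bar>F \<tau> n x - F t n x\<bar> \<le> e * kw n x"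
    and lim': "\<And>t n e. t \<in> {0..b} \<Longrightarrow> 0 < e \<Longrightarrow> \<forall>\<^sub>F \<tau> in at t within {0..b}. \<forall>x. \<bar>G \<tau> n x - G t n x\<bar> \<le> e * kw n x"
    and FG: "\<And>t n x. t \<in> {0..b} \<Longrightarrow> ((\<lambda>t. F t n x) has_real_derivative G t n x) (at t within {0..b})"
  shows "C1_into (Ebar_norm \<phi> p r s) b (\<lambda>t. F t 0) (\<lambda>t. G t 0)"
  unfolding C1_into_def
proof (intro conjI ballI C0_intoI(2) assms)
  fix t assume t: "t \<in> {0..b}"
  have ev: "\<forall>\<^sub>F \<tau> in at t within {0..b}. \<tau> \<in> {0..b} \<and> \<tau> \<noteq> t" by (simp add: eventually_at_filter)
  show "((\<lambda>\<tau>. Ebar_norm \<phi> p r s (\<lambda>x. (F \<tau> 0 x - F t 0 x) / (\<tau> - t) - G t 0 x)) \<longlongrightarrow> 0) (at t within {0..b})"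
  proof (rule E_norm_tendsto_0(2)[OF s p r, of "\<lambda>\<tau> n x. (F \<tau> n x - F t n x) / (\<tau> - t) - G t n x"])
    show "\<forall>\<^sub>F \<tau> in at t within {0..b}. \<forall>n x. ((\<lambda>x. (F \<tau> n x - F t n x) / (\<tau> - t) - G t n x) has_real_derivative
        (F \<tau> (Suc n) x - F t (Suc n) x) / (\<tau> - t) - G t (Suc n) x) (at x)"
      using ev by eventually_elim (intro allI DERIV_diff DERIV_cdivide F G t; simp)
    fix n and e :: real assume e: "0 < e"
    from lim'[OF t e, of n] obtain d where d: "0 < d" "\<And>\<tau> x. \<tau> \<in> {0..b} \<Longrightarrow> \<bar>\<tau> - t\<bar> < d \<Longrightarrow> \<tau> \<noteq> t \<Longrightarrow> \<bar>G \<tau> n x - G t n x\<bar> \<le> e * kw n x"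
      unfolding eventually_at by (auto simp: dist_real_def)
    have "\<forall>\<^sub>F \<tau> in at t within {0..b}. \<tau> \<in> {0..b} \<and> \<tau> \<noteq> t \<and> \<bar>\<tau> - t\<bar> < d"
      unfolding eventually_at using d(1) by (auto simp: dist_real_def intro!: exI[of _ d])
    then show "\<forall>\<^sub>F \<tau> in at t within {0..b}. \<forall>x. \<bar>(F \<tau> n x - F t n x) / (\<tau> - t) - G t n x\<bar> \<le> e * kw n x"
    proof (eventually_elim, intro allI)
      fix \<tau> x assume \<tau>: "\<tau> \<in> {0..b} \<and> \<tau> \<noteq> t \<and> \<bar>\<tau> - t\<bar> < d"
      have mv: "\<exists>z. a < z \<and> z < c \<and> F c n x - F a n x = (c - a) * G z n x" if "a < c" "a \<in> {0..b}" "c \<in> {0..b}" for a c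
      proof -
        have sub: "{a..c} \<subseteq> {0..b}" using that by auto
        have D: "((\<lambda>t. F t n x) has_real_derivative G z n x) (at z within {a..c})" if "a \<le> z" "z \<le> c" for z
          using FG[of z n x] sub that by (intro DERIV_subset[OF _ sub]) auto
        obtain z where "z \<in> {a<..<c}" "F c n x - F a n x = (c - a) * G z n x"
          using mvt_simple[OF \<open>a < c\<close>, of "\<lambda>t. F t n x" "\<lambda>z h. h * G z n x"] D
          by (auto simp: has_field_derivative_def mult.commute[of _ "G _ _ _"] lambda_one)
        then show ?thesis by auto
      qed
      have "\<exists>z. z \<in> {0..b} \<and> \<bar>z - t\<bar> < d \<and> z \<noteq> t \<and> (F \<tau> n x - F t n x) / (\<tau> - t) = G z n x"
      proof (cases "\<tau> < t")
        case True
        with mv[of \<tau> t] \<tau> t obtain z where z: "\<tau> < z" "z < t" "F t n x - F \<tau> n x = (t - \<tau>) * G z n x" by auto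
        then have "(F \<tau> n x - F t n x) / (\<tau> - t) = G z n x" using True by (simp add: field_simps)
        then show ?thesis using z \<tau> t by (intro exI[of _ z]) auto
      next
        case False
        with mv[of t \<tau>] \<tau> t obtain z where z: "t < z" "z < \<tau>" "F \<tau> n x - F t n x = (\<tau> - t) * G z n x" by auto
        then show ?thesis using z \<tau> t by (intro exI[of _ z]) auto
      qed
      then show "\<bar>(F \<tau> n x - F t n x) / (\<tau> - t) - G t n x\<bar> \<le> e * kw n x" using d(2) by auto
    qed
  qed
qed

end

section \<open>The explicit solution along characteristics\<close>

text \<open>Lipschitz rather than continuous dependence on time: it follows from a bounded time
  derivative by \<open>LipTI\<close>, and it is stable under products.\<close>

definition LipT :: "real \<Rightarrow> nat \<Rightarrow> (real \<Rightarrow> real \<Rightarrow> real) \<Rightarrow> bool" where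
  "LipT b n F \<longleftrightarrow> (\<exists>M\<ge>0. \<forall>t\<in>{0..b}. \<forall>\<tau>\<in>{0..b}. \<forall>x. \<bar>F t x\<bar> \<le> M * kw n x \<and> \<bar>F \<tau> x - F t x\<bar> \<le> M * \<bar>\<tau> - t\<bar> * kw n x)"

lemma LipTE:
  assumes "LipT b n F"
  obtains M where "0 \<le> M" "\<And>t \<tau> x. t \<in> {0..b} \<Longrightarrow> \<tau> \<in> {0..b} \<Longrightarrow> \<bar>F t x\<bar> \<le> M * kw n x \<and> \<bar>F \<tau> x - F t x\<bar> \<le> M * \<bar>\<tau> - t\<bar> * kw n x"
  using assms unfolding LipT_def by blast

lemma LipTI:
  assumes F: "\<And>t x. t \<in> {0..b} \<Longrightarrow> ((\<lambda>t. F t x) has_real_derivative F' t x) (at t within {0..b})"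
    and M: "\<And>t x. t \<in> {0..b} \<Longrightarrow> \<bar>F t x\<bar> \<le> M * kw n x" "\<And>t x. t \<in> {0..b} \<Longrightarrow> \<bar>F' t x\<bar> \<le> M' * kw n x"
  shows "LipT b n F"
  unfolding LipT_def
proof (intro exI[of _ "\<bar>M\<bar> + \<bar>M'\<bar>"] conjI ballI allI)
  fix t \<tau> x assume t: "t \<in> {0..b}" "\<tau> \<in> {0..b}"
  have k: "M * kw n x \<le> (\<bar>M\<bar> + \<bar>M'\<bar>) * kw n x" "M' * kw n x \<le> (\<bar>M\<bar> + \<bar>M'\<bar>) * kw n x"
    using kw_pos[of n x] by (auto intro!: mult_right_mono)
  show "\<bar>F t x\<bar> \<le> (\<bar>M\<bar> + \<bar>M'\<bar>) * kw n x" using M(1)[OF t(1), of x] k by linarith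
  have "norm (F \<tau> x - F t x) \<le> ((\<bar>M\<bar> + \<bar>M'\<bar>) * kw n x) * norm (\<tau> - t)"
    by (rule field_differentiable_bound[where S="{0..b}" and f'="\<lambda>t. F' t x"])
       (use F t in \<open>auto intro: order_trans[OF M(2) k(2)]\<close>)
  then show "\<bar>F \<tau> x - F t x\<bar> \<le> (\<bar>M\<bar> + \<bar>M'\<bar>) * \<bar>\<tau> - t\<bar> * kw n x" by (simp add: mult_ac)
qed simp

lemma LipT_diff:
  assumes "LipT b n F" "LipT b n G"
  shows "LipT b n (\<lambda>t x. F t x - G t x)"
proof -
  obtain M N where M: "0 \<le> M" "\<And>t \<tau> x. t \<in> {0..b} \<Longrightarrow> \<tau> \<in> {0..b} \<Longrightarrow> \<bar>F t x\<bar> \<le> M * kw n x \<and> \<bar>F \<tau> x - F t x\<bar> \<le> M * \<bar>\<tau> - t\<bar> * kw n x"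
    and N: "0 \<le> N" "\<And>t \<tau> x. t \<in> {0..b} \<Longrightarrow> \<tau> \<in> {0..b} \<Longrightarrow> \<bar>G t x\<bar> \<le> N * kw n x \<and> \<bar>G \<tau> x - G t x\<bar> \<le> N * \<bar>\<tau> - t\<bar> * kw n x"
    by (rule LipTE[OF assms(1)], rule LipTE[OF assms(2)]) (rule that)
  show ?thesis
    unfolding LipT_def
  proof (intro exI[of _ "M + N"] conjI ballI allI)
    fix t \<tau> x assume t: "t \<in> {0..b}" "\<tau> \<in> {0..b}"
    show "\<bar>F t x - G t x\<bar> \<le> (M + N) * kw n x"
      using M(2)[OF t, of x] N(2)[OF t, of x] unfolding distrib_right by linarith
    show "\<bar>F \<tau> x - G \<tau> x - (F t x - G t x)\<bar> \<le> (M + N) * \<bar>\<tau> - t\<bar> * kw n x"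
      using M(2)[OF t, of x] N(2)[OF t, of x] unfolding distrib_right by linarith
  qed (use M N in simp)
qed

lemma LipT_mult:
  assumes "LipT b m F" "LipT b n G"
  shows "LipT b n (\<lambda>t x. F t x * G t x)"
proof -
  obtain M N where M: "0 \<le> M" "\<And>t \<tau> x. t \<in> {0..b} \<Longrightarrow> \<tau> \<in> {0..b} \<Longrightarrow> \<bar>F t x\<bar> \<le> M * kw m x \<and> \<bar>F \<tau> x - F t x\<bar> \<le> M * \<bar>\<tau> - t\<bar> * kw m x"
    and N: "0 \<le> N" "\<And>t \<tau> x. t \<in> {0..b} \<Longrightarrow> \<tau> \<in> {0..b} \<Longrightarrow> \<bar>G t x\<bar> \<le> N * kw n x \<and> \<bar>G \<tau> x - G t x\<bar> \<le> N * \<bar>\<tau> - t\<bar> * kw n x"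
    by (rule LipTE[OF assms(1)], rule LipTE[OF assms(2)]) (rule that)
  have le1: "a * kw m x \<le> a" if "0 \<le> a" for a x using mult_left_mono[OF kw_le_1 that] by simp
  show ?thesis
    unfolding LipT_def
  proof (intro exI[of _ "2 * (M * N)"] conjI ballI allI)
    fix t \<tau> x assume t: "t \<in> {0..b}" "\<tau> \<in> {0..b}"
    have F: "\<bar>F t x\<bar> \<le> M" "\<bar>F \<tau> x - F t x\<bar> \<le> M * \<bar>\<tau> - t\<bar>"
      using M(2)[OF t, of x] le1[of M x] le1[of "M * \<bar>\<tau> - t\<bar>" x] M(1) by auto
    have G: "\<bar>G t x\<bar> \<le> N * kw n x" "\<bar>G \<tau> x\<bar> \<le> N * kw n x" "\<bar>G \<tau> x - G t x\<bar> \<le> N * \<bar>\<tau> - t\<bar> * kw n x"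
      using N(2)[OF t, of x] N(2)[OF t(2,1), of x] by auto
    have "\<bar>F t x * G t x\<bar> \<le> M * (N * kw n x)"
      unfolding abs_mult by (intro mult_mono F G) (use M(1) in auto)
    moreover have "0 \<le> M * (N * kw n x)" using M(1) N(1) kw_pos[of n x] by simp
    ultimately show "\<bar>F t x * G t x\<bar> \<le> 2 * (M * N) * kw n x" by (simp add: mult.assoc)
    have "F \<tau> x * G \<tau> x - F t x * G t x = (F \<tau> x - F t x) * G \<tau> x + F t x * (G \<tau> x - G t x)" by (simp add: algebra_simps)
    moreover have "\<bar>(F \<tau> x - F t x) * G \<tau> x\<bar> \<le> (M * \<bar>\<tau> - t\<bar>) * (N * kw n x)"
      unfolding abs_mult by (intro mult_mono F G) (use M(1) in auto)
    moreover have "\<bar>F t x * (G \<tau> x - G t x)\<bar> \<le> M * (N * \<bar>\<tau> - t\<bar> * kw n x)"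
      unfolding abs_mult by (intro mult_mono F G) (use M(1) in auto)
    ultimately show "\<bar>F \<tau> x * G \<tau> x - F t x * G t x\<bar> \<le> 2 * (M * N) * \<bar>\<tau> - t\<bar> * kw n x" by (simp add: mult_ac)
  qed (use M N in simp)
qed

lemma LipT_bounded: "LipT b n F \<Longrightarrow> t \<in> {0..b} \<Longrightarrow> \<exists>M. \<forall>x. \<bar>F t x\<bar> \<le> M * kw n x"
  unfolding LipT_def by meson

lemma LipT_eventually:
  assumes "LipT b n F" "t \<in> {0..b}" "0 < e"
  shows "\<forall>\<^sub>F \<tau> in at t within {0..b}. \<forall>x. \<bar>F \<tau> x - F t x\<bar> \<le> e * kw n x"
proof -
  obtain M where M: "0 \<le> M" "\<And>\<tau> x. \<tau> \<in> {0..b} \<Longrightarrow> \<bar>F \<tau> x - F t x\<bar> \<le> M * \<bar>\<tau> - t\<bar> * kw n x"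
    using assms(1,2) unfolding LipT_def by meson
  show ?thesis
    unfolding eventually_at
  proof (intro exI[of _ "e / (M + 1)"] conjI ballI impI allI)
    fix \<tau> x assume \<tau>: "\<tau> \<in> {0..b}" and d: "\<tau> \<noteq> t \<and> dist \<tau> t < e / (M + 1)"
    have "M * \<bar>\<tau> - t\<bar> \<le> (M + 1) * (e / (M + 1))" using d M(1) by (intro mult_mono) (auto simp: dist_real_def)
    also have "\<dots> = e" using M(1) by simp
    finally have "M * \<bar>\<tau> - t\<bar> * kw n x \<le> e * kw n x" using kw_pos[of n x] by (intro mult_right_mono) auto
    with M(2)[OF \<tau>, of x] show "\<bar>F \<tau> x - F t x\<bar> \<le> e * kw n x" by linarith
  qed (use M assms in simp)
qed

text \<open>Expressions in the derivatives of the initial datum, in t and in \<open>1 / (1 + t u0'/2)\<close>: this class of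
  functions is closed under both partial derivatives, and its members decay uniformly in t.\<close>

datatype ex = Bs nat | Ad ex ex | Mu ex ex | Tm ex | Rm ex | Cm real ex

primrec dx :: "ex \<Rightarrow> ex" where
  "dx (Bs n) = Bs (Suc n)"
| "dx (Ad a b) = Ad (dx a) (dx b)"
| "dx (Mu a b) = Ad (Mu (dx a) b) (Mu a (dx b))"
| "dx (Tm a) = Tm (dx a)"
| "dx (Rm a) = Ad (Rm (dx a)) (Cm (- 1 / 2) (Tm (Rm (Rm (Mu (Bs (Suc (Suc 0))) a)))))"
| "dx (Cm c a) = Cm c (dx a)"

text \<open>The derivative of \<open>Bs n\<close> is written \<open>Cm 0 (Bs n)\<close> because the
  syntax has no constants: every expression has a leaf \<open>Bs\<close>, which is the source of its
  decay.\<close>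

primrec dt :: "ex \<Rightarrow> ex" where
  "dt (Bs n) = Cm 0 (Bs n)"
| "dt (Ad a b) = Ad (dt a) (dt b)"
| "dt (Mu a b) = Ad (Mu (dt a) b) (Mu a (dt b))"
| "dt (Tm a) = Ad a (Tm (dt a))"
| "dt (Rm a) = Ad (Rm (dt a)) (Cm (- 1 / 2) (Rm (Rm (Mu (Bs (Suc 0)) a))))"
| "dt (Cm c a) = Cm c (dt a)"

text \<open>\<open>Dx\<close> is differentiation in the Eulerian variable, since the characteristics have derivative
  \<open>(1 + t u0'/2)\<^sup>2\<close>; \<open>Wn n\<close> is the \<open>n\<close>-th Eulerian derivative of \<open>u\<^sub>x\<close>.\<close>

definition Dx :: "ex \<Rightarrow> ex" where "Dx e = Rm (Rm (dx e))"

definition Wn :: "nat \<Rightarrow> ex" where "Wn n = (Dx ^^ n) (Rm (Bs (Suc 0)))"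

lemma Wn_Suc: "Wn (Suc n) = Dx (Wn n)" and Wn_0: "Wn 0 = Rm (Bs (Suc 0))"
  by (simp_all add: Wn_def)

text \<open>\<open>E n\<close> is the n-th derivative of the datum and - K a lower bound of its
  slope; T = 2 / K is the first time at which the factor \<open>1 + t * E (Suc 0) x / 2\<close> may
  vanish.\<close>

locale HS_flow =
  fixes E :: "nat \<Rightarrow> real \<Rightarrow> real" and g :: "real \<Rightarrow> real" and K T :: real
  assumes E_deriv: "\<And>n x. (E n has_real_derivative E (Suc n) x) (at x)"
    and E_decay: "\<And>n. \<exists>M\<ge>0. \<forall>x. \<bar>E n x\<bar> \<le> M / (1 + x\<^sup>2)"
    and E_ge: "\<And>x. - K \<le> E (Suc 0) x"
    and K: "0 < K" and T: "T = 2 / K" and g: "continuous_on {0..T} g"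
begin

definition H0 :: "real \<Rightarrow> real" where "H0 x = (LINT z:{..x}|lborel. (E (Suc 0) z)\<^sup>2 / 2)"
definition G1 :: "real \<Rightarrow> real" where "G1 t = integral {0..t} g"
definition G2 :: "real \<Rightarrow> real" where "G2 t = integral {0..t} G1"
definition R :: "real \<Rightarrow> real \<Rightarrow> real" where "R t x = 1 / (1 + t * E (Suc 0) x / 2)"
text \<open>Lagrangian velocity. The energy to the left of a particle is conserved, so its
  acceleration is \<open>H0 + g\<close>; one integration in time gives \<open>Ul\<close>, a second
  one \<open>Y\<close>.\<close>

definition Ul :: "real \<Rightarrow> real \<Rightarrow> real" where "Ul t x = E 0 x + t * H0 x + G1 t"
definition Y :: "real \<Rightarrow> real \<Rightarrow> real" where "Y t x = x + t * E 0 x + t\<^sup>2 / 2 * H0 x + G2 t"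
definition \<eta> :: "real \<Rightarrow> real \<Rightarrow> real" where "\<eta> t x = (THE y. Y t y = x)"

primrec ev :: "ex \<Rightarrow> real \<Rightarrow> real \<Rightarrow> real" where
  "ev (Bs n) t x = E n x"
| "ev (Ad a b) t x = ev a t x + ev b t x"
| "ev (Mu a b) t x = ev a t x * ev b t x"
| "ev (Tm a) t x = t * ev a t x"
| "ev (Rm a) t x = R t x * ev a t x"
| "ev (Cm c a) t x = c * ev a t x"

section \<open>Bounds for the data of the flow\<close>

lemma T_pos: "0 < T" using K T by simp

lemma E_cont: "continuous_on S (E n)"
  by (rule DERIV_continuous_on[OF has_field_derivative_at_within[OF E_deriv]])

lemma E_measurable [measurable]: "E n \<in> borel_measurable borel"
  by (rule continuous_imp_measurable_borel[OF E_cont])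

lemma E_bounded: "\<exists>M\<ge>0. \<forall>x. \<bar>E n x\<bar> \<le> M"
proof -
  obtain M where M: "0 \<le> M" "\<And>x. \<bar>E n x\<bar> \<le> M / (1 + x\<^sup>2)" using E_decay by blast
  have "M / (1 + x\<^sup>2) \<le> M" for x using mult_left_mono[OF kw_le_1[of 1 x] M(1)] by (simp add: kw_def)
  with M show ?thesis by (meson order_trans)
qed

lemma E_sq_integrable: "integrable lborel (\<lambda>z. (E (Suc 0) z)\<^sup>2 / 2)"
proof -
  obtain M where M: "0 \<le> M" "\<And>x. \<bar>E (Suc 0) x\<bar> \<le> M / (1 + x\<^sup>2)" using E_decay by blast
  obtain N where N: "0 \<le> N" "\<And>x. \<bar>E (Suc 0) x\<bar> \<le> N" using E_bounded by blast
  show ?thesis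
  proof (rule abs_le_imp_integrable_1_plus_sq[of _ "N * M"])
    fix x
    have "\<bar>E (Suc 0) x\<bar> * \<bar>E (Suc 0) x\<bar> \<le> N * (M / (1 + x\<^sup>2))" by (intro mult_mono M N) auto
    moreover have "0 \<le> N * (M / (1 + x\<^sup>2))" using M N by (simp add: add_pos_nonneg)
    moreover have "N * (M / (1 + x\<^sup>2)) = N * M / (1 + x\<^sup>2)" "\<bar>E (Suc 0) x\<bar> * \<bar>E (Suc 0) x\<bar> = (E (Suc 0) x)\<^sup>2"
      by (simp_all add: power2_eq_square)
    moreover have "norm ((E (Suc 0) x)\<^sup>2 / 2) = (E (Suc 0) x)\<^sup>2 / 2" by simp
    ultimately show "norm ((E (Suc 0) x)\<^sup>2 / 2) \<le> N * M / (1 + x\<^sup>2)" by linarith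
  qed simp
qed

lemma H0_deriv: "(H0 has_real_derivative (E (Suc 0) x)\<^sup>2 / 2) (at x)"
proof -
  have c: "continuous_on UNIV (\<lambda>z. (E (Suc 0) z)\<^sup>2 / 2)" by (intro continuous_intros E_cont) auto
  have i: "set_integrable lborel {..x} (\<lambda>z. (E (Suc 0) z)\<^sup>2 / 2)" for x
    unfolding set_integrable_def using integrable_mult_indicator[OF _ E_sq_integrable, of "{..x}"] by simp
  have "H0 = (\<lambda>x. LINT z:{..x}|lborel. (E (Suc 0) z)\<^sup>2 / 2)" by (auto simp: H0_def)
  with set_integral_atMost_has_derivative(1)[OF c i] show ?thesis by simp
qed

lemma H0_bounded: "\<exists>M\<ge>0. \<forall>x. \<bar>H0 x\<bar> \<le> M"
proof (intro exI[of _ "\<integral>z. (E (Suc 0) z)\<^sup>2 / 2 \<partial>lborel"] conjI allI)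
  show "0 \<le> (\<integral>z. (E (Suc 0) z)\<^sup>2 / 2 \<partial>lborel)" by (intro Bochner_Integration.integral_nonneg) auto
  fix x
  have "0 \<le> H0 x" unfolding H0_def set_lebesgue_integral_def by (intro Bochner_Integration.integral_nonneg) auto
  moreover have "H0 x \<le> (\<integral>z. (E (Suc 0) z)\<^sup>2 / 2 \<partial>lborel)"
    unfolding H0_def set_lebesgue_integral_def
    by (intro integral_mono E_sq_integrable integrable_mult_indicator) (auto simp: indicator_def)
  ultimately show "\<bar>H0 x\<bar> \<le> (\<integral>z. (E (Suc 0) z)\<^sup>2 / 2 \<partial>lborel)" by simp
qed

lemma H0_lim: "(\<lambda>n. H0 (- real n)) \<longlonglongrightarrow> 0"
  unfolding H0_def
  by (rule set_integral_atMost_tendsto_0)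
     (use integrable_mult_indicator[OF _ E_sq_integrable, of "{..0}"] in \<open>simp add: set_integrable_def\<close>)

lemma G1_deriv: "t \<in> {0..b} \<Longrightarrow> b \<le> T \<Longrightarrow> (G1 has_real_derivative g t) (at t within {0..b})"
  and G2_deriv: "t \<in> {0..b} \<Longrightarrow> b \<le> T \<Longrightarrow> (G2 has_real_derivative G1 t) (at t within {0..b})"
proof -
  have G1: "(G1 has_real_derivative g t) (at t within {0..b})" if "t \<in> {0..b}" "b \<le> T" for t b
    unfolding G1_def by (rule integral_has_real_derivative) (use that in \<open>auto intro: continuous_on_subset[OF g]\<close>)
  then have c: "continuous_on {0..b} G1" if "b \<le> T" for b
    using that DERIV_continuous_on by blast
  show "(G2 has_real_derivative G1 t) (at t within {0..b})" if "t \<in> {0..b}" "b \<le> T" for t b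
    unfolding G2_def by (rule integral_has_real_derivative) (use that c in auto)
  show "t \<in> {0..b} \<Longrightarrow> b \<le> T \<Longrightarrow> (G1 has_real_derivative g t) (at t within {0..b})" by (rule G1)
qed

lemma G_bounded: "\<exists>M\<ge>0. \<forall>t\<in>{0..T}. \<bar>g t\<bar> \<le> M \<and> \<bar>G1 t\<bar> \<le> M \<and> \<bar>G2 t\<bar> \<le> M"
proof -
  have "continuous_on {0..T} G1" "continuous_on {0..T} G2"
    using G1_deriv[of _ T] G2_deriv[of _ T] DERIV_continuous_on by blast+
  with g have "bounded (g ` {0..T})" "bounded (G1 ` {0..T})" "bounded (G2 ` {0..T})"
    by (auto intro: compact_imp_bounded compact_continuous_image)
  then obtain a c d where "\<forall>t\<in>{0..T}. \<bar>g t\<bar> \<le> a" "\<forall>t\<in>{0..T}. \<bar>G1 t\<bar> \<le> c" "\<forall>t\<in>{0..T}. \<bar>G2 t\<bar> \<le> d"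
    unfolding bounded_iff by (auto simp: image_iff)
  then show ?thesis by (intro exI[of _ "max 0 (max a (max c d))"]) (auto simp: le_max_iff_disj)
qed

lemma G_0: "G1 0 = 0" "G2 0 = 0" by (simp_all add: G1_def G2_def)

text \<open>Uniform distance from the blow-up: on [0, b] the worst case is slope - K at time b, and
  \<open>b * K / 2 = b / T\<close>.\<close>

lemma R_ge:
  assumes "t \<in> {0..b}" "b < T" shows "1 - b / T \<le> 1 + t * E (Suc 0) x / 2"
proof -
  have "t * (- K) \<le> t * E (Suc 0) x" using E_ge assms by (intro mult_left_mono) auto
  moreover have "t * K \<le> b * K" using assms K by (intro mult_right_mono) auto
  moreover have "b / T = b * K / 2" using K by (simp add: T)
  ultimately show ?thesis by linarith
qed

lemma one_minus_pos: "b < T \<Longrightarrow> 0 < 1 - b / T"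
  using T_pos by (simp add: field_simps)

lemma R_pos: "0 \<le> t \<Longrightarrow> t < T \<Longrightarrow> 0 < 1 + t * E (Suc 0) x / 2"
  using less_le_trans[OF one_minus_pos R_ge[of t t x]] by simp

lemma R_bound:
  assumes "t \<in> {0..b}" "b < T" shows "0 < R t x" "R t x \<le> 1 / (1 - b / T)"
  using R_ge[OF assms, of x] one_minus_pos[OF assms(2)] by (auto simp: R_def intro!: frac_le divide_pos_pos)

lemma E_chain:
  assumes "(y has_real_derivative y') (at s within S)"
  shows "((\<lambda>s. E n (y s)) has_real_derivative E (Suc n) (y s) * y') (at s within S)"
  by (rule DERIV_chain'[OF assms E_deriv])

lemma H0_chain:
  assumes "(y has_real_derivative y') (at s within S)"
  shows "((\<lambda>s. H0 (y s)) has_real_derivative (E (Suc 0) (y s))\<^sup>2 / 2 * y') (at s within S)"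
  by (rule DERIV_chain'[OF assms H0_deriv])

lemma R_chain:
  assumes a: "(a has_real_derivative a') (at s within S)" and y: "(y has_real_derivative y') (at s within S)"
    and nz: "1 + a s * E (Suc 0) (y s) / 2 \<noteq> 0"
  shows "((\<lambda>s. R (a s) (y s)) has_real_derivative
    - (1 / 2) * (R (a s) (y s))\<^sup>2 * (a' * E (Suc 0) (y s) + a s * (E (Suc (Suc 0)) (y s) * y'))) (at s within S)"
proof -
  have "((\<lambda>s. 1 + a s * E (Suc 0) (y s) / 2) has_real_derivative
    (a' * E (Suc 0) (y s) + E (Suc (Suc 0)) (y s) * y' * a s) / 2) (at s within S)"
    using DERIV_add[OF DERIV_const DERIV_cdivide[OF DERIV_mult[OF a E_chain[OF y]]], of 1 "Suc 0" 2] by simp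
  from DERIV_inverse'[OF this nz]
  have "((\<lambda>s. inverse (1 + a s * E (Suc 0) (y s) / 2)) has_real_derivative
     - (1 / 2) * (R (a s) (y s))\<^sup>2 * (a' * E (Suc 0) (y s) + a s * (E (Suc (Suc 0)) (y s) * y'))) (at s within S)"
    by (rule DERIV_cong) (simp add: R_def inverse_eq_divide power2_eq_square mult_ac)
  then show ?thesis by (simp add: R_def inverse_eq_divide)
qed

text \<open>Derivative along an arbitrary curve (a s, y s). A constant a gives derivatives in x, the
  identity gives derivatives in t at a fixed Eulerian position.\<close>

lemma ev_chain:
  assumes a: "(a has_real_derivative a') (at s within S)" and y: "(y has_real_derivative y') (at s within S)"
    and nz: "1 + a s * E (Suc 0) (y s) / 2 \<noteq> 0"
  shows "((\<lambda>s. ev e (a s) (y s)) has_real_derivative ev (dt e) (a s) (y s) * a' + ev (dx e) (a s) (y s) * y') (at s within S)"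
proof (induction e)
  case (Bs n) then show ?case using E_chain[OF y, of n] by simp
next
  case (Ad e f) from DERIV_add[OF this] show ?case by (simp add: algebra_simps)
next
  case (Mu e f) from DERIV_mult[OF this] show ?case by (simp add: algebra_simps)
next
  case (Tm e) from DERIV_mult[OF a this] show ?case by (simp add: algebra_simps)
next
  case (Rm e) from DERIV_mult[OF R_chain[OF a y nz] this] show ?case by (simp add: algebra_simps power2_eq_square)
next
  case (Cm c e) from DERIV_cmult[OF this, of c] show ?case by (simp add: algebra_simps)
qed

lemma ev_dt_dx: "ev (dt (dx e)) t x = ev (dx (dt e)) t x"
  by (induction e) (simp_all add: algebra_simps)

text \<open>Commutator of the material derivative with the Eulerian derivative: the factor
  \<open>R\<^sup>2\<close> in \<open>Dx\<close> has time derivative - u_x times itself, and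
  \<open>Wn 0\<close> is u_x.\<close>

lemma ev_dt_Dx: "ev (dt (Dx e)) t x = ev (Dx (dt e)) t x - ev (Wn 0) t x * ev (Dx e) t x"
  by (simp add: Dx_def Wn_0 ev_dt_dx algebra_simps)

text \<open>A product keeps the decay of one factor while the other is bounded, and R is bounded on
  [0, b] since b < T.\<close>

lemma ev_decay:
  assumes b: "b < T"
  shows "\<exists>M\<ge>0. \<forall>t\<in>{0..b}. \<forall>x. \<bar>ev e t x\<bar> \<le> M * kw 1 x"
proof (induction e)
  case (Bs n)
  then show ?case using E_decay[of n] by (auto simp: kw_def)
next
  case (Ad e f)
  then obtain M N where M: "0 \<le> M" "\<And>t x. t \<in> {0..b} \<Longrightarrow> \<bar>ev e t x\<bar> \<le> M * kw 1 x"
    and N: "0 \<le> N" "\<And>t x. t \<in> {0..b} \<Longrightarrow> \<bar>ev f t x\<bar> \<le> N * kw 1 x" by blast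
  show ?case
  proof (intro exI[of _ "M + N"] conjI ballI allI)
    show "\<bar>ev (Ad e f) t x\<bar> \<le> (M + N) * kw 1 x" if "t \<in> {0..b}" for t x
      using abs_triangle_ineq[of "ev e t x" "ev f t x"] M(2)[OF that, of x] N(2)[OF that, of x] unfolding distrib_right ev.simps by linarith
  qed (use M N in simp)
next
  case (Mu e f)
  then obtain M N where M: "0 \<le> M" "\<And>t x. t \<in> {0..b} \<Longrightarrow> \<bar>ev e t x\<bar> \<le> M * kw 1 x"
    and N: "0 \<le> N" "\<And>t x. t \<in> {0..b} \<Longrightarrow> \<bar>ev f t x\<bar> \<le> N * kw 1 x" by blast
  show ?case
  proof (intro exI[of _ "M * N"] conjI ballI allI)
    fix t x assume t: "t \<in> {0..b}"
    have "\<bar>ev e t x\<bar> \<le> M" using M(2)[OF t, of x] mult_left_mono[OF kw_le_1 M(1), of 1 x] by linarith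
    then have "\<bar>ev e t x\<bar> * \<bar>ev f t x\<bar> \<le> M * (N * kw 1 x)" by (intro mult_mono N t) (use M(1) in auto)
    then show "\<bar>ev (Mu e f) t x\<bar> \<le> M * N * kw 1 x" by (simp add: abs_mult mult.assoc)
  qed (use M N in simp)
next
  case (Tm e)
  then obtain M where M: "0 \<le> M" "\<And>t x. t \<in> {0..b} \<Longrightarrow> \<bar>ev e t x\<bar> \<le> M * kw 1 x" by blast
  show ?case
  proof (intro exI[of _ "\<bar>b\<bar> * M"] conjI ballI allI)
    fix t x assume t: "t \<in> {0..b}"
    have "\<bar>t\<bar> * \<bar>ev e t x\<bar> \<le> \<bar>b\<bar> * (M * kw 1 x)" by (intro mult_mono M t) (use t in auto)
    then show "\<bar>ev (Tm e) t x\<bar> \<le> \<bar>b\<bar> * M * kw 1 x" by (simp add: abs_mult mult.assoc)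
  qed (use M in simp)
next
  case (Rm e)
  then obtain M where M: "0 \<le> M" "\<And>t x. t \<in> {0..b} \<Longrightarrow> \<bar>ev e t x\<bar> \<le> M * kw 1 x" by blast
  show ?case
  proof (intro exI[of _ "1 / (1 - b / T) * M"] conjI ballI allI)
    fix t x assume t: "t \<in> {0..b}"
    have "R t x * \<bar>ev e t x\<bar> \<le> 1 / (1 - b / T) * (M * kw 1 x)"
      by (intro mult_mono M t R_bound b) (use one_minus_pos[OF b] in auto)
    then show "\<bar>ev (Rm e) t x\<bar> \<le> 1 / (1 - b / T) * M * kw 1 x"
      using R_bound(1)[OF t b, of x] by (simp add: abs_mult mult.assoc)
  qed (use M one_minus_pos[OF b] in simp)
next
  case (Cm c e)
  then obtain M where M: "0 \<le> M" "\<And>t x. t \<in> {0..b} \<Longrightarrow> \<bar>ev e t x\<bar> \<le> M * kw 1 x" by blast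
  show ?case
  proof (intro exI[of _ "\<bar>c\<bar> * M"] conjI ballI allI)
    fix t x assume t: "t \<in> {0..b}"
    have "\<bar>c\<bar> * \<bar>ev e t x\<bar> \<le> \<bar>c\<bar> * (M * kw 1 x)" by (intro mult_left_mono M t) auto
    then show "\<bar>ev (Cm c e) t x\<bar> \<le> \<bar>c\<bar> * M * kw 1 x" by (simp add: abs_mult mult.assoc)
  qed (use M in simp)
qed

section \<open>The flow map and its inverse\<close>

lemma Y_deriv: "(Y t has_real_derivative (1 + t * E (Suc 0) x / 2)\<^sup>2) (at x)"
proof -
  have "(Y t has_real_derivative (1 + t * E (Suc 0) x + t\<^sup>2 / 2 * ((E (Suc 0) x)\<^sup>2 / 2) + 0)) (at x)"
    unfolding Y_def by (intro DERIV_add DERIV_cmult E_deriv H0_deriv DERIV_const DERIV_ident)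
  \<comment> \<open>The energy term \<open>t\<^sup>2 / 4 * u0'\<^sup>2\<close> completes the
    square.\<close>
  then show ?thesis by (rule DERIV_cong) (simp add: power2_eq_square field_simps)
qed

lemma Y_deriv_t: "t \<in> {0..b} \<Longrightarrow> b \<le> T \<Longrightarrow> ((\<lambda>t. Y t x) has_real_derivative Ul t x) (at t within {0..b})"
proof -
  assume t: "t \<in> {0..b}" "b \<le> T"
  have "((\<lambda>t. Y t x) has_real_derivative 0 + 1 * E 0 x + (2 * t ^ 1 * 1) / 2 * H0 x + G1 t) (at t within {0..b})"
    unfolding Y_def
    by (intro DERIV_add DERIV_cmult_right DERIV_const DERIV_cdivide G2_deriv[OF t] DERIV_ident) (auto intro!: derivative_eq_intros)
  then show ?thesis by (simp add: Ul_def)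
qed

lemma Ul_bounded: "\<exists>M\<ge>0. \<forall>t\<in>{0..T}. \<forall>x. \<bar>Ul t x\<bar> \<le> M" and Y_bounded: "\<exists>M\<ge>0. \<forall>t\<in>{0..T}. \<forall>x. \<bar>Y t x - x\<bar> \<le> M"
proof -
  obtain A B D where A: "0 \<le> A" "\<And>x. \<bar>E 0 x\<bar> \<le> A" and B: "0 \<le> B" "\<And>x. \<bar>H0 x\<bar> \<le> B"
    and D: "0 \<le> D" "\<And>t. t \<in> {0..T} \<Longrightarrow> \<bar>g t\<bar> \<le> D \<and> \<bar>G1 t\<bar> \<le> D \<and> \<bar>G2 t\<bar> \<le> D"
    using E_bounded[of 0] H0_bounded G_bounded by meson
  have "\<bar>Ul t x\<bar> \<le> A + T * B + D" if t: "t \<in> {0..T}" for t x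
  proof -
    have "\<bar>t * H0 x\<bar> \<le> T * B" unfolding abs_mult by (intro mult_mono B) (use t in auto)
    then show ?thesis unfolding Ul_def using A(2)[of x] D(2)[OF t] by linarith
  qed
  then show "\<exists>M\<ge>0. \<forall>t\<in>{0..T}. \<forall>x. \<bar>Ul t x\<bar> \<le> M"
    using A B D T_pos by (intro exI[of _ "A + T * B + D"]) simp
  have "\<bar>Y t x - x\<bar> \<le> T * A + T\<^sup>2 / 2 * B + D" if t: "t \<in> {0..T}" for t x
  proof -
    have "\<bar>t * E 0 x\<bar> \<le> T * A" unfolding abs_mult by (intro mult_mono A) (use t in auto)
    moreover have "\<bar>t\<^sup>2 / 2 * H0 x\<bar> \<le> T\<^sup>2 / 2 * B" unfolding abs_mult by (intro mult_mono B) (use t in \<open>auto intro: power_mono\<close>)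
    ultimately show ?thesis unfolding Y_def using D(2)[OF t] by linarith
  qed
  then show "\<exists>M\<ge>0. \<forall>t\<in>{0..T}. \<forall>x. \<bar>Y t x - x\<bar> \<le> M"
    using A B D T_pos by (intro exI[of _ "T * A + T\<^sup>2 / 2 * B + D"]) simp
qed

text \<open>A lower bound for the Jacobian, uniform for t in [0, b]; it yields injectivity and the
  continuity of the inverse, also in time.\<close>

lemma Y_expand:
  assumes t: "t \<in> {0..b}" and b: "b < T"
  shows "(1 - b / T)\<^sup>2 * \<bar>x - y\<bar> \<le> \<bar>Y t x - Y t y\<bar>"
proof -
  have *: "(1 - b / T)\<^sup>2 * (x - y) \<le> Y t x - Y t y" if yx: "y < x" for x y
  proof -
    obtain z where z: "Y t x - Y t y = (x - y) * (1 + t * E (Suc 0) z / 2)\<^sup>2"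
      using MVT2[OF yx Y_deriv] by blast
    have "(1 - b / T)\<^sup>2 \<le> (1 + t * E (Suc 0) z / 2)\<^sup>2"
      using R_ge[OF t b] one_minus_pos[OF b] by (intro power_mono) auto
    then show ?thesis unfolding z using yx by (simp add: mult.commute)
  qed
  have "0 \<le> (1 - b / T)\<^sup>2 * \<bar>x - y\<bar>" by simp
  then show ?thesis using *[of x y] *[of y x] by (cases x y rule: linorder_cases) auto
qed

text \<open>\<open>Y t\<close> is injective by \<open>Y_expand\<close>, and onto by the intermediate
  value theorem since \<open>Y t x - x\<close> is bounded.\<close>

lemma Y_\<eta>: "Y t (\<eta> t x) = x" and \<eta>_Y: "\<eta> t (Y t x) = x" if t: "0 \<le> t" "t < T"
proof -
  have inj: "x = y" if "Y t x = Y t y" for x y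
    using Y_expand[of t t x y] one_minus_pos[OF t(2)] t that by (auto simp: mult_le_0_iff simp del: zero_less_diff diff_gt_0_iff_gt)
  have ex: "\<exists>y. Y t y = x" for x
  proof -
    obtain M where M: "0 \<le> M" "\<And>x. \<bar>Y t x - x\<bar> \<le> M" using Y_bounded t by force
    have "\<exists>y\<ge>x - M. y \<le> x + M \<and> Y t y = x"
      by (rule IVT') (use M(1) M(2)[of "x - M"] M(2)[of "x + M"] DERIV_continuous_on[OF has_field_derivative_at_within[OF Y_deriv]] in \<open>auto simp: abs_le_iff\<close>)
    then show ?thesis by blast
  qed
  show 1: "Y t (\<eta> t x) = x" for x
  proof -
    have "\<exists>!y. Y t y = x" using ex[of x] inj by metis
    then show ?thesis unfolding \<eta>_def by (rule theI')
  qed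
  show "\<eta> t (Y t x) = x" by (rule inj[OF 1])
qed

lemma \<eta>_bounded: "\<exists>M\<ge>0. \<forall>t. 0 \<le> t \<and> t < T \<longrightarrow> (\<forall>x. \<bar>\<eta> t x - x\<bar> \<le> M)"
proof -
  obtain M where M: "0 \<le> M" "\<And>t x. t \<in> {0..T} \<Longrightarrow> \<bar>Y t x - x\<bar> \<le> M" using Y_bounded by blast
  have "\<bar>\<eta> t x - x\<bar> \<le> M" if "0 \<le> t" "t < T" for t x
    using M(2)[of t "\<eta> t x"] Y_\<eta>[OF that, of x] that by (simp add: abs_minus_commute)
  with M(1) show ?thesis by blast
qed

lemma \<eta>_deriv:
  assumes t: "0 \<le> t" "t < T" shows "(\<eta> t has_real_derivative (R t (\<eta> t x))\<^sup>2) (at x)"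
proof -
  let ?c = "(1 - t / T)\<^sup>2"
  have c: "0 < ?c" by (rule zero_less_power[OF one_minus_pos[OF t(2)]])
  have "isCont (\<eta> t) x"
    unfolding continuous_at_eps_delta
  proof (intro allI impI)
    fix e :: real assume e: "0 < e"
    show "\<exists>d>0. \<forall>y. dist y x < d \<longrightarrow> dist (\<eta> t y) (\<eta> t x) < e"
    proof (intro exI[of _ "?c * e"] conjI allI impI)
      fix y assume "dist y x < ?c * e"
      moreover have "?c * \<bar>\<eta> t y - \<eta> t x\<bar> \<le> dist y x"
        using Y_expand[of t t "\<eta> t y" "\<eta> t x"] t by (simp add: Y_\<eta>[OF t] dist_real_def)
      ultimately have "?c * \<bar>\<eta> t y - \<eta> t x\<bar> < ?c * e" by (rule le_less_trans[rotated])
      then show "dist (\<eta> t y) (\<eta> t x) < e" unfolding mult_less_cancel_left_pos[OF c] dist_real_def .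
    qed (use c e in simp)
  qed
  then have "(\<eta> t has_real_derivative inverse ((1 + t * E (Suc 0) (\<eta> t x) / 2)\<^sup>2)) (at x)"
    by (intro DERIV_inverse_function[where f="Y t" and a="x - 1" and b="x + 1"] Y_deriv)
       (use R_pos[OF t, of "\<eta> t x"] in \<open>auto simp: Y_\<eta>[OF t]\<close>)
  then show ?thesis by (simp add: R_def power_one_over inverse_eq_divide)
qed

text \<open>With y = \<open>\<eta> t x\<close>, the mean value theorem in space writes
  \<open>Y t y - Y \<tau> y\<close> as \<open>\<eta> \<tau> x - y\<close> times the Jacobian at some
  \<open>z \<tau>\<close>. \<open>Y_expand\<close> forces \<open>z \<tau>\<close> to tend to y, so
  the difference quotient of \<open>\<eta>\<close> tends to minus the velocity over the
  Jacobian.\<close>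

lemma \<eta>_deriv_t:
  assumes t: "t \<in> {0..b}" and b: "b < T"
  shows "((\<lambda>t. \<eta> t x) has_real_derivative - Ul t (\<eta> t x) * (R t (\<eta> t x))\<^sup>2) (at t within {0..b})"
proof -
  define y where "y = \<eta> t x"
  let ?c = "(1 - b / T)\<^sup>2"
  have c: "0 < ?c" by (rule zero_less_power[OF one_minus_pos[OF b]])
  have tT: "0 \<le> \<tau>" "\<tau> < T" if "\<tau> \<in> {0..b}" for \<tau> using that b by auto
  have ev: "\<forall>\<^sub>F \<tau> in at t within {0..b}. \<tau> \<in> {0..b} \<and> \<tau> \<noteq> t" by (simp add: eventually_at_filter)
  have Yt: "((\<lambda>\<tau>. (Y \<tau> y - Y t y) / (\<tau> - t)) \<longlongrightarrow> Ul t y) (at t within {0..b})"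
    using Y_deriv_t[OF t, of y] b by (simp add: has_field_derivative_iff)
  have mv: "\<exists>z. \<bar>z - y\<bar> \<le> \<bar>\<eta> \<tau> x - y\<bar> \<and> Y \<tau> (\<eta> \<tau> x) - Y \<tau> y = (\<eta> \<tau> x - y) * (1 + \<tau> * E (Suc 0) z / 2)\<^sup>2" for \<tau>
  proof (cases "\<eta> \<tau> x" y rule: linorder_cases)
    case less
    from MVT2[OF this Y_deriv[of \<tau>]]
    obtain z where "\<eta> \<tau> x < z" "z < y" "Y \<tau> y - Y \<tau> (\<eta> \<tau> x) = (y - \<eta> \<tau> x) * (1 + \<tau> * E (Suc 0) z / 2)\<^sup>2" by auto
    then show ?thesis by (intro exI[of _ z]) (auto simp: algebra_simps)
  next
    case greater
    from MVT2[OF this Y_deriv[of \<tau>]]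
    obtain z where "y < z" "z < \<eta> \<tau> x" "Y \<tau> (\<eta> \<tau> x) - Y \<tau> y = (\<eta> \<tau> x - y) * (1 + \<tau> * E (Suc 0) z / 2)\<^sup>2" by auto
    then show ?thesis by (intro exI[of _ z]) auto
  qed auto
  then obtain z where z: "\<And>\<tau>. \<bar>z \<tau> - y\<bar> \<le> \<bar>\<eta> \<tau> x - y\<bar>"
      "\<And>\<tau>. Y \<tau> (\<eta> \<tau> x) - Y \<tau> y = (\<eta> \<tau> x - y) * (1 + \<tau> * E (Suc 0) (z \<tau>) / 2)\<^sup>2" by metis
  have xY: "x = Y t y" unfolding y_def using Y_\<eta>[OF tT[OF t]] by simp
  have "((\<lambda>\<tau>. Y \<tau> y - Y t y) \<longlongrightarrow> 0) (at t within {0..b})"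
  proof -
    have "continuous (at t within {0..b}) (\<lambda>\<tau>. Y \<tau> y)" using DERIV_continuous[OF Y_deriv_t[OF t]] b by simp
    then show ?thesis unfolding continuous_within by (rule Lim_null[THEN iffD1])
  qed
  then have "((\<lambda>\<tau>. \<bar>Y \<tau> y - Y t y\<bar> / ?c) \<longlongrightarrow> \<bar>0\<bar> / ?c) (at t within {0..b})" using c by (intro tendsto_intros) auto
  moreover have "\<forall>\<^sub>F \<tau> in at t within {0..b}. norm (z \<tau> - y) \<le> \<bar>Y \<tau> y - Y t y\<bar> / ?c"
    using ev
  proof eventually_elim
    case (elim \<tau>)
    then have "?c * \<bar>\<eta> \<tau> x - y\<bar> \<le> \<bar>Y \<tau> y - Y t y\<bar>"
      using Y_expand[of \<tau> b "\<eta> \<tau> x" y] b Y_\<eta>[OF tT, of \<tau> x] xY by (simp add: abs_minus_commute)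
    then have "\<bar>\<eta> \<tau> x - y\<bar> \<le> \<bar>Y \<tau> y - Y t y\<bar> / ?c" using c by (simp add: field_simps)
    with z(1)[of \<tau>] show ?case by simp
  qed
  ultimately have "((\<lambda>\<tau>. z \<tau> - y) \<longlongrightarrow> 0) (at t within {0..b})" by (auto intro: Lim_null_comparison)
  then have "(z \<longlongrightarrow> y) (at t within {0..b})" by (rule Lim_null[THEN iffD2])
  moreover have "isCont (E (Suc 0)) y" using E_deriv DERIV_isCont by blast
  ultimately have "((\<lambda>\<tau>. E (Suc 0) (z \<tau>)) \<longlongrightarrow> E (Suc 0) y) (at t within {0..b})" by (rule isCont_tendsto_compose[rotated])
  then have "((\<lambda>\<tau>. (1 + \<tau> * E (Suc 0) (z \<tau>) / 2)\<^sup>2) \<longlongrightarrow> (1 + t * E (Suc 0) y / 2)\<^sup>2) (at t within {0..b})"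
    by (intro tendsto_intros) auto
  then have "((\<lambda>\<tau>. - ((Y \<tau> y - Y t y) / (\<tau> - t)) / (1 + \<tau> * E (Suc 0) (z \<tau>) / 2)\<^sup>2) \<longlongrightarrow> - Ul t y / (1 + t * E (Suc 0) y / 2)\<^sup>2) (at t within {0..b})"
    by (intro tendsto_divide tendsto_minus Yt) (use R_pos[OF tT[OF t], of y] in auto)
  moreover have "\<forall>\<^sub>F \<tau> in at t within {0..b}. - ((Y \<tau> y - Y t y) / (\<tau> - t)) / (1 + \<tau> * E (Suc 0) (z \<tau>) / 2)\<^sup>2 = (\<eta> \<tau> x - \<eta> t x) / (\<tau> - t)"
    using ev
  proof eventually_elim
    case (elim \<tau>)
    have nz: "1 + \<tau> * E (Suc 0) (z \<tau>) / 2 \<noteq> 0" using R_pos[OF tT, of \<tau> "z \<tau>"] elim by simp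
    have "Y t y - Y \<tau> y = (\<eta> \<tau> x - y) * (1 + \<tau> * E (Suc 0) (z \<tau>) / 2)\<^sup>2"
      using z(2)[of \<tau>] Y_\<eta>[OF tT, of \<tau> x] elim xY by simp
    then have "- ((Y \<tau> y - Y t y) / (\<tau> - t)) = (\<eta> \<tau> x - y) * (1 + \<tau> * E (Suc 0) (z \<tau>) / 2)\<^sup>2 / (\<tau> - t)"
      by (metis minus_diff_eq minus_divide_left)
    then show ?case using nz by (simp add: y_def)
  qed
  ultimately have "((\<lambda>\<tau>. (\<eta> \<tau> x - \<eta> t x) / (\<tau> - t)) \<longlongrightarrow> - Ul t y / (1 + t * E (Suc 0) y / 2)\<^sup>2) (at t within {0..b})"
    by (rule Lim_transform_eventually)
  then show ?thesis by (simp add: has_field_derivative_iff y_def R_def power_one_over)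
qed

end

section \<open>Eulerian derivatives of the explicit solution\<close>

context HS_flow
begin

primrec U :: "real \<Rightarrow> nat \<Rightarrow> real \<Rightarrow> real" where
  "U t 0 = (\<lambda>x. Ul t (\<eta> t x))"
| "U t (Suc n) = (\<lambda>x. ev (Wn n) t (\<eta> t x))"

text \<open>Time derivatives of \<open>U\<close> at fixed x: the material derivative minus
  transport. For n = 0 the material derivative is \<open>H0 + g\<close>; as g does not depend on x,
  it occurs only there.\<close>

primrec V :: "real \<Rightarrow> nat \<Rightarrow> real \<Rightarrow> real" where
  "V t 0 = (\<lambda>x. H0 (\<eta> t x) + g t - U t 0 x * U t (Suc 0) x)"
| "V t (Suc n) = (\<lambda>x. ev (dt (Wn n)) t (\<eta> t x) - U t 0 x * U t (Suc (Suc n)) x)"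

text \<open>One factor R cancels against \<open>1 + t * u0' / 2\<close>; this turns the derivative
  of \<open>Ul\<close> in the Eulerian variable into u_x.\<close>

lemma R_mult:
  assumes "0 \<le> t" "t < T"
  shows "(E (Suc 0) x + t * ((E (Suc 0) x)\<^sup>2 / 2)) * (R t x)\<^sup>2 = R t x * E (Suc 0) x"
proof -
  have 1: "R t x * (1 + t * E (Suc 0) x / 2) = 1" using R_pos[OF assms, of x] by (simp add: R_def)
  have "(E (Suc 0) x + t * ((E (Suc 0) x)\<^sup>2 / 2)) * (R t x)\<^sup>2 = R t x * E (Suc 0) x * (R t x * (1 + t * E (Suc 0) x / 2))"
    by (simp add: power2_eq_square algebra_simps)
  then show ?thesis unfolding 1 by simp
qed

lemma ev_deriv_x:
  assumes t: "0 \<le> t" "t < T"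
  shows "((\<lambda>x. ev e t (\<eta> t x)) has_real_derivative ev (Dx e) t (\<eta> t x)) (at x)"
proof -
  have "1 + t * E (Suc 0) (\<eta> t x) / 2 \<noteq> 0" using R_pos[OF t, of "\<eta> t x"] by simp
  from ev_chain[where a="\<lambda>_. t" and a'=0, OF DERIV_const \<eta>_deriv[OF t] this, of e]
  show ?thesis by (simp add: Dx_def power2_eq_square mult_ac)
qed

lemma ev_deriv_t:
  assumes t: "t \<in> {0..b}" and b: "b < T"
  shows "((\<lambda>t. ev e t (\<eta> t x)) has_real_derivative ev (dt e) t (\<eta> t x) - U t 0 x * ev (Dx e) t (\<eta> t x)) (at t within {0..b})"
proof -
  have "1 + t * E (Suc 0) (\<eta> t x) / 2 \<noteq> 0" using R_pos[of t "\<eta> t x"] t b by simp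
  from ev_chain[where a="\<lambda>s. s" and y="\<lambda>s. \<eta> s x", OF DERIV_ident \<eta>_deriv_t[OF t b] this, of e]
  show ?thesis by (simp add: Dx_def power2_eq_square mult_ac)
qed

lemma H0_deriv_x:
  assumes t: "0 \<le> t" "t < T"
  shows "((\<lambda>x. H0 (\<eta> t x)) has_real_derivative (U t (Suc 0) x)\<^sup>2 / 2) (at x)"
  using H0_chain[OF \<eta>_deriv[OF t]] by (simp add: Wn_0 power_mult_distrib mult_ac)

lemma H0_deriv_t:
  assumes t: "t \<in> {0..b}" and b: "b < T"
  shows "((\<lambda>t. H0 (\<eta> t x)) has_real_derivative - U t 0 x * ((U t (Suc 0) x)\<^sup>2 / 2)) (at t within {0..b})"
  using H0_chain[OF \<eta>_deriv_t[OF t b]] by (simp add: Wn_0 power_mult_distrib mult_ac)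

lemma U_deriv:
  assumes t: "0 \<le> t" "t < T"
  shows "(U t n has_real_derivative U t (Suc n) x) (at x)"
proof (cases n)
  case 0
  note y = \<eta>_deriv[OF t, of x]
  have "((\<lambda>x. Ul t (\<eta> t x)) has_real_derivative
      E (Suc 0) (\<eta> t x) * (R t (\<eta> t x))\<^sup>2 + t * ((E (Suc 0) (\<eta> t x))\<^sup>2 / 2 * (R t (\<eta> t x))\<^sup>2) + 0) (at x)"
    unfolding Ul_def by (intro DERIV_add DERIV_cmult DERIV_const E_chain[OF y] H0_chain[OF y])
  then have "((\<lambda>x. Ul t (\<eta> t x)) has_real_derivative ev (Wn 0) t (\<eta> t x)) (at x)"
    by (rule DERIV_cong) (use R_mult[OF t, of "\<eta> t x"] in \<open>simp add: Wn_0 algebra_simps\<close>)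
  then show ?thesis using 0 by simp
next
  case (Suc k)
  then show ?thesis using ev_deriv_x[OF t, of "Wn k" x] by (simp add: Wn_Suc)
qed

lemma U_deriv_t:
  assumes t: "t \<in> {0..b}" and b: "b < T"
  shows "((\<lambda>t. U t n x) has_real_derivative V t n x) (at t within {0..b})"
proof (cases n)
  case 0
  have tT: "0 \<le> t" "t < T" using t b by auto
  define y' where "y' = - Ul t (\<eta> t x) * (R t (\<eta> t x))\<^sup>2"
  note y = \<eta>_deriv_t[OF t b, of x, folded y'_def]
  have "((\<lambda>t. Ul t (\<eta> t x)) has_real_derivative
      E (Suc 0) (\<eta> t x) * y' + (1 * H0 (\<eta> t x) + (E (Suc 0) (\<eta> t x))\<^sup>2 / 2 * y' * t) + g t) (at t within {0..b})"
    unfolding Ul_def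
    by (intro DERIV_add DERIV_mult DERIV_ident E_chain[OF y] H0_chain[OF y] G1_deriv[OF t]) (use b in simp)
  then have "((\<lambda>t. Ul t (\<eta> t x)) has_real_derivative H0 (\<eta> t x) + g t - Ul t (\<eta> t x) * ev (Wn 0) t (\<eta> t x)) (at t within {0..b})"
  proof (rule DERIV_cong)
    have "E (Suc 0) (\<eta> t x) * y' + (1 * H0 (\<eta> t x) + (E (Suc 0) (\<eta> t x))\<^sup>2 / 2 * y' * t) + g t =
      H0 (\<eta> t x) + g t - Ul t (\<eta> t x) * ((E (Suc 0) (\<eta> t x) + t * ((E (Suc 0) (\<eta> t x))\<^sup>2 / 2)) * (R t (\<eta> t x))\<^sup>2)"
      unfolding y'_def by (simp add: algebra_simps)
    then show "E (Suc 0) (\<eta> t x) * y' + (1 * H0 (\<eta> t x) + (E (Suc 0) (\<eta> t x))\<^sup>2 / 2 * y' * t) + g t =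
      H0 (\<eta> t x) + g t - Ul t (\<eta> t x) * ev (Wn 0) t (\<eta> t x)"
      unfolding R_mult[OF tT] by (simp add: Wn_0)
  qed
  then show ?thesis using 0 by simp
next
  case (Suc k)
  then show ?thesis using ev_deriv_t[OF t b, of "Wn k" x] by (simp add: Wn_Suc)
qed

lemma V_deriv:
  assumes t: "0 \<le> t" "t < T"
  shows "(V t n has_real_derivative V t (Suc n) x) (at x)"
proof (cases n)
  case 0
  have "((\<lambda>x. H0 (\<eta> t x) + g t - U t 0 x * U t (Suc 0) x) has_real_derivative
     (U t (Suc 0) x)\<^sup>2 / 2 + 0 - (U t (Suc 0) x * U t (Suc 0) x + U t (Suc (Suc 0)) x * U t 0 x)) (at x)"
    by (intro DERIV_diff DERIV_add DERIV_mult H0_deriv_x U_deriv DERIV_const t)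
  then have "((\<lambda>x. H0 (\<eta> t x) + g t - U t 0 x * U t (Suc 0) x) has_real_derivative V t (Suc 0) x) (at x)"
    by (rule DERIV_cong) (simp add: Wn_0 power2_eq_square)
  then show ?thesis using 0 by (simp del: U.simps)
next
  case (Suc k)
  have "((\<lambda>x. ev (dt (Wn k)) t (\<eta> t x) - U t 0 x * U t (Suc (Suc k)) x) has_real_derivative
     ev (Dx (dt (Wn k))) t (\<eta> t x) - (U t (Suc 0) x * U t (Suc (Suc k)) x + U t (Suc (Suc (Suc k))) x * U t 0 x)) (at x)"
    by (intro DERIV_diff DERIV_mult ev_deriv_x U_deriv t)
  then have "((\<lambda>x. ev (dt (Wn k)) t (\<eta> t x) - U t 0 x * U t (Suc (Suc k)) x) has_real_derivative V t (Suc (Suc k)) x) (at x)"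
    by (rule DERIV_cong) (simp add: Wn_Suc ev_dt_Dx)
  then show ?thesis using Suc by (simp del: U.simps)
qed

text \<open>Decay in the Lagrangian variable is transported by \<open>kw_shift_le\<close>; the
  stronger weight \<open>kw 1\<close> also serves for n = 0.\<close>

lemma ev_kw:
  assumes b: "b < T"
  shows "\<exists>M\<ge>0. \<forall>t\<in>{0..b}. \<forall>x. \<bar>ev e t (\<eta> t x)\<bar> \<le> M * kw n x"
proof -
  obtain M C where M: "0 \<le> M" "\<And>t x. t \<in> {0..b} \<Longrightarrow> \<bar>ev e t x\<bar> \<le> M * kw 1 x"
    and C: "0 \<le> C" "\<And>t x. 0 \<le> t \<Longrightarrow> t < T \<Longrightarrow> \<bar>\<eta> t x - x\<bar> \<le> C"
    using ev_decay[OF b, of e] \<eta>_bounded by metis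
  show ?thesis
  proof (intro exI[of _ "M * (2 + 2 * C\<^sup>2)"] conjI ballI allI)
    fix t x assume t: "t \<in> {0..b}"
    have "\<bar>ev e t (\<eta> t x)\<bar> \<le> M * kw 1 (\<eta> t x)" by (rule M(2)[OF t])
    also have "\<dots> \<le> M * ((2 + 2 * C\<^sup>2) * kw 1 x)" using C t b by (intro mult_left_mono kw_shift_le M(1)) auto
    also have "\<dots> \<le> M * ((2 + 2 * C\<^sup>2) * kw n x)"
      using M(1) kw_le_1[of 1 x] by (intro mult_left_mono) (auto simp: kw_def)
    finally show "\<bar>ev e t (\<eta> t x)\<bar> \<le> M * (2 + 2 * C\<^sup>2) * kw n x" by (simp add: mult.assoc)
  qed (use M in simp)
qed

lemma U_0_bounded: "\<exists>M\<ge>0. \<forall>t x. 0 \<le> t \<and> t < T \<longrightarrow> \<bar>U t 0 x\<bar> \<le> M"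
  using Ul_bounded by (fastforce simp: less_imp_le)

lemma abs_mult_kw_le: "\<bar>a\<bar> \<le> A \<Longrightarrow> \<bar>c\<bar> \<le> C * k \<Longrightarrow> \<bar>a * c\<bar> \<le> A * C * (k::real)"
  unfolding abs_mult mult.assoc by (rule mult_mono) auto

text \<open>The time derivatives of these quantities are again expressions of the same kind, with at
  most a further bounded factor \<open>U t 0\<close>, and so keep the weight; at n = 0 a bound by
  the weight 1 is enough.\<close>

lemma LipT_flow:
  assumes b: "0 \<le> b" "b < T"
  shows LipT_U: "LipT b n (\<lambda>t. U t n)" and LipT_V: "LipT b (Suc n) (\<lambda>t. V t (Suc n))" and LipT_H0: "LipT b 0 (\<lambda>t x. H0 (\<eta> t x))"
proof -
  obtain A where A: "0 \<le> A" "\<And>t x. t \<in> {0..b} \<Longrightarrow> \<bar>U t 0 x\<bar> \<le> A" using U_0_bounded b by force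
  have ev: "LipT b m (\<lambda>t x. ev e t (\<eta> t x))" for e m
  proof -
    obtain M N L where M: "\<And>t x. t \<in> {0..b} \<Longrightarrow> \<bar>ev e t (\<eta> t x)\<bar> \<le> M * kw m x"
      and N: "\<And>t x. t \<in> {0..b} \<Longrightarrow> \<bar>ev (dt e) t (\<eta> t x)\<bar> \<le> N * kw m x"
      and L: "\<And>t x. t \<in> {0..b} \<Longrightarrow> \<bar>ev (Dx e) t (\<eta> t x)\<bar> \<le> L * kw m x"
      using ev_kw[OF b(2)] by metis
    show ?thesis
    proof (rule LipTI[OF ev_deriv_t[OF _ b(2)] M])
      fix t x assume t: "t \<in> {0..b}"
      have "\<bar>U t 0 x * ev (Dx e) t (\<eta> t x)\<bar> \<le> A * L * kw m x" by (rule abs_mult_kw_le[OF A(2)[OF t] L[OF t]])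
      then show "\<bar>ev (dt e) t (\<eta> t x) - U t 0 x * ev (Dx e) t (\<eta> t x)\<bar> \<le> (N + A * L) * kw m x"
        using N[OF t, of x] unfolding distrib_right by linarith
    qed
  qed
  have U1: "\<exists>M\<ge>0. \<forall>t\<in>{0..b}. \<forall>x. \<bar>U t (Suc 0) x\<bar> \<le> M * kw 0 x" using ev_kw[OF b(2)] by simp
  then obtain L where L: "0 \<le> L" "\<And>t x. t \<in> {0..b} \<Longrightarrow> \<bar>U t (Suc 0) x\<bar> \<le> L" by (auto simp: kw_def)
  obtain B where B: "0 \<le> B" "\<And>x. \<bar>H0 x\<bar> \<le> B" using H0_bounded by blast
  obtain D where D: "\<And>t. t \<in> {0..T} \<Longrightarrow> \<bar>g t\<bar> \<le> D" using G_bounded by blast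
  show LH: "LipT b 0 (\<lambda>t x. H0 (\<eta> t x))"
  proof (rule LipTI[OF H0_deriv_t[OF _ b(2)], where M=B and M'="A * (L * L)"])
    fix t x assume t: "t \<in> {0..b}"
    have "\<bar>U t (Suc 0) x * U t (Suc 0) x\<bar> \<le> L * L" unfolding abs_mult by (intro mult_mono L t) auto
    then have "\<bar>(U t (Suc 0) x)\<^sup>2 / 2\<bar> \<le> L * L" unfolding power2_eq_square by linarith
    then have "\<bar>U t 0 x * ((U t (Suc 0) x)\<^sup>2 / 2)\<bar> \<le> A * (L * L)"
      unfolding abs_mult[of "U t 0 x"] by (intro mult_mono A t) auto
    then show "\<bar>- U t 0 x * ((U t (Suc 0) x)\<^sup>2 / 2)\<bar> \<le> A * (L * L) * kw 0 x" by (simp add: kw_def del: U.simps)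
    show "\<bar>H0 (\<eta> t x)\<bar> \<le> B * kw 0 x" using B(2) by (simp add: kw_def)
  qed
  have U0: "LipT b 0 (\<lambda>t. U t 0)"
  proof (rule LipTI[OF U_deriv_t[OF _ b(2)], where M=A and M'="B + D + A * L"])
    fix t x assume t: "t \<in> {0..b}"
    have "\<bar>U t 0 x * U t (Suc 0) x\<bar> \<le> A * L" unfolding abs_mult by (intro mult_mono A L t) (use A in auto)
    then show "\<bar>V t 0 x\<bar> \<le> (B + D + A * L) * kw 0 x"
      using B(2)[of "\<eta> t x"] D[of t] t b unfolding V.simps kw_def by simp
    show "\<bar>U t 0 x\<bar> \<le> A * kw 0 x" using A(2)[OF t, of x] by (simp add: kw_def)
  qed
  show Un: "LipT b n (\<lambda>t. U t n)" for n
    by (cases n) (use U0 ev in \<open>simp_all\<close>)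
  show "LipT b (Suc n) (\<lambda>t. V t (Suc n))"
    unfolding V.simps
  proof (intro LipT_diff ev)
    have "LipT b (Suc (Suc n)) (\<lambda>t x. U t 0 x * U t (Suc (Suc n)) x)" by (rule LipT_mult[OF U0 Un])
    \<comment> \<open>The weight \<open>kw\<close> is the same for all positive indices.\<close>
    then show "LipT b (Suc n) (\<lambda>t x. U t 0 x * U t (Suc (Suc n)) x)" by (simp add: LipT_def kw_def del: U.simps)
  qed
qed

text \<open>\<open>V t 0\<close> contains g, which is only continuous in time, so g is split off
  from the terms that are Lipschitz.\<close>

lemma V_0_eventually:
  assumes b: "0 \<le> b" "b < T" and t: "t \<in> {0..b}" and e: "0 < e"
  shows "\<forall>\<^sub>F \<tau> in at t within {0..b}. \<forall>x. \<bar>V \<tau> 0 x - V t 0 x\<bar> \<le> e * kw 0 x"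
proof -
  have "LipT b 0 (\<lambda>t x. U t 0 x * U t (Suc 0) x)"
  proof -
    have "LipT b (Suc 0) (\<lambda>t x. U t 0 x * U t (Suc 0) x)" by (rule LipT_mult[OF LipT_U[OF b] LipT_U[OF b]])
    then obtain M where M: "0 \<le> M" "\<And>t \<tau> x. t \<in> {0..b} \<Longrightarrow> \<tau> \<in> {0..b} \<Longrightarrow> \<bar>U t 0 x * U t (Suc 0) x\<bar> \<le> M * kw (Suc 0) x \<and>
       \<bar>U \<tau> 0 x * U \<tau> (Suc 0) x - U t 0 x * U t (Suc 0) x\<bar> \<le> M * \<bar>\<tau> - t\<bar> * kw (Suc 0) x" by (rule LipTE) blast
    have "c * kw (Suc 0) x \<le> c * kw 0 x" if "0 \<le> c" for c x
      using mult_left_mono[OF kw_le_1[of "Suc 0" x] that] by (simp add: kw_def)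
    with M show ?thesis unfolding LipT_def by (meson order_trans mult_nonneg_nonneg abs_ge_zero)
  qed
  then have L: "LipT b 0 (\<lambda>t x. H0 (\<eta> t x) - U t 0 x * U t (Suc 0) x)" by (rule LipT_diff[OF LipT_H0[OF b]])
  have "\<forall>\<^sub>F \<tau> in at t within {0..b}. \<forall>x. \<bar>(H0 (\<eta> \<tau> x) - U \<tau> 0 x * U \<tau> (Suc 0) x) - (H0 (\<eta> t x) - U t 0 x * U t (Suc 0) x)\<bar> \<le> e / 2 * kw 0 x"
    by (rule LipT_eventually[OF L t]) (use e in simp)
  moreover have "\<forall>\<^sub>F \<tau> in at t within {0..b}. dist (g \<tau>) (g t) < e / 2"
  proof (rule tendstoD)
    have "continuous_on {0..b} g" by (rule continuous_on_subset[OF g]) (use b in auto)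
    then show "(g \<longlongrightarrow> g t) (at t within {0..b})" using t by (simp add: continuous_on)
  qed (use e in simp)
  ultimately show ?thesis
  proof (eventually_elim, intro allI)
    fix \<tau> x
    assume "\<forall>x. \<bar>(H0 (\<eta> \<tau> x) - U \<tau> 0 x * U \<tau> (Suc 0) x) - (H0 (\<eta> t x) - U t 0 x * U t (Suc 0) x)\<bar> \<le> e / 2 * kw 0 x"
      and g: "dist (g \<tau>) (g t) < e / 2"
    then have "\<bar>(H0 (\<eta> \<tau> x) - U \<tau> 0 x * U \<tau> (Suc 0) x) - (H0 (\<eta> t x) - U t 0 x * U t (Suc 0) x)\<bar> \<le> e / 2 * kw 0 x" by blast
    with g show "\<bar>V \<tau> 0 x - V t 0 x\<bar> \<le> e * kw 0 x" unfolding V.simps kw_def dist_real_def if_True by (simp del: U.simps) argo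
  qed
qed

lemma U_0_eq: "U 0 0 x = E 0 x"
proof -
  have Y0: "Y 0 = (\<lambda>x. x)" by (simp add: Y_def G_0 fun_eq_iff)
  have "\<eta> 0 x = x" using \<eta>_Y[of 0 x] T_pos by (simp add: Y0)
  then show ?thesis by (simp add: Ul_def G_0)
qed

lemma U_bounded:
  assumes t: "0 \<le> t" "t < T" shows "\<exists>M\<ge>0. \<forall>x. \<bar>U t n x\<bar> \<le> M * kw n x"
proof -
  obtain M where "0 \<le> M" "\<And>x. \<bar>U t n x\<bar> \<le> M * kw n x"
    using LipTE[OF LipT_U[OF t], of n] t by (metis atLeastAtMost_iff order_refl)
  then show ?thesis by blast
qed

text \<open>Both sides have the derivative \<open>u_x\<^sup>2 / 2\<close>, so they differ by a
  constant, which is 0 because both tend to 0 at \<open>-\<infinity>\<close>. This is the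
  conservation of energy along characteristics.\<close>

lemma energy:
  assumes t: "0 \<le> t" "t < T"
  shows "set_integrable lborel {..x} (\<lambda>z. (U t (Suc 0) z)\<^sup>2 / 2)"
    and "(LINT z:{..x}|lborel. (U t (Suc 0) z)\<^sup>2 / 2) = H0 (\<eta> t x)"
proof -
  have c: "continuous_on UNIV (U t (Suc 0))" by (rule DERIV_continuous_on[OF has_field_derivative_at_within[OF U_deriv[OF t]]])
  then have [measurable]: "U t (Suc 0) \<in> borel_measurable borel" by (rule continuous_imp_measurable_borel)
  obtain M where M: "0 \<le> M" "\<And>x. \<bar>U t (Suc 0) x\<bar> \<le> M * kw (Suc 0) x" using U_bounded[OF t] by blast
  have int: "integrable lborel (\<lambda>z. (U t (Suc 0) z)\<^sup>2 / 2)"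
  proof (rule abs_le_imp_integrable_1_plus_sq[of _ "M * M"])
    fix z
    have "\<bar>U t (Suc 0) z\<bar> \<le> M" using M(2)[of z] mult_left_mono[OF kw_le_1 M(1), of "Suc 0" z] by linarith
    then have "\<bar>U t (Suc 0) z * U t (Suc 0) z\<bar> \<le> M * M * kw (Suc 0) z" using M(2) by (rule abs_mult_kw_le)
    moreover have "\<bar>a\<^sup>2 / 2\<bar> \<le> \<bar>a * a\<bar>" for a :: real by (simp add: power2_eq_square)
    ultimately have "norm ((U t (Suc 0) z)\<^sup>2 / 2) \<le> M * M * kw (Suc 0) z" unfolding real_norm_def by (meson order_trans)
    then show "norm ((U t (Suc 0) z)\<^sup>2 / 2) \<le> M * M / (1 + z\<^sup>2)" by (simp add: kw_def del: U.simps)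
  qed (simp del: U.simps)
  show i: "set_integrable lborel {..x} (\<lambda>z. (U t (Suc 0) z)\<^sup>2 / 2)" for x
    unfolding set_integrable_def by (rule integrable_mult_indicator[OF _ int]) simp
  let ?J = "\<lambda>x. LINT z:{..x}|lborel. (U t (Suc 0) z)\<^sup>2 / 2"
  have "continuous_on UNIV (\<lambda>z. (U t (Suc 0) z)\<^sup>2 / 2)" by (intro continuous_intros c) auto
  from set_integral_atMost_has_derivative(1)[OF this i]
  have "((\<lambda>x. ?J x - H0 (\<eta> t x)) has_real_derivative (U t (Suc 0) x)\<^sup>2 / 2 - (U t (Suc 0) x)\<^sup>2 / 2) (at x)" for x
    by (intro DERIV_diff H0_deriv_x t)
  then have const: "?J x - H0 (\<eta> t x) = ?J y - H0 (\<eta> t y)" for x y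
    using DERIV_isconst_all[of "\<lambda>x. ?J x - H0 (\<eta> t x)"] by simp
  have J: "(\<lambda>n. ?J (- real n)) \<longlonglongrightarrow> 0" by (rule set_integral_atMost_tendsto_0[OF i])
  obtain C where C: "0 \<le> C" "\<And>x. \<bar>\<eta> t x - x\<bar> \<le> C" using \<eta>_bounded t by blast
  have mono: "H0 x \<le> H0 y" if "x \<le> y" for x y
    by (rule DERIV_nonneg_imp_nondecreasing[OF that]) (use H0_deriv in \<open>force intro: exI[of _ "(E (Suc 0) _)\<^sup>2 / 2"]\<close>)
  have H0_nonneg: "0 \<le> H0 x" for x
    unfolding H0_def set_lebesgue_integral_def by (intro Bochner_Integration.integral_nonneg) auto
  \<comment> \<open>The shift by the ceiling of C keeps the preimages at or below - n, so that
    monotonicity compares with the known limit of \<open>H0 (- n)\<close>.\<close>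
  have HL: "(\<lambda>n. H0 (\<eta> t (- real (n + nat \<lceil>C\<rceil>)))) \<longlonglongrightarrow> 0"
  proof (rule tendsto_sandwich[OF _ _ tendsto_const H0_lim])
    show "\<forall>\<^sub>F n in sequentially. H0 (\<eta> t (- real (n + nat \<lceil>C\<rceil>))) \<le> H0 (- real n)"
    proof (intro always_eventually allI mono)
      fix n
      have "C \<le> real (nat \<lceil>C\<rceil>)" by linarith
      then show "\<eta> t (- real (n + nat \<lceil>C\<rceil>)) \<le> - real n" using C(2)[of "- real (n + nat \<lceil>C\<rceil>)"] unfolding of_nat_add by linarith
    qed
  qed (simp add: H0_nonneg)
  have "(\<lambda>n. ?J (- real (n + nat \<lceil>C\<rceil>)) - H0 (\<eta> t (- real (n + nat \<lceil>C\<rceil>)))) \<longlonglongrightarrow> 0 - 0"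
    by (intro tendsto_diff HL LIMSEQ_ignore_initial_segment[OF J])
  moreover have "(\<lambda>n. ?J (- real (n + nat \<lceil>C\<rceil>)) - H0 (\<eta> t (- real (n + nat \<lceil>C\<rceil>)))) = (\<lambda>_. ?J x - H0 (\<eta> t x))" for x
    by (rule ext) (rule const)
  ultimately have "(\<lambda>_. ?J x - H0 (\<eta> t x)) \<longlonglongrightarrow> 0" for x by simp
  then have "?J x - H0 (\<eta> t x) = 0" for x using LIMSEQ_unique[OF tendsto_const] by blast
  then show "?J x = H0 (\<eta> t x)" for x by simp
qed

lemma U_weak_deriv:
  assumes t: "0 \<le> t" "t < T"
  shows "is_fun (deriv_distr (rdistr (U t 0))) (cfun (U t (Suc 0)))"
proof -
  have m: "U t n \<in> borel_measurable borel" for n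
    by (rule continuous_imp_measurable_borel[OF DERIV_continuous_on[OF has_field_derivative_at_within[OF U_deriv[OF t]]]])
  have "\<exists>M. \<forall>x. \<bar>U t n x\<bar> \<le> M" for n
  proof -
    obtain M where M: "0 \<le> M" "\<And>x. \<bar>U t n x\<bar> \<le> M * kw n x" using U_bounded[OF t] by blast
    have "\<bar>U t n x\<bar> \<le> M" for x using M(2)[of x] mult_left_mono[OF kw_le_1 M(1), of n x] by linarith
    then show ?thesis by blast
  qed
  then obtain M where "\<And>n x. \<bar>U t n x\<bar> \<le> M n" by metis
  note M = this
  show ?thesis
    by (rule is_fun_deriv_distr[OF U_deriv[OF t] M M m m]) simp
qed

text \<open>The witnesses for the time derivative and the weak derivative are \<open>V t 0\<close>
  and \<open>U t (Suc 0)\<close>; by \<open>energy\<close> the equation is then the definition of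
  \<open>V t 0\<close>.\<close>

theorem is_solution_U:
  assumes LP: "LP_pair chi \<phi>" and p: "1 \<le> p" and r: "1 \<le> r"
  shows "is_solution \<phi> p r g (E 0) T (\<lambda>t. U t 0)"
proof -
  interpret LP chi \<phi> by standard fact
  show ?thesis
    unfolding is_solution_def
  proof (rule exI[of _ "\<lambda>t. V t 0"], rule exI[of _ "\<lambda>t. U t (Suc 0)"], intro conjI allI impI)
    fix s b :: real assume s: "2 < s" and bT: "0 \<le> b \<and> b < T"
    then have b: "0 \<le> b" "b < T" by auto
    have tT: "0 \<le> t" "t < T" if "t \<in> {0..b}" for t using that b by auto
    have bu: "\<exists>M. \<forall>x. \<bar>U t n x\<bar> \<le> M * kw n x" if "t \<in> {0..b}" for t n
      using LipT_bounded[OF LipT_U[OF b] that] .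
    have lu: "\<forall>\<^sub>F \<tau> in at t within {0..b}. \<forall>x. \<bar>U \<tau> n x - U t n x\<bar> \<le> e * kw n x" if "t \<in> {0..b}" "0 < e" for t n e
      by (rule LipT_eventually[OF LipT_U[OF b] that])
    have lv: "\<forall>\<^sub>F \<tau> in at t within {0..b}. \<forall>x. \<bar>V \<tau> n x - V t n x\<bar> \<le> e * kw n x" if "t \<in> {0..b}" "0 < e" for t n e
      using V_0_eventually[OF b that] LipT_eventually[OF LipT_V[OF b] that] by (cases n) blast+
    have bv: "\<exists>M. \<forall>x. \<bar>V t n x\<bar> \<le> M * kw n x" if t: "t \<in> {0..b}" for t n
    proof (cases n)
      case 0
      obtain A L B where A: "\<And>x. \<bar>U t 0 x\<bar> \<le> A * kw 0 x" and L: "\<And>x. \<bar>U t (Suc 0) x\<bar> \<le> L * kw (Suc 0) x" and B: "\<And>x. \<bar>H0 x\<bar> \<le> B"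
        using bu[OF t] H0_bounded by metis
      have "\<bar>V t 0 x\<bar> \<le> (B + \<bar>g t\<bar> + A * \<bar>L\<bar>) * kw 0 x" for x
      proof -
        have "\<bar>U t (Suc 0) x\<bar> \<le> \<bar>L\<bar> * kw (Suc 0) x"
          using L[of x] mult_right_mono[OF abs_ge_self[of L], of "kw (Suc 0) x"] kw_pos[of "Suc 0" x] by linarith
        also have "\<dots> \<le> \<bar>L\<bar> * 1" by (intro mult_left_mono kw_le_1) auto
        finally have "\<bar>U t (Suc 0) x\<bar> \<le> \<bar>L\<bar> * 1" .
        with A[of x] have "\<bar>U t 0 x * U t (Suc 0) x\<bar> \<le> A * \<bar>L\<bar> * 1" by (intro abs_mult_kw_le) (auto simp: kw_def)
        then show ?thesis unfolding V.simps kw_def using B[of "\<eta> t x"] by (simp del: U.simps)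
      qed
      then show ?thesis using 0 by blast
    qed (use LipT_bounded[OF LipT_V[OF b] t] in blast)
    show "C0_into (E_norm \<phi> p r s) b (\<lambda>t. U t 0)"
      by (rule C0_intoI(1)[OF s p r U_deriv[OF tT] bu lu])
    show "C1_into (Ebar_norm \<phi> p r s) b (\<lambda>t. U t 0) (\<lambda>t. V t 0)"
      by (rule C1_intoI[OF s p r U_deriv[OF tT] V_deriv[OF tT] bu bv lu lv U_deriv_t[OF _ b(2)]])
  next
    fix t assume "0 \<le> t \<and> t < T"
    then have t: "0 \<le> t" "t < T" by auto
    show "is_fun (deriv_distr (rdistr (U t 0))) (cfun (U t (Suc 0)))" by (rule U_weak_deriv[OF t])
    show "set_integrable lborel {..x} (\<lambda>z. (U t (Suc 0) z)\<^sup>2 / 2)" for x by (rule energy(1)[OF t])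
    have "V t 0 x + U t 0 x * U t (Suc 0) x = (LINT z:{..x}|lborel. (U t (Suc 0) z)\<^sup>2 / 2) + g t" for x
      unfolding energy(2)[OF t] by (simp del: U.simps)
    then show "AE x in lborel. V t 0 x + U t 0 x * U t (Suc 0) x = (LINT z:{..x}|lborel. (U t (Suc 0) z)\<^sup>2 / 2) + g t"
      by blast
  next
    show "AE x in lborel. U 0 0 x = E 0 x" unfolding U_0_eq by simp
  qed
qed

end

section \<open>Initial data\<close>

lemma fourier_is_fun:
  assumes f: "integrable lborel f"
  shows "is_fun (fourier_distr (distr_of f)) (fourier f)"
  unfolding is_fun_def
proof (intro conjI ballI)
  have [measurable]: "f \<in> borel_measurable borel" using f by auto
  have m [measurable]: "fourier f \<in> borel_measurable borel"
    unfolding fourier_def[abs_def] by measurable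
  show "tempered_fun (fourier f)"
    by (rule tempered_fun_bounded[OF m norm_fourier_le])
  fix \<psi> assume "\<psi> \<in> schwartz"
  then have \<psi>: "integrable lborel \<psi>" by (rule schwartz_integrable)
  have "(\<integral>x. f x * (\<integral>y. exp (- \<i> * complex_of_real (y * x)) * \<psi> y \<partial>lborel) \<partial>lborel) =
    (\<integral>y. \<psi> y * (\<integral>x. exp (- \<i> * complex_of_real (y * x)) * f x \<partial>lborel) \<partial>lborel)"
    by (rule Fubini_bounded_mult[OF f \<psi>]) auto
  then show "fourier_distr (distr_of f) \<psi> = distr_of (fourier f) \<psi>"
    by (simp add: fourier_distr_def distr_of_def fourier_def mult.commute)
qed

text \<open>Passing from F to F - F'' multiplies the transform by \<open>1 + \<xi>\<^sup>2\<close>;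
  the induction over m therefore generalises F.\<close>

lemma fourier_decay:
  assumes "\<And>n x. (F n has_real_derivative F (Suc n) x) (at x)" "\<And>n. \<exists>M. \<forall>x. \<bar>F n x\<bar> \<le> M / (1 + x\<^sup>2)"
  shows "\<exists>C. \<forall>\<xi>. (1 + \<xi>\<^sup>2) ^ m * cmod (fourier (cfun (F 0)) \<xi>) \<le> C"
  using assms
proof (induction m arbitrary: F)
  case 0
  show ?case using norm_fourier_le[of "cfun (F 0)"] by (intro exI[of _ "\<integral>x. cmod (cfun (F 0) x) \<partial>lborel"]) simp
next
  case (Suc m)
  define G where "G = (\<lambda>n x. F n x - F (Suc (Suc n)) x)"
  have "\<exists>C. \<forall>\<xi>. (1 + \<xi>\<^sup>2) ^ m * cmod (fourier (cfun (G 0)) \<xi>) \<le> C"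
  proof (rule Suc.IH)
    show "(G n has_real_derivative G (Suc n) x) (at x)" for n x unfolding G_def by (intro DERIV_diff Suc.prems)
    show "\<exists>M. \<forall>x. \<bar>G n x\<bar> \<le> M / (1 + x\<^sup>2)" for n
    proof -
      obtain M N where MN: "\<And>x. \<bar>F n x\<bar> \<le> M / (1 + x\<^sup>2)" "\<And>x. \<bar>F (Suc (Suc n)) x\<bar> \<le> N / (1 + x\<^sup>2)" using Suc.prems(2) by metis
      have "\<bar>G n x\<bar> \<le> (M + N) / (1 + x\<^sup>2)" for x unfolding G_def add_divide_distrib using MN(1)[of x] MN(2)[of x] by linarith
      then show ?thesis by blast
    qed
  qed
  moreover have "fourier (cfun (G 0)) \<xi> = (1 + \<xi>\<^sup>2) * fourier (cfun (F 0)) \<xi>" for \<xi>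
  proof -
    have d: "(cfun (F n) has_vector_derivative cfun (F (Suc n)) x) (at x)" for n x
      using has_vector_derivative_of_real[OF Suc.prems(1)[of n x]] .
    obtain M where M: "\<And>n x. \<bar>F n x\<bar> \<le> M n / (1 + x\<^sup>2)" using Suc.prems(2) by metis
    then have M': "cmod (cfun (F n) x) \<le> M n / (1 + x\<^sup>2)" for n x by simp
    have i: "integrable lborel (cfun (F n))" for n
      by (rule abs_le_imp_integrable_1_plus_sq[OF has_vderiv_measurable[OF d] M'])
    note D = fourier_derivative[OF d i i tendsto_0_inverse_1_plus_sq[OF M']]
    have "fourier (cfun (G 0)) \<xi> = fourier (cfun (F 0)) \<xi> - fourier (cfun (F (Suc (Suc 0)))) \<xi>"
      unfolding fourier_def G_def of_real_diff right_diff_distrib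
      by (rule Bochner_Integration.integral_diff) (use integrable_exp_mult[OF i, of \<xi>] integrable_exp_mult[OF i, of "- \<xi>"] in \<open>simp_all add: mult.commute\<close>)
    then show ?thesis unfolding D by (simp add: power2_eq_square algebra_simps)
  qed
  moreover have "cmod (1 + (complex_of_real \<xi>)\<^sup>2) = 1 + \<xi>\<^sup>2" for \<xi>
  proof -
    have "1 + (complex_of_real \<xi>)\<^sup>2 = complex_of_real (1 + \<xi>\<^sup>2)" by simp
    then show ?thesis by (simp only: norm_of_real) simp
  qed
  ultimately show ?case by (simp add: norm_mult mult_ac)
qed

lemma H_inftyI:
  assumes F: "\<And>n x. (F n has_real_derivative F (Suc n) x) (at x)" and M: "\<And>n. \<exists>M. \<forall>x. \<bar>F n x\<bar> \<le> M / (1 + x\<^sup>2)"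
  shows "F 0 \<in> H_infty"
proof -
  obtain M0 where M0: "\<And>x. \<bar>F 0 x\<bar> \<le> M0 / (1 + x\<^sup>2)" using M by blast
  have m [measurable]: "F 0 \<in> borel_measurable borel"
    by (rule continuous_imp_measurable_borel[OF DERIV_continuous_on[OF has_field_derivative_at_within[OF F]]])
  have i: "integrable lborel (cfun (F 0))"
    by (rule abs_le_imp_integrable_1_plus_sq) (use M0 in auto)
  have "tempered_fun (cfun (F 0))"
  proof (rule tempered_fun_bounded)
    have "0 \<le> M0" using M0[of 0] by simp
    then show "cmod (cfun (F 0) x) \<le> M0" for x
      using M0[of x] mult_left_mono[OF kw_le_1[of 1 x], of M0] by (simp add: kw_def)
  qed simp
  moreover have "\<exists>h. is_fun (fourier_distr (rdistr (F 0))) h \<and>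
      (\<integral>\<^sup>+\<xi>. ennreal ((1 + \<xi>\<^sup>2) powr \<sigma> * (cmod (h \<xi>))\<^sup>2) \<partial>lborel) < \<infinity>" for \<sigma> :: real
  proof (rule exI[of _ "fourier (cfun (F 0))"], rule conjI[OF fourier_is_fun[OF i]])
    \<comment> \<open>Large enough that \<open>(1 + \<xi>\<^sup>2) ^ (2 * n)\<close> dominates the
      weight with one factor \<open>1 + \<xi>\<^sup>2\<close> left over for integrability.\<close>
    define n where "n = nat \<lceil>\<bar>\<sigma>\<bar>\<rceil> + 1"
    have n: "\<sigma> + 1 \<le> real (n + n)" unfolding n_def by linarith
    obtain C where C: "\<And>\<xi>. (1 + \<xi>\<^sup>2) ^ n * cmod (fourier (cfun (F 0)) \<xi>) \<le> C" using fourier_decay[where F=F, OF F M] by blast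
    have "(1 + \<xi>\<^sup>2) powr \<sigma> * (cmod (fourier (cfun (F 0)) \<xi>))\<^sup>2 \<le> C\<^sup>2 * (1 / (1 + \<xi>\<^sup>2))" for \<xi>
    proof -
      let ?J = "1 + \<xi>\<^sup>2" and ?h = "cmod (fourier (cfun (F 0)) \<xi>)"
      have J: "1 \<le> ?J" "0 < ?J" by (auto intro: add_pos_nonneg)
      have "?J powr \<sigma> * ?J = ?J powr (\<sigma> + 1)" using J by (simp add: powr_add)
      also have "\<dots> \<le> ?J powr real (n + n)" by (rule powr_mono[OF n J(1)])
      also have "\<dots> = (?J ^ n)\<^sup>2" using J by (subst powr_realpow) (simp_all add: power_add power2_eq_square)
      finally have "?J powr \<sigma> * ?J * ?h\<^sup>2 \<le> (?J ^ n)\<^sup>2 * ?h\<^sup>2" by (rule mult_right_mono) simp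
      also have "\<dots> = (?J ^ n * ?h)\<^sup>2" by (simp add: power_mult_distrib)
      also have "\<dots> \<le> C\<^sup>2" using C[of \<xi>] J by (intro power_mono) auto
      finally have "?J powr \<sigma> * ?h\<^sup>2 * ?J \<le> C\<^sup>2" by (simp add: mult_ac)
      then show ?thesis using J(2) by (simp add: pos_le_divide_eq)
    qed
    then have "(\<integral>\<^sup>+\<xi>. ennreal ((1 + \<xi>\<^sup>2) powr \<sigma> * (cmod (fourier (cfun (F 0)) \<xi>))\<^sup>2) \<partial>lborel) \<le>
      (\<integral>\<^sup>+\<xi>. ennreal (C\<^sup>2 * (1 / (1 + \<xi>\<^sup>2))) \<partial>lborel)" by (intro nn_integral_mono ennreal_leI)
    also have "\<dots> < \<infinity>"
      by (subst nn_integral_eq_integral) (auto intro!: integrable_mult_right integrable_inverse_1_plus_sq simp del: times_divide_eq_right)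
    finally show "(\<integral>\<^sup>+\<xi>. ennreal ((1 + \<xi>\<^sup>2) powr \<sigma> * (cmod (fourier (cfun (F 0)) \<xi>))\<^sup>2) \<partial>lborel) < \<infinity>" .
  qed
  ultimately show ?thesis by (simp add: H_infty_def)
qed

text \<open>Hermite polynomials up to sign: they are the factors of
  \<open>exp (- x\<^sup>2 / 2)\<close> in its successive derivatives.\<close>

primrec gauss_poly :: "nat \<Rightarrow> real poly" where
  "gauss_poly 0 = 1"
| "gauss_poly (Suc n) = pderiv (gauss_poly n) - pCons 0 (gauss_poly n)"

definition gauss :: "nat \<Rightarrow> real \<Rightarrow> real" where
  "gauss n x = poly (gauss_poly n) x * exp (- x\<^sup>2 / 2)"

lemma gauss_deriv: "(gauss n has_real_derivative gauss (Suc n) x) (at x)"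
proof -
  have "((\<lambda>x. exp (- x\<^sup>2 / 2)) has_real_derivative exp (- x\<^sup>2 / 2) * (- x)) (at x)"
    by (auto intro!: derivative_eq_intros)
  from DERIV_mult[OF poly_DERIV[of "gauss_poly n" x] this]
  show ?thesis unfolding gauss_def[abs_def] by (simp add: algebra_simps)
qed

text \<open>From \<open>(1 + y / n) ^ n \<le> exp y\<close> at \<open>y = x\<^sup>2 / 2\<close> with
  n = k + 1, which controls the power 2 k + 2 of x; the summand 1 covers
  \<open>\<bar>x\<bar> \<le> 1\<close>.\<close>

lemma power_mult_exp_bounded: "\<bar>x ^ k\<bar> * exp (- x\<^sup>2 / 2) \<le> 1 + (2 * real (Suc k)) ^ Suc k"
proof -
  let ?n = "Suc k"
  have "(1 + (x\<^sup>2 / 2) / real ?n) ^ ?n \<le> exp (x\<^sup>2 / 2)"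
    by (rule exp_ge_one_plus_x_over_n_power_n) (auto intro: order_trans[OF _ zero_le_power2])
  moreover have "((x\<^sup>2 / 2) / real ?n) ^ ?n \<le> (1 + (x\<^sup>2 / 2) / real ?n) ^ ?n" by (intro power_mono) auto
  ultimately have "(x\<^sup>2 / (2 * real ?n)) ^ ?n \<le> exp (x\<^sup>2 / 2)" by simp
  then have "(x\<^sup>2) ^ ?n \<le> (2 * real ?n) ^ ?n * exp (x\<^sup>2 / 2)" by (simp add: power_divide pos_divide_le_eq mult.commute del: power_Suc of_nat_Suc)
  moreover have "\<bar>x ^ k\<bar> \<le> 1 + (x\<^sup>2) ^ ?n"
  proof (cases "\<bar>x\<bar> \<le> 1")
    case True
    then have "\<bar>x ^ k\<bar> \<le> 1" by (simp add: power_abs power_le_one)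
    moreover have "0 \<le> (x\<^sup>2) ^ ?n" by simp
    ultimately show ?thesis by linarith
  next
    case False
    then have "\<bar>x\<bar> ^ k \<le> \<bar>x\<bar> ^ (2 * ?n)" by (intro power_increasing) auto
    moreover have "\<bar>x ^ k\<bar> = \<bar>x\<bar> ^ k" "\<bar>x\<bar> ^ (2 * ?n) = (x\<^sup>2) ^ ?n" unfolding power_mult by (simp_all add: power_abs)
    ultimately show ?thesis by linarith
  qed
  moreover have "1 \<le> exp (x\<^sup>2 / 2)" by simp
  ultimately have "\<bar>x ^ k\<bar> \<le> (1 + (2 * real ?n) ^ ?n) * exp (x\<^sup>2 / 2)" unfolding distrib_right by linarith
  then show ?thesis by (simp add: exp_minus divide_simps del: power_Suc of_nat_Suc)
qed

lemma poly_mult_exp_bounded: "\<exists>M. \<forall>x::real. \<bar>x ^ k * poly p x\<bar> * exp (- x\<^sup>2 / 2) \<le> M"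
proof (induction p arbitrary: k)
  case 0
  show ?case by (auto intro!: exI[of _ 0])
next
  case (pCons a p)
  obtain M where M: "\<And>x::real. \<bar>x ^ Suc k * poly p x\<bar> * exp (- x\<^sup>2 / 2) \<le> M" using pCons.IH by blast
  define N where "N = 1 + (2 * real (Suc k)) ^ Suc k"
  have "\<bar>x ^ k * poly (pCons a p) x\<bar> * exp (- x\<^sup>2 / 2) \<le> \<bar>a\<bar> * N + M" for x
  proof -
    have "\<bar>x ^ k * poly (pCons a p) x\<bar> \<le> \<bar>a\<bar> * \<bar>x ^ k\<bar> + \<bar>x ^ Suc k * poly p x\<bar>"
      using abs_triangle_ineq[of "a * x ^ k" "x ^ Suc k * poly p x"] by (simp add: algebra_simps abs_mult)
    then have "\<bar>x ^ k * poly (pCons a p) x\<bar> * exp (- x\<^sup>2 / 2) \<le> (\<bar>a\<bar> * \<bar>x ^ k\<bar> + \<bar>x ^ Suc k * poly p x\<bar>) * exp (- x\<^sup>2 / 2)"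
      by (rule mult_right_mono) simp
    also have "\<dots> = \<bar>a\<bar> * (\<bar>x ^ k\<bar> * exp (- x\<^sup>2 / 2)) + \<bar>x ^ Suc k * poly p x\<bar> * exp (- x\<^sup>2 / 2)"
      by (simp only: distrib_right mult.assoc)
    also have "\<dots> \<le> \<bar>a\<bar> * N + M"
      unfolding N_def by (intro add_mono mult_left_mono power_mult_exp_bounded M) simp
    finally show ?thesis .
  qed
  then show ?case by blast
qed

lemma gauss_decay: "\<exists>M\<ge>0. \<forall>x. \<bar>gauss n x\<bar> \<le> M / (1 + x\<^sup>2)"
proof -
  obtain M N where M: "\<And>x. \<bar>x ^ 0 * poly (gauss_poly n) x\<bar> * exp (- x\<^sup>2 / 2) \<le> M"
    and N: "\<And>x. \<bar>x ^ 2 * poly (gauss_poly n) x\<bar> * exp (- x\<^sup>2 / 2) \<le> N" using poly_mult_exp_bounded by metis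
  have le: "\<bar>gauss n x\<bar> \<le> (M + N) / (1 + x\<^sup>2)" for x
  proof -
    have "\<bar>gauss n x\<bar> * (1 + x\<^sup>2) = \<bar>x ^ 0 * poly (gauss_poly n) x\<bar> * exp (- x\<^sup>2 / 2) + \<bar>x ^ 2 * poly (gauss_poly n) x\<bar> * exp (- x\<^sup>2 / 2)"
      by (simp add: gauss_def abs_mult algebra_simps)
    also have "\<dots> \<le> M + N" by (intro add_mono M N)
    finally show ?thesis by (simp add: pos_le_divide_eq add_pos_nonneg)
  qed
  moreover have "0 \<le> M + N" using le[of 0] by (simp add: order_trans[OF abs_ge_zero])
  ultimately show ?thesis by blast
qed

lemma gauss_2: "gauss 2 x = (x\<^sup>2 - 1) * exp (- x\<^sup>2 / 2)"
proof -
  have "gauss_poly 2 = [:- 1, 0, 1:]" by (simp add: numeral_2_eq_2 one_pCons pderiv_pCons)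
  then show ?thesis by (simp add: gauss_def power2_eq_square algebra_simps)
qed

lemma gauss_2_ge: "- 1 \<le> gauss 2 x" "gauss 2 0 = - 1"
proof -
  have "0 \<le> x\<^sup>2 * exp (- x\<^sup>2 / 2)" "exp (- x\<^sup>2 / 2) \<le> 1" by auto
  then show "- 1 \<le> gauss 2 x" unfolding gauss_2 left_diff_distrib by linarith
qed (simp add: gauss_2)

text \<open>A dilation by \<open>2 ^ k \<ge> 1\<close> only improves the decay.\<close>

lemma lacunary_decay:
  assumes H: "\<And>n. \<exists>M\<ge>0. \<forall>x. \<bar>H n x\<bar> \<le> M / (1 + x\<^sup>2)"
  shows "\<exists>M\<ge>0. \<forall>x. \<bar>lacunary H N a n x\<bar> \<le> M / (1 + x\<^sup>2)"
proof -
  obtain M where M: "0 \<le> M" "\<And>x. \<bar>H (Suc n) x\<bar> \<le> M / (1 + x\<^sup>2)" using H by blast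
  show ?thesis
  proof (intro exI[of _ "\<Sum>k=1..N. \<bar>a / 2 ^ k * (2 ^ k) ^ n\<bar> * M"] conjI allI)
    fix x
    have "\<bar>lacunary H N a n x\<bar> \<le> (\<Sum>k=1..N. \<bar>a / 2 ^ k * (2 ^ k) ^ n\<bar> * (M / (1 + x\<^sup>2)))"
      unfolding lacunary_def
    proof (rule order_trans[OF sum_abs sum_mono])
      fix k
      have "\<bar>H (Suc n) (2 ^ k * x)\<bar> \<le> M / (1 + (2 ^ k * x)\<^sup>2)" by (rule M(2))
      also have "\<dots> \<le> M / (1 + x\<^sup>2)"
      proof (intro divide_left_mono M(1))
        have "1 * x\<^sup>2 \<le> (2 ^ k)\<^sup>2 * x\<^sup>2" by (intro mult_right_mono) (auto intro: one_le_power)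
        then show "1 + x\<^sup>2 \<le> 1 + (2 ^ k * x)\<^sup>2" by (simp add: power_mult_distrib)
      qed (auto intro!: mult_pos_pos add_pos_nonneg)
      finally show "\<bar>a / 2 ^ k * (2 ^ k) ^ n * H (Suc n) (2 ^ k * x)\<bar> \<le> \<bar>a / 2 ^ k * (2 ^ k) ^ n\<bar> * (M / (1 + x\<^sup>2))"
        unfolding abs_mult[of _ "H _ _"] by (rule mult_left_mono) simp
    qed
    then show "\<bar>lacunary H N a n x\<bar> \<le> (\<Sum>k=1..N. \<bar>a / 2 ^ k * (2 ^ k) ^ n\<bar> * M) / (1 + x\<^sup>2)"
      by (simp add: sum_divide_distrib)
  qed (simp add: sum_nonneg M)
qed

lemma lacunary_gauss_1:
  assumes a: "0 \<le> a"
  shows "- (a * N) \<le> lacunary gauss N a (Suc 0) x" "lacunary gauss N a (Suc 0) 0 = - (a * N)"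
proof -
  have eq: "lacunary gauss N a (Suc 0) x = (\<Sum>k=1..N. a * gauss 2 (2 ^ k * x))" for x
    by (simp add: lacunary_def numeral_2_eq_2)
  have "(\<Sum>k=1..N. a * (- 1)) \<le> (\<Sum>k=1..N. a * gauss 2 (2 ^ k * x))"
    by (intro sum_mono mult_left_mono gauss_2_ge a)
  then show "- (a * N) \<le> lacunary gauss N a (Suc 0) x" unfolding eq by (simp add: mult.commute)
  show "lacunary gauss N a (Suc 0) 0 = - (a * N)" unfolding eq by (simp add: gauss_2_ge mult.commute)
qed

section \<open>Blow-up\<close>

text \<open>The extremal slope is attained, at 0, so that the explicit solution really breaks down
  at T.\<close>

locale HS_blowup = HS_flow E g K T + LP chi \<phi> for E g K T chi \<phi> +
  assumes E_0: "E (Suc 0) 0 = - K"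
begin

lemma slope:
  assumes t: "0 \<le> t" "t < T" shows "U t (Suc 0) (Y t 0) = - (2 / (T - t))"
proof -
  have "1 + t * E (Suc 0) 0 / 2 = (T - t) / T" using K by (simp add: E_0 T field_simps)
  moreover have "K = 2 / T" using K by (simp add: T)
  ultimately show ?thesis using t by (simp add: \<eta>_Y[OF t] Wn_0 R_def E_0)
qed

text \<open>By \<open>R * (1 + t * u0' / 2) = 1\<close> the two terms in the derivative of
  \<open>R * u0'\<close> collapse, and u_xx becomes \<open>u0'' * R ^ 4\<close>; R is at most T / (T
  - t).\<close>

lemma slope_Lipschitz: "\<exists>M\<ge>0. \<forall>t x y. 0 \<le> t \<and> t < T \<longrightarrow> \<bar>U t (Suc 0) x - U t (Suc 0) y\<bar> \<le> M * (T / (T - t)) ^ 4 * \<bar>x - y\<bar>"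
proof -
  obtain M where M: "0 \<le> M" "\<And>x. \<bar>E 2 x\<bar> \<le> M" using E_bounded by blast
  have "\<bar>U t (Suc 0) x - U t (Suc 0) y\<bar> \<le> M * (T / (T - t)) ^ 4 * \<bar>x - y\<bar>" if t: "0 \<le> t" "t < T" for t x y
  proof -
    have U2: "\<bar>U t (Suc (Suc 0)) z\<bar> \<le> M * (T / (T - t)) ^ 4" for z
    proof -
      let ?y = "\<eta> t z"
      have R: "0 < R t ?y" "R t ?y \<le> T / (T - t)"
        using R_bound[of t t ?y] t T_pos by (auto simp: field_simps)
      have 1: "R t ?y * (1 + t * E (Suc 0) ?y / 2) = 1" using R_pos[OF t, of ?y] by (simp add: R_def)
      have "U t (Suc (Suc 0)) z = R t ?y ^ 3 * E 2 ?y * (1 - R t ?y * (t * E (Suc 0) ?y / 2))"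
        by (simp add: Wn_Suc Wn_0 Dx_def numeral_2_eq_2 power3_eq_cube algebra_simps)
      also have "1 - R t ?y * (t * E (Suc 0) ?y / 2) = R t ?y"
        using 1 by (simp add: algebra_simps)
      also have "R t ?y ^ 3 * E 2 ?y * R t ?y = E 2 ?y * R t ?y ^ 4" by (simp add: power3_eq_cube power4_eq_xxxx)
      finally have "\<bar>U t (Suc (Suc 0)) z\<bar> = \<bar>E 2 ?y\<bar> * R t ?y ^ 4" using R(1) by (simp add: abs_mult)
      also have "\<dots> \<le> M * (T / (T - t)) ^ 4"
        using R by (intro mult_mono M power_mono) (auto intro: zero_le_power)
      finally show ?thesis .
    qed
    have "norm (U t (Suc 0) x - U t (Suc 0) y) \<le> M * (T / (T - t)) ^ 4 * norm (x - y)"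
      by (rule field_differentiable_bound[of UNIV _ "U t (Suc (Suc 0))"]) (use U_deriv[OF t] U2 in \<open>auto simp del: U.simps\<close>)
    then show ?thesis by simp
  qed
  with M(1) show ?thesis by blast
qed

text \<open>The slope at the steepest point is \<open>- 2 / (T - t)\<close>. Cutting off at frequency \<open>2\<^sup>N\<close> changes it by at most
  \<open>2\<^sup>-\<^sup>N\<close> times the Lipschitz constant, which is of order \<open>(T - t)\<^sup>-\<^sup>4\<close>, and costs a factor \<open>N\<close>; so \<open>N\<close> of
  order \<open>(T - t)\<close> to the power \<open>- 1 / 2\<close> forces the Besov norm to infinity.\<close>

theorem Besov_blowup:
  assumes p: "1 \<le> p" and r: "1 \<le> r"
  shows "((\<lambda>t. Besov_norm chi \<phi> (enn2real (1 / p)) p r (deriv_distr (rdistr (U t 0)))) \<longlongrightarrow> \<infinity>) (at_left T)"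
proof -
  obtain M where M: "0 \<le> M" "\<And>t x y. 0 \<le> t \<Longrightarrow> t < T \<Longrightarrow> \<bar>U t (Suc 0) x - U t (Suc 0) y\<bar> \<le> M * (T / (T - t)) ^ 4 * \<bar>x - y\<bar>"
    using slope_Lipschitz by blast
  have chi0: "cfun chi 0 = 1" by (simp add: chi_eq_1)
  show ?thesis
  proof (rule conv_kern_approx[OF chi_test chi0], rule norm_conv_chi_le_Besov_norm)
    fix C1 C2 :: real
    assume C1: "0 < C1" "\<And>f B L l x. \<lbrakk>f \<in> borel_measurable borel; \<And>x. cmod (f x) \<le> B;
     \<And>x y. cmod (f x - f y) \<le> L * \<bar>x - y\<bar>; 0 < l\<rbrakk> \<Longrightarrow> cmod (conv f (kern 0 (cfun chi) l) x - f x) \<le> C1 * L / l"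
    and C2: "0 < C2" "\<And>p r U f B N x. \<lbrakk>1 \<le> p; 1 \<le> r; is_fun U f; \<And>x. cmod (f x) \<le> B\<rbrakk> \<Longrightarrow>
    ennreal (cmod (conv f (kern 0 (cfun chi) (2 ^ N)) x)) \<le>
      ennreal (C2 * (real N + 1)) * Besov_norm chi \<phi> (enn2real (1 / p)) p r U"
    define B where "B = (\<lambda>t. Besov_norm chi \<phi> (enn2real (1 / p)) p r (deriv_distr (rdistr (U t 0))))"
    have key: "2 / (T - t) \<le> C2 * (real N + 1) * c + C1 * (M * (T / (T - t)) ^ 4) / 2 ^ N"
      if t: "0 \<le> t" "t < T" and B: "B t \<le> ennreal c" and c: "0 \<le> c" for t N c
    proof -
      let ?f = "cfun (U t (Suc 0))" and ?k = "kern 0 (cfun chi) (2 ^ N)"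
      obtain b where b: "0 \<le> b" "\<And>x. \<bar>U t (Suc 0) x\<bar> \<le> b * kw (Suc 0) x" using U_bounded[OF t] by blast
      have fb: "cmod (?f x) \<le> b" for x using b(2)[of x] mult_left_mono[OF kw_le_1 b(1), of "Suc 0" x] unfolding norm_of_real by linarith
      have fm: "?f \<in> borel_measurable borel"
        using continuous_imp_measurable_borel[OF DERIV_continuous_on[OF has_field_derivative_at_within[OF U_deriv[OF t]]]] by measurable
      have fL: "cmod (?f x - ?f y) \<le> M * (T / (T - t)) ^ 4 * \<bar>x - y\<bar>" for x y
        using M(2)[OF t, of x y] by (metis norm_of_real of_real_diff)
      have "ennreal (cmod (conv ?f ?k (Y t 0))) \<le> ennreal (C2 * (real N + 1)) * B t"
        unfolding B_def by (rule C2(2)[OF p r U_weak_deriv[OF t] fb])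
      also have "\<dots> \<le> ennreal (C2 * (real N + 1)) * ennreal c" by (intro mult_left_mono B) simp
      also have "\<dots> = ennreal (C2 * (real N + 1) * c)" using C2(1) c by (simp add: ennreal_mult[symmetric])
      finally have 1: "cmod (conv ?f ?k (Y t 0)) \<le> C2 * (real N + 1) * c" using C2(1) c by (simp add: ennreal_le_iff)
      have 2: "cmod (conv ?f ?k (Y t 0) - ?f (Y t 0)) \<le> C1 * (M * (T / (T - t)) ^ 4) / 2 ^ N"
        by (rule C1(2)[OF fm fb fL]) simp
      have "cmod (?f (Y t 0)) = 2 / (T - t)" unfolding norm_of_real slope[OF t] using t by simp
      with norm_triangle_ineq3[of "conv ?f ?k (Y t 0)" "?f (Y t 0)"] 1 2 show ?thesis by linarith
    qed
    have "((\<lambda>t. B t) \<longlongrightarrow> \<infinity>) (at_left T)"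
      unfolding infinity_ennreal_def
    proof (rule order_tendstoI)
      fix y :: ennreal assume "y < top"
      then obtain c where c: "y = ennreal c" "0 \<le> c" by (cases y) auto
      have lim: "filterlim (\<lambda>t. 1 / (T - t)) at_top (at_left T)" by real_asymp
      \<comment> \<open>Here s stands for 1 / (T - t). After division by s, the left-hand side of
        \<open>key\<close> is 2, while its right-hand side with N about \<open>sqrt s\<close> tends
        to 0: \<open>sqrt s\<close> is small against s, and \<open>2 powr sqrt s\<close> outgrows
        every power of s.\<close>
      have "((\<lambda>s. C2 * (sqrt s + 2) * c / s + C1 * (M * T ^ 4) * s ^ 3 / 2 powr (sqrt s)) \<longlongrightarrow> 0) at_top"
        by real_asymp
      then have "\<forall>\<^sub>F s in at_top. C2 * (sqrt s + 2) * c / s + C1 * (M * T ^ 4) * s ^ 3 / 2 powr (sqrt s) < 2"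
        by (rule order_tendstoD) simp
      moreover have "\<forall>\<^sub>F s::real in at_top. 0 < s" by (rule eventually_gt_at_top)
      ultimately have "\<forall>\<^sub>F s in at_top. 0 < s \<and> C2 * (sqrt s + 2) * c / s + C1 * (M * T ^ 4) * s ^ 3 / 2 powr (sqrt s) < 2"
        by eventually_elim simp
      from eventually_compose_filterlim[OF this lim]
      have "\<forall>\<^sub>F t in at_left T. 0 < 1 / (T - t) \<and> C2 * (sqrt (1 / (T - t)) + 2) * c / (1 / (T - t)) +
          C1 * (M * T ^ 4) * (1 / (T - t)) ^ 3 / 2 powr (sqrt (1 / (T - t))) < 2" .
      moreover have "\<forall>\<^sub>F t in at_left T. t \<in> {0<..<T}" by (rule eventually_at_leftI[OF _ T_pos]) auto
      ultimately show "\<forall>\<^sub>F t in at_left T. y < B t"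
      proof eventually_elim
        case (elim t)
        define s where "s = 1 / (T - t)"
        define N where "N = nat \<lceil>sqrt s\<rceil>"
        have s: "0 < s" and e: "C2 * (sqrt s + 2) * c / s + C1 * (M * T ^ 4) * s ^ 3 / 2 powr (sqrt s) < 2"
          and t: "0 \<le> t" "t < T"
          using elim by (auto simp: s_def)
        have "0 \<le> sqrt s" using s by simp
        then have N: "sqrt s \<le> real N" "real N + 1 \<le> sqrt s + 2" unfolding N_def by linarith+
        show "y < B t"
        proof (rule ccontr)
          assume "\<not> y < B t"
          then have "B t \<le> ennreal c" using c by simp
          from key[OF t this c(2), of N]
          have "2 * s \<le> C2 * (real N + 1) * c + C1 * (M * T ^ 4) * s ^ 4 / 2 ^ N"
            by (simp add: s_def power_divide mult_ac)
          also have "\<dots> \<le> C2 * (sqrt s + 2) * c + C1 * (M * T ^ 4) * s ^ 4 / 2 powr (sqrt s)"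
          proof (rule add_mono[OF mult_right_mono[OF mult_left_mono[OF N(2)]] divide_left_mono])
            show "2 powr sqrt s \<le> 2 ^ N" using powr_mono[OF N(1), of 2] by (simp add: powr_realpow)
          qed (use C1(1) C2(1) c M(1) T_pos s in auto)
          also have "\<dots> = (C2 * (sqrt s + 2) * c / s + C1 * (M * T ^ 4) * s ^ 3 / 2 powr (sqrt s)) * s"
            unfolding distrib_right using s by (simp add: power3_eq_cube power4_eq_xxxx)
          also have "\<dots> < 2 * s" using e s by (rule mult_strict_right_mono)
          finally show False by simp
        qed
      qed
    qed simp
    then show ?thesis by (simp only: B_def)
  qed
qed

text \<open>A solution living beyond T is a regular flow on the closed interval [0, T], so its slope
  is bounded there by a constant L. Before T it coincides with \<open>U\<close>, whose slope at
  \<open>Y t 0\<close> is \<open>- 2 / (T - t)\<close>.\<close>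

theorem max_time_eq:
  assumes p: "1 \<le> p" and r: "1 \<le> r"
  shows "max_time \<phi> p r g (E 0) = ereal T"
  unfolding max_time_def
proof (rule antisym)
  note sol = is_solution_U[OF LP p r]
  show "ereal T \<le> (SUP T\<in>{T. 0 < T \<and> (\<exists>u. is_solution \<phi> p r g (E 0) T u)}. ereal T)"
    using sol T_pos by (intro SUP_upper) blast
  show "(SUP T\<in>{T. 0 < T \<and> (\<exists>u. is_solution \<phi> p r g (E 0) T u)}. ereal T) \<le> ereal T"
  proof (rule SUP_least)
    fix T' assume "T' \<in> {T. 0 < T \<and> (\<exists>u. is_solution \<phi> p r g (E 0) T u)}"
    then obtain v where v: "is_solution \<phi> p r g (E 0) T' v" by blast
    have "T' \<le> T"
    proof (rule ccontr)
      assume "\<not> T' \<le> T"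
      then have T': "0 \<le> T" "T < T'" using T_pos by auto
      show False
      proof (rule solution_regular[OF p r v T'])
        fix W I L
        assume W: "regular_flow T g W I L" and vW: "\<And>t. t \<in> {0..T} \<Longrightarrow> AE x in lborel. v t x = W t 0 x"
        interpret W: regular_flow T g W I L by fact
        have le: "2 / (T - t) \<le> L" if t: "0 \<le> t" "t < T" for t
        proof -
          have tT: "t \<in> {0..T}" using t by simp
          have "AE x in lborel. v t x = U t 0 x"
            by (rule solution_unique[OF p r sol v]) (use t T' in auto)
          with vW[OF tT] have "AE x in lborel. W t 0 x = U t 0 x" by eventually_elim simp
          then have "W t 0 x = U t 0 x" for x
            by (rule AE_eq_continuous_imp_eq)
               (rule DERIV_continuous_on[OF has_field_derivative_at_within[OF W.deriv[OF tT]]]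
                     DERIV_continuous_on[OF has_field_derivative_at_within[OF U_deriv[OF t]]]; simp)+
          then have "W t 0 = U t 0" ..
          then have "W t (Suc 0) x = U t (Suc 0) x" for x
            using W.deriv[OF tT, of 0 x] U_deriv[OF t, of 0 x] DERIV_unique by (metis zero_less_numeral)
          then have "\<bar>U t (Suc 0) (Y t 0)\<bar> \<le> L" using W.bound[OF tT, of "Suc 0" "Y t 0"] by simp
          then show ?thesis unfolding slope[OF t] using t by simp
        qed
        \<comment> \<open>At this time the slope is at least 2 L in modulus.\<close>
        define t where "t = max 0 (T - 1 / L)"
        have t: "0 \<le> t" "t < T" "T - t \<le> 1 / L" using W.K T_pos by (auto simp: t_def)
        have "2 * L \<le> 2 / (T - t)" using t W.K by (simp add: field_simps)
        with le[OF t(1,2)] W.K show False by linarith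
      qed
    qed
    then show "ereal T' \<le> ereal T" by simp
  qed
qed

end

lemma enn2real_inverse_less_1:
  assumes "1 < (r::ennreal)" shows "enn2real (1 / r) < 1"
proof (cases r)
  case (real x)
  with assms have x: "1 < x" by simp
  then have "1 / r = ennreal (1 / x)" using real divide_ennreal[of 1 x] by simp
  with x show ?thesis by simp
next
  case top
  then show ?thesis by simp
qed

theorem theorem5p1:
  fixes chi \<phi> g :: "real \<Rightarrow> real" and p r :: ennreal and \<epsilon> :: real
  assumes "LP_pair chi \<phi>"
    and "bounded (g ` {0..})"
    and "\<exists>\<delta>>0. continuous_on {0..<\<delta>} g"
    and "1 < r" and "1 \<le> p"
    and "0 < \<epsilon>"
  shows "\<exists>u0 \<in> H_infty.
    A_norm \<phi> p r u0 \<le> ennreal \<epsilon> \<and>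
    (\<exists>(T::real) u.
       0 < T \<and> T < \<epsilon> \<and>
       is_solution \<phi> p r g u0 T u \<and>
       (\<forall>T'>0. \<forall>v. is_solution \<phi> p r g u0 T' v \<longrightarrow>
          (\<forall>t. 0 \<le> t \<and> t < min T T' \<longrightarrow> (AE x in lborel. v t x = u t x))) \<and>
       max_time \<phi> p r g u0 = ereal T \<and>
       (\<exists>L M.
          ((\<lambda>t. Besov_norm chi \<phi> (enn2real (1 / p)) p r (deriv_distr (rdistr (u t)))) \<longlongrightarrow> L) (at_left T) \<and>
          ((\<lambda>t. Besov_norm chi \<phi> 0 \<infinity> \<infinity> (deriv_distr (rdistr (u t)))) \<longlongrightarrow> M) (at_left T) \<and>
          L \<ge> M \<and> M = \<infinity>))"
proof -
  interpret LP chi \<phi> by standard fact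
  have r: "1 \<le> r" and p: "1 \<le> p" using assms by auto
  obtain \<delta> where \<delta>: "0 < \<delta>" "continuous_on {0..<\<delta>} g" using assms(3) by blast
  \<comment> \<open>Halving makes T strictly smaller than both bounds, so that g is continuous on
    the closed interval [0, T].\<close>
  define T where "T = min \<epsilon> \<delta> / 2"
  define K where "K = 2 / T"
  have Tb: "0 < T" "T < \<epsilon>" "T < \<delta>" using \<delta>(1) assms(6) by (auto simp: T_def)
  have K: "0 < K" "T = 2 / K" using Tb by (auto simp: K_def)
  obtain M where M: "0 \<le> M" "\<And>n x. n \<le> 4 \<Longrightarrow> \<bar>gauss n x\<bar> \<le> M / (1 + x\<^sup>2)"
  proof -
    obtain m where m: "\<And>n. 0 \<le> m n" "\<And>n x. \<bar>gauss n x\<bar> \<le> m n / (1 + x\<^sup>2)" using gauss_decay by metis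
    have "\<bar>gauss n x\<bar> \<le> (\<Sum>i\<le>4. m i) / (1 + x\<^sup>2)" if "n \<le> 4" for n x
    proof -
      have "m n \<le> (\<Sum>i\<le>4. m i)" by (rule member_le_sum) (use m(1) that in auto)
      then have "m n / (1 + x\<^sup>2) \<le> (\<Sum>i\<le>4. m i) / (1 + x\<^sup>2)" by (intro divide_right_mono) auto
      with m(2)[of n x] show ?thesis by linarith
    qed
    then show thesis by (intro that[of "\<Sum>i\<le>4. m i"] sum_nonneg m(1))
  qed
  obtain C where C: "0 \<le> C" "\<And>N a. 1 \<le> N \<Longrightarrow> 0 \<le> a \<Longrightarrow>
    A_norm \<phi> p r (lacunary gauss N a 0) \<le> ennreal (C * a * real N powr enn2real (1 / r))"
  proof (rule lacunary_norm_le[where H=gauss, OF gauss_deriv M(2) M(1)])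
    fix C
    assume C: "0 \<le> C" "\<And>p r N a. \<lbrakk>1 \<le> p; 1 \<le> r; 1 \<le> N; 0 \<le> a\<rbrakk> \<Longrightarrow>
      A_norm \<phi> p r (lacunary gauss N a 0) \<le> ennreal (C * a * real N powr enn2real (1 / r))"
    show thesis by (rule that[OF C(1) C(2)[OF p r]])
  qed
  define \<rho> where "\<rho> = enn2real (1 / r)"
  have \<rho>: "\<rho> < 1" unfolding \<rho>_def by (rule enn2real_inverse_less_1[OF assms(4)])
  \<comment> \<open>Here r > 1 enters: the power of N is \<open>\<rho> - 1 < 0\<close>, so with K
    fixed the norm of the datum is made small by N alone.\<close>
  have "((\<lambda>N. C * (K / real N) * real N powr \<rho>) \<longlongrightarrow> 0) sequentially"
    using \<rho> by real_asymp
  then have "\<forall>\<^sub>F N in sequentially. C * (K / real N) * real N powr \<rho> < \<epsilon>"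
    by (rule order_tendstoD) (rule assms(6))
  then have "\<forall>\<^sub>F N in sequentially. C * (K / real N) * real N powr \<rho> < \<epsilon> \<and> 1 \<le> N"
    using eventually_ge_at_top[of 1] by eventually_elim simp
  then obtain N where N: "C * (K / real N) * real N powr \<rho> < \<epsilon>" "1 \<le> N"
    using eventually_happens'[OF sequentially_bot] by blast
  define a where "a = K / real N"
  have a: "0 \<le> a" "a * real N = K" using K N by (auto simp: a_def)
  define E where "E = lacunary gauss N a"
  interpret HS_blowup E g K T chi \<phi>
  proof
    show "(E n has_real_derivative E (Suc n) x) (at x)" for n x unfolding E_def by (rule lacunary_deriv[where H=gauss, OF gauss_deriv])
    show "\<exists>M\<ge>0. \<forall>x. \<bar>E n x\<bar> \<le> M / (1 + x\<^sup>2)" for n unfolding E_def by (rule lacunary_decay[where H=gauss, OF gauss_decay])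
    show "- K \<le> E (Suc 0) x" for x using lacunary_gauss_1(1)[OF a(1), of N x] a by (simp add: E_def)
    show "E (Suc 0) 0 = - K" using lacunary_gauss_1(2)[OF a(1), of N] a by (simp add: E_def)
    show "continuous_on {0..T} g" by (rule continuous_on_subset[OF \<delta>(2)]) (use Tb in auto)
  qed (fact K)+
  have "\<exists>M. \<forall>x. \<bar>E n x\<bar> \<le> M / (1 + x\<^sup>2)" for n using E_decay by blast
  then have H: "E 0 \<in> H_infty" by (intro H_inftyI E_deriv)
  have A: "A_norm \<phi> p r (E 0) \<le> ennreal \<epsilon>"
    using C(2)[OF N(2) a(1)] N(1) unfolding E_def a_def \<rho>_def
    by (elim order_trans) (simp add: ennreal_leI)
  note sol = is_solution_U[OF assms(1) p r]
  have unique: "AE x in lborel. v t x = U t 0 x" if "is_solution \<phi> p r g (E 0) T' v" "0 \<le> t" "t < min T T'" for T' v t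
    by (rule solution_unique[OF p r sol that])
  \<comment> \<open>The case \<open>p = r = \<infinity>\<close> of the blow-up, where
    \<open>1 / p\<close> is 0.\<close>
  have B: "((\<lambda>t. Besov_norm chi \<phi> 0 \<infinity> \<infinity> (deriv_distr (rdistr (U t 0)))) \<longlongrightarrow> \<infinity>) (at_left T)"
    using Besov_blowup[of \<infinity> \<infinity>] by simp
  show ?thesis
  proof (intro bexI[OF _ H] conjI A exI[of _ T] exI[of _ "\<lambda>t. U t 0"] Tb(1,2) sol allI impI max_time_eq p r)
    show "\<exists>L M. ((\<lambda>t. Besov_norm chi \<phi> (enn2real (1 / p)) p r (deriv_distr (rdistr (U t 0)))) \<longlongrightarrow> L) (at_left T) \<and>
          ((\<lambda>t. Besov_norm chi \<phi> 0 \<infinity> \<infinity> (deriv_distr (rdistr (U t 0)))) \<longlongrightarrow> M) (at_left T) \<and> L \<ge> M \<and> M = \<infinity>"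
      using Besov_blowup[OF p r] B by blast
  qed (use unique in blast)
qed

end
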